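(* Let $\mathbb{A}^2_*=\mathbb{A}^2\setminus\{0\}$ be the complement of the origin in the complex affine plane. The total space of every nontrivial principal $\mathbb{G}_a$-bundle over $\mathbb{A}^2_*$ is an affine scheme.
   Context: $\mathbb{G}_a$ is the additive group of $\mathbb{C}$. A principal $\mathbb{G}_a$-bundle over $\mathbb{A}^2_*$ is nontrivial if it is not isomorphic to the trivial bundle $\mathbb{A}^2_*\times\mathbb{G}_a$; isomorphism classes of principal $\mathbb{G}_a$-bundles over $\mathbb{A}^2_*$ are classified by $H^1(\mathbb{A}^2_*,\mathcal{O}_{\mathbb{A}^2_*})$. *)

theory Defs
  imports
    "HOL-Analysis.Abstract_Topology"
    "HOL-Algebra.UnivPoly"
    "HOL-Algebra.Algebraic_Closure_Type"
begin

section \<open>Localisation and local rings\<close>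

text \<open>The fraction \<open>a/f\<close>, as the class of all pairs \<open>(b,g)\<close> representing it.\<close>

definition frac ::
  "('a, 'm) ring_scheme \<Rightarrow> 'a set \<Rightarrow> 'a \<Rightarrow> 'a \<Rightarrow> ('a \<times> 'a) set" where
  "frac R M a f =
     {(b, g). b \<in> carrier R \<and> g \<in> M \<and>
        (\<exists>h\<in>M. h \<otimes>\<^bsub>R\<^esub> (g \<otimes>\<^bsub>R\<^esub> a) = h \<otimes>\<^bsub>R\<^esub> (f \<otimes>\<^bsub>R\<^esub> b))}"

text \<open>
  Operations on classes are written, here and for stalks below, as the union over all
  representatives of the resulting classes, in the style of the library's quotient rings;
  when the operation is well defined all members of that union coincide.
\<close>

definition localization :: "('a, 'm) ring_scheme \<Rightarrow> 'a set \<Rightarrow> ('a \<times> 'a) set ring" where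
  "localization R M =
     \<lparr>carrier = {frac R M a f | a f. a \<in> carrier R \<and> f \<in> M},
      monoid.mult = (\<lambda>A B. \<Union>(a, f)\<in>A. \<Union>(b, g)\<in>B. frac R M (a \<otimes>\<^bsub>R\<^esub> b) (f \<otimes>\<^bsub>R\<^esub> g)),
      one = frac R M \<one>\<^bsub>R\<^esub> \<one>\<^bsub>R\<^esub>,
      ring.zero = frac R M \<zero>\<^bsub>R\<^esub> \<one>\<^bsub>R\<^esub>,
      add = (\<lambda>A B. \<Union>(a, f)\<in>A. \<Union>(b, g)\<in>B.
               frac R M ((a \<otimes>\<^bsub>R\<^esub> g) \<oplus>\<^bsub>R\<^esub> (b \<otimes>\<^bsub>R\<^esub> f)) (f \<otimes>\<^bsub>R\<^esub> g))\<rparr>"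

definition local_ring :: "('a, 'm) ring_scheme \<Rightarrow> bool" where
  "local_ring R \<longleftrightarrow> cring R \<and> (\<exists>!m. maximalideal m R)"


section \<open>Locally ringed spaces\<close>

record ('p, 's) ringed_space =
  topo :: "'p topology"
  sections :: "'p set \<Rightarrow> 's ring"
  res :: "'p set \<Rightarrow> 'p set \<Rightarrow> 's \<Rightarrow> 's"  \<comment> \<open>\<open>res S U V\<close> restricts from \<open>U\<close> to \<open>V\<close>\<close>

abbreviation opens :: "('p, 's) ringed_space \<Rightarrow> 'p set \<Rightarrow> bool" where
  "opens S \<equiv> openin (topo S)"

abbreviation points :: "('p, 's) ringed_space \<Rightarrow> 'p set" where
  "points S \<equiv> topspace (topo S)"

definition ringed_space :: "('p, 's) ringed_space \<Rightarrow> bool" where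
  "ringed_space S \<longleftrightarrow>
     (\<forall>U. opens S U \<longrightarrow> cring (sections S U)) \<and>
     (\<forall>U V. opens S U \<and> opens S V \<and> V \<subseteq> U \<longrightarrow>
        res S U V \<in> ring_hom (sections S U) (sections S V)) \<and>
     (\<forall>U. opens S U \<longrightarrow> (\<forall>s\<in>carrier (sections S U). res S U U s = s)) \<and>
     (\<forall>U V W. opens S U \<and> opens S V \<and> opens S W \<and> W \<subseteq> V \<and> V \<subseteq> U \<longrightarrow>
        (\<forall>s\<in>carrier (sections S U). res S V W (res S U V s) = res S U W s)) \<and>
     (\<forall>\<U> s. (\<forall>V\<in>\<U>. opens S V \<and> s V \<in> carrier (sections S V)) \<and>
        (\<forall>V\<in>\<U>. \<forall>W\<in>\<U>. res S V (V \<inter> W) (s V) = res S W (V \<inter> W) (s W)) \<longrightarrow>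
        (\<exists>!t. t \<in> carrier (sections S (\<Union>\<U>)) \<and> (\<forall>V\<in>\<U>. res S (\<Union>\<U>) V t = s V)))"

definition germ ::
  "('p, 's) ringed_space \<Rightarrow> 'p \<Rightarrow> 'p set \<Rightarrow> 's \<Rightarrow> ('p set \<times> 's) set" where
  "germ S x U s =
     {(V, t). opens S V \<and> x \<in> V \<and> t \<in> carrier (sections S V) \<and>
        (\<exists>W. opens S W \<and> x \<in> W \<and> W \<subseteq> U \<inter> V \<and> res S U W s = res S V W t)}"

definition stalk :: "('p, 's) ringed_space \<Rightarrow> 'p \<Rightarrow> ('p set \<times> 's) set ring" where
  "stalk S x =
     \<lparr>carrier = {germ S x U s | U s. opens S U \<and> x \<in> U \<and> s \<in> carrier (sections S U)},
      monoid.mult = (\<lambda>A B. \<Union>(U, s)\<in>A. \<Union>(V, t)\<in>B.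
         germ S x (U \<inter> V)
           (res S U (U \<inter> V) s \<otimes>\<^bsub>sections S (U \<inter> V)\<^esub> res S V (U \<inter> V) t)),
      one = germ S x (points S) \<one>\<^bsub>sections S (points S)\<^esub>,
      ring.zero = germ S x (points S) \<zero>\<^bsub>sections S (points S)\<^esub>,
      add = (\<lambda>A B. \<Union>(U, s)\<in>A. \<Union>(V, t)\<in>B.
         germ S x (U \<inter> V)
           (res S U (U \<inter> V) s \<oplus>\<^bsub>sections S (U \<inter> V)\<^esub> res S V (U \<inter> V) t))\<rparr>"

definition locally_ringed_space :: "('p, 's) ringed_space \<Rightarrow> bool" where
  "locally_ringed_space S \<longleftrightarrow>
     ringed_space S \<and> (\<forall>x\<in>points S. local_ring (stalk S x))"

definition open_subspace :: "('p, 's) ringed_space \<Rightarrow> 'p set \<Rightarrow> ('p, 's) ringed_space" where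
  "open_subspace S U =
     \<lparr>topo = subtopology (topo S) U, sections = sections S, res = res S\<rparr>"


section \<open>Morphisms\<close>

text \<open>
  A map \<open>S \<rightarrow> Y\<close> of ringed spaces; \<open>pull f V\<close> takes sections of \<open>Y\<close> over \<open>V\<close> to sections of
  \<open>S\<close> over the preimage of \<open>V\<close>.
\<close>

record ('p, 's, 'q, 't) space_map =
  pt :: "'p \<Rightarrow> 'q"
  pull :: "'q set \<Rightarrow> 't \<Rightarrow> 's"

definition preimg ::
  "('p, 's) ringed_space \<Rightarrow> ('p, 's, 'q, 't) space_map \<Rightarrow> 'q set \<Rightarrow> 'p set" where
  "preimg S f V = {x \<in> points S. pt f x \<in> V}"

definition stalk_map ::
  "('p, 's) ringed_space \<Rightarrow> ('p, 's, 'q, 't) space_map \<Rightarrow> 'p \<Rightarrow>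
   ('q set \<times> 't) set \<Rightarrow> ('p set \<times> 's) set" where
  "stalk_map S f x A = (\<Union>(V, t)\<in>A. germ S x (preimg S f V) (pull f V t))"

definition morphism ::
  "('p, 's) ringed_space \<Rightarrow> ('q, 't) ringed_space \<Rightarrow> ('p, 's, 'q, 't) space_map \<Rightarrow> bool" where
  "morphism S Y f \<longleftrightarrow>
     continuous_map (topo S) (topo Y) (pt f) \<and>
     (\<forall>V. opens Y V \<longrightarrow> pull f V \<in> ring_hom (sections Y V) (sections S (preimg S f V))) \<and>
     (\<forall>V W. opens Y V \<and> opens Y W \<and> W \<subseteq> V \<longrightarrow>
        (\<forall>t\<in>carrier (sections Y V).
           res S (preimg S f V) (preimg S f W) (pull f V t) = pull f W (res Y V W t))) \<and>
     (\<forall>x\<in>points S. \<forall>A\<in>carrier (stalk Y (pt f x)).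
        stalk_map S f x A \<in> Units (stalk S x) \<longrightarrow> A \<in> Units (stalk Y (pt f x)))"

text \<open>Equality of morphisms, disregarding values outside the domains of definition.\<close>

definition mor_eq ::
  "('p, 's) ringed_space \<Rightarrow> ('q, 't) ringed_space \<Rightarrow>
   ('p, 's, 'q, 't) space_map \<Rightarrow> ('p, 's, 'q, 't) space_map \<Rightarrow> bool" where
  "mor_eq S Y f g \<longleftrightarrow>
     (\<forall>x\<in>points S. pt f x = pt g x) \<and>
     (\<forall>V. opens Y V \<longrightarrow> (\<forall>t\<in>carrier (sections Y V). pull f V t = pull g V t))"

definition id_map :: "('p, 's, 'p, 's) space_map" where
  "id_map = \<lparr>pt = (\<lambda>x. x), pull = (\<lambda>V s. s)\<rparr>"

text \<open>\<open>mcomp Y g f\<close> is the composite of \<open>f : S \<rightarrow> Y\<close> and \<open>g : Y \<rightarrow> Z\<close>.\<close>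

definition mcomp ::
  "('q, 't) ringed_space \<Rightarrow> ('q, 't, 'r, 'u) space_map \<Rightarrow> ('p, 's, 'q, 't) space_map \<Rightarrow>
   ('p, 's, 'r, 'u) space_map" where
  "mcomp Y g f =
     \<lparr>pt = (\<lambda>x. pt g (pt f x)), pull = (\<lambda>W u. pull f (preimg Y g W) (pull g W u))\<rparr>"

definition isomorphism ::
  "('p, 's) ringed_space \<Rightarrow> ('q, 't) ringed_space \<Rightarrow> ('p, 's, 'q, 't) space_map \<Rightarrow> bool" where
  "isomorphism S Y f \<longleftrightarrow>
     morphism S Y f \<and>
     (\<exists>g. morphism Y S g \<and> mor_eq S S (mcomp Y g f) id_map \<and>
          mor_eq Y Y (mcomp S f g) id_map)"


section \<open>Schemes\<close>

text \<open>
  The ringed space whose sections over \<open>U\<close> are the functions \<open>s\<close> on \<open>U\<close>, with \<open>s p\<close> in the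
  ring \<open>L p\<close>, that near each point agree with one of the given basic functions \<open>B V\<close>.
\<close>

definition function_space ::
  "'p topology \<Rightarrow> ('p \<Rightarrow> 'v ring) \<Rightarrow> ('p set \<Rightarrow> ('p \<Rightarrow> 'v) set) \<Rightarrow>
   ('p, 'p \<Rightarrow> 'v) ringed_space" where
  "function_space T L B =
     \<lparr>topo = T,
      sections = (\<lambda>U.
        \<lparr>carrier = {s. s \<in> (\<Pi>\<^sub>E p\<in>U. carrier (L p)) \<and>
            (\<forall>p\<in>U. \<exists>V. openin T V \<and> p \<in> V \<and> V \<subseteq> U \<and> (\<exists>b\<in>B V. \<forall>q\<in>V. s q = b q))},
         monoid.mult = (\<lambda>s t. \<lambda>p\<in>U. s p \<otimes>\<^bsub>L p\<^esub> t p),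
         one = (\<lambda>p\<in>U. \<one>\<^bsub>L p\<^esub>),
         ring.zero = (\<lambda>p\<in>U. \<zero>\<^bsub>L p\<^esub>),
         add = (\<lambda>s t. \<lambda>p\<in>U. s p \<oplus>\<^bsub>L p\<^esub> t p)\<rparr>),
      res = (\<lambda>U V s. restrict s V)\<rparr>"

definition Spec ::
  "('a, 'm) ring_scheme \<Rightarrow> ('a set, 'a set \<Rightarrow> ('a \<times> 'a) set) ringed_space" where
  "Spec R =
     function_space
       (topology_generated_by {{p. primeideal p R \<and> f \<notin> p} | f. f \<in> carrier R})
       (\<lambda>p. localization R (carrier R - p))
       (\<lambda>V. {(\<lambda>p. frac R (carrier R - p) a f) | a f.
               a \<in> carrier R \<and> f \<in> carrier R \<and> (\<forall>p\<in>V. f \<notin> p)})"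

text \<open>
  No generality is lost in taking \<open>R\<close> over the type of sections, as \<open>R\<close> is isomorphic to the
  ring of global sections of \<open>S\<close>.
\<close>

definition affine_scheme :: "('p, 's) ringed_space \<Rightarrow> bool" where
  "affine_scheme S \<longleftrightarrow>
     locally_ringed_space S \<and> (\<exists>(R :: 's ring) f. cring R \<and> isomorphism S (Spec R) f)"

definition scheme :: "('p, 's) ringed_space \<Rightarrow> bool" where
  "scheme S \<longleftrightarrow>
     locally_ringed_space S \<and>
     (\<forall>x\<in>points S. \<exists>U. opens S U \<and> x \<in> U \<and> affine_scheme (open_subspace S U))"


section \<open>The product of a scheme with the additive group\<close>

text \<open>
  \<open>Ga_times S\<close> is the scheme \<open>\<bbbG>\<^sub>a \<times> S\<close>, that is the relative affine line, the relative spectrum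
  of \<open>\<O>\<^sub>S[T]\<close>.  For \<open>S\<close> over the complex numbers it is the fibre product of
  \<open>\<bbbG>\<^sub>a = Spec \<complex>[T]\<close> and \<open>S\<close> over \<open>Spec \<complex>\<close>.
  Its points over \<open>x\<close> are the primes \<open>q\<close> of \<open>\<O>\<^bsub>S,x\<^esub>[T]\<close> that contract to the maximal ideal
  of \<open>\<O>\<^bsub>S,x\<^esub>\<close>, and the local ring at such a point is \<open>\<O>\<^bsub>S,x\<^esub>[T]\<close> localised at \<open>q\<close>.  If \<open>S\<close> is
  \<open>Spec A\<close>, a prime \<open>Q\<close> of \<open>A[T]\<close> lying over \<open>x\<close> corresponds to \<open>(x, Q \<O>\<^bsub>S,x\<^esub>[T])\<close>.
\<close>

type_synonym ('p, 's) line_point = "'p \<times> (nat \<Rightarrow> ('p set \<times> 's) set) set"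
type_synonym ('p, 's) line_section =
  "('p, 's) line_point \<Rightarrow> ((nat \<Rightarrow> ('p set \<times> 's) set) \<times> (nat \<Rightarrow> ('p set \<times> 's) set)) set"

definition line_points :: "('p, 's) ringed_space \<Rightarrow> ('p, 's) line_point set" where
  "line_points S =
     {(x, q). x \<in> points S \<and> primeideal q (UP (stalk S x)) \<and>
        {c \<in> carrier (stalk S x). up_ring.monom (UP (stalk S x)) c 0 \<in> q}
          = carrier (stalk S x) - Units (stalk S x)}"

definition poly_germ ::
  "('p, 's) ringed_space \<Rightarrow> 'p \<Rightarrow> 'p set \<Rightarrow> (nat \<Rightarrow> 's) \<Rightarrow> nat \<Rightarrow> ('p set \<times> 's) set" where
  "poly_germ S x U F = (\<lambda>n. germ S x U (F n))"

definition line_frac ::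
  "('p, 's) ringed_space \<Rightarrow> 'p set \<Rightarrow> (nat \<Rightarrow> 's) \<Rightarrow> (nat \<Rightarrow> 's) \<Rightarrow> ('p, 's) line_section" where
  "line_frac S U F G =
     (\<lambda>(x, q). frac (UP (stalk S x)) (carrier (UP (stalk S x)) - q)
                 (poly_germ S x U F) (poly_germ S x U G))"

definition Ga_times ::
  "('p, 's) ringed_space \<Rightarrow> (('p, 's) line_point, ('p, 's) line_section) ringed_space" where
  "Ga_times S =
     function_space
       (topology_generated_by
          {{(x, q) \<in> line_points S. x \<in> U \<and> poly_germ S x U F \<notin> q} | U F.
             opens S U \<and> F \<in> carrier (UP (sections S U))})
       (\<lambda>(x, q). localization (UP (stalk S x)) (carrier (UP (stalk S x)) - q))
       (\<lambda>V. {line_frac S U F G | U F G.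
               opens S U \<and> F \<in> carrier (UP (sections S U)) \<and> G \<in> carrier (UP (sections S U)) \<and>
               (\<forall>(x, q)\<in>V. x \<in> U \<and> poly_germ S x U G \<notin> q)})"

definition Ga_proj ::
  "('p, 's) ringed_space \<Rightarrow>
   (('p, 's) line_point, ('p, 's) line_section, 'p, 's) space_map" where
  "Ga_proj S =
     \<lparr>pt = fst,
      pull = (\<lambda>U s. \<lambda>z\<in>{z \<in> line_points S. fst z \<in> U}.
        line_frac S U (up_ring.monom (UP (sections S U)) s 0) \<one>\<^bsub>UP (sections S U)\<^esub> z)\<rparr>"

text \<open>The coordinate \<open>T\<close> of \<open>\<bbbG>\<^sub>a\<close>, as a global section.\<close>

definition Ga_coord :: "('p, 's) ringed_space \<Rightarrow> ('p, 's) line_section" where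
  "Ga_coord S =
     (\<lambda>z\<in>line_points S.
        line_frac S (points S)
          (up_ring.monom (UP (sections S (points S))) \<one>\<^bsub>sections S (points S)\<^esub> 1)
          \<one>\<^bsub>UP (sections S (points S))\<^esub> z)"

text \<open>\<open>h\<close> is the morphism \<open>(a, f) : Y \<rightarrow> \<bbbG>\<^sub>a \<times> S\<close>, where \<open>a\<close> is a global section of \<open>Y\<close>.\<close>

definition Ga_pair ::
  "('q, 't) ringed_space \<Rightarrow> ('p, 's) ringed_space \<Rightarrow> 't \<Rightarrow> ('q, 't, 'p, 's) space_map \<Rightarrow>
   ('q, 't, ('p, 's) line_point, ('p, 's) line_section) space_map \<Rightarrow> bool" where
  "Ga_pair Y S a f h \<longleftrightarrow>
     morphism Y (Ga_times S) h \<and>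
     mor_eq Y S (mcomp (Ga_times S) (Ga_proj S) h) f \<and>
     pull h (points (Ga_times S)) (Ga_coord S) = a"


section \<open>Principal bundles under the additive group\<close>

text \<open>
  An action \<open>\<mu> : \<bbbG>\<^sub>a \<times> P \<rightarrow> P\<close>: the composite with \<open>(0, id)\<close> is the identity, and \<open>\<mu>\<close> has the
  same composite with the two morphisms \<open>(a, b, p) \<mapsto> (a + b, p)\<close> and \<open>(a, b, p) \<mapsto> (a, b \<cdot> p)\<close>
  from \<open>\<bbbG>\<^sub>a \<times> \<bbbG>\<^sub>a \<times> P\<close> to \<open>\<bbbG>\<^sub>a \<times> P\<close>.
\<close>

definition Ga_action ::
  "('p, 's) ringed_space \<Rightarrow>
   (('p, 's) line_point, ('p, 's) line_section, 'p, 's) space_map \<Rightarrow> bool" where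
  "Ga_action P \<mu> \<longleftrightarrow>
     morphism (Ga_times P) P \<mu> \<and>
     (\<exists>e. Ga_pair P P \<zero>\<^bsub>sections P (points P)\<^esub> id_map e \<and>
          mor_eq P P (mcomp (Ga_times P) \<mu> e) id_map) \<and>
     (let Q = Ga_times P; R = Ga_times Q;
          a = Ga_coord Q;
          b = pull (Ga_proj Q) (points Q) (Ga_coord P)
      in \<exists>m n.
           Ga_pair R P (a \<oplus>\<^bsub>sections R (points R)\<^esub> b) (mcomp Q (Ga_proj P) (Ga_proj Q)) m \<and>
           Ga_pair R P a (mcomp Q \<mu> (Ga_proj Q)) n \<and>
           mor_eq R P (mcomp Q \<mu> m) (mcomp Q \<mu> n))"

text \<open>
  A \<open>\<bbbG>\<^sub>a\<close>-equivariant isomorphism over \<open>U\<close> of the part of \<open>P\<close> over \<open>U\<close> with \<open>\<bbbG>\<^sub>a \<times> U\<close>, on which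
  \<open>\<bbbG>\<^sub>a\<close> acts by translation.  A morphism to \<open>\<bbbG>\<^sub>a \<times> U\<close> is determined by its two components.
  For the components in \<open>U\<close> equivariance is the invariance of \<open>\<pi>\<close>, required in
  \<open>principal_Ga_bundle\<close> below; for the components in \<open>\<bbbG>\<^sub>a\<close> it says that \<open>\<tau> = T \<circ> \<phi>\<close> satisfies
  \<open>\<tau> (a \<cdot> p) = \<tau> p + a\<close>, an identity of functions on the part of \<open>\<bbbG>\<^sub>a \<times> P\<close> over \<open>U\<close>.
\<close>

definition Ga_trivialization ::
  "('p, 's) ringed_space \<Rightarrow> ('q, 't) ringed_space \<Rightarrow> ('p, 's, 'q, 't) space_map \<Rightarrow>
   (('p, 's) line_point, ('p, 's) line_section, 'p, 's) space_map \<Rightarrow> 'q set \<Rightarrow>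
   ('p, 's, ('q, 't) line_point, ('q, 't) line_section) space_map \<Rightarrow> bool" where
  "Ga_trivialization P S \<pi> \<mu> U \<phi> \<longleftrightarrow>
     (let V = preimg P \<pi> U;
          P\<^sub>U = open_subspace P V;
          S\<^sub>U = open_subspace S U;
          \<tau> = pull \<phi> (points (Ga_times S\<^sub>U)) (Ga_coord S\<^sub>U);
          W = preimg (Ga_times P) (Ga_proj P) V
      in isomorphism P\<^sub>U (Ga_times S\<^sub>U) \<phi> \<and>
         mor_eq P\<^sub>U S\<^sub>U (mcomp (Ga_times S\<^sub>U) (Ga_proj S\<^sub>U) \<phi>) \<pi> \<and>
         pull \<mu> V \<tau> =
           pull (Ga_proj P) V \<tau> \<oplus>\<^bsub>sections (Ga_times P) W\<^esub>
           res (Ga_times P) (points (Ga_times P)) W (Ga_coord P))"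

text \<open>
  Local triviality is with respect to the Zariski topology.  The bundle is a triple
  \<open>(P, \<pi>, \<mu>)\<close> over \<open>S\<close>, with total space \<open>P\<close>.
\<close>

definition principal_Ga_bundle ::
  "('p, 's) ringed_space \<Rightarrow> ('q, 't) ringed_space \<Rightarrow> ('p, 's, 'q, 't) space_map \<Rightarrow>
   (('p, 's) line_point, ('p, 's) line_section, 'p, 's) space_map \<Rightarrow> bool" where
  "principal_Ga_bundle P S \<pi> \<mu> \<longleftrightarrow>
     scheme P \<and> morphism P S \<pi> \<and> Ga_action P \<mu> \<and>
     mor_eq (Ga_times P) S (mcomp P \<pi> \<mu>) (mcomp P \<pi> (Ga_proj P)) \<and>
     (\<forall>x\<in>points S. \<exists>U \<phi>. opens S U \<and> x \<in> U \<and> Ga_trivialization P S \<pi> \<mu> U \<phi>)"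

text \<open>Isomorphic, as a principal bundle over \<open>S\<close>, to \<open>\<bbbG>\<^sub>a \<times> S\<close>.\<close>

definition trivial_Ga_bundle ::
  "('p, 's) ringed_space \<Rightarrow> ('q, 't) ringed_space \<Rightarrow> ('p, 's, 'q, 't) space_map \<Rightarrow>
   (('p, 's) line_point, ('p, 's) line_section, 'p, 's) space_map \<Rightarrow> bool" where
  "trivial_Ga_bundle P S \<pi> \<mu> \<longleftrightarrow> (\<exists>\<phi>. Ga_trivialization P S \<pi> \<mu> (points S) \<phi>)"


section \<open>The punctured affine plane\<close>

text \<open>
  The coordinate ring \<open>\<complex>[x, y]\<close> of the plane is taken as \<open>\<complex>[x][y]\<close>; the origin is the prime
  ideal of all polynomials vanishing at \<open>(0, 0)\<close>.
\<close>

type_synonym plane_point = "complex poly poly set"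
type_synonym plane_section = "plane_point \<Rightarrow> (complex poly poly \<times> complex poly poly) set"

definition affine_plane :: "(plane_point, plane_section) ringed_space" where
  "affine_plane = Spec (ring_of_type_algebra :: complex poly poly ring)"

definition origin :: plane_point where
  "origin = {f. poly (poly f 0) 0 = 0}"

definition punctured_plane :: "(plane_point, plane_section) ringed_space" where
  "punctured_plane = open_subspace affine_plane (points affine_plane - {origin})"

end

theory Submission
 imports Defs "HOL-Computational_Algebra.Fraction_Field"
begin

text \<open>Let \<open>A = \<complex>[x, y]\<close> and let \<open>P\<close> be a principal \<open>\<bbbG>\<^sub>a\<close>-bundle over the punctured plane, trivial over
the basic open sets \<open>D(f)\<close> for finitely many \<open>f\<close> such that only one prime contains them all, the ideal of the origin.
The part \<open>P\<^sub>f\<close> of \<open>P\<close> over \<open>D(f)\<close> is \<open>Spec A\<^sub>f[\<tau>\<^sub>f]\<close>, where \<open>\<bbbG>\<^sub>a\<close> translates the coordinate \<open>\<tau>\<^sub>f\<close>.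
The differences \<open>\<tau>\<^sub>f - \<tau>\<^sub>g\<close> are invariant, and invariant functions come from the base, as the
substitution \<open>T \<mapsto> \<tau> + T\<close> makes a non-constant polynomial in \<open>\<tau>\<close> depend on \<open>T\<close>
(\<open>invariant_polynomial\<close>, \<open>chart_diff\<close>). So these differences form the cocycle of the bundle with
values in the rings \<open>A\<^sub>f\<^sub>g\<close>.

Instead of its class in \<open>H\<^sup>1\<close> the proof uses the rings \<open>A\<^sub>f[\<tau>\<^sub>f]\<close> as subrings of the function field
of \<open>P\<close>. Their intersection \<open>\<R>\<close> is the ring of global functions, and \<open>\<R> \<inter> Frac A = A\<close>
(\<open>hartogs\<close>). Let \<open>J\<close> be the ideal of all \<open>a\<close> for which some member of \<open>\<R>\<close> differs from
\<open>a\<tau>\<^sub>f\<close> by an element of \<open>Frac A\<close>; it is the annihilator of the class, and it contains powers of \<open>x\<close>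
and \<open>y\<close>. If \<open>1 \<in> J\<close> there is a global coordinate, and it trivialises the bundle
(\<open>trivial_of_coordinate\<close>). Otherwise some \<open>a \<notin> J\<close> has \<open>xa, ya \<in> J\<close>. Take \<open>v, u \<in> \<R>\<close> that belong to
\<open>xa\<close> and \<open>ya\<close>. Then \<open>r = yv - xu\<close> lies in \<open>\<R> \<inter> Frac A = A\<close>. If \<open>r\<close> vanished at the
origin, \<open>v\<close> could be changed by an element of \<open>A\<close> so as to become divisible by \<open>x\<close> in \<open>\<R>\<close>, and the
quotient would show that \<open>a \<in> J\<close>. So \<open>r\<close> has a nonzero constant term, and \<open>x\<close> and \<open>y\<close> generate the unit ideal
of \<open>\<R>\<close> (\<open>dichotomy\<close>). Then no prime of \<open>\<R>\<close> contains all the \<open>f\<close>, and since \<open>\<R>\<^sub>f = A\<^sub>f[\<tau>\<^sub>f]\<close>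
(\<open>extend\<close>) the open sets \<open>P\<^sub>f = Spec \<R>\<^sub>f\<close> cover \<open>Spec \<R>\<close>, so that \<open>P = Spec \<R>\<close>.

The geometry is reduced to rings by charts. A chart of an open set \<open>V\<close> is a homomorphism
\<open>\<rho> : R \<rightarrow> \<Gamma>(V)\<close> that identifies \<open>V\<close> with a set of primes of \<open>R\<close> in such a way that sections are locally
fractions of \<open>R\<close>. Two spaces that have charts over the same ring with the same primes are
isomorphic (\<open>isomorphism_iso\<close>). Hence the two isomorphisms that the theorem is about, of \<open>P\<close>
with a spectrum and of \<open>P\<close> with \<open>\<bbbG>\<^sub>a\<close> times the plane, are obtained by comparing sets of
primes. The charts themselves come from the spectrum (\<open>Spec_chart\<close>), from the relative affine line
over a chart (\<open>line_chart_and_prm\<close>), by restriction, and by transport along the trivialisations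
(\<open>chart_transport\<close>).\<close>

section \<open>Sections of a ringed space\<close>

abbreviation "\<Gamma> S U \<equiv> carrier (sections S U)"

lemma hom_Units:
 assumes "h \<in> ring_hom R S" "cring R" "cring S" "u \<in> Units R"
 shows "h u \<in> Units S"
proof -
 interpret R: cring R by fact
 interpret S: cring S by fact
 obtain v where v: "v \<in> carrier R" "u \<otimes>\<^bsub>R\<^esub> v = \<one>\<^bsub>R\<^esub>" "u \<in> carrier R" using assms(4) by (auto simp: Units_def)
 then have "h u \<otimes>\<^bsub>S\<^esub> h v = \<one>\<^bsub>S\<^esub>" using assms(1) ring_hom_mult ring_hom_one by metis
 then show ?thesis using v assms(1) S.m_comm by (auto simp: Units_def ring_hom_closed intro!: bexI[of _ "h v"])
qed

lemma (in cring) Units_mult_iff: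
 assumes "a \<in> carrier R" "b \<in> carrier R"
 shows "a \<otimes> b \<in> Units R \<longleftrightarrow> a \<in> Units R & b \<in> Units R"
proof
 assume u: "a \<otimes> b \<in> Units R"
 then show "a \<in> Units R & b \<in> Units R" using assms unit_factor[OF u] unit_factor[of b a] m_comm by auto
qed auto

lemma (in cring) UnitsI:
 "a \<in> carrier R ==> b \<in> carrier R ==> a \<otimes> b = \<one> ==> a \<in> Units R" using unit_factor[of a b] by simp

text \<open>The largest open subset of \<open>V\<close> on which \<open>s\<close> becomes invertible: the basic open set \<open>D(s)\<close> when
\<open>V\<close> is a spectrum.\<close>

definition locus :: "('p, 's) ringed_space => 'p set => 's => 'p set" where "locus S V s =
  {x \<in> V. \<exists>W. opens S W & x \<in> W & W \<subseteq> V & res S V W s \<in> Units (sections S W)}"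

locale rspace =
 fixes S :: "('p, 's) ringed_space"
 assumes ringed_space: "ringed_space S"
begin

lemmas ringed_spaceD = ringed_space[unfolded ringed_space_def]

lemma cring_sections: "opens S U ==> cring (sections S U)"
 using ringed_spaceD[THEN conjunct1] by simp

lemma res_hom:
 "opens S U ==> opens S V ==> V \<subseteq> U ==>
  res S U V \<in> ring_hom (sections S U) (sections S V)" using ringed_spaceD[THEN conjunct2, THEN conjunct1] by simp

lemma res_id: "opens S U ==> s \<in> \<Gamma> S U ==> res S U U s = s"
 using ringed_spaceD[THEN conjunct2, THEN conjunct2, THEN conjunct1] by simp

lemma res_res:
 "opens S U ==> opens S V ==> opens S W ==> W \<subseteq> V ==> V \<subseteq> U ==>
  s \<in> \<Gamma> S U ==> res S V W (res S U V s) = res S U W s"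
 using ringed_spaceD[THEN conjunct2, THEN conjunct2, THEN conjunct2, THEN conjunct1] by simp

lemma glue:
 assumes "\<And>V. V \<in> \<U> ==> opens S V" "\<And>V. V \<in> \<U> ==> s V \<in> \<Gamma> S V"
  and "\<And>V W. V \<in> \<U> ==> W \<in> \<U> ==> res S V (V \<inter> W) (s V) = res S W (V \<inter> W) (s W)"
 shows "\<exists>!t. t \<in> \<Gamma> S (\<Union>\<U>) & (\<forall>V\<in>\<U>. res S (\<Union>\<U>) V t = s V)"
 by (rule ringed_spaceD[THEN conjunct2, THEN conjunct2, THEN conjunct2, THEN conjunct2, rule_format])
  (intro conjI ballI; rule assms; assumption)

lemma res_closed:
 "opens S U ==> opens S V ==> V \<subseteq> U ==> s \<in> \<Gamma> S U ==>
  res S U V s \<in> \<Gamma> S V" by (rule ring_hom_closed[OF res_hom])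

lemma res_mult:
 "opens S U ==> opens S V ==> V \<subseteq> U ==> s \<in> \<Gamma> S U ==>
  t \<in> \<Gamma> S U ==>
  res S U V (s \<otimes>\<^bsub>sections S U\<^esub> t) = res S U V s \<otimes>\<^bsub>sections S V\<^esub> res S U V t" by (rule ring_hom_mult[OF res_hom])

lemma res_add:
 "opens S U ==> opens S V ==> V \<subseteq> U ==> s \<in> \<Gamma> S U ==>
  t \<in> \<Gamma> S U ==>
  res S U V (s \<oplus>\<^bsub>sections S U\<^esub> t) = res S U V s \<oplus>\<^bsub>sections S V\<^esub> res S U V t" by (rule ring_hom_add[OF res_hom])

lemma res_one:
 "opens S U ==> opens S V ==> V \<subseteq> U ==> res S U V \<one>\<^bsub>sections S U\<^esub> = \<one>\<^bsub>sections S V\<^esub>" by (rule ring_hom_one[OF res_hom])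

lemma res_zero:
 "opens S U ==> opens S V ==> V \<subseteq> U ==> res S U V \<zero>\<^bsub>sections S U\<^esub> = \<zero>\<^bsub>sections S V\<^esub>"
 using ring_hom_zero[OF res_hom] cring_sections cring.axioms(1) by metis

text \<open>Gluing in the form in which it is used: the local pieces are described by a relation
  \<open>D\<close>, any two of whose members agree on the overlap.\<close>

lemma glue_rel:
 assumes U: "opens S U" and D: "\<And>W s. D W s ==> opens S W & W \<subseteq> U & s \<in> \<Gamma> S W"
  and cover: "\<And>x. x \<in> U ==> \<exists>W s. x \<in> W & D W s"
  and agree: "\<And>W s W' s'. D W s ==> D W' s' ==> res S W (W \<inter> W') s = res S W' (W \<inter> W') s'"
 shows "\<exists>t \<in> \<Gamma> S U. \<forall>W s. D W s --> res S U W t = s"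
proof -
 define \<U> where "\<U> = {W. \<exists>s. D W s}"
 define s where "s W = (SOME s. D W s)" for W
 have s: "D W (s W)" if "W \<in> \<U>" for W using that unfolding \<U>_def s_def by (auto intro: someI)
 have un: "\<Union>\<U> = U" using cover D unfolding \<U>_def by blast
 have "\<exists>!t. t \<in> \<Gamma> S (\<Union>\<U>) & (\<forall>V\<in>\<U>. res S (\<Union>\<U>) V t = s V)" by (rule glue) (use s D agree in blast)+
 then obtain t where t: "t \<in> \<Gamma> S U" "\<forall>V\<in>\<U>. res S U V t = s V" unfolding un by blast
 have "res S U W t = r" if "D W r" for W r
 proof -
  have W: "W \<in> \<U>" using that unfolding \<U>_def by blast
  have "s W = r" using agree[OF s[OF W] that] D[OF that] D[OF s[OF W]] res_id by simp
  then show ?thesis using t W by simp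
 qed
 then show ?thesis using t by blast
qed

lemma sections_eqI:
 assumes U: "opens S U" and st: "s \<in> \<Gamma> S U" "t \<in> \<Gamma> S U"
  and loc: "\<And>x. x \<in> U ==> \<exists>W. opens S W & x \<in> W & W \<subseteq> U & res S U W s = res S U W t"
 shows "s = t"
proof -
 define \<U> where "\<U> = {W. opens S W & W \<subseteq> U & res S U W s = res S U W t}"
 have un: "\<Union>\<U> = U" using loc unfolding \<U>_def by blast
 have "\<exists>!r. r \<in> \<Gamma> S (\<Union>\<U>) & (\<forall>V\<in>\<U>. res S (\<Union>\<U>) V r = res S U V s)"
 proof (rule glue)
  fix V W assume "V \<in> \<U>" "W \<in> \<U>"
  then have "opens S V" "opens S W" "V \<subseteq> U" "W \<subseteq> U" unfolding \<U>_def by auto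
  then show "res S V (V \<inter> W) (res S U V s) = res S W (V \<inter> W) (res S U W s)" using res_res U st by (simp add: openin_Int)
 qed (use U st res_closed in \<open>auto simp: \<U>_def\<close>)
 moreover have "\<forall>V\<in>\<U>. res S U V t = res S U V s" unfolding \<U>_def by simp
 ultimately show ?thesis using st unfolding un by auto
qed

lemma locus_subset: "locus S V s \<subseteq> V"
 unfolding locus_def by blast

lemma open_locus:
 assumes "opens S V" shows "opens S (locus S V s)"
proof -
 have "locus S V s = \<Union>{W. opens S W & W \<subseteq> V & res S V W s \<in> Units (sections S W)}" unfolding locus_def by blast
 moreover have "opens S \<dots>" by (rule openin_Union) blast
 ultimately show ?thesis by simp
qed

text \<open>Inverses are unique, hence local inverses glue.\<close>

lemma Units_iff_locus:
 assumes V: "opens S V" and s: "s \<in> \<Gamma> S V" and W: "opens S W" "W \<subseteq> V"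
 shows "res S V W s \<in> Units (sections S W) \<longleftrightarrow> W \<subseteq> locus S V s"
proof
 assume "res S V W s \<in> Units (sections S W)"
 then show "W \<subseteq> locus S V s" unfolding locus_def using W by blast
next
 assume sub: "W \<subseteq> locus S V s"
 define D where "D N t \<longleftrightarrow> opens S N & N \<subseteq> W & t \<in> \<Gamma> S N &
  res S V N s \<otimes>\<^bsub>sections S N\<^esub> t = \<one>\<^bsub>sections S N\<^esub>" for N t
 have local: "\<exists>N t. x \<in> N & D N t" if x: "x \<in> W" for x
 proof -
  obtain N where N: "opens S N" "x \<in> N" "N \<subseteq> V" "res S V N s \<in> Units (sections S N)"
   using sub x unfolding locus_def by blast
  have o: "opens S (N \<inter> W)" using N W by (simp add: openin_Int)
  have "res S N (N \<inter> W) (res S V N s) \<in> Units (sections S (N \<inter> W))"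
   by (rule hom_Units[OF res_hom]) (use N o cring_sections in auto)
  then have "res S V (N \<inter> W) s \<in> Units (sections S (N \<inter> W))" using res_res N V o s by auto
  then obtain t where "D (N \<inter> W) t" unfolding D_def Units_def using o by blast
  then show ?thesis using N x by blast
 qed
 have down: "res S V N' s \<otimes>\<^bsub>sections S N'\<^esub> res S N N' t = \<one>\<^bsub>sections S N'\<^esub>"
  if "D N t" "opens S N'" "N' \<subseteq> N" for N N' t
  using that W(2) res_mult[of N N' "res S V N s" t] res_one[of N N'] res_res[OF V, of N N' s] res_closed[OF V, of N s] s
  unfolding D_def by auto
 have "\<exists>t \<in> \<Gamma> S W. \<forall>N r. D N r --> res S W N t = r"
 proof (rule glue_rel[OF W(1)])
  fix N t Y r assume d: "D N t" "D Y r"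
  let ?Z = "N \<inter> Y"
  have Z: "opens S ?Z" "?Z \<subseteq> V" using d W unfolding D_def by (auto simp: openin_Int)
  interpret Z: cring "sections S ?Z" by (rule cring_sections[OF Z(1)])
  have "res S V ?Z s \<in> \<Gamma> S ?Z" "res S N ?Z t \<in> \<Gamma> S ?Z" "res S Y ?Z r \<in> \<Gamma> S ?Z"
   using res_closed d Z V s unfolding D_def by auto
  then show "res S N ?Z t = res S Y ?Z r"
   using down[OF d(1) Z(1)] down[OF d(2) Z(1)] Z.inv_unique Z.m_comm by (metis Int_lower1 Int_lower2)
 qed (use local in \<open>auto simp: D_def\<close>)
 then obtain t where t: "t \<in> \<Gamma> S W" "\<And>N r. D N r ==> res S W N t = r" by blast
 interpret W: cring "sections S W" by (rule cring_sections[OF W(1)])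
 have sW: "res S V W s \<in> \<Gamma> S W" using res_closed V W s by auto
 have "res S V W s \<otimes>\<^bsub>sections S W\<^esub> t = \<one>\<^bsub>sections S W\<^esub>"
 proof (rule sections_eqI[OF W(1)])
  fix x assume "x \<in> W"
  then obtain N r where N: "x \<in> N" "D N r" using local by blast
  then have "res S W N (res S V W s \<otimes>\<^bsub>sections S W\<^esub> t) = res S W N \<one>\<^bsub>sections S W\<^esub>"
   using t(2)[OF N(2)] res_mult[OF W(1) _ _ sW t(1)] res_one[OF W(1)] res_res[OF V W(1)] W s unfolding D_def by auto
  then show "\<exists>N. opens S N & x \<in> N & N \<subseteq> W &
    res S W N (res S V W s \<otimes>\<^bsub>sections S W\<^esub> t) = res S W N \<one>\<^bsub>sections S W\<^esub>" using N unfolding D_def by blast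
 qed (use sW t in auto)
 then show "res S V W s \<in> Units (sections S W)" using sW t W.m_comm unfolding Units_def by auto
qed

lemma locus_res:
 assumes V: "opens S V" "s \<in> \<Gamma> S V" and W: "opens S W" "W \<subseteq> V"
 shows "locus S W (res S V W s) = W \<inter> locus S V s"
proof (intro equalityI subsetI)
 fix x assume "x \<in> locus S W (res S V W s)"
 then obtain N where "opens S N" "x \<in> N" "N \<subseteq> W" "res S W N (res S V W s) \<in> Units (sections S N)" "x \<in> W"
  unfolding locus_def by blast
 then show "x \<in> W \<inter> locus S V s" using res_res[OF V(1) W(1) _ _ W(2) V(2)] W unfolding locus_def by auto
next
 fix x assume x: "x \<in> W \<inter> locus S V s"
 let ?N = "W \<inter> locus S V s"
 have N: "opens S ?N" using W open_locus[OF V(1)] by (simp add: openin_Int)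
 then have "res S V ?N s \<in> Units (sections S ?N)" using Units_iff_locus[OF V N] W by auto
 then have "res S W ?N (res S V W s) \<in> Units (sections S ?N)" using res_res[OF V(1) W(1) N _ W(2) V(2)] by simp
 then show "x \<in> locus S W (res S V W s)" unfolding locus_def[of S W] using x N by blast
qed

lemma locus_mult:
 assumes V: "opens S V" and "s \<in> \<Gamma> S V" "t \<in> \<Gamma> S V"
 shows "locus S V (s \<otimes>\<^bsub>sections S V\<^esub> t) = locus S V s \<inter> locus S V t"
proof -
 interpret V: cring "sections S V" by (rule cring_sections[OF V])
 have iff: "W \<subseteq> locus S V (s \<otimes>\<^bsub>sections S V\<^esub> t) \<longleftrightarrow> W \<subseteq> locus S V s \<inter> locus S V t"
  if W: "opens S W" "W \<subseteq> V" for W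
 proof -
  interpret W: cring "sections S W" by (rule cring_sections[OF W(1)])
  show ?thesis using Units_iff_locus[OF V _ W] assms res_mult[OF V W assms(2,3)]
    W.Units_mult_iff res_closed[OF V W] by (metis Int_subset_iff V.m_closed)
 qed
 show ?thesis
 proof
  show "locus S V (s \<otimes>\<^bsub>sections S V\<^esub> t) \<subseteq> locus S V s \<inter> locus S V t" using iff[OF open_locus[OF V] locus_subset] by blast
  have "opens S (locus S V s \<inter> locus S V t)" "locus S V s \<inter> locus S V t \<subseteq> V"
   using open_locus[OF V] locus_subset by (blast intro: openin_Int)+
  from iff[OF this] show "locus S V s \<inter> locus S V t \<subseteq> locus S V (s \<otimes>\<^bsub>sections S V\<^esub> t)" by blast
 qed
qed

lemma locus_one: "opens S V ==> locus S V \<one>\<^bsub>sections S V\<^esub> = V"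
 using Units_iff_locus[of V "\<one>\<^bsub>sections S V\<^esub>" V] locus_subset[of V "\<one>\<^bsub>sections S V\<^esub>"]
  cring_sections[of V] res_id by (auto simp: cring_def ring_def ring.ring_simprules monoid.Units_one_closed ring.is_monoid)

end

section \<open>Stalks\<close>

lemma UN_const1:
 assumes "(u, a) \<in> A" "\<And>u a. (u, a) \<in> A ==> g u a = c"
 shows "(\<Union>(u, a)\<in>A. g u a) = c"
proof -
 have "(\<Union>(u, a)\<in>A. g u a) = (\<Union>p\<in>A. c)" using assms(2) by (intro SUP_cong) auto
 then show ?thesis using assms(1) by auto
qed

lemma UN_const2:
 assumes "(u, a) \<in> A" "(v, b) \<in> B"
  "\<And>u a v b. (u, a) \<in> A ==> (v, b) \<in> B ==> g u a v b = c"
 shows "(\<Union>(u, a)\<in>A. \<Union>(v, b)\<in>B. g u a v b) = c" by (rule UN_const1[OF assms(1)], rule UN_const1[OF assms(2)], rule assms(3))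

context rspace
begin

definition near :: "'p => 'p set => 's => 'p set => 's => bool" where
 "near x U s V t \<longleftrightarrow> (\<exists>W. opens S W & x \<in> W & W \<subseteq> U \<inter> V & res S U W s = res S V W t)"

lemma near_sym: "near x U s V t ==> near x V t U s"
 unfolding near_def by (metis Int_commute)

lemma near_trans:
 assumes U: "opens S U" "s \<in> \<Gamma> S U" and V: "opens S V" "t \<in> \<Gamma> S V" and Z: "opens S Z" "r \<in> \<Gamma> S Z"
  and n: "near x U s V t" "near x V t Z r"
 shows "near x U s Z r"
proof -
 obtain W where W: "opens S W" "x \<in> W" "W \<subseteq> U" "W \<subseteq> V" "res S U W s = res S V W t" using n(1) unfolding near_def by auto
 obtain W' where W': "opens S W'" "x \<in> W'" "W' \<subseteq> V" "W' \<subseteq> Z" "res S V W' t = res S Z W' r"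
  using n(2) unfolding near_def by auto
 let ?W = "W \<inter> W'"
 have o: "opens S ?W" using W W' by (simp add: openin_Int)
 have "res S U ?W s = res S V ?W t"
  using res_res[OF U(1) W(1) o _ W(3) U(2)] res_res[OF V(1) W(1) o _ W(4) V(2)] W(5) by simp
 also have "\<dots> = res S Z ?W r"
  using res_res[OF V(1) W'(1) o _ W'(3) V(2)] res_res[OF Z(1) W'(1) o _ W'(4) Z(2)] W'(5) by simp
 finally show ?thesis unfolding near_def using o W W' by (intro exI[of _ ?W]) auto
qed

lemma germ_def2: "germ S x U s = {(V, t). opens S V & x \<in> V & t \<in> \<Gamma> S V & near x U s V t}"
 unfolding germ_def near_def ..

lemma near_refl: "opens S U ==> x \<in> U ==> near x U s U s"
 unfolding near_def by auto

lemma germ_eq_iff: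
 assumes U: "opens S U" "x \<in> U" "s \<in> \<Gamma> S U" and V: "opens S V" "x \<in> V" "t \<in> \<Gamma> S V"
 shows "germ S x U s = germ S x V t \<longleftrightarrow> near x U s V t"
proof
 assume e: "germ S x U s = germ S x V t"
 have "(V, t) \<in> germ S x V t" unfolding germ_def2 using V near_refl by auto
 then have "(V, t) \<in> germ S x U s" using e by simp
 then show "near x U s V t" unfolding germ_def2 by simp
next
 assume n: "near x U s V t"
 have "near x U s Z r \<longleftrightarrow> near x V t Z r" if "opens S Z" "r \<in> \<Gamma> S Z" for Z r
  using near_trans[OF U(1,3) V(1,3) that n] near_trans[OF V(1,3) U(1,3) that near_sym[OF n]] by blast
 then show "germ S x U s = germ S x V t" unfolding germ_def2 by auto
qed

lemma germ_res:
 assumes U: "opens S U" "s \<in> \<Gamma> S U" and W: "opens S W" "W \<subseteq> U" "x \<in> W"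
 shows "germ S x W (res S U W s) = germ S x U s"
proof -
 have "near x W (res S U W s) U s"
  unfolding near_def using W res_res[OF U(1) W(1) W(1) _ _ U(2)] by (intro exI[of _ W]) auto
 then show ?thesis using germ_eq_iff[of W x "res S U W s" U s] res_closed U W by auto
qed

lemma stalk_carrierE:
 assumes "c \<in> carrier (stalk S x)"
 obtains U s where "opens S U" "x \<in> U" "s \<in> \<Gamma> S U" "c = germ S x U s" using assms unfolding stalk_def by auto

lemma germ_closed:
 "opens S U ==> x \<in> U ==> s \<in> \<Gamma> S U ==> germ S x U s \<in> carrier (stalk S x)" unfolding stalk_def by auto

lemma germ_op:
 fixes f :: "'p set => 's => 's => 's"
 assumes cl: "\<And>W a b. opens S W ==> a \<in> \<Gamma> S W ==> b \<in> \<Gamma> S W ==>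
   f W a b \<in> \<Gamma> S W" and nat: "\<And>V W a b. opens S V ==> opens S W ==> W \<subseteq> V ==> a \<in> \<Gamma> S V ==>
   b \<in> \<Gamma> S V ==> res S V W (f V a b) = f W (res S V W a) (res S V W b)" and U: "opens S U" "x \<in> U" "s \<in> \<Gamma> S U" "t \<in> \<Gamma> S U"
 shows "(\<Union>(U', a) \<in> germ S x U s. \<Union>(V', b) \<in> germ S x U t.
   germ S x (U' \<inter> V') (f (U' \<inter> V') (res S U' (U' \<inter> V') a) (res S V' (U' \<inter> V') b)))
  = germ S x U (f U s t)"
proof -
 have main: "germ S x (U' \<inter> V') (f (U' \<inter> V') (res S U' (U' \<inter> V') a) (res S V' (U' \<inter> V') b))
   = germ S x U (f U s t)"
  if a: "(U', a) \<in> germ S x U s" and b: "(V', b) \<in> germ S x U t" for U' a V' b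
 proof -
  obtain W where U': "opens S U'" "x \<in> U'" "a \<in> \<Gamma> S U'" and
   W: "opens S W" "x \<in> W" "W \<subseteq> U" "W \<subseteq> U'" "res S U W s = res S U' W a" using a unfolding germ_def by auto
  obtain W' where V': "opens S V'" "x \<in> V'" "b \<in> \<Gamma> S V'" and
   W': "opens S W'" "x \<in> W'" "W' \<subseteq> U" "W' \<subseteq> V'" "res S U W' t = res S V' W' b" using b unfolding germ_def by auto
  let ?I = "U' \<inter> V'" and ?W = "W \<inter> W'"
  have o: "opens S ?W" "opens S ?I" using W W' U' V' by (simp_all add: openin_Int)
  have sub: "?W \<subseteq> ?I" "?W \<subseteq> U" "?W \<subseteq> U'" "?W \<subseteq> V'" using W W' by auto
  have e1: "res S U ?W s = res S U' ?W a"
   using res_res[OF U(1) W(1) o(1) _ W(3) U(3)] res_res[OF U'(1) W(1) o(1) _ W(4) U'(3)] W(5) by simp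
  have e2: "res S U ?W t = res S V' ?W b"
   using res_res[OF U(1) W'(1) o(1) _ W'(3) U(4)] res_res[OF V'(1) W'(1) o(1) _ W'(4) V'(3)] W'(5) by simp
  have c: "res S U' ?I a \<in> \<Gamma> S ?I" "res S V' ?I b \<in> \<Gamma> S ?I" using res_closed o U' V' by auto
  have "res S ?I ?W (f ?I (res S U' ?I a) (res S V' ?I b)) = f ?W (res S U' ?W a) (res S V' ?W b)"
   using nat[OF o(2,1) sub(1) c] res_res[OF U'(1) o(2,1) sub(1) _ U'(3)] res_res[OF V'(1) o(2,1) sub(1) _ V'(3)] by simp
  also have "\<dots> = res S U ?W (f U s t)" using nat[OF U(1) o(1) sub(2) U(3,4)] e1 e2 by simp
  finally have "near x ?I (f ?I (res S U' ?I a) (res S V' ?I b)) U (f U s t)"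
   unfolding near_def using o sub W W' by (intro exI[of _ ?W]) auto
  then show ?thesis using germ_eq_iff[of ?I x _ U] o c U cl U' V' by auto
 qed
 have "(U, s) \<in> germ S x U s" "(U, t) \<in> germ S x U t" unfolding germ_def2 using U near_refl by auto
 then show ?thesis by (rule UN_const2) (rule main)
qed

lemma germ_mult:
 assumes "opens S U" "x \<in> U" "s \<in> \<Gamma> S U" "t \<in> \<Gamma> S U"
 shows "germ S x U s \<otimes>\<^bsub>stalk S x\<^esub> germ S x U t = germ S x U (s \<otimes>\<^bsub>sections S U\<^esub> t)" unfolding stalk_def monoid.simps
 by (rule germ_op[of "\<lambda>W a b. a \<otimes>\<^bsub>sections S W\<^esub> b"])
  (use assms cring_sections res_mult in \<open>auto intro!: monoid.m_closed simp: cring_def ring_def\<close>)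

lemma germ_add:
 assumes "opens S U" "x \<in> U" "s \<in> \<Gamma> S U" "t \<in> \<Gamma> S U"
 shows "germ S x U s \<oplus>\<^bsub>stalk S x\<^esub> germ S x U t = germ S x U (s \<oplus>\<^bsub>sections S U\<^esub> t)" unfolding stalk_def ring.simps
 by (rule germ_op[of "\<lambda>W a b. a \<oplus>\<^bsub>sections S W\<^esub> b"])
  (use assms cring_sections res_add in \<open>auto intro!: ring.ring_simprules(1) simp: cring_def\<close>)

lemma germ_one:
 assumes "opens S U" "x \<in> U"
 shows "germ S x U \<one>\<^bsub>sections S U\<^esub> = \<one>\<^bsub>stalk S x\<^esub>"
proof -
 interpret cring "sections S (points S)" by (rule cring_sections) simp
 have "U \<subseteq> points S" using assms openin_subset by blast
 then show ?thesis using germ_res[of "points S" "\<one>\<^bsub>sections S (points S)\<^esub>" U x] assms res_one[of "points S" U]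
  unfolding stalk_def by simp
qed

lemma germ_zero:
 assumes "opens S U" "x \<in> U"
 shows "germ S x U \<zero>\<^bsub>sections S U\<^esub> = \<zero>\<^bsub>stalk S x\<^esub>"
proof -
 interpret cring "sections S (points S)" by (rule cring_sections) simp
 have "U \<subseteq> points S" using assms openin_subset by blast
 then show ?thesis using germ_res[of "points S" "\<zero>\<^bsub>sections S (points S)\<^esub>" U x] assms res_zero[of "points S" U]
  unfolding stalk_def by simp
qed

lemma germ_hom:
 "opens S U ==> x \<in> U ==> germ S x U \<in> ring_hom (sections S U) (stalk S x)"
 by (rule ring_hom_memI) (simp_all add: germ_closed germ_mult germ_add germ_one)

lemma stalk_common2:
 assumes "c \<in> carrier (stalk S x)" "d \<in> carrier (stalk S x)"
 obtains U s t where "opens S U" "x \<in> U" "s \<in> \<Gamma> S U" "t \<in> \<Gamma> S U" "c = germ S x U s" "d = germ S x U t"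
proof -
 obtain U s where U: "opens S U" "x \<in> U" "s \<in> \<Gamma> S U" "c = germ S x U s" using assms(1) by (rule stalk_carrierE)
 obtain V t where V: "opens S V" "x \<in> V" "t \<in> \<Gamma> S V" "d = germ S x V t" using assms(2) by (rule stalk_carrierE)
 have o: "opens S (U \<inter> V)" using U V by (simp add: openin_Int)
 show ?thesis using that[OF o, of "res S U (U \<inter> V) s" "res S V (U \<inter> V) t"] U V o
   germ_res[of U s "U \<inter> V" x] germ_res[of V t "U \<inter> V" x] res_closed by auto
qed

lemma stalk_common3:
 assumes "c \<in> carrier (stalk S x)" "d \<in> carrier (stalk S x)" "e \<in> carrier (stalk S x)"
 obtains U s t r where "opens S U" "x \<in> U" "s \<in> \<Gamma> S U" "t \<in> \<Gamma> S U"
  "r \<in> \<Gamma> S U" "c = germ S x U s" "d = germ S x U t" "e = germ S x U r"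
proof -
 obtain U s t where U: "opens S U" "x \<in> U" "s \<in> \<Gamma> S U" "t \<in> \<Gamma> S U" "c = germ S x U s" "d = germ S x U t"
  using assms(1,2) by (rule stalk_common2)
 obtain V r where V: "opens S V" "x \<in> V" "r \<in> \<Gamma> S V" "e = germ S x V r" using assms(3) by (rule stalk_carrierE)
 have o: "opens S (U \<inter> V)" using U V by (simp add: openin_Int)
 show ?thesis using that[OF o, of "res S U (U \<inter> V) s" "res S U (U \<inter> V) t" "res S V (U \<inter> V) r"] U V o
   germ_res[of U s "U \<inter> V" x] germ_res[of U t "U \<inter> V" x] germ_res[of V r "U \<inter> V" x]
   res_closed by auto
qed

lemma cring_stalk:
 assumes x: "x \<in> points S"
 shows "cring (stalk S x)"
proof -
 let ?K = "stalk S x"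
 have top: "opens S (points S)" by simp
 interpret T: cring "sections S (points S)" by (rule cring_sections[OF top])
 have cl: "\<zero>\<^bsub>?K\<^esub> \<in> carrier ?K" "\<one>\<^bsub>?K\<^esub> \<in> carrier ?K"
  using germ_closed[OF top x T.zero_closed] germ_closed[OF top x T.one_closed] germ_zero[OF top x] germ_one[OF top x]
  by simp_all
 have laws: "a \<oplus>\<^bsub>?K\<^esub> b \<in> carrier ?K & a \<otimes>\<^bsub>?K\<^esub> b \<in> carrier ?K &
   a \<oplus>\<^bsub>?K\<^esub> b = b \<oplus>\<^bsub>?K\<^esub> a & a \<otimes>\<^bsub>?K\<^esub> b = b \<otimes>\<^bsub>?K\<^esub> a &
   a \<oplus>\<^bsub>?K\<^esub> b \<oplus>\<^bsub>?K\<^esub> d = a \<oplus>\<^bsub>?K\<^esub> (b \<oplus>\<^bsub>?K\<^esub> d) & a \<otimes>\<^bsub>?K\<^esub> b \<otimes>\<^bsub>?K\<^esub> d = a \<otimes>\<^bsub>?K\<^esub> (b \<otimes>\<^bsub>?K\<^esub> d) &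
   (a \<oplus>\<^bsub>?K\<^esub> b) \<otimes>\<^bsub>?K\<^esub> d = a \<otimes>\<^bsub>?K\<^esub> d \<oplus>\<^bsub>?K\<^esub> b \<otimes>\<^bsub>?K\<^esub> d &
   \<zero>\<^bsub>?K\<^esub> \<oplus>\<^bsub>?K\<^esub> a = a & \<one>\<^bsub>?K\<^esub> \<otimes>\<^bsub>?K\<^esub> a = a & (\<exists>y\<in>carrier ?K. y \<oplus>\<^bsub>?K\<^esub> a = \<zero>\<^bsub>?K\<^esub>)"
  if abd: "a \<in> carrier ?K" "b \<in> carrier ?K" "d \<in> carrier ?K" for a b d
 proof -
  obtain U s t r where U: "opens S U" "x \<in> U" "s \<in> \<Gamma> S U" "t \<in> \<Gamma> S U" "r \<in> \<Gamma> S U"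
   "a = germ S x U s" "b = germ S x U t" "d = germ S x U r" using abd by (rule stalk_common3)
  interpret cring "sections S U" by (rule cring_sections) fact
  have "\<exists>y\<in>carrier ?K. y \<oplus>\<^bsub>?K\<^esub> a = \<zero>\<^bsub>?K\<^esub>" using U germ_zero[OF U(1,2), symmetric]
   by (intro bexI[of _ "germ S x U (\<ominus>\<^bsub>sections S U\<^esub> s)"]) (simp_all add: germ_add germ_closed l_neg)
  then show ?thesis using U germ_zero[OF U(1,2), symmetric] germ_one[OF U(1,2), symmetric]
   by (simp add: germ_add germ_mult germ_closed a_ac m_ac r_distr)
 qed
 show ?thesis
 proof (intro cringI abelian_groupI comm_monoidI)
  fix a b d assume "a \<in> carrier ?K" "b \<in> carrier ?K" "d \<in> carrier ?K"
  from laws[OF this] show "a \<oplus>\<^bsub>?K\<^esub> b \<oplus>\<^bsub>?K\<^esub> d = a \<oplus>\<^bsub>?K\<^esub> (b \<oplus>\<^bsub>?K\<^esub> d)" "a \<otimes>\<^bsub>?K\<^esub> b \<otimes>\<^bsub>?K\<^esub> d = a \<otimes>\<^bsub>?K\<^esub> (b \<otimes>\<^bsub>?K\<^esub> d)"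
   "(a \<oplus>\<^bsub>?K\<^esub> b) \<otimes>\<^bsub>?K\<^esub> d = a \<otimes>\<^bsub>?K\<^esub> d \<oplus>\<^bsub>?K\<^esub> b \<otimes>\<^bsub>?K\<^esub> d" by - (elim conjE, assumption)+
 next
  fix a b assume ab: "a \<in> carrier ?K" "b \<in> carrier ?K"
  from laws[OF ab ab(2)] show "a \<oplus>\<^bsub>?K\<^esub> b \<in> carrier ?K" "a \<otimes>\<^bsub>?K\<^esub> b \<in> carrier ?K"
   "a \<oplus>\<^bsub>?K\<^esub> b = b \<oplus>\<^bsub>?K\<^esub> a" "a \<otimes>\<^bsub>?K\<^esub> b = b \<otimes>\<^bsub>?K\<^esub> a" by - (elim conjE, assumption)+
  from laws[OF ab(1) ab(1) ab(1)] show "\<zero>\<^bsub>?K\<^esub> \<oplus>\<^bsub>?K\<^esub> a = a" "\<one>\<^bsub>?K\<^esub> \<otimes>\<^bsub>?K\<^esub> a = a"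
   "\<exists>y\<in>carrier ?K. y \<oplus>\<^bsub>?K\<^esub> a = \<zero>\<^bsub>?K\<^esub>" by - (elim conjE, assumption)+
 qed (rule cl)+
qed

lemma germ_zero_iff:
 assumes U: "opens S U" "x \<in> U" "s \<in> \<Gamma> S U"
 shows "germ S x U s = \<zero>\<^bsub>stalk S x\<^esub> \<longleftrightarrow>
  (\<exists>W. opens S W & x \<in> W & W \<subseteq> U & res S U W s = \<zero>\<^bsub>sections S W\<^esub>)"
proof -
 interpret cring "sections S U" by (rule cring_sections) fact
 have "res S U W \<zero>\<^bsub>sections S U\<^esub> = \<zero>\<^bsub>sections S W\<^esub>" if "opens S W" "W \<subseteq> U" for W using res_zero U that by simp
 then show ?thesis unfolding germ_zero[OF U(1,2), symmetric] germ_eq_iff[OF U U(1,2) zero_closed] near_def by auto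
qed

lemma germ_Units_iff:
 assumes U: "opens S U" "x \<in> U" "s \<in> \<Gamma> S U"
 shows "germ S x U s \<in> Units (stalk S x) \<longleftrightarrow> x \<in> locus S U s"
proof
 have x: "x \<in> points S" using U openin_subset by blast
 interpret K: cring "stalk S x" by (rule cring_stalk) fact
 assume "germ S x U s \<in> Units (stalk S x)"
 then obtain c where c: "c \<in> carrier (stalk S x)" "germ S x U s \<otimes>\<^bsub>stalk S x\<^esub> c = \<one>\<^bsub>stalk S x\<^esub>" unfolding Units_def by blast
 obtain V t where V: "opens S V" "x \<in> V" "t \<in> \<Gamma> S V" "c = germ S x V t" using c(1) by (rule stalk_carrierE)
 let ?I = "U \<inter> V"
 have o: "opens S ?I" "x \<in> ?I" using U V by (auto simp: openin_Int)
 interpret I: cring "sections S ?I" by (rule cring_sections) fact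
 have cl: "res S U ?I s \<in> \<Gamma> S ?I" "res S V ?I t \<in> \<Gamma> S ?I" using res_closed U V o by auto
 have "germ S x ?I (res S U ?I s \<otimes>\<^bsub>sections S ?I\<^esub> res S V ?I t) = germ S x ?I \<one>\<^bsub>sections S ?I\<^esub>"
  using germ_mult[OF o cl] germ_res[OF U(1,3) o(1) _ o(2)] germ_res[OF V(1,3) o(1) _ o(2)] c(2) V(4) germ_one[OF o] by simp
 then obtain W where W: "opens S W" "x \<in> W" "W \<subseteq> ?I"
  "res S ?I W (res S U ?I s \<otimes>\<^bsub>sections S ?I\<^esub> res S V ?I t) = res S ?I W \<one>\<^bsub>sections S ?I\<^esub>"
  using germ_eq_iff[OF o _ o] cl unfolding near_def by auto
 interpret W: cring "sections S W" by (rule cring_sections) fact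
 have "res S U W s \<otimes>\<^bsub>sections S W\<^esub> res S V W t = \<one>\<^bsub>sections S W\<^esub>"
  using W res_mult[OF o(1) W(1,3) cl] res_one[OF o(1) W(1,3)]
   res_res[OF U(1) o(1) W(1,3) _ U(3)] res_res[OF V(1) o(1) W(1,3) _ V(3)] by simp
 moreover have "res S U W s \<in> \<Gamma> S W" "res S V W t \<in> \<Gamma> S W" using res_closed U V W by auto
 ultimately have "res S U W s \<in> Units (sections S W)"
  using W.m_comm[of "res S U W s" "res S V W t"] unfolding Units_def by force
 then show "x \<in> locus S U s" unfolding locus_def using W U by auto
next
 have x: "x \<in> points S" using U openin_subset by blast
 assume "x \<in> locus S U s"
 then obtain W where W: "opens S W" "x \<in> W" "W \<subseteq> U" "res S U W s \<in> Units (sections S W)" unfolding locus_def by blast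
 have "germ S x W (res S U W s) \<in> Units (stalk S x)"
  by (rule hom_Units[OF germ_hom]) (use W x cring_sections cring_stalk in auto)
 then show "germ S x U s \<in> Units (stalk S x)" using germ_res[OF U(1,3) W(1,3,2)] by simp
qed

end

section \<open>Morphisms\<close>

lemma open_preimg:
 "continuous_map (topo S) (topo Y) (pt f) ==> opens Y V ==> opens S (preimg S f V)"
 unfolding preimg_def by (rule openin_continuous_map_preimage)

text \<open>The first three conditions in the definition of a morphism make the stalk maps
  well defined.\<close>

lemma stalk_map_germ:
 assumes S: "rspace S" and Y: "rspace Y" and cont: "continuous_map (topo S) (topo Y) (pt f)"
  and hom: "\<And>V. opens Y V ==> pull f V \<in> ring_hom (sections Y V) (sections S (preimg S f V))"
  and nat: "\<And>V W t. opens Y V ==> opens Y W ==> W \<subseteq> V ==> t \<in> \<Gamma> Y V ==>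
   res S (preimg S f V) (preimg S f W) (pull f V t) = pull f W (res Y V W t)"
  and x: "x \<in> points S" and V: "opens Y V" "pt f x \<in> V" "t \<in> \<Gamma> Y V"
 shows "stalk_map S f x (germ Y (pt f x) V t) = germ S x (preimg S f V) (pull f V t)"
proof -
 interpret S: rspace S by fact
 interpret Y: rspace Y by fact
 have eq: "germ S x (preimg S f V') (pull f V' t') = germ S x (preimg S f V) (pull f V t)"
  if g: "(V', t') \<in> germ Y (pt f x) V t" for V' t'
 proof -
  obtain W where V': "opens Y V'" "pt f x \<in> V'" "t' \<in> \<Gamma> Y V'" and
   W: "opens Y W" "pt f x \<in> W" "W \<subseteq> V" "W \<subseteq> V'" "res Y V W t = res Y V' W t'" using g unfolding germ_def by auto
  have o: "opens S (preimg S f W)" "opens S (preimg S f V)" "opens S (preimg S f V')"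
   using open_preimg[OF cont] W V V' by auto
  have sub: "preimg S f W \<subseteq> preimg S f V" "preimg S f W \<subseteq> preimg S f V'" "x \<in> preimg S f W"
   using W x unfolding preimg_def by auto
  have "pull f V t \<in> \<Gamma> S (preimg S f V)" "pull f V' t' \<in> \<Gamma> S (preimg S f V')" using ring_hom_closed[OF hom] V V' by auto
  then show ?thesis using S.germ_res[of "preimg S f V" "pull f V t" "preimg S f W" x]
    S.germ_res[of "preimg S f V'" "pull f V' t'" "preimg S f W" x] o sub
    nat[OF V(1) W(1,3) V(3)] nat[OF V'(1) W(1,4) V'(3)] W(5) by simp
 qed
 have "(V, t) \<in> germ Y (pt f x) V t" unfolding Y.germ_def2 using V Y.near_refl by auto
 then show ?thesis unfolding stalk_map_def by (rule UN_const1) (rule eq)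
qed

text \<open>Locality of the stalk maps says that a section is invertible at \<open>f x\<close> as soon as its
  pullback is invertible at \<open>x\<close>.\<close>

lemma morphismI:
 assumes S: "rspace S" and Y: "rspace Y" and cont: "continuous_map (topo S) (topo Y) (pt f)"
  and hom: "\<And>V. opens Y V ==> pull f V \<in> ring_hom (sections Y V) (sections S (preimg S f V))"
  and nat: "\<And>V W t. opens Y V ==> opens Y W ==> W \<subseteq> V ==> t \<in> \<Gamma> Y V ==>
   res S (preimg S f V) (preimg S f W) (pull f V t) = pull f W (res Y V W t)"
  and local: "\<And>V t x. opens Y V ==> t \<in> \<Gamma> Y V ==> pt f x \<in> V ==>
   x \<in> locus S (preimg S f V) (pull f V t) ==> pt f x \<in> locus Y V t"
 shows "morphism S Y f"
proof -
 interpret S: rspace S by fact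
 interpret Y: rspace Y by fact
 have "A \<in> Units (stalk Y (pt f x))"
  if x: "x \<in> points S" and A: "A \<in> carrier (stalk Y (pt f x))" and u: "stalk_map S f x A \<in> Units (stalk S x)" for x A
 proof -
  obtain V t where V: "opens Y V" "pt f x \<in> V" "t \<in> \<Gamma> Y V" "A = germ Y (pt f x) V t" using A by (rule Y.stalk_carrierE)
  have "x \<in> locus S (preimg S f V) (pull f V t)"
   using u stalk_map_germ[OF S Y cont hom nat x V(1-3)] V(4) open_preimg[OF cont V(1)]
    S.germ_Units_iff[of "preimg S f V" x "pull f V t"] x V(1-3) ring_hom_closed[OF hom] by (simp add: preimg_def)
  then show ?thesis using local[OF V(1,3,2)] Y.germ_Units_iff[OF V(1-3)] V(4) by simp
 qed
 then show ?thesis unfolding morphism_def using cont hom nat by blast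
qed

lemma morphism_cont: "morphism S Y f ==> continuous_map (topo S) (topo Y) (pt f)"
 unfolding morphism_def by (rule conjunct1)

lemma morphism_open: "morphism S Y f ==> opens Y V ==> opens S (preimg S f V)"
 using open_preimg morphism_cont by blast

lemma morphism_hom:
 "morphism S Y f ==> opens Y V ==> pull f V \<in> ring_hom (sections Y V) (sections S (preimg S f V))"
 unfolding morphism_def by simp

lemma morphism_closed:
 "morphism S Y f ==> opens Y V ==> t \<in> \<Gamma> Y V ==>
  pull f V t \<in> \<Gamma> S (preimg S f V)" by (rule ring_hom_closed[OF morphism_hom])

lemma morphism_nat:
 "morphism S Y f ==> opens Y V ==> opens Y W ==> W \<subseteq> V ==> t \<in> \<Gamma> Y V ==>
  res S (preimg S f V) (preimg S f W) (pull f V t) = pull f W (res Y V W t)" unfolding morphism_def by simp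

lemma morphism_pt: "morphism S Y f ==> x \<in> points S ==> pt f x \<in> points Y"
 using morphism_cont continuous_map_image_subset_topspace by blast

lemma preimg_points: "morphism S Y f ==> preimg S f (points Y) = points S"
 by (auto simp: preimg_def dest: morphism_pt)

lemma locus_pull:
 assumes S: "rspace S" and Y: "rspace Y" and f: "morphism S Y f" and V: "opens Y V" "t \<in> \<Gamma> Y V"
 shows "locus S (preimg S f V) (pull f V t) = preimg S f (locus Y V t)"
proof (intro equalityI subsetI)
 interpret S: rspace S by fact
 interpret Y: rspace Y by fact
 note o = morphism_open[OF f]
 note cl = morphism_closed[OF f]
 fix x assume a: "x \<in> locus S (preimg S f V) (pull f V t)"
 then have x: "x \<in> preimg S f V" unfolding locus_def by simp
 then have x': "x \<in> points S" "pt f x \<in> V" unfolding preimg_def by auto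
 have "stalk_map S f x (germ Y (pt f x) V t) \<in> Units (stalk S x)"
  using a stalk_map_germ[OF S Y morphism_cont[OF f] morphism_hom[OF f] morphism_nat[OF f] x'(1) V(1) x'(2) V(2)]
   S.germ_Units_iff[OF o[OF V(1)] x cl[OF V]] by simp
 then have "germ Y (pt f x) V t \<in> Units (stalk Y (pt f x))"
  using f x' Y.germ_closed[OF V(1) x'(2) V(2)] unfolding morphism_def by blast
 then show "x \<in> preimg S f (locus Y V t)" using Y.germ_Units_iff[OF V(1) x'(2) V(2)] x' unfolding preimg_def by simp
next
 interpret S: rspace S by fact
 interpret Y: rspace Y by fact
 note o = morphism_open[OF f]
 fix x assume a: "x \<in> preimg S f (locus Y V t)"
 let ?L = "locus Y V t"
 have L: "opens Y ?L" "?L \<subseteq> V" using Y.open_locus V Y.locus_subset by auto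
 have "res Y V ?L t \<in> Units (sections Y ?L)" using Y.Units_iff_locus[OF V L] by simp
 then have "pull f ?L (res Y V ?L t) \<in> Units (sections S (preimg S f ?L))"
  by (rule hom_Units[OF morphism_hom[OF f L(1)] Y.cring_sections[OF L(1)] S.cring_sections[OF o[OF L(1)]]])
 then have "res S (preimg S f V) (preimg S f ?L) (pull f V t) \<in> Units (sections S (preimg S f ?L))"
  using morphism_nat[OF f V(1) L V(2)] by simp
 then show "x \<in> locus S (preimg S f V) (pull f V t)"
  unfolding locus_def[of S] using a o[OF L(1)] L(2) by (auto simp: preimg_def)
qed

lemma morphism_mcomp:
 assumes S: "rspace S" and Y: "rspace Y" and Z: "rspace Z" and f: "morphism S Y f" and g: "morphism Y Z g"
 shows "morphism S Z (mcomp Y g f)"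
proof (rule morphismI[OF S Z])
 have pre: "preimg S (mcomp Y g f) V = preimg S f (preimg Y g V)" for V
  using morphism_pt[OF f] unfolding preimg_def mcomp_def by auto
 note o = morphism_open[OF g]
 show "continuous_map (topo S) (topo Z) (pt (mcomp Y g f))"
  using continuous_map_compose[OF morphism_cont[OF f] morphism_cont[OF g]] by (simp add: mcomp_def o_def)
 fix V assume V: "opens Z V"
 show "pull (mcomp Y g f) V \<in> ring_hom (sections Z V) (sections S (preimg S (mcomp Y g f) V))"
  using ring_hom_trans[OF morphism_hom[OF g V] morphism_hom[OF f o[OF V]]] unfolding pre by (simp add: mcomp_def o_def)
 {
  fix W t assume "opens Z W" "W \<subseteq> V" "t \<in> \<Gamma> Z V"
  then show "res S (preimg S (mcomp Y g f) V) (preimg S (mcomp Y g f) W) (pull (mcomp Y g f) V t)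
    = pull (mcomp Y g f) W (res Z V W t)" using morphism_nat[OF g V, of W t] morphism_closed[OF g V, of t] V o
    morphism_nat[OF f o[OF V], of "preimg Y g W" "pull g V t"]
   unfolding pre by (simp add: mcomp_def preimg_def subset_iff)
 }
 fix t x assume t: "t \<in> \<Gamma> Z V" and "pt (mcomp Y g f) x \<in> V"
  and x: "x \<in> locus S (preimg S (mcomp Y g f) V) (pull (mcomp Y g f) V t)"
 have "x \<in> preimg S f (preimg Y g (locus Z V t))"
  using x locus_pull[OF Y Z g V t] locus_pull[OF S Y f o[OF V] morphism_closed[OF g V t]]
  unfolding pre by (simp add: mcomp_def)
 then show "pt (mcomp Y g f) x \<in> locus Z V t" unfolding preimg_def mcomp_def by simp
qed

section \<open>Localisations\<close>

text \<open>All identities of fractions below are reduced to identities in \<open>R\<close> by choosing representatives.\<close>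

locale localize = cring R for R (structure) +
 fixes M
 assumes M_sub: "M \<subseteq> carrier R" and one_M: "\<one> \<in> M" and mult_M: "f \<in> M ==> g \<in> M ==> f \<otimes> g \<in> M"
begin

abbreviation "Q \<equiv> localization R M"

lemma M_carrier: "f \<in> M ==> f \<in> carrier R"
 using M_sub by blast

lemma frac_rel_trans:
 assumes "a \<in> carrier R" "b \<in> carrier R" "c \<in> carrier R" "f \<in> M" "g \<in> M" "e \<in> M" "h \<in> M" "k \<in> M"
  and "h \<otimes> (g \<otimes> a) = h \<otimes> (f \<otimes> b)" "k \<otimes> (e \<otimes> b) = k \<otimes> (g \<otimes> c)"
 shows "(h \<otimes> k \<otimes> g) \<otimes> (e \<otimes> a) = (h \<otimes> k \<otimes> g) \<otimes> (f \<otimes> c)"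
proof -
 note c = assms(1-3) assms(4-8)[THEN M_carrier]
 have "(h \<otimes> k \<otimes> g) \<otimes> (e \<otimes> a) = (h \<otimes> (g \<otimes> a)) \<otimes> (k \<otimes> e)" using c by algebra
 also have "\<dots> = (k \<otimes> (e \<otimes> b)) \<otimes> (h \<otimes> f)" unfolding assms(9) using c by algebra
 also have "\<dots> = (h \<otimes> k \<otimes> g) \<otimes> (f \<otimes> c)" unfolding assms(10) using c by algebra
 finally show ?thesis .
qed

lemma frac_eq_iff:
 assumes "a \<in> carrier R" "f \<in> M" "b \<in> carrier R" "g \<in> M"
 shows "frac R M a f = frac R M b g \<longleftrightarrow> (\<exists>h\<in>M. h \<otimes> (g \<otimes> a) = h \<otimes> (f \<otimes> b))"
proof
 assume "frac R M a f = frac R M b g"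
 moreover have "(b, g) \<in> frac R M b g" unfolding frac_def using assms one_M by auto
 ultimately have "(b, g) \<in> frac R M a f" by simp
 then show "\<exists>h\<in>M. h \<otimes> (g \<otimes> a) = h \<otimes> (f \<otimes> b)" unfolding frac_def by simp
next
 assume "\<exists>h\<in>M. h \<otimes> (g \<otimes> a) = h \<otimes> (f \<otimes> b)"
 then obtain h where h: "h \<in> M" "h \<otimes> (g \<otimes> a) = h \<otimes> (f \<otimes> b)" by blast
 have "(c, e) \<in> frac R M a f \<longleftrightarrow> (c, e) \<in> frac R M b g" for c e
 proof
  assume "(c, e) \<in> frac R M b g"
  then obtain k where k: "c \<in> carrier R" "e \<in> M" "k \<in> M" "k \<otimes> (e \<otimes> b) = k \<otimes> (g \<otimes> c)" unfolding frac_def by auto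
  then show "(c, e) \<in> frac R M a f" using frac_rel_trans[OF assms(1,3) k(1) assms(2,4) k(2) h(1) k(3) h(2) k(4)]
   unfolding frac_def by (auto intro!: bexI[of _ "h \<otimes> k \<otimes> g"] mult_M h(1) assms)
 next
  assume "(c, e) \<in> frac R M a f"
  then obtain k where k: "c \<in> carrier R" "e \<in> M" "k \<in> M" "k \<otimes> (e \<otimes> a) = k \<otimes> (f \<otimes> c)" unfolding frac_def by auto
  then show "(c, e) \<in> frac R M b g" using frac_rel_trans[OF assms(3,1) k(1) assms(4,2) k(2) h(1) k(3) h(2)[symmetric] k(4)]
   unfolding frac_def by (auto intro!: bexI[of _ "h \<otimes> k \<otimes> f"] mult_M h(1) assms)
 qed
 then show "frac R M a f = frac R M b g" by auto
qed

lemma frac_self: "a \<in> carrier R ==> f \<in> M ==> (a, f) \<in> frac R M a f"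
 unfolding frac_def using one_M by auto

lemma frac_cong:
 assumes "a \<in> carrier R" "f \<in> M" "b \<in> carrier R" "g \<in> M" "g \<otimes> a = f \<otimes> b"
 shows "frac R M a f = frac R M b g" using frac_eq_iff[OF assms(1-4)] assms(5) one_M by auto

lemma frac_mult:
 assumes "a \<in> carrier R" "f \<in> M" "b \<in> carrier R" "g \<in> M"
 shows "frac R M a f \<otimes>\<^bsub>Q\<^esub> frac R M b g = frac R M (a \<otimes> b) (f \<otimes> g)" unfolding localization_def monoid.simps
proof (rule UN_const2[OF frac_self[OF assms(1,2)] frac_self[OF assms(3,4)]])
 fix a' f' b' g' assume "(a', f') \<in> frac R M a f" "(b', g') \<in> frac R M b g"
 then obtain h k where 1: "a' \<in> carrier R" "f' \<in> M" "h \<in> M" "h \<otimes> (f' \<otimes> a) = h \<otimes> (f \<otimes> a')"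
  and 2: "b' \<in> carrier R" "g' \<in> M" "k \<in> M" "k \<otimes> (g' \<otimes> b) = k \<otimes> (g \<otimes> b')" unfolding frac_def by auto
 note c = assms(1,3) 1(1) 2(1) assms(2,4)[THEN M_carrier] 1(2,3)[THEN M_carrier] 2(2,3)[THEN M_carrier]
 have "(h \<otimes> k) \<otimes> ((f \<otimes> g) \<otimes> (a' \<otimes> b')) = (h \<otimes> (f \<otimes> a')) \<otimes> (k \<otimes> (g \<otimes> b'))" using c by algebra
 also have "\<dots> = (h \<otimes> k) \<otimes> ((f' \<otimes> g') \<otimes> (a \<otimes> b))" unfolding 1(4)[symmetric] 2(4)[symmetric] using c by algebra
 finally show "frac R M (a' \<otimes> b') (f' \<otimes> g') = frac R M (a \<otimes> b) (f \<otimes> g)"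
  using frac_eq_iff[of "a' \<otimes> b'" "f' \<otimes> g'" "a \<otimes> b" "f \<otimes> g"] assms 1 2 mult_M by auto
qed

lemma frac_add:
 assumes "a \<in> carrier R" "f \<in> M" "b \<in> carrier R" "g \<in> M"
 shows "frac R M a f \<oplus>\<^bsub>Q\<^esub> frac R M b g = frac R M (a \<otimes> g \<oplus> b \<otimes> f) (f \<otimes> g)" unfolding localization_def ring.simps
proof (rule UN_const2[OF frac_self[OF assms(1,2)] frac_self[OF assms(3,4)]])
 fix a' f' b' g' assume "(a', f') \<in> frac R M a f" "(b', g') \<in> frac R M b g"
 then obtain h k where 1: "a' \<in> carrier R" "f' \<in> M" "h \<in> M" "h \<otimes> (f' \<otimes> a) = h \<otimes> (f \<otimes> a')"
  and 2: "b' \<in> carrier R" "g' \<in> M" "k \<in> M" "k \<otimes> (g' \<otimes> b) = k \<otimes> (g \<otimes> b')" unfolding frac_def by auto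
 note c = assms(1,3) 1(1) 2(1) assms(2,4)[THEN M_carrier] 1(2,3)[THEN M_carrier] 2(2,3)[THEN M_carrier]
 have "(h \<otimes> k) \<otimes> ((f \<otimes> g) \<otimes> (a' \<otimes> g' \<oplus> b' \<otimes> f'))
   = (h \<otimes> (f \<otimes> a')) \<otimes> (k \<otimes> g \<otimes> g') \<oplus> (k \<otimes> (g \<otimes> b')) \<otimes> (h \<otimes> f \<otimes> f')" using c by algebra
 also have "\<dots> = (h \<otimes> k) \<otimes> ((f' \<otimes> g') \<otimes> (a \<otimes> g \<oplus> b \<otimes> f))" unfolding 1(4)[symmetric] 2(4)[symmetric] using c by algebra
 finally show "frac R M (a' \<otimes> g' \<oplus> b' \<otimes> f') (f' \<otimes> g') = frac R M (a \<otimes> g \<oplus> b \<otimes> f) (f \<otimes> g)"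
  using frac_eq_iff[of "a' \<otimes> g' \<oplus> b' \<otimes> f'" "f' \<otimes> g'" "a \<otimes> g \<oplus> b \<otimes> f" "f \<otimes> g"]
   assms 1 2 mult_M c by auto
qed

lemma frac_closed: "a \<in> carrier R ==> f \<in> M ==> frac R M a f \<in> carrier Q"
 unfolding localization_def by auto

lemma frac_one: "\<one>\<^bsub>Q\<^esub> = frac R M \<one> \<one>"
 and frac_zero: "\<zero>\<^bsub>Q\<^esub> = frac R M \<zero> \<one>" unfolding localization_def by simp_all

lemma localizationE:
 assumes "x \<in> carrier Q"
 obtains a f where "a \<in> carrier R" "f \<in> M" "x = frac R M a f" using assms unfolding localization_def by auto

lemma cring_localization: "cring Q"
proof (rule cringI)
 note ops = frac_mult frac_add frac_closed mult_M M_carrier frac_one frac_zero one_M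
 show "abelian_group Q"
 proof (rule abelian_groupI)
  fix x y assume "x \<in> carrier Q" "y \<in> carrier Q"
  then obtain a f b g where x: "a \<in> carrier R" "f \<in> M" "x = frac R M a f"
   and y: "b \<in> carrier R" "g \<in> M" "y = frac R M b g" by (metis localizationE)
  note c = x(1) y(1) x(2)[THEN M_carrier] y(2)[THEN M_carrier]
  show "x \<oplus>\<^bsub>Q\<^esub> y \<in> carrier Q" using x y by (simp add: ops)
  have "a \<otimes> g \<oplus> b \<otimes> f = b \<otimes> f \<oplus> a \<otimes> g" "f \<otimes> g = g \<otimes> f" using c by algebra+
  then show "x \<oplus>\<^bsub>Q\<^esub> y = y \<oplus>\<^bsub>Q\<^esub> x" using x y by (simp add: ops)
  fix z assume "z \<in> carrier Q"
  then obtain d e where z: "d \<in> carrier R" "e \<in> M" "z = frac R M d e" by (metis localizationE)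
  have "(a \<otimes> g \<oplus> b \<otimes> f) \<otimes> e \<oplus> d \<otimes> (f \<otimes> g) = a \<otimes> (g \<otimes> e) \<oplus> (b \<otimes> e \<oplus> d \<otimes> g) \<otimes> f" "f \<otimes> g \<otimes> e = f \<otimes> (g \<otimes> e)"
   using c z(1) M_carrier[OF z(2)] by algebra+
  then show "x \<oplus>\<^bsub>Q\<^esub> y \<oplus>\<^bsub>Q\<^esub> z
    = x \<oplus>\<^bsub>Q\<^esub> (y \<oplus>\<^bsub>Q\<^esub> z)" using x y z by (simp add: ops)
 next
  fix x assume "x \<in> carrier Q"
  then obtain a f where x: "a \<in> carrier R" "f \<in> M" "x = frac R M a f" by (rule localizationE)
  show "\<zero>\<^bsub>Q\<^esub> \<oplus>\<^bsub>Q\<^esub> x = x" using x by (simp add: ops)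
  have "frac R M (\<ominus> a) f \<oplus>\<^bsub>Q\<^esub> x = \<zero>\<^bsub>Q\<^esub>"
  proof -
   have "\<one> \<otimes> ((\<ominus> a) \<otimes> f \<oplus> a \<otimes> f) = (f \<otimes> f) \<otimes> \<zero>" using x(1) x(2)[THEN M_carrier] by algebra
   then show ?thesis using x by (simp add: frac_add frac_zero frac_cong[of _ "f \<otimes> f" \<zero> \<one>] mult_M one_M M_carrier)
  qed
  then show "\<exists>y\<in>carrier Q. y \<oplus>\<^bsub>Q\<^esub> x = \<zero>\<^bsub>Q\<^esub>" using frac_closed x by (intro bexI[of _ "frac R M (\<ominus> a) f"]) auto
 qed (simp add: ops)
 show "comm_monoid Q" by (rule comm_monoidI; (elim localizationE)?) (simp_all add: ops m_ac)
 fix x y z assume "x \<in> carrier Q" "y \<in> carrier Q" "z \<in> carrier Q"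
 then obtain a f b g d e where x: "a \<in> carrier R" "f \<in> M" "x = frac R M a f"
  and y: "b \<in> carrier R" "g \<in> M" "y = frac R M b g"
  and z: "d \<in> carrier R" "e \<in> M" "z = frac R M d e" by (metis localizationE)
 note c = x(1) y(1) z(1) x(2)[THEN M_carrier] y(2)[THEN M_carrier] z(2)[THEN M_carrier]
 have "frac R M ((a \<otimes> g \<oplus> b \<otimes> f) \<otimes> d) (f \<otimes> g \<otimes> e)
   = frac R M (a \<otimes> d \<otimes> (g \<otimes> e) \<oplus> b \<otimes> d \<otimes> (f \<otimes> e)) (f \<otimes> e \<otimes> (g \<otimes> e))"
  by (rule frac_cong) (use x y z mult_M c in \<open>(simp; fail | algebra)+\<close>)
 then show "(x \<oplus>\<^bsub>Q\<^esub> y) \<otimes>\<^bsub>Q\<^esub> z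
   = x \<otimes>\<^bsub>Q\<^esub> z \<oplus>\<^bsub>Q\<^esub> y \<otimes>\<^bsub>Q\<^esub> z" using x y z by (simp add: ops)
qed

lemma frac_inverse:
 assumes "a \<in> M" "f \<in> M"
 shows "frac R M a f \<otimes>\<^bsub>Q\<^esub> frac R M f a = \<one>\<^bsub>Q\<^esub>"
proof -
 have "frac R M (a \<otimes> f) (f \<otimes> a) = frac R M \<one> \<one>" by (rule frac_cong) (use assms mult_M M_carrier m_comm one_M in auto)
 then show ?thesis using assms M_carrier by (simp add: frac_mult frac_one)
qed

lemma frac_hom: "(\<lambda>a. frac R M a \<one>) \<in> ring_hom R Q"
 by (rule ring_hom_memI) (simp_all add: frac_mult frac_add frac_closed frac_one one_M)

lemma frac_minus:
 assumes "a \<in> carrier R" "f \<in> M"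
 shows "\<ominus>\<^bsub>Q\<^esub> frac R M a f = frac R M (\<ominus> a) f"
proof -
 interpret L: cring "Q" by (rule cring_localization)
 have "\<one> \<otimes> ((\<ominus> a) \<otimes> f \<oplus> a \<otimes> f) = (f \<otimes> f) \<otimes> \<zero>" using assms M_carrier by algebra
 then have "frac R M (\<ominus> a) f \<oplus>\<^bsub>Q\<^esub> frac R M a f = \<zero>\<^bsub>Q\<^esub>"
  using assms by (simp add: frac_add frac_zero frac_cong[of _ "f \<otimes> f" \<zero> \<one>] mult_M one_M M_carrier)
 then show ?thesis using L.minus_equality frac_closed assms by auto
qed

end

lemma primeideal_mult_iff:
 assumes "primeideal q R" "a \<in> carrier R" "b \<in> carrier R"
 shows "a \<otimes>\<^bsub>R\<^esub> b \<in> q \<longleftrightarrow> a \<in> q \<or> b \<in> q"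
proof -
 interpret primeideal q R by fact
 show ?thesis using I_prime[of a b] I_l_closed[of b a] I_r_closed[of a b] assms by blast
qed

lemma prime_localize:
 assumes "primeideal q R" shows "localize R (carrier R - q)"
proof -
 interpret primeideal q R by fact
 show ?thesis by unfold_locales (use I_notcarr I_prime one_imp_carrier in auto)
qed

lemma prime_frac_Units:
 assumes q: "primeideal q R" and a: "a \<in> carrier R" "f \<in> carrier R - q"
 shows "frac R (carrier R - q) a f \<in> Units (localization R (carrier R - q)) \<longleftrightarrow> a \<notin> q"
proof -
 interpret primeideal q R by fact
 interpret localize R "carrier R - q" by (rule prime_localize) fact
 interpret L: cring "localization R (carrier R - q)" by (rule cring_localization)
 let ?M = "carrier R - q"
 show ?thesis
 proof
  assume "frac R ?M a f \<in> Units (localization R ?M)"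
  then obtain y where y: "y \<in> carrier (localization R ?M)"
   "frac R ?M a f \<otimes>\<^bsub>localization R ?M\<^esub> y = \<one>\<^bsub>localization R ?M\<^esub>" unfolding Units_def by blast
  then obtain b g where b: "b \<in> carrier R" "g \<in> ?M" "y = frac R ?M b g" by (metis localizationE)
  have "frac R ?M (a \<otimes>\<^bsub>R\<^esub> b) (f \<otimes>\<^bsub>R\<^esub> g) = frac R ?M \<one>\<^bsub>R\<^esub> \<one>\<^bsub>R\<^esub>" using y b a by (simp add: frac_mult frac_one)
  then obtain h where h: "h \<in> ?M" "h \<otimes>\<^bsub>R\<^esub> (\<one>\<^bsub>R\<^esub> \<otimes>\<^bsub>R\<^esub> (a \<otimes>\<^bsub>R\<^esub> b)) = h \<otimes>\<^bsub>R\<^esub> ((f \<otimes>\<^bsub>R\<^esub> g) \<otimes>\<^bsub>R\<^esub> \<one>\<^bsub>R\<^esub>)"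
   using frac_eq_iff[of "a \<otimes>\<^bsub>R\<^esub> b" "f \<otimes>\<^bsub>R\<^esub> g" "\<one>\<^bsub>R\<^esub>" "\<one>\<^bsub>R\<^esub>"] a b mult_M one_M by auto
  then have "h \<otimes>\<^bsub>R\<^esub> (a \<otimes>\<^bsub>R\<^esub> b) \<in> ?M" using mult_M a b by simp
  then show "a \<notin> q" using I_l_closed I_r_closed b h by auto
 next
  assume "a \<notin> q"
  then have a': "a \<in> ?M" using a by simp
  then show "frac R ?M a f \<in> Units (localization R ?M)"
   using L.UnitsI[OF _ _ frac_inverse[OF a' a(2)]] a frac_closed by simp
 qed
qed

section \<open>Spaces of locally fractional functions\<close>

text \<open>The spectrum of a ring and the relative affine line are both of the following kind: the
  local ring at \<open>p\<close> is the localisation of a ring \<open>R p\<close> at a prime \<open>q p\<close>, and the basic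
  functions over \<open>V\<close> are the quotients of two members of a family \<open>N V\<close> of functions.\<close>

locale frac_space =
 fixes T :: "'p topology" and R :: "'p => ('a, 'm) ring_scheme" and q :: "'p => 'a set"
  and N :: "'p set => ('p => 'a) set" and B :: "'p set => ('p => ('a \<times> 'a) set) set"
 assumes prime: "p \<in> topspace T ==> primeideal (q p) (R p)"
  and N_closed: "openin T V ==> a \<in> N V ==> p \<in> V ==> a p \<in> carrier (R p)" and N_mono: "a \<in> N V ==> V' \<subseteq> V ==> a \<in> N V'"
  and N_zero: "openin T V ==> (\<lambda>p. \<zero>\<^bsub>R p\<^esub>) \<in> N V" and N_one: "openin T V ==> (\<lambda>p. \<one>\<^bsub>R p\<^esub>) \<in> N V"
  and N_add: "openin T V ==> a \<in> N V ==> b \<in> N V ==> (\<lambda>p. a p \<oplus>\<^bsub>R p\<^esub> b p) \<in> N V"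
  and N_mult: "openin T V ==> a \<in> N V ==> b \<in> N V ==> (\<lambda>p. a p \<otimes>\<^bsub>R p\<^esub> b p) \<in> N V"
  and N_minus: "openin T V ==> a \<in> N V ==> (\<lambda>p. \<ominus>\<^bsub>R p\<^esub> a p) \<in> N V"
  and N_open: "openin T V ==> a \<in> N V ==> openin T {p \<in> V. a p \<notin> q p}"
  and B_iff: "openin T V ==> (\<exists>b\<in>B V. \<forall>p\<in>V. s p = b p) \<longleftrightarrow>
   (\<exists>a\<in>N V. \<exists>f\<in>N V. \<forall>p\<in>V. f p \<notin> q p & s p = frac (R p) (carrier (R p) - q p) (a p) (f p))"
begin

abbreviation L :: "'p => ('a \<times> 'a) set ring" where "L p \<equiv> localization (R p) (carrier (R p) - q p)"

abbreviation fr :: "'p => 'a => 'a => ('a \<times> 'a) set" where "fr p \<equiv> frac (R p) (carrier (R p) - q p)"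

abbreviation space :: "('p, 'p => ('a \<times> 'a) set) ringed_space" where "space \<equiv> function_space T L B"

lemma loc: "p \<in> topspace T ==> localize (R p) (carrier (R p) - q p)"
 using prime_localize prime by blast

lemma cring_L: "p \<in> topspace T ==> cring (L p)"
 using localize.cring_localization loc by blast

lemma cring_R: "p \<in> topspace T ==> cring (R p)"
 using primeideal.axioms(2) prime by blast

lemma topo_space [simp]: "topo space = T"
 unfolding function_space_def by simp

lemma in_top: "openin T U ==> p \<in> U ==> p \<in> topspace T"
 using openin_subset by blast

lemma res_space [simp]: "res space U V s = restrict s V"
 unfolding function_space_def by simp

lemma mult_space [simp]: "s \<otimes>\<^bsub>sections space U\<^esub> t = (\<lambda>p\<in>U. s p \<otimes>\<^bsub>L p\<^esub> t p)"
 and add_space [simp]: "s \<oplus>\<^bsub>sections space U\<^esub> t = (\<lambda>p\<in>U. s p \<oplus>\<^bsub>L p\<^esub> t p)"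
 and one_space [simp]: "\<one>\<^bsub>sections space U\<^esub> = (\<lambda>p\<in>U. \<one>\<^bsub>L p\<^esub>)" and zero_space [simp]: "\<zero>\<^bsub>sections space U\<^esub> = (\<lambda>p\<in>U. \<zero>\<^bsub>L p\<^esub>)"
 unfolding function_space_def by simp_all

definition locally_frac :: "('p => ('a \<times> 'a) set) => 'p set => 'p => bool" where
 "locally_frac s U p \<longleftrightarrow> (\<exists>V a f. openin T V & p \<in> V & V \<subseteq> U & a \<in> N V & f \<in> N V &
  (\<forall>p'\<in>V. f p' \<notin> q p' & s p' = fr p' (a p') (f p')))"

lemma locally_fracE:
 assumes "locally_frac s U p"
 obtains V a f where "openin T V" "p \<in> V" "V \<subseteq> U" "a \<in> N V" "f \<in> N V"
  "\<And>p'. p' \<in> V ==> f p' \<notin> q p'" "\<And>p'. p' \<in> V ==> s p' = fr p' (a p') (f p')"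
proof -
 obtain V a f where "openin T V & p \<in> V & V \<subseteq> U & a \<in> N V & f \<in> N V &
  (\<forall>p'\<in>V. f p' \<notin> q p' & s p' = fr p' (a p') (f p'))" using assms unfolding locally_frac_def by (elim exE)
 then show thesis by (intro that[of V a f]) auto
qed

lemma locally_fracI:
 assumes "openin T V" "p \<in> V" "V \<subseteq> U" "a \<in> N V" "f \<in> N V"
  "\<And>p'. p' \<in> V ==> f p' \<notin> q p'" "\<And>p'. p' \<in> V ==> s p' = fr p' (a p') (f p')"
 shows "locally_frac s U p" unfolding locally_frac_def
 by (intro exI[of _ V] exI[of _ a] exI[of _ f] conjI ballI; rule assms; assumption)

lemma fr_closed:
 "openin T V ==> a \<in> N V ==> f \<in> N V ==> p \<in> V ==> f p \<notin> q p ==> fr p (a p) (f p) \<in> carrier (L p)"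
 using localize.frac_closed[OF loc] N_closed in_top by simp

lemma section_iff:
 assumes U: "openin T U"
 shows "s \<in> \<Gamma> space U \<longleftrightarrow> s \<in> extensional U & (\<forall>p\<in>U. locally_frac s U p)"
proof -
 have 1: "s \<in> \<Gamma> space U \<longleftrightarrow> s \<in> (\<Pi>\<^sub>E p\<in>U. carrier (L p)) & (\<forall>p\<in>U. locally_frac s U p)"
 proof -
  have "(openin T V & p \<in> V & V \<subseteq> U & (\<exists>b\<in>B V. \<forall>q\<in>V. s q = b q)) \<longleftrightarrow>
   (\<exists>a f. openin T V & p \<in> V & V \<subseteq> U & a \<in> N V & f \<in> N V &
    (\<forall>p'\<in>V. f p' \<notin> q p' & s p' = fr p' (a p') (f p')))" for V p
  proof (cases "openin T V")
   case True
   show ?thesis unfolding B_iff[OF True] by blast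
  qed simp
  then show ?thesis unfolding function_space_def locally_frac_def by simp
 qed
 have "s p \<in> carrier (L p)" if "\<forall>p\<in>U. locally_frac s U p" "p \<in> U" for p
 proof -
  have "locally_frac s U p" using that by blast
  then show ?thesis by (rule locally_fracE) (simp add: fr_closed)
 qed
 then show ?thesis unfolding 1 by (auto simp: PiE_def)
qed

lemma section_PiE: "s \<in> \<Gamma> space U ==> s \<in> (\<Pi>\<^sub>E p\<in>U. carrier (L p))"
 unfolding function_space_def by simp

lemma section_closed: "s \<in> \<Gamma> space U ==> p \<in> U ==> s p \<in> carrier (L p)"
 by (rule PiE_mem[OF section_PiE])

lemma section_ext: "s \<in> \<Gamma> space U ==> s \<in> extensional U"
 using section_PiE[of s U] by (simp add: PiE_def)

lemma locally_frac_op1: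
 assumes s: "locally_frac s U p" and U: "openin T U"
  and op: "\<And>V a f. openin T V ==> V \<subseteq> U ==> a \<in> N V ==> f \<in> N V ==> \<forall>p\<in>V. f p \<notin> q p ==>
   \<exists>c\<in>N V. \<exists>h\<in>N V. \<forall>p\<in>V. h p \<notin> q p & op p (fr p (a p) (f p)) = fr p (c p) (h p)"
 shows "locally_frac (\<lambda>p\<in>U. op p (s p)) U p"
proof -
 obtain V a f where V: "openin T V" "p \<in> V" "V \<subseteq> U" "a \<in> N V" "f \<in> N V"
  "\<And>p'. p' \<in> V ==> f p' \<notin> q p'" "\<And>p'. p' \<in> V ==> s p' = fr p' (a p') (f p')" using s by (rule locally_fracE) blast
 obtain c h where ch: "c \<in> N V" "h \<in> N V"
  "\<forall>p\<in>V. h p \<notin> q p & op p (fr p (a p) (f p)) = fr p (c p) (h p)" using op[OF V(1,3-5)] V(6) by blast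
 show ?thesis by (rule locally_fracI[OF V(1-3) ch(1,2)]) (use ch(3) V(3,7) in \<open>auto simp: subset_iff\<close>)
qed

lemma locally_frac_op2:
 assumes s: "locally_frac s U p" and t: "locally_frac t U p" and U: "openin T U"
  and op: "\<And>V a f b g. openin T V ==> V \<subseteq> U ==> a \<in> N V ==> f \<in> N V ==> \<forall>p\<in>V. f p \<notin> q p ==>
   b \<in> N V ==> g \<in> N V ==> \<forall>p\<in>V. g p \<notin> q p ==>
   \<exists>c\<in>N V. \<exists>h\<in>N V. \<forall>p\<in>V. h p \<notin> q p & op p (fr p (a p) (f p)) (fr p (b p) (g p)) = fr p (c p) (h p)"
 shows "locally_frac (\<lambda>p\<in>U. op p (s p) (t p)) U p"
proof -
 obtain V a f where V: "openin T V" "p \<in> V" "V \<subseteq> U" "a \<in> N V" "f \<in> N V"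
  "\<And>p'. p' \<in> V ==> f p' \<notin> q p'" "\<And>p'. p' \<in> V ==> s p' = fr p' (a p') (f p')" using s by (rule locally_fracE) blast
 obtain V' b g where V': "openin T V'" "p \<in> V'" "V' \<subseteq> U" "b \<in> N V'" "g \<in> N V'"
  "\<And>p'. p' \<in> V' ==> g p' \<notin> q p'" "\<And>p'. p' \<in> V' ==> t p' = fr p' (b p') (g p')" using t by (rule locally_fracE) blast
 let ?I = "V \<inter> V'"
 have I: "openin T ?I" "p \<in> ?I" "?I \<subseteq> U" using V V' by (auto simp: openin_Int)
 have "\<exists>c\<in>N ?I. \<exists>h\<in>N ?I. \<forall>p\<in>?I. h p \<notin> q p & op p (fr p (a p) (f p)) (fr p (b p) (g p)) = fr p (c p) (h p)"
  by (rule op[OF I(1,3)]) (use V(6) V'(6) N_mono[of _ V ?I] N_mono[of _ V' ?I] V(4,5) V'(4,5) in auto)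
 then obtain c h where ch: "c \<in> N ?I" "h \<in> N ?I"
  "\<forall>p\<in>?I. h p \<notin> q p & op p (fr p (a p) (f p)) (fr p (b p) (g p)) = fr p (c p) (h p)" by blast
 show ?thesis by (rule locally_fracI[OF I ch(1,2)]) (use ch(3) V(7) V'(7) I(3) in \<open>auto simp: subset_iff\<close>)
qed

lemma nonmem_mult:
 "p \<in> topspace T ==> f \<in> carrier (R p) ==> g \<in> carrier (R p) ==> f \<notin> q p ==> g \<notin> q p ==>
  f \<otimes>\<^bsub>R p\<^esub> g \<notin> q p" using primeideal.I_prime[OF prime, of p f g] by blast

lemma section_mult:
 assumes U: "openin T U" and s: "s \<in> \<Gamma> space U" "t \<in> \<Gamma> space U"
 shows "(\<lambda>p\<in>U. s p \<otimes>\<^bsub>L p\<^esub> t p) \<in> \<Gamma> space U"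
proof -
 have "locally_frac (\<lambda>p\<in>U. s p \<otimes>\<^bsub>L p\<^esub> t p) U p" if "p \<in> U" for p
 proof (rule locally_frac_op2[OF _ _ U, of s p t])
  fix V a f b g assume V: "openin T V" "V \<subseteq> U" "a \<in> N V" "f \<in> N V" "\<forall>p\<in>V. f p \<notin> q p" "b \<in> N V" "g \<in> N V" "\<forall>p\<in>V. g p \<notin> q p"
  show "\<exists>c\<in>N V. \<exists>h\<in>N V. \<forall>p\<in>V. h p \<notin> q p & fr p (a p) (f p) \<otimes>\<^bsub>L p\<^esub> fr p (b p) (g p) = fr p (c p) (h p)"
   using V N_mult[OF V(1,3,6)] N_mult[OF V(1,4,7)]
   by (intro bexI[of _ "\<lambda>p. a p \<otimes>\<^bsub>R p\<^esub> b p"] bexI[of _ "\<lambda>p. f p \<otimes>\<^bsub>R p\<^esub> g p"])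
    (simp_all add: localize.frac_mult[OF loc] N_closed[OF V(1)] in_top[OF V(1)] nonmem_mult)
 qed (use s section_iff[OF U] that in auto)
 then show ?thesis using section_iff[OF U] by simp
qed

lemma section_add:
 assumes U: "openin T U" and s: "s \<in> \<Gamma> space U" "t \<in> \<Gamma> space U"
 shows "(\<lambda>p\<in>U. s p \<oplus>\<^bsub>L p\<^esub> t p) \<in> \<Gamma> space U"
proof -
 have "locally_frac (\<lambda>p\<in>U. s p \<oplus>\<^bsub>L p\<^esub> t p) U p" if "p \<in> U" for p
 proof (rule locally_frac_op2[OF _ _ U, of s p t])
  fix V a f b g assume V: "openin T V" "V \<subseteq> U" "a \<in> N V" "f \<in> N V" "\<forall>p\<in>V. f p \<notin> q p" "b \<in> N V" "g \<in> N V" "\<forall>p\<in>V. g p \<notin> q p"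
  show "\<exists>c\<in>N V. \<exists>h\<in>N V. \<forall>p\<in>V. h p \<notin> q p & fr p (a p) (f p) \<oplus>\<^bsub>L p\<^esub> fr p (b p) (g p) = fr p (c p) (h p)"
   using V N_add[OF V(1) N_mult[OF V(1,3,7)] N_mult[OF V(1,6,4)]] N_mult[OF V(1,4,7)]
   by (intro bexI[of _ "\<lambda>p. a p \<otimes>\<^bsub>R p\<^esub> g p \<oplus>\<^bsub>R p\<^esub> b p \<otimes>\<^bsub>R p\<^esub> f p"] bexI[of _ "\<lambda>p. f p \<otimes>\<^bsub>R p\<^esub> g p"])
    (simp_all add: localize.frac_add[OF loc] N_closed[OF V(1)] in_top[OF V(1)] nonmem_mult)
 qed (use s section_iff[OF U] that in auto)
 then show ?thesis using section_iff[OF U] by simp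
qed

lemma section_minus:
 assumes U: "openin T U" and s: "s \<in> \<Gamma> space U"
 shows "(\<lambda>p\<in>U. \<ominus>\<^bsub>L p\<^esub> s p) \<in> \<Gamma> space U"
proof -
 have "locally_frac (\<lambda>p\<in>U. \<ominus>\<^bsub>L p\<^esub> s p) U p" if "p \<in> U" for p
 proof (rule locally_frac_op1[OF _ U, of s p])
  fix V a f assume V: "openin T V" "V \<subseteq> U" "a \<in> N V" "f \<in> N V" "\<forall>p\<in>V. f p \<notin> q p"
  show "\<exists>c\<in>N V. \<exists>h\<in>N V. \<forall>p\<in>V. h p \<notin> q p & \<ominus>\<^bsub>L p\<^esub> fr p (a p) (f p) = fr p (c p) (h p)" using V N_minus[OF V(1,3)]
   by (intro bexI[of _ "\<lambda>p. \<ominus>\<^bsub>R p\<^esub> a p"] bexI[of _ f])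
    (simp_all add: localize.frac_minus[OF loc] N_closed[OF V(1)] in_top[OF V(1)])
 qed (use s section_iff[OF U] that in auto)
 then show ?thesis using section_iff[OF U] by simp
qed

lemma section_frac:
 assumes "openin T U" "a \<in> N U" "f \<in> N U" "\<forall>p\<in>U. f p \<notin> q p"
 shows "(\<lambda>p\<in>U. fr p (a p) (f p)) \<in> \<Gamma> space U"
proof -
 have "locally_frac (\<lambda>p\<in>U. fr p (a p) (f p)) U p" if "p \<in> U" for p unfolding locally_frac_def
  by (intro exI[of _ U] exI[of _ a] exI[of _ f]) (use assms that in simp)
 then show ?thesis unfolding section_iff[OF assms(1)] by simp
qed

lemma section_zero:
 assumes U: "openin T U" shows "(\<lambda>p\<in>U. \<zero>\<^bsub>L p\<^esub>) \<in> \<Gamma> space U"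
proof -
 have "\<one>\<^bsub>R p\<^esub> \<notin> q p" if "p \<in> U" for p using localize.one_M[OF loc[OF in_top[OF U that]]] by simp
 then have "(\<lambda>p\<in>U. fr p \<zero>\<^bsub>R p\<^esub> \<one>\<^bsub>R p\<^esub>) \<in> \<Gamma> space U" using section_frac[OF U N_zero[OF U] N_one[OF U]] by blast
 then show ?thesis unfolding localization_def by simp
qed

lemma section_one:
 assumes U: "openin T U" shows "(\<lambda>p\<in>U. \<one>\<^bsub>L p\<^esub>) \<in> \<Gamma> space U"
proof -
 have "\<one>\<^bsub>R p\<^esub> \<notin> q p" if "p \<in> U" for p using localize.one_M[OF loc[OF in_top[OF U that]]] by simp
 then have "(\<lambda>p\<in>U. fr p \<one>\<^bsub>R p\<^esub> \<one>\<^bsub>R p\<^esub>) \<in> \<Gamma> space U" using section_frac[OF U N_one[OF U] N_one[OF U]] by blast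
 then show ?thesis unfolding localization_def by simp
qed

lemma cring_sections_space:
 assumes U: "openin T U" shows "cring (sections space U)"
proof (rule cringI)
 note cl = section_closed[where U = U]
 have c: "cring (L p)" "monoid (L p)" if "p \<in> U" for p using cring_L in_top[OF U that] by (auto simp: cring_def ring_def)
 note rules = cring.cring_simprules[OF c(1)] monoid.r_one[OF c(2)]
 have ext: "restrict f U = s" if "s \<in> \<Gamma> space U" "\<And>p. p \<in> U ==> f p = s p" for f s
  using that section_ext[OF that(1)] by (simp add: fun_eq_iff restrict_def extensional_def)
 show "abelian_group (sections space U)"
 proof (rule abelian_groupI)
  fix s assume s: "s \<in> \<Gamma> space U"
  show "\<exists>t\<in>\<Gamma> space U. t \<oplus>\<^bsub>sections space U\<^esub> s = \<zero>\<^bsub>sections space U\<^esub>" using section_minus[OF U s] cl[OF s]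
   by (intro bexI[of _ "\<lambda>p\<in>U. \<ominus>\<^bsub>L p\<^esub> s p"]) (simp_all add: rules cong: restrict_cong)
  show "\<zero>\<^bsub>sections space U\<^esub> \<oplus>\<^bsub>sections space U\<^esub> s = s" unfolding add_space by (rule ext[OF s]) (simp add: rules cl[OF s])
 qed (simp_all add: section_add[OF U] section_zero[OF U] rules cl cong: restrict_cong)
 show "comm_monoid (sections space U)"
 proof (rule comm_monoidI)
  fix s assume s: "s \<in> \<Gamma> space U"
  show "\<one>\<^bsub>sections space U\<^esub> \<otimes>\<^bsub>sections space U\<^esub> s = s" unfolding mult_space by (rule ext[OF s]) (simp add: rules cl[OF s])
 qed (simp_all add: section_mult[OF U] section_one[OF U] rules cl cong: restrict_cong)
 fix x y z assume "x \<in> \<Gamma> space U" "y \<in> \<Gamma> space U" "z \<in> \<Gamma> space U"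
 then show "(x \<oplus>\<^bsub>sections space U\<^esub> y) \<otimes>\<^bsub>sections space U\<^esub> z
   = x \<otimes>\<^bsub>sections space U\<^esub> z \<oplus>\<^bsub>sections space U\<^esub> y \<otimes>\<^bsub>sections space U\<^esub> z" by (simp add: rules cl cong: restrict_cong)
qed

lemma ringed_space_space: "ringed_space space"
 unfolding ringed_space_def
proof (intro conjI allI impI ballI)
 fix U assume "opens space U"
 then show "cring (sections space U)" using cring_sections_space by simp
next
 fix U V assume "opens space U & opens space V & V \<subseteq> U"
 then have U: "openin T U" and V: "openin T V" "V \<subseteq> U" by auto
 show "res space U V \<in> ring_hom (sections space U) (sections space V)"
 proof (rule ring_hom_memI)
  fix s assume s: "s \<in> \<Gamma> space U"
  have "locally_frac (restrict s V) V p" if p: "p \<in> V" for p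
  proof -
   have "locally_frac s U p" using s p V(2) section_iff[OF U] by blast
   then obtain W a f where W: "openin T W" "p \<in> W" "W \<subseteq> U" "a \<in> N W" "f \<in> N W"
    "\<And>p'. p' \<in> W ==> f p' \<notin> q p'" "\<And>p'. p' \<in> W ==> s p' = fr p' (a p') (f p')" by (rule locally_fracE) blast
   show ?thesis by (rule locally_fracI[of "W \<inter> V" _ _ a f]) (use W V p N_mono[of _ W "W \<inter> V"] in \<open>auto simp: openin_Int\<close>)
  qed
  then show "res space U V s \<in> \<Gamma> space V" using section_iff[OF V(1)] by simp
 qed (use V(2) in \<open>simp_all add: fun_eq_iff restrict_def subset_iff\<close>)
next
 fix U s assume "opens space U" "s \<in> \<Gamma> space U"
 then show "res space U U s = s" using section_ext by (simp add: extensional_restrict)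
next
 fix U V W s assume "opens space U & opens space V & opens space W & W \<subseteq> V & V \<subseteq> U"
 then show "res space V W (res space U V s) = res space U W s" by (simp add: restrict_def fun_eq_iff subset_iff)
next
 fix \<U> :: "'p set set" and s
 assume "(\<forall>V\<in>\<U>. opens space V & s V \<in> \<Gamma> space V) &
  (\<forall>V\<in>\<U>. \<forall>W\<in>\<U>. res space V (V \<inter> W) (s V) = res space W (V \<inter> W) (s W))"
 then have o: "\<And>V. V \<in> \<U> ==> openin T V" and s: "\<And>V. V \<in> \<U> ==> s V \<in> \<Gamma> space V"
  and agree: "\<And>V W. V \<in> \<U> ==> W \<in> \<U> ==> restrict (s V) (V \<inter> W) = restrict (s W) (V \<inter> W)" by auto
 have agree': "s V p = s W p" if "V \<in> \<U>" "W \<in> \<U>" "p \<in> V" "p \<in> W" for V W p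
  using fun_cong[OF agree[OF that(1,2)], of p] that by simp
 have U: "openin T (\<Union>\<U>)" using o by blast
 define c where "c p = (SOME V. V \<in> \<U> & p \<in> V)" for p
 have c: "c p \<in> \<U>" "p \<in> c p" if "p \<in> \<Union>\<U>" for p using someI_ex[of "\<lambda>V. V \<in> \<U> & p \<in> V"] that unfolding c_def by auto
 define t where "t = (\<lambda>p\<in>\<Union>\<U>. s (c p) p)"
 have tV: "t p = s V p" if "V \<in> \<U>" "p \<in> V" for V p using that c[of p] agree'[of "c p" V p] unfolding t_def by auto
 show "\<exists>!t. t \<in> \<Gamma> space (\<Union>\<U>) & (\<forall>V\<in>\<U>. res space (\<Union>\<U>) V t = s V)"
 proof (rule ex1I[of _ t])
  have "locally_frac t (\<Union>\<U>) p" if p: "p \<in> \<Union>\<U>" for p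
  proof -
   obtain V where V: "V \<in> \<U>" "p \<in> V" using p by blast
   have "locally_frac (s V) V p" using s[OF V(1)] V(2) section_iff[OF o[OF V(1)]] by blast
   then obtain W a f where W: "openin T W" "p \<in> W" "W \<subseteq> V" "a \<in> N W" "f \<in> N W"
    "\<And>p'. p' \<in> W ==> f p' \<notin> q p'" "\<And>p'. p' \<in> W ==> s V p' = fr p' (a p') (f p')" by (rule locally_fracE) blast
   have "W \<subseteq> \<Union>\<U>" using W(3) V(1) by blast
   show ?thesis by (rule locally_fracI[OF W(1,2) \<open>W \<subseteq> \<Union>\<U>\<close> W(4-6)]) (use W(3,7) tV[OF V(1)] in \<open>simp_all add: subset_iff\<close>)
  qed
  then have "t \<in> \<Gamma> space (\<Union>\<U>)" unfolding section_iff[OF U] by (simp add: t_def)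
  moreover have "restrict t V = s V" if "V \<in> \<U>" for V
   using tV[OF that] section_ext[OF s[OF that]] by (auto simp: extensional_def restrict_def fun_eq_iff)
  ultimately show "t \<in> \<Gamma> space (\<Union>\<U>) & (\<forall>V\<in>\<U>. res space (\<Union>\<U>) V t = s V)" by simp
 next
  fix r assume r: "r \<in> \<Gamma> space (\<Union>\<U>) & (\<forall>V\<in>\<U>. res space (\<Union>\<U>) V r = s V)"
  have "r p = t p" for p
  proof (cases "p \<in> \<Union>\<U>")
   case True
   then obtain V where V: "V \<in> \<U>" "p \<in> V" by blast
   then have "restrict r V p = s V p" using r by simp
   then show ?thesis using V tV by simp
  next
   case False
   then show ?thesis using section_ext[of r "\<Union>\<U>"] r unfolding t_def by (simp add: extensional_def)
  qed
  then show "r = t" by blast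
 qed
qed

lemma rspace_space: "rspace space"
 using ringed_space_space by (rule rspace.intro)

lemma locus_iff:
 assumes V: "openin T V" "s \<in> \<Gamma> space V" "p \<in> V"
 shows "p \<in> locus space V s \<longleftrightarrow> s p \<in> Units (L p)"
proof
 interpret rspace space by (rule rspace_space)
 assume "p \<in> locus space V s"
 then obtain W where W: "openin T W" "p \<in> W" "W \<subseteq> V" "restrict s W \<in> Units (sections space W)" unfolding locus_def by auto
 have "(\<lambda>s. s p) \<in> ring_hom (sections space W) (L p)" by (rule ring_hom_memI) (use section_closed W in auto)
 then have "restrict s W p \<in> Units (L p)"
  by (rule hom_Units[OF _ cring_sections_space[OF W(1)] cring_L[OF in_top[OF W(1,2)]] W(4)])
 then show "s p \<in> Units (L p)" using W by simp
next
 assume u: "s p \<in> Units (L p)"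
 obtain W a f where W: "openin T W" "p \<in> W" "W \<subseteq> V" "a \<in> N W" "f \<in> N W"
  "\<And>p'. p' \<in> W ==> f p' \<notin> q p'" "\<And>p'. p' \<in> W ==> s p' = fr p' (a p') (f p')"
  using V(2,3) unfolding section_iff[OF V(1)] by (elim conjE) (drule (1) bspec, erule locally_fracE, blast)
 define Z where "Z = {p' \<in> W. a p' \<notin> q p'}"
 have Z: "openin T Z" "Z \<subseteq> W" unfolding Z_def using N_open[OF W(1,4)] by auto
 have ap: "a p \<notin> q p" using u prime_frac_Units[OF prime[OF in_top[OF W(1,2)]]] N_closed[OF W(1) _ W(2)] W by simp
 note N = N_mono[OF W(4) Z(2)] N_mono[OF W(5) Z(2)]
 have i: "(\<lambda>p\<in>Z. fr p (f p) (a p)) \<in> \<Gamma> space Z" by (rule section_frac[OF Z(1) N(2,1)]) (simp add: Z_def)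
 have s: "restrict s Z \<in> \<Gamma> space Z" using rspace.res_closed[OF rspace_space, of V Z s] V Z W by simp
 have "s p' \<otimes>\<^bsub>L p'\<^esub> fr p' (f p') (a p') = \<one>\<^bsub>L p'\<^esub>" if "p' \<in> Z" for p'
 proof -
  interpret localize "R p'" "carrier (R p') - q p'" by (rule loc) (use that Z in_top in auto)
  have "s p' = fr p' (a p') (f p')" using W(7) that Z by blast
  then show ?thesis using frac_inverse[of "a p'" "f p'"] that W Z N_closed[OF W(1)] unfolding Z_def by auto
 qed
 then have m: "restrict s Z \<otimes>\<^bsub>sections space Z\<^esub> (\<lambda>p\<in>Z. fr p (f p) (a p)) = \<one>\<^bsub>sections space Z\<^esub>"
  by (auto simp: restrict_def fun_eq_iff)
 interpret Z: cring "sections space Z" by (rule cring_sections_space) fact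
 have "restrict s Z \<in> Units (sections space Z)" by (rule Z.UnitsI[OF s i m])
 moreover have "p \<in> Z" "Z \<subseteq> V" unfolding Z_def using W ap by auto
 ultimately show "p \<in> locus space V s" unfolding locus_def using Z(1) V(3) by auto
qed

end

section \<open>Charts\<close>

text \<open>On a spectrum, with its canonical chart, this is the prime \<open>y\<close> itself: a function lies in a prime
exactly if it is not invertible there.\<close>

definition prm ::
 "('p, 's) ringed_space => 'p set => ('a, 'm) ring_scheme => ('a => 's) => 'p => 'a set" where
 "prm S V R \<rho> y = {F \<in> carrier R. y \<notin> locus S V (\<rho> F)}"

text \<open>A chart says that \<open>V\<close> is a subset of \<open>Spec R\<close> with the induced structure, without using a
morphism to \<open>Spec R\<close>: points are determined by their primes, the loci of elements of \<open>R\<close> are a basis,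
sections are locally fractions of elements of \<open>R\<close>, and an element of \<open>R\<close> vanishes near \<open>y\<close> only if
it vanishes in the localisation of \<open>R\<close> at the prime of \<open>y\<close>.\<close>

locale chart = rspace S for S :: "('p, 's) ringed_space" +
 fixes V :: "'p set" and R :: "('a, 'm) ring_scheme" (structure) and \<rho> :: "'a => 's"
 assumes open_V: "opens S V" and cring_R: "cring R" and hom: "\<rho> \<in> ring_hom R (sections S V)"
  and prime: "y \<in> V ==> primeideal (prm S V R \<rho> y) R" and inj: "inj_on (prm S V R \<rho>) V"
  and basis: "opens S W ==> W \<subseteq> V ==> y \<in> W ==>
   \<exists>F\<in>carrier R. y \<in> locus S V (\<rho> F) & locus S V (\<rho> F) \<subseteq> W" and fracs: "opens S W ==> W \<subseteq> V ==> y \<in> W ==> s \<in> \<Gamma> S W ==>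
   \<exists>F\<in>carrier R. \<exists>G\<in>carrier R. y \<in> locus S V (\<rho> G) &
    (\<exists>W'. opens S W' & y \<in> W' & W' \<subseteq> W &
     res S V W' (\<rho> G) \<otimes>\<^bsub>sections S W'\<^esub> res S W W' s = res S V W' (\<rho> F))"
  and ker: "opens S W ==> W \<subseteq> V ==> y \<in> W ==> F \<in> carrier R ==>
   res S V W (\<rho> F) = \<zero>\<^bsub>sections S W\<^esub> ==>
   \<exists>h\<in>carrier R. y \<in> locus S V (\<rho> h) & h \<otimes> F = \<zero>"
begin

abbreviation "\<rho>r W F \<equiv> res S V W (\<rho> F)"

sublocale R: cring R by (rule cring_R)

lemma \<rho>_closed: "F \<in> carrier R ==> \<rho> F \<in> \<Gamma> S V"
 by (rule ring_hom_closed[OF hom])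

lemma res_\<rho>_hom: "opens S W ==> W \<subseteq> V ==> (\<lambda>F. \<rho>r W F) \<in> ring_hom R (sections S W)"
 using ring_hom_trans[OF hom res_hom[OF open_V]] by (simp add: o_def)

lemma res_\<rho>_closed:
 "opens S W ==> W \<subseteq> V ==> F \<in> carrier R ==> \<rho>r W F \<in> \<Gamma> S W" by (rule ring_hom_closed[OF res_\<rho>_hom])

lemma res_\<rho>_Units:
 "opens S W ==> W \<subseteq> locus S V (\<rho> F) ==> F \<in> carrier R ==> \<rho>r W F \<in> Units (sections S W)"
 using Units_iff_locus[OF open_V \<rho>_closed] locus_subset[of V "\<rho> F"] by blast

lemma res_\<rho>_res:
 "opens S W ==> opens S W' ==> W' \<subseteq> W ==> W \<subseteq> V ==> F \<in> carrier R ==>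
  res S W W' (\<rho>r W F) = \<rho>r W' F" by (rule res_res[OF open_V _ _ _ _ \<rho>_closed])

lemma fracs_on:
 assumes "opens S W" "W \<subseteq> V" "y \<in> W" "s \<in> \<Gamma> S W"
 obtains W' F G where "opens S W'" "y \<in> W'" "W' \<subseteq> W" "F \<in> carrier R" "G \<in> carrier R" "W' \<subseteq> locus S V (\<rho> G)"
  "\<rho>r W' G \<otimes>\<^bsub>sections S W'\<^esub> res S W W' s = \<rho>r W' F"
proof -
 obtain F G W' where F: "F \<in> carrier R" "G \<in> carrier R" "y \<in> locus S V (\<rho> G)" and W': "opens S W'" "y \<in> W'" "W' \<subseteq> W"
  "\<rho>r W' G \<otimes>\<^bsub>sections S W'\<^esub> res S W W' s = \<rho>r W' F" using fracs[OF assms] by blast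
 let ?Z = "W' \<inter> locus S V (\<rho> G)"
 have Z: "opens S ?Z" using W' open_locus[OF open_V] by (simp add: openin_Int)
 have sub: "?Z \<subseteq> W'" "W' \<subseteq> V" using W' assms by auto
 have "res S W' ?Z (\<rho>r W' G \<otimes>\<^bsub>sections S W'\<^esub> res S W W' s) = res S W' ?Z (\<rho>r W' F)" using W'(4) by simp
 then have "\<rho>r ?Z G \<otimes>\<^bsub>sections S ?Z\<^esub> res S W ?Z s = \<rho>r ?Z F"
  using res_mult[OF W'(1) Z sub(1) res_\<rho>_closed[OF W'(1) sub(2) F(2)] res_closed[OF assms(1) W'(1,3) assms(4)]]
   res_\<rho>_res[OF W'(1) Z sub F(1)] res_\<rho>_res[OF W'(1) Z sub F(2)]
   res_res[OF assms(1) W'(1) Z sub(1) W'(3) assms(4)] by simp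
 then show thesis using that[of ?Z F G] Z W' F by auto
qed

lemma locus_\<rho>_mult:
 "F \<in> carrier R ==> G \<in> carrier R ==>
  locus S V (\<rho> (F \<otimes> G)) = locus S V (\<rho> F) \<inter> locus S V (\<rho> G)"
 using locus_mult[OF open_V \<rho>_closed \<rho>_closed] ring_hom_mult[OF hom] by metis

lemma locus_\<rho>_one: "locus S V (\<rho> \<one>) = V"
 using locus_one[OF open_V] ring_hom_one[OF hom] by simp

end

lemma chart_restrict:
 assumes "chart S V R \<rho>" and V': "opens S V'" "V' \<subseteq> V"
 shows "chart S V' R (\<lambda>F. res S V V' (\<rho> F))" and "y \<in> V' ==> prm S V' R (\<lambda>F. res S V V' (\<rho> F)) y = prm S V R \<rho> y"
proof -
 interpret chart S V R \<rho> by fact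
 have loc: "locus S V' (res S V V' (\<rho> F)) = V' \<inter> locus S V (\<rho> F)" if "F \<in> carrier R" for F
  by (rule locus_res[OF open_V \<rho>_closed[OF that] V'])
 then show prm: "prm S V' R (\<lambda>F. res S V V' (\<rho> F)) y = prm S V R \<rho> y" if "y \<in> V'" for y using that unfolding prm_def by auto
 have rr: "res S V' W (res S V V' (\<rho> F)) = res S V W (\<rho> F)"
  if "opens S W" "W \<subseteq> V'" "F \<in> carrier R" for W F using res_\<rho>_res[OF V'(1) that(1,2) V'(2) that(3)] .
 show "chart S V' R (\<lambda>F. res S V V' (\<rho> F))"
 proof (intro chart.intro chart_axioms.intro rspace_axioms)
  show "(\<lambda>F. res S V V' (\<rho> F)) \<in> ring_hom R (sections S V')" by (rule res_\<rho>_hom) fact+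
  show "inj_on (prm S V' R (\<lambda>F. res S V V' (\<rho> F))) V'" using inj V' prm unfolding inj_on_def by (simp add: subset_iff)
  fix y assume "y \<in> V'"
  then show "primeideal (prm S V' R (\<lambda>F. res S V V' (\<rho> F)) y) R" using prime prm V' by auto
 next
  fix W y assume W: "opens S W" "W \<subseteq> V'" "y \<in> W"
  then obtain F where "F \<in> carrier R" "y \<in> locus S V (\<rho> F)" "locus S V (\<rho> F) \<subseteq> W" using basis V' by (meson subset_trans)
  then show "\<exists>F\<in>carrier R. y \<in> locus S V' (res S V V' (\<rho> F)) & locus S V' (res S V V' (\<rho> F)) \<subseteq> W"
   using W loc by (intro bexI[of _ F]) auto
  fix s assume s: "s \<in> \<Gamma> S W"
  have WV: "W \<subseteq> V" using W V' by auto
  obtain F G W' where F: "F \<in> carrier R" "G \<in> carrier R" "y \<in> locus S V (\<rho> G)" and W': "opens S W'" "y \<in> W'" "W' \<subseteq> W"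
    "res S V W' (\<rho> G) \<otimes>\<^bsub>sections S W'\<^esub> res S W W' s = res S V W' (\<rho> F)" using fracs[OF W(1) WV W(3) s] by blast
  have "W' \<subseteq> V'" using W' W by auto
  then show "\<exists>F\<in>carrier R. \<exists>G\<in>carrier R. y \<in> locus S V' (res S V V' (\<rho> G)) &
    (\<exists>W'. opens S W' & y \<in> W' & W' \<subseteq> W &
     res S V' W' (res S V V' (\<rho> G)) \<otimes>\<^bsub>sections S W'\<^esub> res S W W' s = res S V' W' (res S V V' (\<rho> F)))"
   using F W' W rr[OF W'(1)] loc by (intro bexI[of _ F] bexI[of _ G] conjI exI[of _ W']) auto
 next
  fix W y F assume W: "opens S W" "W \<subseteq> V'" "y \<in> W" "F \<in> carrier R" and 0: "res S V' W (res S V V' (\<rho> F)) = \<zero>\<^bsub>sections S W\<^esub>"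
  have "W \<subseteq> V" using W V' by auto
  then obtain h where "h \<in> carrier R" "y \<in> locus S V (\<rho> h)" "h \<otimes>\<^bsub>R\<^esub> F = \<zero>\<^bsub>R\<^esub>"
   using ker[OF W(1) _ W(3,4)] 0 rr[OF W(1,2,4)] by auto
  then show "\<exists>h\<in>carrier R. y \<in> locus S V' (res S V V' (\<rho> h)) & h \<otimes>\<^bsub>R\<^esub> F = \<zero>\<^bsub>R\<^esub>" using loc W by auto
 qed (fact V' cring_R)+
qed

subsection \<open>Open subspaces\<close>

lemma sections_open_subspace [simp]: "sections (open_subspace S U) = sections S"
 and res_open_subspace [simp]: "res (open_subspace S U) = res S"
 and topo_open_subspace: "topo (open_subspace S U) = subtopology (topo S) U" unfolding open_subspace_def by simp_all

lemma open_subspace_points: "open_subspace S (points S) = S"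
 by (cases S) (simp add: open_subspace_def)

context rspace
begin

lemma opens_open_subspace:
 "opens S U ==> opens (open_subspace S U) W \<longleftrightarrow> opens S W & W \<subseteq> U"
 unfolding topo_open_subspace by (rule openin_open_subtopology)

lemma points_open_subspace: "opens S U ==> points (open_subspace S U) = U"
 unfolding topo_open_subspace using openin_subset by auto

lemma rspace_open_subspace:
 assumes U: "opens S U" shows "rspace (open_subspace S U)"
proof (rule rspace.intro)
 note o = opens_open_subspace[OF U]
 show "ringed_space (open_subspace S U)" unfolding ringed_space_def o sections_open_subspace res_open_subspace
 proof (intro conjI allI impI ballI)
  fix \<U> :: "'p set set" and s
  assume A: "(\<forall>V\<in>\<U>. (opens S V & V \<subseteq> U) & s V \<in> \<Gamma> S V) &
   (\<forall>V\<in>\<U>. \<forall>W\<in>\<U>. res S V (V \<inter> W) (s V) = res S W (V \<inter> W) (s W))"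
  show "\<exists>!t. t \<in> \<Gamma> S (\<Union>\<U>) & (\<forall>V\<in>\<U>. res S (\<Union>\<U>) V t = s V)" by (rule glue) (use A in blast)+
 qed (use cring_sections res_hom res_id res_res in auto)
qed

lemma locus_open_subspace:
 "opens S U ==> V \<subseteq> U ==> locus (open_subspace S U) V s = locus S V s"
 unfolding locus_def by (auto simp: opens_open_subspace)

end

lemma chart_change_space:
 assumes c: "chart S V R \<rho>" and S': "rspace S'" "sections S' = sections S" "res S' = res S"
  and o: "\<And>W. W \<subseteq> V ==> opens S' W \<longleftrightarrow> opens S W"
 shows "chart S' V R \<rho>" and "prm S' V R \<rho> = prm S V R \<rho>"
proof -
 interpret chart S V R \<rho> by fact
 have l: "locus S' V s = locus S V s" for s unfolding locus_def S'(2,3) using o by blast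
 show p: "prm S' V R \<rho> = prm S V R \<rho>" unfolding prm_def l ..
 show "chart S' V R \<rho>"
 proof (intro chart.intro chart_axioms.intro S'(1); (unfold l p S'(2,3))?)
  show "opens S' V" using o open_V by simp
  fix W y assume "opens S' W" and W: "W \<subseteq> V" "y \<in> W"
  then have oW: "opens S W" using o by simp
  show "\<exists>F\<in>carrier R. y \<in> locus S V (\<rho> F) & locus S V (\<rho> F) \<subseteq> W" by (rule basis[OF oW W])
  {
   fix s assume s: "s \<in> \<Gamma> S W"
   obtain F G W' where "F \<in> carrier R" "G \<in> carrier R" "y \<in> locus S V (\<rho> G)" and W': "opens S W'" "y \<in> W'" "W' \<subseteq> W"
     "res S V W' (\<rho> G) \<otimes>\<^bsub>sections S W'\<^esub> res S W W' s = res S V W' (\<rho> F)" using fracs[OF oW W s] by blast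
   moreover have "opens S' W'" using o[of W'] W' W by auto
   ultimately show "\<exists>F\<in>carrier R. \<exists>G\<in>carrier R. y \<in> locus S V (\<rho> G) &
    (\<exists>W'. opens S' W' & y \<in> W' & W' \<subseteq> W &
     res S V W' (\<rho> G) \<otimes>\<^bsub>sections S W'\<^esub> res S W W' s = res S V W' (\<rho> F))" by blast
  }
  fix F assume "F \<in> carrier R" "res S V W (\<rho> F) = \<zero>\<^bsub>sections S W\<^esub>"
  then show "\<exists>h\<in>carrier R. y \<in> locus S V (\<rho> h) & h \<otimes>\<^bsub>R\<^esub> F = \<zero>\<^bsub>R\<^esub>" by (rule ker[OF oW W])
 qed (fact cring_R hom inj prime)+
qed

lemma (in rspace) chart_open_subspace:
 assumes U: "opens S U" and V: "V \<subseteq> U"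
 shows "chart (open_subspace S U) V R \<rho> \<longleftrightarrow> chart S V R \<rho>" and "prm (open_subspace S U) V R \<rho> = prm S V R \<rho>"
proof -
 have o: "opens (open_subspace S U) W \<longleftrightarrow> opens S W" if "W \<subseteq> V" for W using that V opens_open_subspace[OF U] by auto
 show "chart (open_subspace S U) V R \<rho> \<longleftrightarrow> chart S V R \<rho>"
  using chart_change_space(1)[where S = S, OF _ rspace_open_subspace[OF U], of V R \<rho>]
   chart_change_space(1)[where S = "open_subspace S U", OF _ rspace_axioms, of V R \<rho>] o by auto
 show "prm (open_subspace S U) V R \<rho> = prm S V R \<rho>" unfolding prm_def locus_open_subspace[OF U V] ..
qed

section \<open>Spaces with the same chart are isomorphic\<close>

lemma (in cring) frac_unique:
 assumes "g \<in> Units R" "g' \<in> Units R" "s \<in> carrier R" "s' \<in> carrier R" "f \<in> carrier R" "f' \<in> carrier R"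
  and "g \<otimes> s = f" "g' \<otimes> s' = f'" "g' \<otimes> f = g \<otimes> f'"
 shows "s = s'"
proof -
 have c: "g \<in> carrier R" "g' \<in> carrier R" using assms Units_closed by auto
 have "(g \<otimes> g') \<otimes> s = g' \<otimes> (g \<otimes> s)" using c assms(3) by algebra
 also have "\<dots> = g \<otimes> (g' \<otimes> s')" unfolding assms(7,8) by (rule assms(9))
 also have "\<dots> = (g \<otimes> g') \<otimes> s'" using c assms(4) by algebra
 finally show ?thesis using assms(1-4) by (simp add: Units_l_cancel)
qed

lemma continuous_mapI:
 assumes "\<And>x. x \<in> topspace T ==> f x \<in> topspace T'" and "\<And>U. openin T' U ==> openin T {x \<in> topspace T. f x \<in> U}"
 shows "continuous_map T T' f" using assms unfolding continuous_map_def by auto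

locale chart_pair =
 Y: chart Y "points Y" R \<rho> + Z: chart Z "points Z" R \<rho>'
 for Y :: "('p, 's) ringed_space" and Z :: "('q, 't) ringed_space" and R :: "('a, 'm) ring_scheme" (structure) and \<rho> \<rho>' +
 assumes same: "prm Y (points Y) R \<rho> ` points Y = prm Z (points Z) R \<rho>' ` points Z"
begin

abbreviation "PY \<equiv> points Y"
abbreviation "PZ \<equiv> points Z"
abbreviation "pY \<equiv> prm Y (points Y) R \<rho>"
abbreviation "pZ \<equiv> prm Z (points Z) R \<rho>'"
abbreviation "rY W F \<equiv> res Y (points Y) W (\<rho> F)"
abbreviation "rZ W F \<equiv> res Z (points Z) W (\<rho>' F)"
abbreviation "DY F \<equiv> locus Y PY (\<rho> F)"
abbreviation "DZ F \<equiv> locus Z PZ (\<rho>' F)"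

definition \<beta> :: "'p => 'q" where
 "\<beta> y = (SOME z. z \<in> PZ & pZ z = pY y)"

lemma \<beta>:
 assumes "y \<in> PY"
 shows "\<beta> y \<in> PZ" "pZ (\<beta> y) = pY y"
proof -
 have "pY y \<in> pZ ` PZ" using same assms by blast
 then have "\<exists>z. z \<in> PZ & pZ z = pY y" by auto
 from someI_ex[OF this]
 show "\<beta> y \<in> PZ" "pZ (\<beta> y) = pY y" unfolding \<beta>_def by auto
qed

lemma \<beta>_unique:
 "y \<in> PY ==> z \<in> PZ ==> pZ z = pY y ==> \<beta> y = z" using \<beta>[of y] Z.inj unfolding inj_on_def by auto

lemma \<beta>_locus: "y \<in> PY ==> F \<in> carrier R ==> \<beta> y \<in> DZ F \<longleftrightarrow> y \<in> DY F"
 using \<beta>[of y] unfolding prm_def by auto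

definition pre :: "'q set => 'p set" where "pre V = {y \<in> PY. \<beta> y \<in> V}"

lemma pre_Int: "pre V \<inter> pre W = pre (V \<inter> W)" and pre_mono: "V \<subseteq> W ==> pre V \<subseteq> pre W"
 and pre_sub: "pre V \<subseteq> PY" unfolding pre_def by auto

lemma pre_locus: "F \<in> carrier R ==> pre (DZ F) = DY F"
 using \<beta>_locus Y.locus_subset unfolding pre_def by blast

lemma open_pre:
 assumes V: "opens Z V" shows "opens Y (pre V)"
proof -
 have "\<exists>U. opens Y U & y \<in> U & U \<subseteq> pre V" if y: "y \<in> pre V" for y
 proof -
  have y': "y \<in> PY" "\<beta> y \<in> V" using y unfolding pre_def by auto
  obtain F where F: "F \<in> carrier R" "\<beta> y \<in> DZ F" "DZ F \<subseteq> V" using Z.basis[OF V openin_subset[OF V] y'(2)] by blast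
  have "DY F \<subseteq> pre V" using pre_locus[OF F(1)] pre_mono[OF F(3)] by simp
  moreover have "y \<in> DY F" "opens Y (DY F)" using F y' \<beta>_locus Y.open_locus[OF Y.open_V] by auto
  ultimately show ?thesis by blast
 qed
 then show ?thesis by (subst openin_subopen) blast
qed

text \<open>A relation between elements of \<open>R\<close> holding on an open part of one space holds on the
  corresponding part of the other, because it can be tested in the localisations of \<open>R\<close>.\<close>

lemma transfer_zero:
 assumes V: "opens Z V" and F: "F \<in> carrier R" and 0: "rZ V F = \<zero>\<^bsub>sections Z V\<^esub>"
 shows "rY (pre V) F = \<zero>\<^bsub>sections Y (pre V)\<^esub>"
proof (rule Y.sections_eqI[OF open_pre[OF V]])
 have oV: "opens Y (pre V)" by (rule open_pre) fact
 interpret PV: cring "sections Y (pre V)" by (rule Y.cring_sections) fact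
 show "rY (pre V) F \<in> \<Gamma> Y (pre V)" by (rule Y.res_\<rho>_closed[OF oV pre_sub F])
 show "\<zero>\<^bsub>sections Y (pre V)\<^esub> \<in> \<Gamma> Y (pre V)" by simp
 fix y assume y: "y \<in> pre V"
 then have y': "y \<in> PY" "\<beta> y \<in> V" unfolding pre_def by auto
 obtain h where h: "h \<in> carrier R" "\<beta> y \<in> DZ h" "h \<otimes> F = \<zero>" using Z.ker[OF V openin_subset[OF V] y'(2) F 0] by blast
 let ?W = "pre V \<inter> DY h"
 have W: "opens Y ?W" "?W \<subseteq> PY" using oV Y.open_locus pre_sub by (auto simp: openin_Int)
 interpret W: cring "sections Y ?W" by (rule Y.cring_sections) fact
 have "rY ?W h \<otimes>\<^bsub>sections Y ?W\<^esub> rY ?W F = \<zero>\<^bsub>sections Y ?W\<^esub>" using ring_hom_mult[OF Y.res_\<rho>_hom[OF W] h(1) F] h(3)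
   ring_hom_zero[OF Y.res_\<rho>_hom[OF W] Y.R.ring_axioms W.ring_axioms] by simp
 moreover have "rY ?W h \<in> Units (sections Y ?W)" by (rule Y.res_\<rho>_Units) (use W h in auto)
 ultimately have "rY ?W F = \<zero>\<^bsub>sections Y ?W\<^esub>" using W.Units_l_cancel[of _ "rY ?W F" "\<zero>\<^bsub>sections Y ?W\<^esub>"]
   Y.res_\<rho>_closed[OF W F] W.Units_closed by simp
 then have "res Y (pre V) ?W (rY (pre V) F) = res Y (pre V) ?W \<zero>\<^bsub>sections Y (pre V)\<^esub>"
  using Y.res_\<rho>_res[OF oV W(1) _ pre_sub F] Y.res_zero[OF oV W(1)] by simp
 then show "\<exists>W. opens Y W & y \<in> W & W \<subseteq> pre V &
   res Y (pre V) W (rY (pre V) F) = res Y (pre V) W \<zero>\<^bsub>sections Y (pre V)\<^esub>"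
  using W(1) y h(2) \<beta>_locus[OF y'(1) h(1)] by (intro exI[of _ ?W]) auto
qed

lemma transfer_eq:
 assumes V: "opens Z V" and F: "F \<in> carrier R" and G: "G \<in> carrier R" and eq: "rZ V F = rZ V G"
 shows "rY (pre V) F = rY (pre V) G"
proof -
 have VZ: "V \<subseteq> PZ" using V openin_subset by blast
 interpret zV: cring "sections Z V" by (rule Z.cring_sections) fact
 interpret yV: cring "sections Y (pre V)" by (rule Y.cring_sections) (rule open_pre[OF V])
 interpret hz: ring_hom_cring R "sections Z V" "\<lambda>F. rZ V F" using Z.res_\<rho>_hom[OF V VZ] by unfold_locales
 interpret hy: ring_hom_cring R "sections Y (pre V)" "\<lambda>F. rY (pre V) F"
  using Y.res_\<rho>_hom[OF open_pre[OF V] pre_sub] by unfold_locales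
 have "rZ V (F \<ominus> G) = \<zero>\<^bsub>sections Z V\<^esub>" using F G eq by (simp add: a_minus_def zV.r_neg)
 then have "rY (pre V) (F \<ominus> G) = \<zero>\<^bsub>sections Y (pre V)\<^esub>" using transfer_zero[OF V, of "F \<ominus> G"] F G by simp
 then show ?thesis using F G yV.r_right_minus_eq by (simp add: a_minus_def)
qed

definition represents :: "'q set => 't => 'q set => 'a => 'a => bool" where
 "represents V t W F G \<longleftrightarrow> opens Z W & W \<subseteq> V & F \<in> carrier R & G \<in> carrier R & W \<subseteq> DZ G &
  rZ W G \<otimes>\<^bsub>sections Z W\<^esub> res Z V W t = rZ W F"

definition represents' :: "'p set => 's => 'q set => 'a => 'a => bool" where "represents' U s W F G \<longleftrightarrow>
  rY (pre W) G \<otimes>\<^bsub>sections Y (pre W)\<^esub> res Y U (pre W) s = rY (pre W) F"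

lemma represents_ex:
 assumes "opens Z V" "t \<in> \<Gamma> Z V" "z \<in> V"
 obtains W F G where "z \<in> W" "represents V t W F G"
 using Z.fracs_on[OF assms(1) openin_subset[OF assms(1)] assms(3,2)] unfolding represents_def by metis

lemma represents_restrict:
 assumes r: "represents V t W F G" and V: "opens Z V" "t \<in> \<Gamma> Z V" and W': "opens Z W'" "W' \<subseteq> W"
 shows "represents V t W' F G"
proof -
 have W: "opens Z W" "W \<subseteq> V" "F \<in> carrier R" "G \<in> carrier R" "W \<subseteq> DZ G" "rZ W G \<otimes>\<^bsub>sections Z W\<^esub> res Z V W t = rZ W F"
  using r unfolding represents_def by auto
 have Wp: "W \<subseteq> PZ" using W(1) openin_subset by blast
 have "res Z W W' (rZ W G \<otimes>\<^bsub>sections Z W\<^esub> res Z V W t) = res Z W W' (rZ W F)" using W(6) by simp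
 then show ?thesis using Z.res_mult[OF W(1) W' Z.res_\<rho>_closed[OF W(1) Wp W(4)] Z.res_closed[OF V(1) W(1,2) V(2)]]
   Z.res_\<rho>_res[OF W(1) W' Wp W(3)] Z.res_\<rho>_res[OF W(1) W' Wp W(4)] Z.res_res[OF V(1) W(1) W' W(2) V(2)] W W'
  unfolding represents_def by auto
qed

lemma represents'_restrict:
 assumes r: "represents' U s W F G" and U: "opens Y U" "s \<in> \<Gamma> Y U"
  and W: "opens Z W" "pre W \<subseteq> U" "F \<in> carrier R" "G \<in> carrier R" and W': "opens Z W'" "W' \<subseteq> W"
 shows "represents' U s W' F G"
proof -
 note o = open_pre[OF W(1)] open_pre[OF W'(1)] pre_mono[OF W'(2)]
 have "res Y (pre W) (pre W') (rY (pre W) G \<otimes>\<^bsub>sections Y (pre W)\<^esub> res Y U (pre W) s)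
   = res Y (pre W) (pre W') (rY (pre W) F)" using r unfolding represents'_def by simp
 then show ?thesis using Y.res_mult[OF o Y.res_\<rho>_closed[OF o(1) pre_sub W(4)] Y.res_closed[OF U(1) o(1) W(2) U(2)]]
   Y.res_\<rho>_res[OF o pre_sub W(3)] Y.res_\<rho>_res[OF o pre_sub W(4)] Y.res_res[OF U(1) o W(2) U(2)]
  unfolding represents'_def by simp
qed

lemma transfer_agree:
 assumes V: "opens Z V" "t \<in> \<Gamma> Z V" and r: "represents V t W F G" "represents V t W F' G'"
  and s: "s \<in> \<Gamma> Y (pre W)" "s' \<in> \<Gamma> Y (pre W)" and e: "represents' (pre W) s W F G" "represents' (pre W) s' W F' G'"
 shows "s = s'"
proof -
 have W: "opens Z W" "W \<subseteq> V" "F \<in> carrier R" "G \<in> carrier R" "W \<subseteq> DZ G" "F' \<in> carrier R" "G' \<in> carrier R" "W \<subseteq> DZ G'"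
  and 1: "rZ W G \<otimes>\<^bsub>sections Z W\<^esub> res Z V W t = rZ W F" and 2: "rZ W G' \<otimes>\<^bsub>sections Z W\<^esub> res Z V W t = rZ W F'"
  using r unfolding represents_def by auto
 have o: "opens Y (pre W)" by (rule open_pre) fact
 have Wp: "W \<subseteq> PZ" using W(1) openin_subset by blast
 interpret zW: cring "sections Z W" by (rule Z.cring_sections) fact
 interpret yW: cring "sections Y (pre W)" by (rule Y.cring_sections) fact
 note zc = Z.res_\<rho>_closed[OF W(1) Wp] and yc = Y.res_\<rho>_closed[OF o pre_sub]
 note zm = ring_hom_mult[OF Z.res_\<rho>_hom[OF W(1) Wp]] and ym = ring_hom_mult[OF Y.res_\<rho>_hom[OF o pre_sub]]
 have "rZ W (G' \<otimes> F) = rZ W (G \<otimes> F')" unfolding zm[OF W(7,3)] zm[OF W(4,6)] 1[symmetric] 2[symmetric]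
  using zc[OF W(4)] zc[OF W(7)] Z.res_closed[OF V(1) W(1,2) V(2)] by (simp add: zW.m_lcomm)
 then have "rY (pre W) (G' \<otimes> F) = rY (pre W) (G \<otimes> F')"
  by (rule transfer_eq[OF W(1) Y.R.m_closed Y.R.m_closed, rotated -1]) fact+
 then have x: "rY (pre W) G' \<otimes>\<^bsub>sections Y (pre W)\<^esub> rY (pre W) F
   = rY (pre W) G \<otimes>\<^bsub>sections Y (pre W)\<^esub> rY (pre W) F'" unfolding ym[OF W(7,3)] ym[OF W(4,6)] .
 have u: "rY (pre W) G \<in> Units (sections Y (pre W))" "rY (pre W) G' \<in> Units (sections Y (pre W))"
  using Y.res_\<rho>_Units[OF o] pre_mono[OF W(5)] pre_mono[OF W(8)] pre_locus W by auto
 have "res Y (pre W) (pre W) s = s" "res Y (pre W) (pre W) s' = s'" using Y.res_id o s by auto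
 then show ?thesis using yW.frac_unique[OF u s yc[OF W(3)] yc[OF W(6)] _ _ x] e unfolding represents'_def by simp
qed

definition transfers :: "'q set => 't => 's => bool" where "transfers V t s \<longleftrightarrow> s \<in> \<Gamma> Y (pre V) &
  (\<forall>W F G. represents V t W F G --> represents' (pre V) s W F G)"

lemma transfers_ex:
 assumes V: "opens Z V" "t \<in> \<Gamma> Z V"
 shows "\<exists>s. transfers V t s"
proof -
 define D where "D U s \<longleftrightarrow> (\<exists>W F G. represents V t W F G & U = pre W &
   s \<in> \<Gamma> Y (pre W) & represents' (pre W) s W F G)" for U s
 have ex: "\<exists>s. s \<in> \<Gamma> Y (pre W) & represents' (pre W) s W F G"
  if "represents V t W F G" for W F G
 proof -
  have W: "opens Z W" "F \<in> carrier R" "G \<in> carrier R" "W \<subseteq> DZ G" using that unfolding represents_def by auto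
  have o: "opens Y (pre W)" by (rule open_pre) fact
  interpret yW: cring "sections Y (pre W)" by (rule Y.cring_sections) fact
  have "rY (pre W) G \<in> Units (sections Y (pre W))" using Y.res_\<rho>_Units[OF o] pre_mono[OF W(4)] pre_locus W by auto
  then obtain i where i: "i \<in> \<Gamma> Y (pre W)" "rY (pre W) G \<otimes>\<^bsub>sections Y (pre W)\<^esub> i = \<one>\<^bsub>sections Y (pre W)\<^esub>"
   unfolding Units_def by blast
  let ?s = "i \<otimes>\<^bsub>sections Y (pre W)\<^esub> rY (pre W) F"
  note c = Y.res_\<rho>_closed[OF o pre_sub W(2)] Y.res_\<rho>_closed[OF o pre_sub W(3)]
  have s: "?s \<in> \<Gamma> Y (pre W)" using i c by simp
  then have "represents' (pre W) ?s W F G"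
   unfolding represents'_def Y.res_id[OF o s] using i c by (simp add: yW.m_assoc[symmetric])
  then show ?thesis using s by blast
 qed
 have pv: "pre W \<subseteq> pre V" if "represents V t W F G" for W F G using that pre_mono unfolding represents_def by blast
 have "\<exists>s \<in> \<Gamma> Y (pre V). \<forall>U u. D U u --> res Y (pre V) U s = u"
 proof (rule Y.glue_rel[OF open_pre[OF V(1)]])
  fix U u assume "D U u"
  then obtain W F G where "represents V t W F G" "U = pre W" "u \<in> \<Gamma> Y (pre W)" unfolding D_def by blast
  then show "opens Y U & U \<subseteq> pre V & u \<in> \<Gamma> Y U" using pv[of W F G] open_pre[of W] unfolding represents_def by simp
 next
  fix y assume "y \<in> pre V"
  then have y: "y \<in> PY" "\<beta> y \<in> V" unfolding pre_def by auto
  obtain W F G where r: "\<beta> y \<in> W" "represents V t W F G" using represents_ex[OF V y(2)] by blast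
  obtain s where "s \<in> \<Gamma> Y (pre W)" "represents' (pre W) s W F G" using ex[OF r(2)] by blast
  then have "D (pre W) s" unfolding D_def using r(2) by blast
  moreover have "y \<in> pre W" using y(1) r(1) unfolding pre_def by simp
  ultimately show "\<exists>U u. y \<in> U & D U u" by (intro exI[of _ "pre W"] exI[of _ s] conjI)
 next
  fix U u U' u' assume "D U u" "D U' u'"
  then obtain W F G W' F' G' where 1: "represents V t W F G" "U = pre W" "u \<in> \<Gamma> Y (pre W)" "represents' (pre W) u W F G"
   and 2: "represents V t W' F' G'" "U' = pre W'" "u' \<in> \<Gamma> Y (pre W')" "represents' (pre W') u' W' F' G'"
   unfolding D_def by blast
  have W: "opens Z W" "F \<in> carrier R" "G \<in> carrier R" using 1(1) unfolding represents_def by auto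
  have W': "opens Z W'" "F' \<in> carrier R" "G' \<in> carrier R" using 2(1) unfolding represents_def by auto
  let ?I = "W \<inter> W'"
  have I: "opens Z ?I" using W W' by (simp add: openin_Int)
  have oI: "opens Y (pre ?I)" by (rule open_pre) fact
  note m = pre_mono[of ?I W, OF Int_lower1] pre_mono[of ?I W', OF Int_lower2]
  note oW = open_pre[OF W(1)] open_pre[OF W'(1)]
  have c: "res Y (pre W) (pre ?I) u \<in> \<Gamma> Y (pre ?I)" "res Y (pre W') (pre ?I) u' \<in> \<Gamma> Y (pre ?I)"
   using Y.res_closed[OF oW(1) oI m(1) 1(3)] Y.res_closed[OF oW(2) oI m(2) 2(3)] by auto
  have "represents' (pre W) u ?I F G" by (rule represents'_restrict[OF 1(4) oW(1) 1(3) W(1) _ W(2,3) I]) auto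
  then have e1: "represents' (pre ?I) (res Y (pre W) (pre ?I) u) ?I F G" unfolding represents'_def Y.res_id[OF oI c(1)] .
  have "represents' (pre W') u' ?I F' G'" by (rule represents'_restrict[OF 2(4) oW(2) 2(3) W'(1) _ W'(2,3) I]) auto
  then have e2: "represents' (pre ?I) (res Y (pre W') (pre ?I) u') ?I F' G'"
   unfolding represents'_def Y.res_id[OF oI c(2)] .
  have "res Y (pre W) (pre ?I) u = res Y (pre W') (pre ?I) u'"
   by (rule transfer_agree[OF V represents_restrict[OF 1(1) V I Int_lower1]
      represents_restrict[OF 2(1) V I Int_lower2] c e1 e2])
  then show "res Y U (U \<inter> U') u = res Y U' (U \<inter> U') u'" unfolding 1(2) 2(2) pre_Int .
 qed
 then obtain s where s: "s \<in> \<Gamma> Y (pre V)" "\<And>U u. D U u ==> res Y (pre V) U s = u" by blast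
 have "represents' (pre V) s W F G" if r: "represents V t W F G" for W F G
 proof -
  obtain u where u: "u \<in> \<Gamma> Y (pre W)" "represents' (pre W) u W F G" using ex[OF r] by blast
  have o: "opens Y (pre W)" using r open_pre unfolding represents_def by blast
  have "res Y (pre V) (pre W) s = u" using s(2) r u unfolding D_def by blast
  then show ?thesis using u(2) Y.res_id[OF o u(1)] unfolding represents'_def by simp
 qed
 then show ?thesis using s(1) unfolding transfers_def by blast
qed

definition tr :: "'q set => 't => 's" where "tr V t = (SOME s. transfers V t s)"

lemma tr:
 assumes "opens Z V" "t \<in> \<Gamma> Z V"
 shows "tr V t \<in> \<Gamma> Y (pre V)" and "represents V t W F G ==> represents' (pre V) (tr V t) W F G"
proof -
 have "transfers V t (tr V t)" unfolding tr_def by (rule someI_ex[OF transfers_ex[OF assms]])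
 then show "tr V t \<in> \<Gamma> Y (pre V)" and "represents V t W F G ==> represents' (pre V) (tr V t) W F G"
  unfolding transfers_def by auto
qed

lemma tr_eqI:
 assumes V: "opens Z V" "t \<in> \<Gamma> Z V" and s: "s \<in> \<Gamma> Y (pre V)"
  and e: "\<And>y. y \<in> pre V ==> \<exists>W F G. \<beta> y \<in> W & represents V t W F G & represents' (pre V) s W F G"
 shows "tr V t = s"
proof (rule Y.sections_eqI[OF open_pre[OF V(1)] tr(1)[OF V] s])
 fix y assume y: "y \<in> pre V"
 then obtain W F G where r: "\<beta> y \<in> W" "represents V t W F G" "represents' (pre V) s W F G" using e by blast
 have W: "opens Z W" "W \<subseteq> V" using r unfolding represents_def by auto
 note o = open_pre[OF V(1)] open_pre[OF W(1)] pre_mono[OF W(2)]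
 have c: "res Y (pre V) (pre W) (tr V t) \<in> \<Gamma> Y (pre W)" "res Y (pre V) (pre W) s \<in> \<Gamma> Y (pre W)"
  using Y.res_closed o tr(1)[OF V] s by auto
 have "res Y (pre V) (pre W) (tr V t) = res Y (pre V) (pre W) s"
 proof (rule transfer_agree[OF V r(2) r(2) c])
  show "represents' (pre W) (res Y (pre V) (pre W) (tr V t)) W F G"
   using tr(2)[OF V r(2)] unfolding represents'_def Y.res_id[OF o(2) c(1)] .
  show "represents' (pre W) (res Y (pre V) (pre W) s) W F G" using r(3) unfolding represents'_def Y.res_id[OF o(2) c(2)] .
 qed
 then show "\<exists>W. opens Y W & y \<in> W & W \<subseteq> pre V & res Y (pre V) W (tr V t) = res Y (pre V) W s"
  using o r(1) y unfolding pre_def by (intro exI[of _ "pre W"]) (auto simp: pre_def)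
qed

text \<open>The ring operations and restrictions on sections are computed on representing fractions.\<close>

lemma represents_op:
 assumes W: "opens Z W" "W \<subseteq> V" "opens Z V" "t \<in> \<Gamma> Z V" "t' \<in> \<Gamma> Z V" and r: "represents V t W F G" "represents V t' W F' G'"
 shows "represents V (t \<otimes>\<^bsub>sections Z V\<^esub> t') W (F \<otimes> F') (G \<otimes> G')"
  and "represents V (t \<oplus>\<^bsub>sections Z V\<^esub> t') W (F \<otimes> G' \<oplus> F' \<otimes> G) (G \<otimes> G')"
proof -
 have c: "F \<in> carrier R" "G \<in> carrier R" "W \<subseteq> DZ G" "F' \<in> carrier R" "G' \<in> carrier R" "W \<subseteq> DZ G'"
  and e: "rZ W G \<otimes>\<^bsub>sections Z W\<^esub> res Z V W t = rZ W F" "rZ W G' \<otimes>\<^bsub>sections Z W\<^esub> res Z V W t' = rZ W F'"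
  using r unfolding represents_def by auto
 have Wp: "W \<subseteq> PZ" using W(1) openin_subset by blast
 interpret W: cring "sections Z W" by (rule Z.cring_sections) fact
 note cl = Z.res_closed[OF W(3,1,2)] and rc = Z.res_\<rho>_closed[OF W(1) Wp]
 note h = Z.res_\<rho>_hom[OF W(1) Wp]
 have D: "W \<subseteq> DZ (G \<otimes> G')" using c Z.locus_\<rho>_mult by auto
 note cc = rc[OF c(2)] rc[OF c(5)] cl[OF W(4)] cl[OF W(5)]
 show "represents V (t \<otimes>\<^bsub>sections Z V\<^esub> t') W (F \<otimes> F') (G \<otimes> G')"
  unfolding represents_def Z.res_mult[OF W(3,1,2,4,5)] ring_hom_mult[OF h c(2,5)] ring_hom_mult[OF h c(1,4)] e[symmetric]
  using W c D cc by (simp add: W.m_ac)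
 have e': "rZ W (F \<otimes> G' \<oplus> F' \<otimes> G)
   = rZ W F \<otimes>\<^bsub>sections Z W\<^esub> rZ W G' \<oplus>\<^bsub>sections Z W\<^esub>
    rZ W F' \<otimes>\<^bsub>sections Z W\<^esub> rZ W G" using ring_hom_mult[OF h] ring_hom_add[OF h] c by simp
 show "represents V (t \<oplus>\<^bsub>sections Z V\<^esub> t') W (F \<otimes> G' \<oplus> F' \<otimes> G) (G \<otimes> G')"
  unfolding represents_def e' Z.res_add[OF W(3,1,2,4,5)] ring_hom_mult[OF h c(2,5)] e[symmetric]
  using W c D cc by (simp add: W.m_ac W.r_distr)
qed

lemma represents'_op:
 assumes W: "opens Z W" "pre W \<subseteq> U" "opens Y U" "s \<in> \<Gamma> Y U" "s' \<in> \<Gamma> Y U"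
  and c: "F \<in> carrier R" "G \<in> carrier R" "F' \<in> carrier R" "G' \<in> carrier R"
  and r: "represents' U s W F G" "represents' U s' W F' G'"
 shows "represents' U (s \<otimes>\<^bsub>sections Y U\<^esub> s') W (F \<otimes> F') (G \<otimes> G')"
  and "represents' U (s \<oplus>\<^bsub>sections Y U\<^esub> s') W (F \<otimes> G' \<oplus> F' \<otimes> G) (G \<otimes> G')"
proof -
 have o: "opens Y (pre W)" by (rule open_pre) fact
 interpret W: cring "sections Y (pre W)" by (rule Y.cring_sections) fact
 note cl = Y.res_closed[OF W(3) o W(2)] and rc = Y.res_\<rho>_closed[OF o pre_sub]
 note h = Y.res_\<rho>_hom[OF o pre_sub]
 note cc = rc[OF c(2)] rc[OF c(4)] cl[OF W(4)] cl[OF W(5)]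
 note e = r[unfolded represents'_def]
 show "represents' U (s \<otimes>\<^bsub>sections Y U\<^esub> s') W (F \<otimes> F') (G \<otimes> G')"
  unfolding represents'_def Y.res_mult[OF W(3) o W(2,4,5)] ring_hom_mult[OF h c(2,4)] ring_hom_mult[OF h c(1,3)]
   e[symmetric] using cc by (simp add: W.m_ac)
 have e': "rY (pre W) (F \<otimes> G' \<oplus> F' \<otimes> G)
   = rY (pre W) F \<otimes>\<^bsub>sections Y (pre W)\<^esub> rY (pre W) G' \<oplus>\<^bsub>sections Y (pre W)\<^esub>
    rY (pre W) F' \<otimes>\<^bsub>sections Y (pre W)\<^esub> rY (pre W) G" using ring_hom_mult[OF h] ring_hom_add[OF h] c by simp
 show "represents' U (s \<oplus>\<^bsub>sections Y U\<^esub> s') W (F \<otimes> G' \<oplus> F' \<otimes> G) (G \<otimes> G')"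
  unfolding represents'_def e' Y.res_add[OF W(3) o W(2,4,5)] ring_hom_mult[OF h c(2,4)] e[symmetric]
  using cc by (simp add: W.m_ac W.r_distr)
qed

lemma represents_ex2:
 assumes V: "opens Z V" "t \<in> \<Gamma> Z V" "t' \<in> \<Gamma> Z V" "z \<in> V"
 obtains W F G F' G' where "z \<in> W" "represents V t W F G" "represents V t' W F' G'"
proof -
 obtain W F G where 1: "z \<in> W" "represents V t W F G" using represents_ex[OF V(1,2,4)] .
 obtain W' F' G' where 2: "z \<in> W'" "represents V t' W' F' G'" using represents_ex[OF V(1,3,4)] .
 have I: "opens Z (W \<inter> W')" using 1 2 unfolding represents_def by (auto simp: openin_Int)
 show thesis by (rule that[OF _ represents_restrict[OF 1(2) V(1,2) I] represents_restrict[OF 2(2) V(1,3) I]])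
   (use 1 2 in auto)
qed

lemma representsD:
 assumes "represents V t W F G"
 shows "opens Z W" "W \<subseteq> V" "F \<in> carrier R" "G \<in> carrier R" "pre W \<subseteq> pre V"
 using assms pre_mono unfolding represents_def by auto

lemma tr_op:
 assumes V: "opens Z V" "t \<in> \<Gamma> Z V" "t' \<in> \<Gamma> Z V"
 shows "tr V (t \<otimes>\<^bsub>sections Z V\<^esub> t') = tr V t \<otimes>\<^bsub>sections Y (pre V)\<^esub> tr V t'"
  and "tr V (t \<oplus>\<^bsub>sections Z V\<^esub> t') = tr V t \<oplus>\<^bsub>sections Y (pre V)\<^esub> tr V t'"
proof -
 interpret V: cring "sections Z V" by (rule Z.cring_sections) fact
 have o: "opens Y (pre V)" by (rule open_pre) fact
 interpret pV: cring "sections Y (pre V)" by (rule Y.cring_sections) fact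
 note tc = tr(1)[OF V(1,2)] tr(1)[OF V(1,3)]
 show "tr V (t \<otimes>\<^bsub>sections Z V\<^esub> t') = tr V t \<otimes>\<^bsub>sections Y (pre V)\<^esub> tr V t'"
 proof (rule tr_eqI[OF V(1)])
  fix y assume "y \<in> pre V"
  then have "\<beta> y \<in> V" unfolding pre_def by simp
  then obtain W F G F' G' where r: "\<beta> y \<in> W" "represents V t W F G" "represents V t' W F' G'"
   using represents_ex2[OF V] by blast
  note d = representsD[OF r(2)] representsD[OF r(3)]
  show "\<exists>W F G. \<beta> y \<in> W & represents V (t \<otimes>\<^bsub>sections Z V\<^esub> t') W F G &
    represents' (pre V) (tr V t \<otimes>\<^bsub>sections Y (pre V)\<^esub> tr V t') W F G" using r(1) represents_op(1)[OF d(1,2) V r(2,3)]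
    represents'_op(1)[OF d(1,5) o tc d(3,4,8,9) tr(2)[OF V(1,2) r(2)] tr(2)[OF V(1,3) r(3)]] by blast
 qed (use V tc in auto)
 show "tr V (t \<oplus>\<^bsub>sections Z V\<^esub> t') = tr V t \<oplus>\<^bsub>sections Y (pre V)\<^esub> tr V t'"
 proof (rule tr_eqI[OF V(1)])
  fix y assume "y \<in> pre V"
  then have "\<beta> y \<in> V" unfolding pre_def by simp
  then obtain W F G F' G' where r: "\<beta> y \<in> W" "represents V t W F G" "represents V t' W F' G'"
   using represents_ex2[OF V] by blast
  note d = representsD[OF r(2)] representsD[OF r(3)]
  show "\<exists>W F G. \<beta> y \<in> W & represents V (t \<oplus>\<^bsub>sections Z V\<^esub> t') W F G &
    represents' (pre V) (tr V t \<oplus>\<^bsub>sections Y (pre V)\<^esub> tr V t') W F G" using r(1) represents_op(2)[OF d(1,2) V r(2,3)]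
    represents'_op(2)[OF d(1,5) o tc d(3,4,8,9) tr(2)[OF V(1,2) r(2)] tr(2)[OF V(1,3) r(3)]] by blast
 qed (use V tc in auto)
qed

lemma tr_\<rho>:
 assumes V: "opens Z V" and F: "F \<in> carrier R"
 shows "tr V (rZ V F) = rY (pre V) F"
proof -
 have Vp: "V \<subseteq> PZ" using V openin_subset by blast
 have o: "opens Y (pre V)" by (rule open_pre) fact
 interpret V: cring "sections Z V" by (rule Z.cring_sections) fact
 interpret pV: cring "sections Y (pre V)" by (rule Y.cring_sections) fact
 note c = Z.res_\<rho>_closed[OF V Vp F] Y.res_\<rho>_closed[OF o pre_sub F]
 show ?thesis
 proof (rule tr_eqI[OF V c])
  fix y assume "y \<in> pre V"
  then have "\<beta> y \<in> V" unfolding pre_def by simp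
  moreover have "represents V (rZ V F) V F \<one>"
   unfolding represents_def Z.locus_\<rho>_one Z.res_id[OF V c(1)] ring_hom_one[OF Z.res_\<rho>_hom[OF V Vp]] using V Vp F c by simp
  moreover have "represents' (pre V) (rY (pre V) F) V F \<one>"
   unfolding represents'_def Y.res_id[OF o c(2)] ring_hom_one[OF Y.res_\<rho>_hom[OF o pre_sub]] using c by simp
  ultimately show "\<exists>W F' G. \<beta> y \<in> W & represents V (rZ V F) W F' G &
   represents' (pre V) (rY (pre V) F) W F' G" by blast
 qed
qed

lemma tr_one: assumes V: "opens Z V" shows "tr V \<one>\<^bsub>sections Z V\<^esub> = \<one>\<^bsub>sections Y (pre V)\<^esub>"
 using tr_\<rho>[OF V Y.R.one_closed] ring_hom_one[OF Z.res_\<rho>_hom[OF V]]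
  ring_hom_one[OF Y.res_\<rho>_hom[OF open_pre[OF V] pre_sub]] openin_subset[OF V] by simp

lemma tr_res:
 assumes V: "opens Z V" "t \<in> \<Gamma> Z V" and W: "opens Z W" "W \<subseteq> V"
 shows "tr W (res Z V W t) = res Y (pre V) (pre W) (tr V t)"
proof -
 note o = open_pre[OF V(1)] open_pre[OF W(1)] pre_mono[OF W(2)]
 have c: "res Z V W t \<in> \<Gamma> Z W" "res Y (pre V) (pre W) (tr V t) \<in> \<Gamma> Y (pre W)"
  using Z.res_closed[OF V(1) W V(2)] Y.res_closed[OF o tr(1)[OF V]] by auto
 show ?thesis
 proof (rule tr_eqI[OF W(1) c])
  fix y assume "y \<in> pre W"
  then have y: "\<beta> y \<in> W" unfolding pre_def by simp
  then obtain W0 F G where r0: "\<beta> y \<in> W0" "represents V t W0 F G" using represents_ex[OF V] W(2) by blast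
  let ?I = "W0 \<inter> W"
  have I: "opens Z ?I" using representsD(1)[OF r0(2)] W by (simp add: openin_Int)
  have r: "represents V t ?I F G" by (rule represents_restrict[OF r0(2) V I]) auto
  have "represents W (res Z V W t) ?I F G"
   using r Z.res_res[OF V(1) W(1) I Int_lower2 W(2) V(2)] unfolding represents_def by auto
  moreover have "represents' (pre W) (res Y (pre V) (pre W) (tr V t)) ?I F G"
   using tr(2)[OF V r] Y.res_res[OF o(1,2) open_pre[OF I] pre_mono[OF Int_lower2] o(3) tr(1)[OF V]]
   unfolding represents'_def by simp
  ultimately show "\<exists>W' F G. \<beta> y \<in> W' & represents W (res Z V W t) W' F G &
    represents' (pre W) (res Y (pre V) (pre W) (tr V t)) W' F G" using y r0(1) by blast
 qed
qed

definition iso :: "('p, 's, 'q, 't) space_map" where "iso = \<lparr>pt = \<beta>, pull = tr\<rparr>"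

lemma preimg_iso: "preimg Y iso V = pre V"
 unfolding preimg_def iso_def pre_def by simp

lemma morphism_iso: "morphism Y Z iso"
proof (rule morphismI[OF Y.rspace_axioms Z.rspace_axioms])
 show "continuous_map (topo Y) (topo Z) (pt iso)"
  by (rule continuous_mapI) (use \<beta>(1) open_pre in \<open>auto simp: iso_def pre_def\<close>)
 fix V assume V: "opens Z V"
 show "pull iso V \<in> ring_hom (sections Z V) (sections Y (preimg Y iso V))"
  unfolding preimg_iso by (rule ring_hom_memI) (simp_all add: iso_def tr V tr_op tr_one)
 show "res Y (preimg Y iso V) (preimg Y iso W) (pull iso V t) = pull iso W (res Z V W t)"
  if "opens Z W" "W \<subseteq> V" "t \<in> \<Gamma> Z V" for W t unfolding preimg_iso using tr_res[OF V that(3,1,2)] by (simp add: iso_def)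
 fix t y assume t: "t \<in> \<Gamma> Z V" and y: "pt iso y \<in> V" and "y \<in> locus Y (preimg Y iso V) (pull iso V t)"
 then have l: "y \<in> locus Y (pre V) (tr V t)" and b: "\<beta> y \<in> V" unfolding preimg_iso by (simp_all add: iso_def)
 obtain W F G where r: "\<beta> y \<in> W" "represents V t W F G" using represents_ex[OF V t b] .
 note d = representsD[OF r(2)]
 note o = open_pre[OF V] open_pre[OF d(1)]
 have yp: "y \<in> PY" "y \<in> pre W" using l Y.locus_subset r(1) unfolding pre_def by auto
 have WG: "W \<subseteq> DZ G" and eq: "rZ W G \<otimes>\<^bsub>sections Z W\<^esub> res Z V W t = rZ W F" using r(2) unfolding represents_def by auto
 have Wp: "W \<subseteq> PZ" using openin_subset d by blast
 have eq': "rY (pre W) G \<otimes>\<^bsub>sections Y (pre W)\<^esub> res Y (pre V) (pre W) (tr V t) = rY (pre W) F"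
  using tr(2)[OF V t r(2)] unfolding represents'_def .
 have "y \<in> locus Y (pre W) (rY (pre W) G)"
  using Y.locus_res[OF Y.open_V Y.\<rho>_closed[OF d(4)] o(2) pre_sub] yp \<beta>_locus[OF yp(1) d(4)] WG r(1) by blast
 moreover have "y \<in> locus Y (pre W) (res Y (pre V) (pre W) (tr V t))"
  using Y.locus_res[OF o(1) tr(1)[OF V t] o(2) d(5)] yp l by blast
 ultimately have "y \<in> locus Y (pre W) (rY (pre W) F)"
  using Y.locus_mult[OF o(2) Y.res_\<rho>_closed[OF o(2) pre_sub d(4)] Y.res_closed[OF o d(5) tr(1)[OF V t]]] eq' by simp
 then have "y \<in> DY F" using Y.locus_res[OF Y.open_V Y.\<rho>_closed[OF d(3)] o(2) pre_sub] by blast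
 then have "\<beta> y \<in> DZ F" using \<beta>_locus[OF yp(1) d(3)] by simp
 then have "\<beta> y \<in> locus Z W (rZ W F)" using Z.locus_res[OF Z.open_V Z.\<rho>_closed[OF d(3)] d(1) Wp] r(1) by blast
 then have "\<beta> y \<in> locus Z W (res Z V W t)"
  using Z.locus_mult[OF d(1) Z.res_\<rho>_closed[OF d(1) Wp d(4)] Z.res_closed[OF V d(1,2) t]] eq by simp
 then show "pt iso y \<in> locus Z V t" using Z.locus_res[OF V t d(1,2)] by (simp add: iso_def)
qed

end

text \<open>The construction is symmetric, and the two morphisms it yields are inverse to each other
  because fractions determine sections.\<close>

lemma (in chart_pair) mor_eq_round_trip:
 "mor_eq Y Y (mcomp Z (chart_pair.iso Z Y R \<rho>' \<rho>) iso) id_map"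
proof -
 interpret inv: chart_pair Z Y R \<rho>' \<rho> by unfold_locales (rule same[symmetric])
 have bb: "inv.\<beta> (\<beta> y) = y" if "y \<in> PY" for y by (rule inv.\<beta>_unique) (use \<beta> that in auto)

 have pp: "pre (inv.pre W) = W" if "W \<subseteq> PY" for W using that bb \<beta>(1) unfolding pre_def inv.pre_def by auto
 have tt: "tr (inv.pre W) (inv.tr W u) = u" if W: "opens Y W" and u: "u \<in> \<Gamma> Y W" for W u
 proof (rule tr_eqI[OF inv.open_pre[OF W] inv.tr(1)[OF W u]])
  have Wp: "W \<subseteq> PY" using W openin_subset by blast
  show "u \<in> \<Gamma> Y (pre (inv.pre W))" using u pp[OF Wp] by simp
  fix y assume "y \<in> pre (inv.pre W)"
  then have y: "y \<in> W" using pp[OF Wp] by simp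
  obtain W0 F G where r: "y \<in> W0" "inv.represents W u W0 F G" using inv.represents_ex[OF W u y] .
  note d = inv.representsD[OF r(2)]
  have W0p: "W0 \<subseteq> PY" using d openin_subset by blast
  have "represents (inv.pre W) (inv.tr W u) (inv.pre W0) F G"
   using inv.tr(2)[OF W u r(2)] d inv.open_pre[OF d(1)] inv.pre_locus[OF d(4)] inv.pre_mono[of W0 "DY G"] r(2)
   unfolding represents_def inv.represents'_def inv.represents_def by auto
  moreover have "represents' (pre (inv.pre W)) u (inv.pre W0) F G"
   using r(2) unfolding represents'_def inv.represents_def pp[OF Wp] pp[OF W0p] by simp
  moreover have "\<beta> y \<in> inv.pre W0" using r(1) W0p bb \<beta>(1) unfolding inv.pre_def by auto
  ultimately show "\<exists>Wa F G. \<beta> y \<in> Wa & represents (inv.pre W) (inv.tr W u) Wa F G &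
    represents' (pre (inv.pre W)) u Wa F G" by blast
 qed
 show ?thesis unfolding mor_eq_def mcomp_def id_map_def inv.preimg_iso using bb tt by (simp add: iso_def inv.iso_def)
qed

lemma (in chart_pair) isomorphism_iso: "isomorphism Y Z iso"
proof -
 interpret inv: chart_pair Z Y R \<rho>' \<rho> by unfold_locales (rule same[symmetric])
 show ?thesis unfolding isomorphism_def using morphism_iso inv.morphism_iso mor_eq_round_trip inv.mor_eq_round_trip by blast
qed

section \<open>Charts and morphisms\<close>

text \<open>A morphism into a space with a chart is determined by the pullbacks of the functions in
  the chart: they give the image points, and they give the pullbacks of fractions.\<close>

lemma mor_eq_chart:
 assumes S: "rspace S" and Z: "chart Z (points Z) R \<rho>" and f: "morphism S Z f" and g: "morphism S Z g"
  and eq: "\<And>F. F \<in> carrier R ==> pull f (points Z) (\<rho> F) = pull g (points Z) (\<rho> F)"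
 shows "mor_eq S Z f g"
proof -
 interpret S: rspace S by fact
 interpret Z: chart Z "points Z" R \<rho> by fact
 have pt: "pt f x = pt g x" if x: "x \<in> points S" for x
 proof -
  have "pt f x \<in> locus Z (points Z) (\<rho> F) \<longleftrightarrow> pt g x \<in> locus Z (points Z) (\<rho> F)" if F: "F \<in> carrier R" for F
   using locus_pull[OF S Z.rspace_axioms f Z.open_V Z.\<rho>_closed[OF F]]
    locus_pull[OF S Z.rspace_axioms g Z.open_V Z.\<rho>_closed[OF F]]
    eq[OF F] preimg_points[OF f] preimg_points[OF g] x unfolding preimg_def by auto
  then have "prm Z (points Z) R \<rho> (pt f x) = prm Z (points Z) R \<rho> (pt g x)" unfolding prm_def by auto
  then show ?thesis using Z.inj morphism_pt[OF f x] morphism_pt[OF g x] unfolding inj_on_def by blast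
 qed
 have pre: "preimg S f V = preimg S g V" for V using pt unfolding preimg_def by auto
 have "pull f V t = pull g V t" if V: "opens Z V" and t: "t \<in> \<Gamma> Z V" for V t
 proof (rule S.sections_eqI[OF morphism_open[OF f V] morphism_closed[OF f V t]])
  show "pull g V t \<in> \<Gamma> S (preimg S f V)" unfolding pre by (rule morphism_closed[OF g V t])
  fix x assume x: "x \<in> preimg S f V"
  then have fx: "pt f x \<in> V" unfolding preimg_def by simp
  obtain W F G where W: "opens Z W" "pt f x \<in> W" "W \<subseteq> V" "F \<in> carrier R" "G \<in> carrier R" "W \<subseteq> locus Z (points Z) (\<rho> G)"
   and e: "res Z (points Z) W (\<rho> G) \<otimes>\<^bsub>sections Z W\<^esub> res Z V W t = res Z (points Z) W (\<rho> F)"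
   using Z.fracs_on[OF V openin_subset[OF V] fx t] .
  have Wp: "W \<subseteq> points Z" using W(1) openin_subset by blast
  let ?W = "preimg S f W"
  have o: "opens S ?W" by (rule morphism_open[OF f W(1)])
  interpret W: cring "sections S ?W" by (rule S.cring_sections) fact
  have rc: "res Z (points Z) W (\<rho> F) \<in> \<Gamma> Z W" if "F \<in> carrier R" for F by (rule Z.res_\<rho>_closed[OF W(1) Wp that])
  have tc: "res Z V W t \<in> \<Gamma> Z W" by (rule Z.res_closed[OF V W(1,3) t])
  have same: "pull f W (res Z (points Z) W (\<rho> F)) = pull g W (res Z (points Z) W (\<rho> F))"
   if F: "F \<in> carrier R" for F using morphism_nat[OF f Z.open_V W(1) Wp Z.\<rho>_closed[OF F]]
    morphism_nat[OF g Z.open_V W(1) Wp Z.\<rho>_closed[OF F]] eq[OF F] unfolding pre by simp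
  have u: "pull f W (res Z (points Z) W (\<rho> G)) \<in> Units (sections S ?W)"
   by (rule hom_Units[OF morphism_hom[OF f W(1)] Z.cring_sections[OF W(1)] W.is_cring Z.res_\<rho>_Units[OF W(1,6,5)]])
  have "pull f W (res Z (points Z) W (\<rho> G)) \<otimes>\<^bsub>sections S ?W\<^esub> pull f W (res Z V W t)
    = pull f W (res Z (points Z) W (\<rho> F))" using ring_hom_mult[OF morphism_hom[OF f W(1)] rc[OF W(5)] tc] e by simp
  also have "\<dots> = pull f W (res Z (points Z) W (\<rho> G)) \<otimes>\<^bsub>sections S ?W\<^esub> pull g W (res Z V W t)"
   using ring_hom_mult[OF morphism_hom[OF g W(1)] rc[OF W(5)] tc] e same W(4,5) unfolding pre by simp
  finally have "pull f W (res Z V W t) = pull g W (res Z V W t)"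
   using W.Units_l_cancel[OF u] morphism_closed[OF f W(1) tc] morphism_closed[OF g W(1) tc] unfolding pre by simp
  then have "res S (preimg S f V) ?W (pull f V t) = res S (preimg S f V) ?W (pull g V t)"
   using morphism_nat[OF f V W(1,3) t] morphism_nat[OF g V W(1,3) t] unfolding pre by simp
  then show "\<exists>W. opens S W & x \<in> W & W \<subseteq> preimg S f V &
    res S (preimg S f V) W (pull f V t) = res S (preimg S f V) W (pull g V t)"
   using o W(2,3) x by (intro exI[of _ ?W]) (auto simp: preimg_def)
 qed
 then show ?thesis using pt unfolding mor_eq_def by blast
qed

text \<open>The conditions of a chart mention points, loci and restrictions only, and an isomorphism
respects these. This is how a trivialisation gives a chart of the total space.\<close>

lemma chart_transport:
 assumes Y: "rspace Y" and c: "chart Z (points Z) R \<rho>" and iso: "isomorphism Y Z \<phi>"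
 shows "chart Y (points Y) R (\<lambda>F. pull \<phi> (points Z) (\<rho> F))" and "\<And>y. y \<in> points Y ==>
   prm Y (points Y) R (\<lambda>F. pull \<phi> (points Z) (\<rho> F)) y = prm Z (points Z) R \<rho> (pt \<phi> y)" and "pt \<phi> ` points Y = points Z"
proof -
 interpret Y: rspace Y by fact
 interpret Z: chart Z "points Z" R \<rho> by fact
 have f: "morphism Y Z \<phi>" using iso unfolding isomorphism_def by blast
 obtain g where g: "morphism Z Y g" and i1: "mor_eq Y Y (mcomp Z g \<phi>) id_map" and i2: "mor_eq Z Z (mcomp Y \<phi> g) id_map"
  using iso unfolding isomorphism_def by blast
 have gf: "pt g (pt \<phi> y) = y" if "y \<in> points Y" for y using i1 that unfolding mor_eq_def mcomp_def id_map_def by simp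
 have fg: "pt \<phi> (pt g z) = z" if "z \<in> points Z" for z using i2 that unfolding mor_eq_def mcomp_def id_map_def by simp
 have pgf: "pull \<phi> (preimg Z g W) (pull g W u) = u" if "opens Y W" "u \<in> \<Gamma> Y W" for W u
  using i1 that unfolding mor_eq_def mcomp_def id_map_def by simp
 have pfg: "pull g (preimg Y \<phi> W) (pull \<phi> W u) = u" if "opens Z W" "u \<in> \<Gamma> Z W" for W u
  using i2 that unfolding mor_eq_def mcomp_def id_map_def by simp
 show surj: "pt \<phi> ` points Y = points Z" using morphism_pt[OF f] morphism_pt[OF g] fg by force
 let ?\<rho> = "\<lambda>F. pull \<phi> (points Z) (\<rho> F)"
 have pf: "preimg Y \<phi> (points Z) = points Y" and pg: "preimg Z g (points Y) = points Z" using preimg_points f g by blast+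
 have pp: "preimg Y \<phi> (preimg Z g W) = W" if "W \<subseteq> points Y" for W
  using that gf morphism_pt[OF f] unfolding preimg_def by auto
 have loc: "locus Y (points Y) (?\<rho> F) = preimg Y \<phi> (locus Z (points Z) (\<rho> F))" if "F \<in> carrier R" for F
  using locus_pull[OF Y Z.rspace_axioms f Z.open_V Z.\<rho>_closed[OF that]] unfolding pf .
 show p: "prm Y (points Y) R ?\<rho> y = prm Z (points Z) R \<rho> (pt \<phi> y)" if "y \<in> points Y" for y
  using that loc unfolding prm_def preimg_def by auto
 have nat: "res Y (points Y) (preimg Y \<phi> W) (?\<rho> F) = pull \<phi> W (res Z (points Z) W (\<rho> F))"
  if "opens Z W" "F \<in> carrier R" for W F
  using morphism_nat[OF f Z.open_V that(1) openin_subset[OF that(1)] Z.\<rho>_closed[OF that(2)]] unfolding pf .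
 show "chart Y (points Y) R ?\<rho>"
 proof (intro chart.intro chart_axioms.intro Y Z.cring_R)
  show "opens Y (points Y)" by simp
  show "?\<rho> \<in> ring_hom R (sections Y (points Y))"
   using ring_hom_trans[OF Z.hom morphism_hom[OF f Z.open_V]] unfolding pf by (simp add: o_def)
  show "primeideal (prm Y (points Y) R ?\<rho> y) R" if "y \<in> points Y" for y
   unfolding p[OF that] by (rule Z.prime[OF morphism_pt[OF f that]])
  show "inj_on (prm Y (points Y) R ?\<rho>) (points Y)"
  proof (rule inj_onI)
   fix x y assume xy: "x \<in> points Y" "y \<in> points Y" "prm Y (points Y) R ?\<rho> x = prm Y (points Y) R ?\<rho> y"
   then have "pt \<phi> x = pt \<phi> y" using Z.inj morphism_pt[OF f] unfolding p[OF xy(1)] p[OF xy(2)] inj_on_def by blast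
   then show "x = y" using gf xy by metis
  qed
  fix W y assume W: "opens Y W" "W \<subseteq> points Y" "y \<in> W"
  let ?W = "preimg Z g W"
  have oW: "opens Z ?W" "?W \<subseteq> points Z" using morphism_open[OF g W(1)] openin_subset by auto
  have y: "y \<in> points Y" "pt \<phi> y \<in> ?W" using W gf morphism_pt[OF f] unfolding preimg_def by auto
  {
   obtain F where F: "F \<in> carrier R" "pt \<phi> y \<in> locus Z (points Z) (\<rho> F)" "locus Z (points Z) (\<rho> F) \<subseteq> ?W"
    using Z.basis[OF oW y(2)] by blast
   have "preimg Y \<phi> (locus Z (points Z) (\<rho> F)) \<subseteq> preimg Y \<phi> ?W" using F(3) unfolding preimg_def by blast
   then show "\<exists>F\<in>carrier R. y \<in> locus Y (points Y) (?\<rho> F) & locus Y (points Y) (?\<rho> F) \<subseteq> W"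
    using F y unfolding pp[OF W(2)] by (intro bexI[of _ F]) (auto simp: loc preimg_def)
  }
  {
   fix s assume s: "s \<in> \<Gamma> Y W"
   let ?t = "pull g W s"
   have t: "?t \<in> \<Gamma> Z ?W" by (rule morphism_closed[OF g W(1) s])
   obtain W' F G where W': "opens Z W'" "pt \<phi> y \<in> W'" "W' \<subseteq> ?W" "F \<in> carrier R" "G \<in> carrier R"
    "W' \<subseteq> locus Z (points Z) (\<rho> G)"
    and e: "res Z (points Z) W' (\<rho> G) \<otimes>\<^bsub>sections Z W'\<^esub> res Z ?W W' ?t = res Z (points Z) W' (\<rho> F)"
    using Z.fracs_on[OF oW y(2) t] .
   have W'p: "W' \<subseteq> points Z" using W' openin_subset by blast
   let ?Z = "preimg Y \<phi> W'"
   have oZ: "opens Y ?Z" "y \<in> ?Z" using morphism_open[OF f W'(1)] y W'(2) unfolding preimg_def by auto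
   have ZW: "?Z \<subseteq> W" using W'(3) pp[OF W(2)] unfolding preimg_def by blast
   have "pull \<phi> W' (res Z ?W W' ?t) = res Y W ?Z s"
    using morphism_nat[OF f oW(1) W'(1,3) t] pgf[OF W(1) s] pp[OF W(2)] by simp
   then have "res Y (points Y) ?Z (?\<rho> G) \<otimes>\<^bsub>sections Y ?Z\<^esub> res Y W ?Z s = res Y (points Y) ?Z (?\<rho> F)"
    using ring_hom_mult[OF morphism_hom[OF f W'(1)] Z.res_\<rho>_closed[OF W'(1) W'p W'(5)]
      Z.res_closed[OF oW(1) W'(1,3) t]] e nat[OF W'(1)] W'(4,5) by simp
   moreover have "y \<in> locus Y (points Y) (?\<rho> G)" using loc[OF W'(5)] y W'(2,6) unfolding preimg_def by auto
   ultimately show "\<exists>F\<in>carrier R. \<exists>G\<in>carrier R. y \<in> locus Y (points Y) (?\<rho> G) &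
     (\<exists>W'. opens Y W' & y \<in> W' & W' \<subseteq> W &
      res Y (points Y) W' (?\<rho> G) \<otimes>\<^bsub>sections Y W'\<^esub> res Y W W' s = res Y (points Y) W' (?\<rho> F))"
    using oZ ZW W'(4,5) by blast
  }
  fix F assume F: "F \<in> carrier R" and 0: "res Y (points Y) W (?\<rho> F) = \<zero>\<^bsub>sections Y W\<^esub>"
  have \<rho>F: "?\<rho> F \<in> \<Gamma> Y (points Y)" using morphism_closed[OF f Z.open_V Z.\<rho>_closed[OF F]] unfolding pf .
  have "res Z (points Z) ?W (pull g (points Y) (?\<rho> F)) = pull g W (res Y (points Y) W (?\<rho> F))"
   using morphism_nat[OF g _ W(1,2) \<rho>F] unfolding pg by simp
  also have "\<dots> = \<zero>\<^bsub>sections Z ?W\<^esub>"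
   using 0 ring_hom_zero[OF morphism_hom[OF g W(1)]] Y.cring_sections[OF W(1)] Z.cring_sections[OF oW(1)]
   by (simp add: cring.axioms(1))
  finally have "res Z (points Z) ?W (\<rho> F) = \<zero>\<^bsub>sections Z ?W\<^esub>" using pfg[OF Z.open_V Z.\<rho>_closed[OF F]] unfolding pf by simp
  then obtain h where "h \<in> carrier R" "pt \<phi> y \<in> locus Z (points Z) (\<rho> h)" "h \<otimes>\<^bsub>R\<^esub> F = \<zero>\<^bsub>R\<^esub>"
   using Z.ker[OF oW y(2) F] by blast
  then show "\<exists>h\<in>carrier R. y \<in> locus Y (points Y) (?\<rho> h) & h \<otimes>\<^bsub>R\<^esub> F = \<zero>\<^bsub>R\<^esub>"
   using y(1) loc unfolding preimg_def by (intro bexI[of _ h]) auto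
 qed
qed

section \<open>Charts of spaces of fractional functions\<close>

lemma (in frac_space) locus_frac:
 assumes V: "openin T V" and a: "a \<in> N V" "f \<in> N V" "\<And>p. p \<in> V ==> f p \<notin> q p"
 shows "locus space V (\<lambda>p\<in>V. fr p (a p) (f p)) = {p \<in> V. a p \<notin> q p}"
proof -
 have s: "(\<lambda>p\<in>V. fr p (a p) (f p)) \<in> \<Gamma> space V" by (rule section_frac) (use assms in auto)
 have "p \<in> locus space V (\<lambda>p\<in>V. fr p (a p) (f p)) \<longleftrightarrow> a p \<notin> q p" if p: "p \<in> V" for p
  using locus_iff[OF V s p] prime_frac_Units[OF prime[OF in_top[OF V p]]] N_closed[OF V _ p] a p by simp
 then show ?thesis using rspace.locus_subset[OF rspace_space] by blast
qed

text \<open>A ring \<open>R0\<close> that maps to all the rings \<open>R p\<close> gives a chart as soon as the members of the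
families \<open>N\<close> are locally fractions of \<open>R0\<close>: the other sections are locally quotients of these.\<close>

lemma (in frac_space) chart_space:
 fixes \<kappa> :: "'p => 'b => 'a"
 assumes R0: "cring R0" and \<kappa>: "\<And>p. p \<in> topspace T ==> \<kappa> p \<in> ring_hom R0 (R p)"
  and \<kappa>N: "\<And>F. F \<in> carrier R0 ==> (\<lambda>p. \<kappa> p F) \<in> N (topspace T)"
  and inj: "inj_on (\<lambda>p. {F \<in> carrier R0. \<kappa> p F \<in> q p}) (topspace T)" and basis: "\<And>W p. openin T W ==> p \<in> W ==>
   \<exists>F\<in>carrier R0. \<kappa> p F \<notin> q p & {p' \<in> topspace T. \<kappa> p' F \<notin> q p'} \<subseteq> W"
  and fracs: "\<And>V a p. openin T V ==> a \<in> N V ==> p \<in> V ==> \<exists>F\<in>carrier R0. \<exists>G\<in>carrier R0. \<kappa> p G \<notin> q p &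
   (\<exists>W. openin T W & p \<in> W & W \<subseteq> V & (\<forall>p'\<in>W. \<kappa> p' G \<otimes>\<^bsub>R p'\<^esub> a p' = \<kappa> p' F))"
  and ker: "\<And>p F h. p \<in> topspace T ==> F \<in> carrier R0 ==> h \<in> carrier (R p) ==> h \<notin> q p ==>
   h \<otimes>\<^bsub>R p\<^esub> \<kappa> p F = \<zero>\<^bsub>R p\<^esub> ==> \<exists>G\<in>carrier R0. \<kappa> p G \<notin> q p & G \<otimes>\<^bsub>R0\<^esub> F = \<zero>\<^bsub>R0\<^esub>"
 shows "chart space (topspace T) R0 (\<lambda>F. \<lambda>p\<in>topspace T. fr p (\<kappa> p F) \<one>\<^bsub>R p\<^esub>) & (\<forall>p\<in>topspace T.
   prm space (topspace T) R0 (\<lambda>F. \<lambda>p\<in>topspace T. fr p (\<kappa> p F) \<one>\<^bsub>R p\<^esub>) p = {F \<in> carrier R0. \<kappa> p F \<in> q p})"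
proof -
 interpret R0: cring R0 by fact
 interpret rspace space by (rule rspace_space)
 let ?X = "topspace T" and ?\<rho> = "\<lambda>F. \<lambda>p\<in>topspace T. fr p (\<kappa> p F) \<one>\<^bsub>R p\<^esub>"
 have one: "\<one>\<^bsub>R p\<^esub> \<notin> q p" "\<one>\<^bsub>R p\<^esub> \<in> carrier (R p)" if "p \<in> ?X" for p using localize.one_M[OF loc[OF that]] by auto
 have \<kappa>c: "\<kappa> p F \<in> carrier (R p)" if "p \<in> ?X" "F \<in> carrier R0" for p F by (rule ring_hom_closed[OF \<kappa>]) fact+
 have \<rho>c: "?\<rho> F \<in> \<Gamma> space ?X" if "F \<in> carrier R0" for F by (rule section_frac) (use \<kappa>N[OF that] N_one one in auto)
 have loc\<rho>: "locus space ?X (?\<rho> F) = {p \<in> ?X. \<kappa> p F \<notin> q p}" if "F \<in> carrier R0" for F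
  by (rule locus_frac) (use \<kappa>N[OF that] N_one one in auto)
 have prm: "prm space ?X R0 ?\<rho> p = {F \<in> carrier R0. \<kappa> p F \<in> q p}" if "p \<in> ?X" for p
  using that loc\<rho> unfolding prm_def by auto
 have "chart space ?X R0 ?\<rho>"
 proof (intro chart.intro chart_axioms.intro rspace_space R0)
  show "opens space ?X" by simp
  show "?\<rho> \<in> ring_hom R0 (sections space ?X)"
  proof (rule ring_hom_memI)
   fix F G assume F: "F \<in> carrier R0" and G: "G \<in> carrier R0"
   have "fr p (\<kappa> p (F \<otimes>\<^bsub>R0\<^esub> G)) \<one>\<^bsub>R p\<^esub> = fr p (\<kappa> p F) \<one>\<^bsub>R p\<^esub> \<otimes>\<^bsub>L p\<^esub> fr p (\<kappa> p G) \<one>\<^bsub>R p\<^esub>" if "p \<in> ?X" for p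
    using ring_hom_mult[OF \<kappa>[OF that] F G] ring_hom_mult[OF localize.frac_hom[OF loc[OF that]]] \<kappa>c that F G by simp
   then show "?\<rho> (F \<otimes>\<^bsub>R0\<^esub> G) = ?\<rho> F \<otimes>\<^bsub>sections space ?X\<^esub> ?\<rho> G" by (simp cong: restrict_cong)
   have "fr p (\<kappa> p (F \<oplus>\<^bsub>R0\<^esub> G)) \<one>\<^bsub>R p\<^esub> = fr p (\<kappa> p F) \<one>\<^bsub>R p\<^esub> \<oplus>\<^bsub>L p\<^esub> fr p (\<kappa> p G) \<one>\<^bsub>R p\<^esub>" if "p \<in> ?X" for p
    using ring_hom_add[OF \<kappa>[OF that] F G] ring_hom_add[OF localize.frac_hom[OF loc[OF that]]] \<kappa>c that F G by simp
   then show "?\<rho> (F \<oplus>\<^bsub>R0\<^esub> G) = ?\<rho> F \<oplus>\<^bsub>sections space ?X\<^esub> ?\<rho> G" by (simp cong: restrict_cong)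
  next
   have "fr p (\<kappa> p \<one>\<^bsub>R0\<^esub>) \<one>\<^bsub>R p\<^esub> = \<one>\<^bsub>L p\<^esub>" if "p \<in> ?X" for p
    using ring_hom_one[OF \<kappa>[OF that]] ring_hom_one[OF localize.frac_hom[OF loc[OF that]]] by simp
   then show "?\<rho> \<one>\<^bsub>R0\<^esub> = \<one>\<^bsub>sections space ?X\<^esub>" by (simp cong: restrict_cong)
  qed (rule \<rho>c)
  show "primeideal (prm space ?X R0 ?\<rho> p) R0" if p: "p \<in> ?X" for p
  proof -
   interpret ring_hom_ring R0 "R p" "\<kappa> p"
    by (rule ring_hom_ringI2) (use R0 cring_R[OF p] \<kappa>[OF p] in \<open>auto simp: cring_def\<close>)
   show ?thesis unfolding prm[OF p] by (rule primeideal_vimage[OF R0 prime[OF p]])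
  qed
  show "inj_on (prm space ?X R0 ?\<rho>) ?X" using inj prm unfolding inj_on_def by simp
  fix W p assume "opens space W" "W \<subseteq> ?X" and p: "p \<in> W"
  then have W: "openin T W" by simp
  have pX: "p \<in> ?X" by (rule in_top) fact+
  show "\<exists>F\<in>carrier R0. p \<in> locus space ?X (?\<rho> F) & locus space ?X (?\<rho> F) \<subseteq> W"
   using basis[OF W p] pX loc\<rho> by (metis (mono_tags, lifting) mem_Collect_eq)
  {
   fix s assume s: "s \<in> \<Gamma> space W"
   then have "locally_frac s W p" using section_iff[OF W] p by blast
   then obtain V a f where V: "openin T V" "p \<in> V" "V \<subseteq> W" "a \<in> N V" "f \<in> N V"
    "\<And>p'. p' \<in> V ==> f p' \<notin> q p'" "\<And>p'. p' \<in> V ==> s p' = fr p' (a p') (f p')" by (rule locally_fracE) blast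
   obtain Fa Ga Wa where a: "Fa \<in> carrier R0" "Ga \<in> carrier R0" "\<kappa> p Ga \<notin> q p" "openin T Wa" "p \<in> Wa" "Wa \<subseteq> V"
    "\<And>p'. p' \<in> Wa ==> \<kappa> p' Ga \<otimes>\<^bsub>R p'\<^esub> a p' = \<kappa> p' Fa" using fracs[OF V(1,4,2)] by blast
   obtain Ff Gf Wf where f: "Ff \<in> carrier R0" "Gf \<in> carrier R0" "\<kappa> p Gf \<notin> q p" "openin T Wf" "p \<in> Wf" "Wf \<subseteq> V"
    "\<And>p'. p' \<in> Wf ==> \<kappa> p' Gf \<otimes>\<^bsub>R p'\<^esub> f p' = \<kappa> p' Ff" using fracs[OF V(1,5,2)] by blast
   let ?F = "Fa \<otimes>\<^bsub>R0\<^esub> Gf" and ?G = "Ff \<otimes>\<^bsub>R0\<^esub> Ga" and ?W = "Wa \<inter> Wf"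
   have FG: "?F \<in> carrier R0" "?G \<in> carrier R0" using a f by auto
   have W': "openin T ?W" "p \<in> ?W" "?W \<subseteq> W" "?W \<subseteq> ?X" using a f V openin_subset[OF W] by (auto simp: openin_Int)
   have "\<kappa> p Ff \<notin> q p"
    using f(7)[OF f(5)] nonmem_mult[OF pX \<kappa>c[OF pX f(2)] N_closed[OF V(1,5,2)] f(3) V(6)[OF V(2)]] by simp
   then have "\<kappa> p ?G \<notin> q p"
    using nonmem_mult[OF pX \<kappa>c[OF pX f(1)] \<kappa>c[OF pX a(2)]] a(3) ring_hom_mult[OF \<kappa>[OF pX] f(1) a(2)] by simp
   then have "p \<in> locus space ?X (?\<rho> ?G)" using loc\<rho>[OF FG(2)] pX by simp
   moreover have "fr p' (\<kappa> p' ?G) \<one>\<^bsub>R p'\<^esub> \<otimes>\<^bsub>L p'\<^esub> s p' = fr p' (\<kappa> p' ?F) \<one>\<^bsub>R p'\<^esub>" if p': "p' \<in> ?W" for p'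
   proof -
    have pX': "p' \<in> ?X" "p' \<in> V" using p' W' a by auto
    interpret localize "R p'" "carrier (R p') - q p'" by (rule loc) (rule pX')
    note c = \<kappa>c[OF pX'(1) a(1)] \<kappa>c[OF pX'(1) a(2)] \<kappa>c[OF pX'(1) f(1)] \<kappa>c[OF pX'(1) f(2)]
     N_closed[OF V(1,4) pX'(2)] N_closed[OF V(1,5) pX'(2)]
    have k: "\<kappa> p' ?G = \<kappa> p' Ff \<otimes>\<^bsub>R p'\<^esub> \<kappa> p' Ga" "\<kappa> p' ?F = \<kappa> p' Fa \<otimes>\<^bsub>R p'\<^esub> \<kappa> p' Gf"
     using ring_hom_mult[OF \<kappa>[OF pX'(1)]] a f by auto
    have e: "\<kappa> p' Ga \<otimes>\<^bsub>R p'\<^esub> a p' = \<kappa> p' Fa" "\<kappa> p' Gf \<otimes>\<^bsub>R p'\<^esub> f p' = \<kappa> p' Ff" using a(7) f(7) p' by auto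
    have "\<one>\<^bsub>R p'\<^esub> \<otimes>\<^bsub>R p'\<^esub> ((\<kappa> p' Ff \<otimes>\<^bsub>R p'\<^esub> \<kappa> p' Ga) \<otimes>\<^bsub>R p'\<^esub> a p')
      = \<kappa> p' Ff \<otimes>\<^bsub>R p'\<^esub> (\<kappa> p' Ga \<otimes>\<^bsub>R p'\<^esub> a p')" using c by algebra
    also have "\<dots> = (\<kappa> p' Gf \<otimes>\<^bsub>R p'\<^esub> f p') \<otimes>\<^bsub>R p'\<^esub> \<kappa> p' Fa" unfolding e ..
    also have "\<dots> = (\<one>\<^bsub>R p'\<^esub> \<otimes>\<^bsub>R p'\<^esub> f p') \<otimes>\<^bsub>R p'\<^esub> (\<kappa> p' Fa \<otimes>\<^bsub>R p'\<^esub> \<kappa> p' Gf)" using c by algebra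
    finally have "fr p' ((\<kappa> p' Ff \<otimes>\<^bsub>R p'\<^esub> \<kappa> p' Ga) \<otimes>\<^bsub>R p'\<^esub> a p') (\<one>\<^bsub>R p'\<^esub> \<otimes>\<^bsub>R p'\<^esub> f p')
      = fr p' (\<kappa> p' Fa \<otimes>\<^bsub>R p'\<^esub> \<kappa> p' Gf) \<one>\<^bsub>R p'\<^esub>" by (intro frac_cong) (use c V(6)[OF pX'(2)] one_M in auto)
    then show ?thesis unfolding V(7)[OF pX'(2)] k using c V(6)[OF pX'(2)] one_M by (subst frac_mult) auto
   qed
   then have "res space ?X ?W (?\<rho> ?G) \<otimes>\<^bsub>sections space ?W\<^esub> res space W ?W s = res space ?X ?W (?\<rho> ?F)"
    using W'(3,4) by (auto simp: fun_eq_iff restrict_def subset_iff)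
   ultimately show "\<exists>F\<in>carrier R0. \<exists>G\<in>carrier R0. p \<in> locus space ?X (?\<rho> G) &
     (\<exists>W'. opens space W' & p \<in> W' & W' \<subseteq> W &
      res space ?X W' (?\<rho> G) \<otimes>\<^bsub>sections space W'\<^esub> res space W W' s = res space ?X W' (?\<rho> F))"
    using FG W'(1-3) unfolding topo_space by blast
  }
  fix F assume F: "F \<in> carrier R0" and 0: "res space ?X W (?\<rho> F) = \<zero>\<^bsub>sections space W\<^esub>"
  interpret localize "R p" "carrier (R p) - q p" by (rule loc) fact
  have "fr p (\<kappa> p F) \<one>\<^bsub>R p\<^esub> = fr p \<zero>\<^bsub>R p\<^esub> \<one>\<^bsub>R p\<^esub>" using fun_cong[OF 0, of p] p pX frac_zero by simp
  then obtain h where h: "h \<in> carrier (R p) - q p" "h \<otimes>\<^bsub>R p\<^esub> (\<one>\<^bsub>R p\<^esub> \<otimes>\<^bsub>R p\<^esub> \<kappa> p F) = h \<otimes>\<^bsub>R p\<^esub> (\<one>\<^bsub>R p\<^esub> \<otimes>\<^bsub>R p\<^esub> \<zero>\<^bsub>R p\<^esub>)"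
   using frac_eq_iff[OF \<kappa>c[OF pX F] one_M _ one_M] by auto
  then have "h \<otimes>\<^bsub>R p\<^esub> \<kappa> p F = \<zero>\<^bsub>R p\<^esub>" using \<kappa>c[OF pX F] by simp
  then obtain G where "G \<in> carrier R0" "\<kappa> p G \<notin> q p" "G \<otimes>\<^bsub>R0\<^esub> F = \<zero>\<^bsub>R0\<^esub>" using ker[OF pX F] h(1) by blast
  then show "\<exists>h\<in>carrier R0. p \<in> locus space ?X (?\<rho> h) & h \<otimes>\<^bsub>R0\<^esub> F = \<zero>\<^bsub>R0\<^esub>" using loc\<rho> pX by (intro bexI[of _ G]) auto
 qed
 then show ?thesis using prm by blast
qed

lemma topology_generated_basis:
 assumes Int: "\<And>A B. A \<in> \<B> ==> B \<in> \<B> ==> A \<inter> B \<in> \<B>" and W: "openin (topology_generated_by \<B>) W" and x: "x \<in> W"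
 shows "\<exists>A\<in>\<B>. x \<in> A & A \<subseteq> W"
proof -
 have "generate_topology_on \<B> W" using W by (rule openin_topology_generated_by)
 then show ?thesis using x
 proof (induction arbitrary: x)
  case (Int a b)
  obtain A where A: "A \<in> \<B>" "x \<in> A" "A \<subseteq> a" using Int.IH(1)[of x] Int.prems by auto
  obtain B where "B \<in> \<B>" "x \<in> B" "B \<subseteq> b" using Int.IH(2)[of x] Int.prems by auto
  then show ?case using A assms(1) by (intro bexI[of _ "A \<inter> B"]) auto
 next
  case (UN K)
  then obtain k where k: "k \<in> K" "x \<in> k" by blast
  then obtain A where "A \<in> \<B>" "x \<in> A" "A \<subseteq> k" using UN.IH by blast
  then show ?case using k by blast
 next
  case (Basis s)
  then show ?case by blast
 qed simp
qed

section \<open>The spectrum\<close>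

definition spec_N :: "('a, 'm) ring_scheme => 'a set set => ('a set => 'a) set" where
 "spec_N R V = {a. \<exists>c\<in>carrier R. \<forall>p\<in>V. a p = c}"

lemma spec_NE:
 assumes "a \<in> spec_N R V"
 obtains c where "c \<in> carrier R" "\<And>p. p \<in> V ==> a p = c"
 using assms unfolding spec_N_def by (elim CollectE bexE) (rule that; simp)

text \<open>The identity of \<open>R\<close> is a chart of the spectrum.\<close>

lemma Spec_chart:
 fixes R (structure)
 assumes R: "cring R"
 shows "points (Spec R) = {p. primeideal p R}" and "rspace (Spec R)" and "chart (Spec R) (points (Spec R)) R
   (\<lambda>a. \<lambda>p\<in>points (Spec R). frac R (carrier R - p) a \<one>)" and "\<And>p. primeideal p R ==>
   prm (Spec R) (points (Spec R)) R (\<lambda>a. \<lambda>p\<in>points (Spec R). frac R (carrier R - p) a \<one>) p = p"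
proof -
 interpret R: cring R by fact
 define \<B> where "\<B> = {{p. primeideal p R & f \<notin> p} | f. f \<in> carrier R}"
 define T where "T = topology_generated_by \<B>"
 define B where "B V = {(\<lambda>p. frac R (carrier R - p) a f) | a f.
       a \<in> carrier R & f \<in> carrier R & (\<forall>p\<in>V. f \<notin> p)}" for V
 have S: "Spec R = function_space T (\<lambda>p. localization R (carrier R - p)) B" unfolding Spec_def T_def \<B>_def B_def ..
 have one: "\<one> \<notin> p" if "primeideal p R" for p using localize.one_M[OF prime_localize[OF that]] by simp
 have top: "topspace T = {p. primeideal p R}" unfolding T_def \<B>_def using one by (auto intro!: exI[of _ "\<one>"])
 have Dint: "A \<inter> A' \<in> \<B>" if AA: "A \<in> \<B>" "A' \<in> \<B>" for A A'
 proof -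
  obtain f g where f: "f \<in> carrier R" "A = {p. primeideal p R & f \<notin> p}"
   and g: "g \<in> carrier R" "A' = {p. primeideal p R & g \<notin> p}" using AA unfolding \<B>_def by blast
  have "f \<otimes> g \<notin> p \<longleftrightarrow> f \<notin> p & g \<notin> p" if "primeideal p R" for p using primeideal_mult_iff[OF that f(1) g(1)] by simp
  then have "A \<inter> A' = {p. primeideal p R & f \<otimes> g \<notin> p}" unfolding f g by blast
  then show ?thesis unfolding \<B>_def using f g by blast
 qed
 have Dopen: "openin T {p. primeideal p R & f \<notin> p}" if "f \<in> carrier R" for f
  unfolding T_def by (rule topology_generated_by_Basis) (use that in \<open>auto simp: \<B>_def\<close>)

 interpret frac_space T "\<lambda>p. R" "\<lambda>p. p" "spec_N R" B
 proof (rule frac_space.intro)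
  fix V a b
  assume V: "openin T V" and a: "a \<in> spec_N R V"
  obtain c where c: "c \<in> carrier R" "\<And>p. p \<in> V ==> a p = c" using a by (rule spec_NE) blast
  show "p \<in> V ==> a p \<in> carrier R" for p using c by simp
  show "(\<lambda>p. \<ominus> a p) \<in> spec_N R V" unfolding spec_N_def using c by (auto intro!: bexI[of _ "\<ominus> c"])
  have "{p \<in> V. a p \<notin> p} = V \<inter> {p. primeideal p R & c \<notin> p}" using c(2) V openin_subset top by blast
  then show "openin T {p \<in> V. a p \<notin> p}" using V Dopen[OF c(1)] by (simp add: openin_Int)
  assume b: "b \<in> spec_N R V"
  obtain d where d: "d \<in> carrier R" "\<And>p. p \<in> V ==> b p = d" using b by (rule spec_NE) blast
  show "(\<lambda>p. a p \<oplus> b p) \<in> spec_N R V" unfolding spec_N_def using c d by (auto intro!: bexI[of _ "c \<oplus> d"])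
  show "(\<lambda>p. a p \<otimes> b p) \<in> spec_N R V" unfolding spec_N_def using c d by (auto intro!: bexI[of _ "c \<otimes> d"])
 next
  fix V and s :: "'a set => ('a \<times> 'a) set"
  assume V: "openin T V"
  show "(\<exists>b\<in>B V. \<forall>p\<in>V. s p = b p) \<longleftrightarrow> (\<exists>a\<in>spec_N R V. \<exists>f\<in>spec_N R V. \<forall>p\<in>V. f p \<notin> p &
    s p = frac R (carrier R - p) (a p) (f p))" (is "?l \<longleftrightarrow> ?r")
  proof
   assume ?l
   then obtain b where b: "b \<in> B V" "\<forall>p\<in>V. s p = b p" by (rule bexE)
   then obtain a f where "b = (\<lambda>p. frac R (carrier R - p) a f)" "a \<in> carrier R" "f \<in> carrier R"
    "\<forall>p\<in>V. f \<notin> p" unfolding B_def by (elim CollectE exE conjE)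
   moreover have "(\<lambda>_. c) \<in> spec_N R V" if "c \<in> carrier R" for c using that unfolding spec_N_def by blast
   ultimately show ?r using b(2) by (intro bexI[of _ "\<lambda>_. a"] bexI[of _ "\<lambda>_. f"]) simp_all
  next
   assume ?r
   then obtain a f where af: "a \<in> spec_N R V" "f \<in> spec_N R V"
    and 1: "\<forall>p\<in>V. f p \<notin> p & s p = frac R (carrier R - p) (a p) (f p)" by (elim bexE)
   obtain c where c: "c \<in> carrier R" "\<And>p. p \<in> V ==> a p = c" using af(1) by (rule spec_NE) blast
   obtain d where d: "d \<in> carrier R" "\<And>p. p \<in> V ==> f p = d" using af(2) by (rule spec_NE) blast
   have "(\<lambda>p. frac R (carrier R - p) c d) \<in> B V" unfolding B_def using 1 c(1) d by auto
   then show ?l using 1 c d by (intro bexI[of _ "\<lambda>p. frac R (carrier R - p) c d"]) simp_all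
  qed
 next
  fix V V' a assume "a \<in> spec_N R V" "V' \<subseteq> V"
  then show "a \<in> spec_N R V'" unfolding spec_N_def by blast
 next
  fix p assume "p \<in> topspace T"
  then show "primeideal p R" unfolding top by simp
 next
  show "(\<lambda>p. \<zero>) \<in> spec_N R V" "(\<lambda>p. \<one>) \<in> spec_N R V" for V unfolding spec_N_def by blast+
 qed
 show pts: "points (Spec R) = {p. primeideal p R}" unfolding S using top by simp
 show "rspace (Spec R)" unfolding S by (rule rspace_space)
 have main: "chart space (topspace T) R (\<lambda>F. \<lambda>p\<in>topspace T. fr p F \<one>) & (\<forall>p\<in>topspace T.
   prm space (topspace T) R (\<lambda>F. \<lambda>p\<in>topspace T. fr p F \<one>) p = {F \<in> carrier R. F \<in> p})"
 proof (rule chart_space[where \<kappa> = "\<lambda>p a. a", OF R])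
  show "inj_on (\<lambda>p. {F \<in> carrier R. F \<in> p}) (topspace T)"
  proof (rule inj_onI)
   fix p p' assume "p \<in> topspace T" "p' \<in> topspace T" and e: "{F \<in> carrier R. F \<in> p} = {F \<in> carrier R. F \<in> p'}"
   then have "p \<subseteq> carrier R" "p' \<subseteq> carrier R" unfolding top by (auto dest!: primeideal.axioms(1) intro: ideal.Icarr)
   then show "p = p'" using e by blast
  qed
 next
  fix W p assume W: "openin T W" "p \<in> W"
  then obtain A where A: "A \<in> \<B>" "p \<in> A" "A \<subseteq> W" using topology_generated_basis[OF Dint, of W p] unfolding T_def by blast
  then show "\<exists>F\<in>carrier R. F \<notin> p & {p' \<in> topspace T. F \<notin> p'} \<subseteq> W" unfolding \<B>_def top by blast
 next
  fix V a p assume V: "openin T V" "a \<in> spec_N R V" "p \<in> V"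
  obtain c where c: "c \<in> carrier R" "\<And>p. p \<in> V ==> a p = c" using V(2) by (rule spec_NE) blast
  have "\<one> \<notin> p" using one in_top[OF V(1,3)] top by blast
  then show "\<exists>F\<in>carrier R. \<exists>G\<in>carrier R. G \<notin> p &
    (\<exists>W. openin T W & p \<in> W & W \<subseteq> V & (\<forall>p'\<in>W. G \<otimes> a p' = F))"
   using V c by (intro bexI[of _ c] bexI[of _ "\<one>"] conjI exI[of _ V]) auto
 next
  show "(\<lambda>a. a) \<in> ring_hom R R" by (rule ring_hom_memI) auto
  show "(\<lambda>p. F) \<in> spec_N R (topspace T)" if "F \<in> carrier R" for F using that unfolding spec_N_def by blast
  fix p F h assume "p \<in> topspace T" "F \<in> carrier R" "h \<in> carrier R" "h \<notin> p" "h \<otimes> F = \<zero>"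
  then show "\<exists>G\<in>carrier R. G \<notin> p & G \<otimes> F = \<zero>" by blast
 qed
 show "chart (Spec R) (points (Spec R)) R (\<lambda>a. \<lambda>p\<in>points (Spec R). frac R (carrier R - p) a \<one>)"
  using main unfolding S by simp
 show "prm (Spec R) (points (Spec R)) R (\<lambda>a. \<lambda>p\<in>points (Spec R). frac R (carrier R - p) a \<one>) p = p"
  if p: "primeideal p R" for p
 proof -
  have "p \<subseteq> carrier R" using p by (auto dest!: primeideal.axioms(1) intro: ideal.Icarr)
  then show ?thesis using main p top unfolding S by auto
 qed
qed

section \<open>Polynomial rings\<close>

lemma UP_carrier: "p \<in> carrier (UP R) \<longleftrightarrow> (\<forall>n. p n \<in> carrier R) & (\<exists>N. \<forall>n>N. p n = \<zero>\<^bsub>R\<^esub>)"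
 unfolding UP_def up_def bound_def by auto

lemma UP_mult_apply:
 "p \<in> carrier (UP R) ==> r \<in> carrier (UP R) ==>
  (p \<otimes>\<^bsub>UP R\<^esub> r) n = (\<Oplus>\<^bsub>R\<^esub>i \<in> {..n}. p i \<otimes>\<^bsub>R\<^esub> r (n - i))" unfolding UP_def by simp

lemma UP_add_apply:
 "p \<in> carrier (UP R) ==> r \<in> carrier (UP R) ==> (p \<oplus>\<^bsub>UP R\<^esub> r) n = p n \<oplus>\<^bsub>R\<^esub> r n" unfolding UP_def by simp

lemma UP_one_apply: "\<one>\<^bsub>UP R\<^esub> n = (if n = 0 then \<one>\<^bsub>R\<^esub> else \<zero>\<^bsub>R\<^esub>)"
 and UP_zero_apply: "\<zero>\<^bsub>UP R\<^esub> n = \<zero>\<^bsub>R\<^esub>" unfolding UP_def by simp_all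

lemma UP_monom_apply:
 "a \<in> carrier R ==> up_ring.monom (UP R) a n = (\<lambda>i. if i = n then a else \<zero>\<^bsub>R\<^esub>)" unfolding UP_def by (auto simp: fun_eq_iff)

lemma cring_UP: "cring R ==> cring (UP R)"
 by (rule UP_cring.UP_cring) (simp add: UP_cring_def)

lemma UP_monom_closed: "cring R ==> a \<in> carrier R ==> up_ring.monom (UP R) a n \<in> carrier (UP R)"
 by (rule UP_ring.monom_closed) (simp_all add: UP_ring_def cring.axioms)

lemma UP_const_mult_apply:
 assumes R: "cring R" and a: "a \<in> carrier R" and p: "p \<in> carrier (UP R)"
 shows "(up_ring.monom (UP R) a 0 \<otimes>\<^bsub>UP R\<^esub> p) n = a \<otimes>\<^bsub>R\<^esub> p n"
proof -
 have "up_ring.monom (UP R) a 0 \<otimes>\<^bsub>UP R\<^esub> p = a \<odot>\<^bsub>UP R\<^esub> p"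
  by (rule UP_ring.monom_mult_is_smult) (simp_all add: UP_ring_def R cring.axioms a p)
 then show ?thesis using a p unfolding UP_def by simp
qed

lemma UP_map_hom:
 assumes R: "cring R" "cring R'" and h: "h \<in> ring_hom R R'"
 shows "(\<lambda>p n. h (p n)) \<in> ring_hom (UP R) (UP R')"
proof -
 interpret ring_hom_cring R R' h using R h by (simp add: ring_hom_cring_def ring_hom_cring_axioms_def)
 interpret h: ring_hom_ring R R' h ..
 have cl: "(\<lambda>n. h (p n)) \<in> carrier (UP R')" if p: "p \<in> carrier (UP R)" for p
 proof -
  obtain N where "\<forall>n>N. p n = \<zero>\<^bsub>R\<^esub>" using p unfolding UP_carrier by blast
  then have "\<forall>n>N. h (p n) = \<zero>\<^bsub>R'\<^esub>" by simp
  then show ?thesis using p unfolding UP_carrier by auto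
 qed
 show ?thesis
 proof (rule ring_hom_memI)
  fix p r assume p: "p \<in> carrier (UP R)" and r: "r \<in> carrier (UP R)"
  then have c: "p n \<in> carrier R" "r n \<in> carrier R" for n unfolding UP_carrier by auto
  show "(\<lambda>n. h ((p \<otimes>\<^bsub>UP R\<^esub> r) n)) = (\<lambda>n. h (p n)) \<otimes>\<^bsub>UP R'\<^esub> (\<lambda>n. h (r n))"
   by (rule ext) (use c in \<open>simp add: UP_mult_apply p r cl Pi_def o_def\<close>)
  show "(\<lambda>n. h ((p \<oplus>\<^bsub>UP R\<^esub> r) n)) = (\<lambda>n. h (p n)) \<oplus>\<^bsub>UP R'\<^esub> (\<lambda>n. h (r n))"
   by (rule ext) (use c in \<open>simp add: UP_add_apply p r cl\<close>)
 qed (simp_all add: cl UP_one_apply fun_eq_iff)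
qed

section \<open>The relative affine line\<close>

lemma primeidealI':
 assumes R: "cring R" and sub: "I \<subseteq> carrier R" and 0: "\<zero>\<^bsub>R\<^esub> \<in> I" and add: "\<And>a b. a \<in> I ==> b \<in> I ==> a \<oplus>\<^bsub>R\<^esub> b \<in> I"
  and mult: "\<And>a x. a \<in> I ==> x \<in> carrier R ==> x \<otimes>\<^bsub>R\<^esub> a \<in> I" and one: "\<one>\<^bsub>R\<^esub> \<notin> I"
  and prime: "\<And>a b. a \<in> carrier R ==> b \<in> carrier R ==> a \<otimes>\<^bsub>R\<^esub> b \<in> I ==> a \<in> I \<or> b \<in> I"
 shows "primeideal I R"
proof -
 interpret cring R by fact
 have "ideal I R"
 proof (rule idealI[OF ring_axioms])
  show "subgroup I (add_monoid R)"
  proof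
   fix a assume a: "a \<in> I"
   have "\<ominus>\<^bsub>R\<^esub> a = (\<ominus>\<^bsub>R\<^esub> \<one>\<^bsub>R\<^esub>) \<otimes>\<^bsub>R\<^esub> a" using a sub by (auto simp: l_minus)
   then show "inv\<^bsub>add_monoid R\<^esub> a \<in> I" using mult[OF a, of "\<ominus>\<^bsub>R\<^esub> \<one>\<^bsub>R\<^esub>"] by (simp add: a_inv_def)
  qed (use sub 0 add in auto)
  fix a x assume a: "a \<in> I" "x \<in> carrier R"
  show "x \<otimes>\<^bsub>R\<^esub> a \<in> I" by (rule mult) fact+
  then show "a \<otimes>\<^bsub>R\<^esub> x \<in> I" using m_comm[of a x] a sub by auto
 qed
 then show ?thesis by (rule primeidealI[OF _ R]) (use one prime in auto)
qed

text \<open>If \<open>K\<close> is the localisation of \<open>A\<close> at \<open>M\<close>, the primes of \<open>A\<close> that avoid \<open>M\<close> extend to \<open>K\<close>. With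
\<open>A = R[T]\<close> and \<open>K = \<O>\<^sub>x[T]\<close> this produces the points of the relative affine line over \<open>x\<close>.\<close>

lemma prime_extension:
 assumes A: "cring A" and K: "cring K" and \<kappa>: "\<kappa> \<in> ring_hom A K"
  and M: "M \<subseteq> carrier A" "\<one>\<^bsub>A\<^esub> \<in> M" "\<And>m m'. m \<in> M ==> m' \<in> M ==> m \<otimes>\<^bsub>A\<^esub> m' \<in> M"
  and surj: "\<And>p. p \<in> carrier K ==> \<exists>m\<in>M. \<exists>F\<in>carrier A. \<kappa> m \<otimes>\<^bsub>K\<^esub> p = \<kappa> F"
  and ker: "\<And>F. F \<in> carrier A ==> \<kappa> F = \<zero>\<^bsub>K\<^esub> ==> \<exists>m\<in>M. m \<otimes>\<^bsub>A\<^esub> F = \<zero>\<^bsub>A\<^esub>" and Q: "primeideal Q A" "Q \<inter> M = {}"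
 defines "q \<equiv> {p \<in> carrier K. \<exists>m\<in>M. \<exists>F\<in>Q. \<kappa> m \<otimes>\<^bsub>K\<^esub> p = \<kappa> F}"
 shows "primeideal q K" and "\<And>F. F \<in> carrier A ==> \<kappa> F \<in> q \<longleftrightarrow> F \<in> Q"
proof -
 interpret A: cring A by fact
 interpret K: cring K by fact
 interpret Q: primeideal Q A by fact
 interpret h: ring_hom_cring A K \<kappa> using A K \<kappa> by (simp add: ring_hom_cring_def ring_hom_cring_axioms_def)
 have Mc: "m \<in> carrier A" if "m \<in> M" for m using M that by blast
 have Qc: "F \<in> carrier A" if "F \<in> Q" for F using Q.Icarr that by blast
 show iff: "\<kappa> F \<in> q \<longleftrightarrow> F \<in> Q" if F: "F \<in> carrier A" for F
 proof
  assume "\<kappa> F \<in> q"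
  then obtain m F' where m: "m \<in> M" "F' \<in> Q" "\<kappa> m \<otimes>\<^bsub>K\<^esub> \<kappa> F = \<kappa> F'" unfolding q_def by blast
  note c = Mc[OF m(1)] Qc[OF m(2)] F
  have "\<kappa> (m \<otimes>\<^bsub>A\<^esub> F \<ominus>\<^bsub>A\<^esub> F') = \<zero>\<^bsub>K\<^esub>" using m(3) c by (simp add: a_minus_def K.r_neg)
  then obtain m' where m': "m' \<in> M" "m' \<otimes>\<^bsub>A\<^esub> (m \<otimes>\<^bsub>A\<^esub> F \<ominus>\<^bsub>A\<^esub> F') = \<zero>\<^bsub>A\<^esub>" using ker[of "m \<otimes>\<^bsub>A\<^esub> F \<ominus>\<^bsub>A\<^esub> F'"] c by auto
  note c = c Mc[OF m'(1)]
  have "m' \<otimes>\<^bsub>A\<^esub> m \<otimes>\<^bsub>A\<^esub> F = m' \<otimes>\<^bsub>A\<^esub> (m \<otimes>\<^bsub>A\<^esub> F \<ominus>\<^bsub>A\<^esub> F') \<oplus>\<^bsub>A\<^esub> m' \<otimes>\<^bsub>A\<^esub> F'" using c by algebra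
  then have "m' \<otimes>\<^bsub>A\<^esub> m \<otimes>\<^bsub>A\<^esub> F \<in> Q" using m' Q.I_l_closed[OF m(2), of m'] c by simp
  moreover have "m' \<otimes>\<^bsub>A\<^esub> m \<notin> Q" using M(3)[OF m'(1) m(1)] Q(2) by blast
  ultimately show "F \<in> Q" using primeideal_mult_iff[OF Q(1), of "m' \<otimes>\<^bsub>A\<^esub> m" F] c by simp
 next
  assume FQ: "F \<in> Q"
  have "\<kappa> \<one>\<^bsub>A\<^esub> \<otimes>\<^bsub>K\<^esub> \<kappa> F = \<kappa> F" using F by simp
  then show "\<kappa> F \<in> q" unfolding q_def using FQ M(2) F by blast
 qed
 have mult: "r \<otimes>\<^bsub>K\<^esub> p \<in> q" if p: "p \<in> q" and r: "r \<in> carrier K" for p r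
 proof -
  obtain m F where m: "m \<in> M" "F \<in> Q" "\<kappa> m \<otimes>\<^bsub>K\<^esub> p = \<kappa> F" and pc: "p \<in> carrier K" using p unfolding q_def by blast
  obtain n G where n: "n \<in> M" "G \<in> carrier A" "\<kappa> n \<otimes>\<^bsub>K\<^esub> r = \<kappa> G" using surj[OF r] by blast
  have kc: "\<kappa> n \<in> carrier K" "\<kappa> m \<in> carrier K" using Mc m n by auto
  have "\<kappa> (n \<otimes>\<^bsub>A\<^esub> m) \<otimes>\<^bsub>K\<^esub> (r \<otimes>\<^bsub>K\<^esub> p) = (\<kappa> n \<otimes>\<^bsub>K\<^esub> r) \<otimes>\<^bsub>K\<^esub> (\<kappa> m \<otimes>\<^bsub>K\<^esub> p)"
   using Mc[OF m(1)] Mc[OF n(1)] r pc kc by (simp add: K.m_ac)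
  also have "\<dots> = \<kappa> (G \<otimes>\<^bsub>A\<^esub> F)" unfolding n(3) m(3) using n(2) Qc[OF m(2)] by simp
  finally show ?thesis unfolding q_def using M(3)[OF n(1) m(1)] Q.I_l_closed[OF m(2) n(2)] r pc by blast
 qed
 have q_iff: "p \<in> q \<longleftrightarrow> F \<in> Q" if p: "p \<in> carrier K" and m: "m \<in> M" "F \<in> carrier A" "\<kappa> m \<otimes>\<^bsub>K\<^esub> p = \<kappa> F" for p m F
 proof
  assume "p \<in> q"
  then have "\<kappa> m \<otimes>\<^bsub>K\<^esub> p \<in> q" using mult Mc[OF m(1)] by simp
  then show "F \<in> Q" using iff[OF m(2)] m(3) by simp
 qed (use p m in \<open>auto simp: q_def\<close>)
 show "primeideal q K"
 proof (rule primeidealI'[OF K])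
  show "q \<subseteq> carrier K" unfolding q_def by blast
  show "\<zero>\<^bsub>K\<^esub> \<in> q" using iff[of "\<zero>\<^bsub>A\<^esub>"] by simp
  show "\<one>\<^bsub>K\<^esub> \<notin> q" using iff[of "\<one>\<^bsub>A\<^esub>"] Q(2) M(2) by auto
  show "x \<otimes>\<^bsub>K\<^esub> a \<in> q" if "a \<in> q" "x \<in> carrier K" for a x by (rule mult) fact+
  fix p p'
  show "p \<oplus>\<^bsub>K\<^esub> p' \<in> q" if pq: "p \<in> q" "p' \<in> q"
  proof -
   obtain m F where m: "m \<in> M" "F \<in> Q" "\<kappa> m \<otimes>\<^bsub>K\<^esub> p = \<kappa> F" "p \<in> carrier K" using pq(1) unfolding q_def by blast
   obtain n G where n: "n \<in> M" "G \<in> Q" "\<kappa> n \<otimes>\<^bsub>K\<^esub> p' = \<kappa> G" "p' \<in> carrier K" using pq(2) unfolding q_def by blast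
   have c: "m \<in> carrier A" "n \<in> carrier A" "F \<in> carrier A" "G \<in> carrier A" "\<kappa> n \<in> carrier K" "\<kappa> m \<in> carrier K"
    using Mc Qc m n by auto
   have "\<kappa> (m \<otimes>\<^bsub>A\<^esub> n) \<otimes>\<^bsub>K\<^esub> (p \<oplus>\<^bsub>K\<^esub> p') = \<kappa> n \<otimes>\<^bsub>K\<^esub> (\<kappa> m \<otimes>\<^bsub>K\<^esub> p) \<oplus>\<^bsub>K\<^esub> \<kappa> m \<otimes>\<^bsub>K\<^esub> (\<kappa> n \<otimes>\<^bsub>K\<^esub> p')"
    using c m(4) n(4) by (simp add: K.m_ac K.r_distr)
   also have "\<dots> = \<kappa> (n \<otimes>\<^bsub>A\<^esub> F \<oplus>\<^bsub>A\<^esub> m \<otimes>\<^bsub>A\<^esub> G)" unfolding n(3) m(3) using c by simp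
   finally show ?thesis using q_iff[of "p \<oplus>\<^bsub>K\<^esub> p'" "m \<otimes>\<^bsub>A\<^esub> n" "n \<otimes>\<^bsub>A\<^esub> F \<oplus>\<^bsub>A\<^esub> m \<otimes>\<^bsub>A\<^esub> G"] M(3)[OF m(1) n(1)] m n c
     Q.I_l_closed[OF m(2) c(2)] Q.I_l_closed[OF n(2) c(1)] by (simp add: Q.a_closed)
  qed
  assume p: "p \<in> carrier K" "p' \<in> carrier K" and pq: "p \<otimes>\<^bsub>K\<^esub> p' \<in> q"
  obtain m F where m: "m \<in> M" "F \<in> carrier A" "\<kappa> m \<otimes>\<^bsub>K\<^esub> p = \<kappa> F" using surj[OF p(1)] by blast
  obtain n G where n: "n \<in> M" "G \<in> carrier A" "\<kappa> n \<otimes>\<^bsub>K\<^esub> p' = \<kappa> G" using surj[OF p(2)] by blast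
  have c: "m \<in> carrier A" "n \<in> carrier A" "\<kappa> n \<in> carrier K" "\<kappa> m \<in> carrier K" using Mc m n by auto
  have "\<kappa> (m \<otimes>\<^bsub>A\<^esub> n) \<otimes>\<^bsub>K\<^esub> (p \<otimes>\<^bsub>K\<^esub> p') = (\<kappa> m \<otimes>\<^bsub>K\<^esub> p) \<otimes>\<^bsub>K\<^esub> (\<kappa> n \<otimes>\<^bsub>K\<^esub> p')" using c p by (simp add: K.m_ac)
  also have "\<dots> = \<kappa> (F \<otimes>\<^bsub>A\<^esub> G)" unfolding n(3) m(3) using m n by simp
  finally have "F \<otimes>\<^bsub>A\<^esub> G \<in> Q" using q_iff[of "p \<otimes>\<^bsub>K\<^esub> p'" "m \<otimes>\<^bsub>A\<^esub> n" "F \<otimes>\<^bsub>A\<^esub> G"] M(3)[OF m(1) n(1)] p m n pq by simp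
  then have "F \<in> Q \<or> G \<in> Q" using Q.I_prime m n by blast
  then show "p \<in> q \<or> p' \<in> q" using q_iff[OF p(1) m] q_iff[OF p(2) n] by blast
 qed
qed

context rspace
begin

definition line_top :: "('p, 's) line_point topology" where "line_top = topology_generated_by
     {{(x, q) \<in> line_points S. x \<in> U & poly_germ S x U F \<notin> q} | U F.
      opens S U & F \<in> carrier (UP (sections S U))}"

definition line_B :: "('p, 's) line_point set => ('p, 's) line_section set" where "line_B V = {line_frac S U F G | U F G.
       opens S U & F \<in> carrier (UP (sections S U)) & G \<in> carrier (UP (sections S U)) &
       (\<forall>(x, q)\<in>V. x \<in> U & poly_germ S x U G \<notin> q)}"

definition line_N :: "('p, 's) line_point set => (('p, 's) line_point => nat => ('p set \<times> 's) set) set" where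
 "line_N V = {a. \<exists>U F. opens S U & F \<in> carrier (UP (sections S U)) &
  (\<forall>z\<in>V. fst z \<in> U & a z = poly_germ S (fst z) U F)}"

abbreviation K :: "'p => (('p set \<times> 's) set, nat => ('p set \<times> 's) set) up_ring" where "K x \<equiv> UP (stalk S x)"

lemma Ga_times_eq:
 "Ga_times S = function_space line_top
  (\<lambda>z. localization (K (fst z)) (carrier (K (fst z)) - snd z)) line_B"
 unfolding Ga_times_def line_top_def line_B_def by (simp add: case_prod_unfold)

lemma poly_germ_hom:
 assumes "opens S U" "x \<in> U"
 shows "poly_germ S x U \<in> ring_hom (UP (sections S U)) (K x)"
proof -
 have "x \<in> points S" using assms openin_subset by blast
 then have "(\<lambda>F n. germ S x U (F n)) \<in> ring_hom (UP (sections S U)) (K x)"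
  by (rule UP_map_hom[OF cring_sections[OF assms(1)] cring_stalk germ_hom[OF assms]])
 then show ?thesis unfolding poly_germ_def .
qed

lemma UP_res_closed:
 assumes "opens S U" "opens S W" "W \<subseteq> U" "F \<in> carrier (UP (sections S U))"
 shows "(\<lambda>n. res S U W (F n)) \<in> carrier (UP (sections S W))"
 using ring_hom_closed[OF UP_map_hom[OF cring_sections cring_sections res_hom] assms(4)] assms by simp

lemma UP_coeff: "F \<in> carrier (UP R) ==> F n \<in> carrier R"
 unfolding UP_carrier by blast

lemma poly_germ_res:
 assumes "opens S U" "opens S W" "W \<subseteq> U" "F \<in> carrier (UP (sections S U))" "x \<in> W"
 shows "poly_germ S x W (\<lambda>n. res S U W (F n)) = poly_germ S x U F"
 unfolding poly_germ_def using germ_res[OF assms(1) UP_coeff[OF assms(4)] assms(2,3,5)] by simp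

lemma line_pointsD:
 assumes "z \<in> line_points S"
 shows "fst z \<in> points S" "primeideal (snd z) (K (fst z))" and "c \<in> carrier (stalk S (fst z)) ==>
   up_ring.monom (K (fst z)) c 0 \<in> snd z \<longleftrightarrow> c \<notin> Units (stalk S (fst z))"
 using assms unfolding line_points_def by (auto simp: set_eq_iff)

abbreviation "line_D U F \<equiv> {z \<in> line_points S. fst z \<in> U & poly_germ S (fst z) U F \<notin> snd z}"

lemma line_top_eq:
 "line_top = topology_generated_by {line_D U F | U F. opens S U & F \<in> carrier (UP (sections S U))}"
 unfolding line_top_def by (simp add: case_prod_unfold)

lemma open_line_D:
 "opens S U ==> F \<in> carrier (UP (sections S U)) ==> openin line_top (line_D U F)"
 unfolding line_top_eq by (rule topology_generated_by_Basis) blast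

lemma UP_sections_cring: "opens S U ==> cring (UP (sections S U))"
 by (rule cring_UP[OF cring_sections])

lemma UP_sections_one: "opens S U ==> \<one>\<^bsub>UP (sections S U)\<^esub> \<in> carrier (UP (sections S U))"
 by (rule cring.cring_simprules(6)[OF UP_sections_cring])

lemma line_D_one: "opens S U ==> line_D U \<one>\<^bsub>UP (sections S U)\<^esub> = {z \<in> line_points S. fst z \<in> U}"
proof -
 assume U: "opens S U"
 have "poly_germ S (fst z) U \<one>\<^bsub>UP (sections S U)\<^esub> \<notin> snd z" if "z \<in> line_points S" "fst z \<in> U" for z
  using ring_hom_one[OF poly_germ_hom[OF U that(2)]]
   localize.one_M[OF prime_localize[OF line_pointsD(2)[OF that(1)]]] by simp
 then show ?thesis by blast
qed

lemma open_line_over: "opens S U ==> openin line_top {z \<in> line_points S. fst z \<in> U}"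
 using open_line_D[OF _ UP_sections_one, of U] line_D_one by simp

lemma topspace_line: "topspace line_top = line_points S"
proof -
 have "{z \<in> line_points S. fst z \<in> points S} = line_points S" using line_pointsD(1) by blast
 then have "line_points S \<subseteq> topspace line_top" using openin_subset[OF open_line_over[of "points S"]] by simp
 moreover have "topspace line_top \<subseteq> line_points S" unfolding line_top_eq by auto
 ultimately show ?thesis by blast
qed

lemma line_D_Int:
 assumes U: "opens S U" "F \<in> carrier (UP (sections S U))" and V: "opens S V" "G \<in> carrier (UP (sections S V))"
 shows "line_D U F \<inter> line_D V G =
  line_D (U \<inter> V) ((\<lambda>n. res S U (U \<inter> V) (F n)) \<otimes>\<^bsub>UP (sections S (U \<inter> V))\<^esub> (\<lambda>n. res S V (U \<inter> V) (G n)))"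
  (is "_ = line_D ?I (?F \<otimes>\<^bsub>_\<^esub> ?G)")
proof -
 have o: "opens S ?I" using U V by (simp add: openin_Int)
 have c: "?F \<in> carrier (UP (sections S ?I))" "?G \<in> carrier (UP (sections S ?I))" using UP_res_closed U V o by auto
 have "poly_germ S (fst z) ?I (?F \<otimes>\<^bsub>UP (sections S ?I)\<^esub> ?G) \<in> snd z \<longleftrightarrow>
   poly_germ S (fst z) U F \<in> snd z \<or> poly_germ S (fst z) V G \<in> snd z"
  if z: "z \<in> line_points S" and x: "fst z \<in> ?I" for z
 proof -
  have "poly_germ S (fst z) ?I ?F = poly_germ S (fst z) U F" "poly_germ S (fst z) ?I ?G = poly_germ S (fst z) V G"
   using poly_germ_res[OF U(1) o _ U(2) x] poly_germ_res[OF V(1) o _ V(2) x] by auto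
  then show ?thesis using ring_hom_mult[OF poly_germ_hom[OF o x] c] ring_hom_closed[OF poly_germ_hom[OF o x] c(1)]
    ring_hom_closed[OF poly_germ_hom[OF o x] c(2)] primeideal_mult_iff[OF line_pointsD(2)[OF z]] by simp
 qed
 then show ?thesis by auto
qed

lemma line_basis:
 assumes W: "openin line_top W" and z: "z \<in> W"
 obtains U F where "opens S U" "F \<in> carrier (UP (sections S U))" "z \<in> line_D U F" "line_D U F \<subseteq> W"
proof -
 have "\<exists>A\<in>{line_D U F | U F. opens S U & F \<in> carrier (UP (sections S U))}. z \<in> A & A \<subseteq> W"
 proof (rule topology_generated_basis[OF _ W[unfolded line_top_eq] z])
  fix A B assume "A \<in> {line_D U F | U F. opens S U & F \<in> carrier (UP (sections S U))}"
   "B \<in> {line_D U F | U F. opens S U & F \<in> carrier (UP (sections S U))}"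
  then obtain U F V G where U: "A = line_D U F" "opens S U" "F \<in> carrier (UP (sections S U))"
   and V: "B = line_D V G" "opens S V" "G \<in> carrier (UP (sections S V))" by blast
  have o: "opens S (U \<inter> V)" using U V by (simp add: openin_Int)
  have "(\<lambda>n. res S U (U \<inter> V) (F n)) \<otimes>\<^bsub>UP (sections S (U \<inter> V))\<^esub> (\<lambda>n. res S V (U \<inter> V) (G n))
    \<in> carrier (UP (sections S (U \<inter> V)))"
   by (rule cring.cring_simprules(5)[OF UP_sections_cring[OF o]]) (use UP_res_closed U V o in auto)
  then show "A \<inter> B \<in> {line_D U F | U F. opens S U & F \<in> carrier (UP (sections S U))}"
   unfolding U V line_D_Int[OF U(2,3) V(2,3)] using o by blast
 qed
 then show thesis using that by blast
qed

lemma line_NE: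
 assumes "a \<in> line_N V"
 obtains U F where "opens S U" "F \<in> carrier (UP (sections S U))"
  "\<And>z. z \<in> V ==> fst z \<in> U" "\<And>z. z \<in> V ==> a z = poly_germ S (fst z) U F"
 using assms unfolding line_N_def by (elim CollectE exE conjE) (rule that; simp)

lemma line_NI:
 assumes "opens S U" "F \<in> carrier (UP (sections S U))"
  "\<And>z. z \<in> V ==> fst z \<in> U" "\<And>z. z \<in> V ==> a z = poly_germ S (fst z) U F"
 shows "a \<in> line_N V" unfolding line_N_def using assms by blast

lemma line_NE2:
 assumes a: "a \<in> line_N V" and b: "b \<in> line_N V"
 obtains U F G where "opens S U" "F \<in> carrier (UP (sections S U))" "G \<in> carrier (UP (sections S U))"
  "\<And>z. z \<in> V ==> fst z \<in> U" "\<And>z. z \<in> V ==> a z = poly_germ S (fst z) U F"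
  "\<And>z. z \<in> V ==> b z = poly_germ S (fst z) U G"
proof -
 obtain U F where U: "opens S U" "F \<in> carrier (UP (sections S U))"
  "\<And>z. z \<in> V ==> fst z \<in> U" "\<And>z. z \<in> V ==> a z = poly_germ S (fst z) U F" using a by (rule line_NE) blast
 obtain U' G where U': "opens S U'" "G \<in> carrier (UP (sections S U'))"
  "\<And>z. z \<in> V ==> fst z \<in> U'" "\<And>z. z \<in> V ==> b z = poly_germ S (fst z) U' G" using b by (rule line_NE) blast
 have o: "opens S (U \<inter> U')" using U U' by (simp add: openin_Int)
 show thesis by (rule that[OF o UP_res_closed[OF U(1) o _ U(2)] UP_res_closed[OF U'(1) o _ U'(2)]])
   (use U U' poly_germ_res[OF U(1) o _ U(2)] poly_germ_res[OF U'(1) o _ U'(2)] in auto)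
qed

lemma frac_space_line: "frac_space line_top (\<lambda>z. K (fst z)) snd line_N line_B"
proof (rule frac_space.intro)
 fix p assume "p \<in> topspace line_top"
 then show "primeideal (snd p) (K (fst p))" unfolding topspace_line by (rule line_pointsD)
next
 fix V V' a assume "a \<in> line_N V" "V' \<subseteq> V"
 then show "a \<in> line_N V'" unfolding line_N_def by blast
next
 fix V a assume V: "openin line_top V"
 have VL: "V \<subseteq> line_points S" using openin_subset[OF V] topspace_line by simp
 have pts: "fst z \<in> points S" if "z \<in> V" for z using line_pointsD(1) VL that by blast
 have top: "opens S (points S)" by simp
 interpret top: cring "UP (sections S (points S))" by (rule UP_sections_cring) simp
 have "\<zero>\<^bsub>K (fst z)\<^esub> = poly_germ S (fst z) (points S) \<zero>\<^bsub>UP (sections S (points S))\<^esub>" if "z \<in> V" for z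
  using ring_hom_zero[OF poly_germ_hom[OF top pts[OF that]] top.ring_axioms]
   cring_UP[OF cring_stalk[OF pts[OF that]]] by (simp add: cring.axioms)
 then show "(\<lambda>p. \<zero>\<^bsub>K (fst p)\<^esub>) \<in> line_N V" by (intro line_NI[OF top top.zero_closed pts])
 show "(\<lambda>p. \<one>\<^bsub>K (fst p)\<^esub>) \<in> line_N V"
  by (rule line_NI[OF top top.one_closed pts]) (use pts ring_hom_one[OF poly_germ_hom[OF top]] in auto)
 assume "a \<in> line_N V"
 then obtain U F where U: "opens S U" "F \<in> carrier (UP (sections S U))"
  "\<And>z. z \<in> V ==> fst z \<in> U" "\<And>z. z \<in> V ==> a z = poly_germ S (fst z) U F" by (rule line_NE) blast
 show "a p \<in> carrier (K (fst p))" if "p \<in> V" for p using ring_hom_closed[OF poly_germ_hom[OF U(1,3)] U(2)] that U(4) by simp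
 have "{p \<in> V. a p \<notin> snd p} = V \<inter> line_D U F" using U(3,4) VL by auto
 then show "openin line_top {p \<in> V. a p \<notin> snd p}" using V open_line_D[OF U(1,2)] by (simp add: openin_Int)
 interpret U: cring "UP (sections S U)" by (rule UP_sections_cring) fact
 have "poly_germ S (fst z) U (\<ominus>\<^bsub>UP (sections S U)\<^esub> F) = \<ominus>\<^bsub>K (fst z)\<^esub> poly_germ S (fst z) U F" if "z \<in> V" for z
 proof -
  interpret ring_hom_cring "UP (sections S U)" "K (fst z)" "poly_germ S (fst z) U"
   using poly_germ_hom[OF U(1,3)] that cring_UP[OF cring_stalk[OF pts]] U.is_cring
   by (simp add: ring_hom_cring_def ring_hom_cring_axioms_def)
  show ?thesis using U(2) by simp
 qed
 then show "(\<lambda>p. \<ominus>\<^bsub>K (fst p)\<^esub> a p) \<in> line_N V" by (intro line_NI[of U "\<ominus>\<^bsub>UP (sections S U)\<^esub> F"]) (use U in auto)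
next
 fix V a b assume V: "openin line_top V" and a: "a \<in> line_N V" and b: "b \<in> line_N V"
 obtain U F G where U: "opens S U" "F \<in> carrier (UP (sections S U))" "G \<in> carrier (UP (sections S U))"
  "\<And>z. z \<in> V ==> fst z \<in> U" "\<And>z. z \<in> V ==> a z = poly_germ S (fst z) U F"
  "\<And>z. z \<in> V ==> b z = poly_germ S (fst z) U G" by (rule line_NE2[OF a b]) blast
 interpret U: cring "UP (sections S U)" by (rule UP_sections_cring) fact
 show "(\<lambda>p. a p \<oplus>\<^bsub>K (fst p)\<^esub> b p) \<in> line_N V" by (rule line_NI[of U "F \<oplus>\<^bsub>UP (sections S U)\<^esub> G"])
   (use U U.a_closed[OF U(2,3)] ring_hom_add[OF poly_germ_hom[OF U(1,4)] U(2,3)] in auto)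
 show "(\<lambda>p. a p \<otimes>\<^bsub>K (fst p)\<^esub> b p) \<in> line_N V" by (rule line_NI[of U "F \<otimes>\<^bsub>UP (sections S U)\<^esub> G"])
   (use U U.m_closed[OF U(2,3)] ring_hom_mult[OF poly_germ_hom[OF U(1,4)] U(2,3)] in auto)
next
 fix V and s :: "('p, 's) line_section" assume V: "openin line_top V"
 show "(\<exists>b\<in>line_B V. \<forall>p\<in>V. s p = b p) \<longleftrightarrow> (\<exists>a\<in>line_N V. \<exists>f\<in>line_N V. \<forall>p\<in>V. f p \<notin> snd p &
   s p = frac (K (fst p)) (carrier (K (fst p)) - snd p) (a p) (f p))" (is "?l \<longleftrightarrow> ?r")
 proof
  assume ?l
  then obtain b where b: "b \<in> line_B V" "\<forall>p\<in>V. s p = b p" by (rule bexE)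
  obtain U F G where U: "b = line_frac S U F G" "opens S U" "F \<in> carrier (UP (sections S U))"
   "G \<in> carrier (UP (sections S U))" "\<forall>(x, q)\<in>V. x \<in> U & poly_germ S x U G \<notin> q"
   using b(1) unfolding line_B_def by (elim CollectE exE conjE)
  have "(\<lambda>z. poly_germ S (fst z) U F) \<in> line_N V" "(\<lambda>z. poly_germ S (fst z) U G) \<in> line_N V"
   by (rule line_NI[OF U(2,3)], use U(5) in auto) (rule line_NI[OF U(2,4)], use U(5) in auto)
  moreover have "\<forall>z\<in>V. poly_germ S (fst z) U G \<notin> snd z & s z = frac (K (fst z)) (carrier (K (fst z)) - snd z)
    (poly_germ S (fst z) U F) (poly_germ S (fst z) U G)" using U(1,5) b(2) by (auto simp: line_frac_def)
  ultimately show ?r by (intro bexI[of _ "\<lambda>z. poly_germ S (fst z) U F"] bexI[of _ "\<lambda>z. poly_germ S (fst z) U G"])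
 next
  assume ?r
  then obtain a f where af: "a \<in> line_N V" "f \<in> line_N V" and 1: "\<forall>p\<in>V. f p \<notin> snd p &
   s p = frac (K (fst p)) (carrier (K (fst p)) - snd p) (a p) (f p)" by (elim bexE)
  obtain U F G where U: "opens S U" "F \<in> carrier (UP (sections S U))" "G \<in> carrier (UP (sections S U))"
   "\<And>z. z \<in> V ==> fst z \<in> U" "\<And>z. z \<in> V ==> a z = poly_germ S (fst z) U F"
   "\<And>z. z \<in> V ==> f z = poly_germ S (fst z) U G" by (rule line_NE2[OF af]) blast
  have "\<forall>(x, q)\<in>V. x \<in> U & poly_germ S x U G \<notin> q"
  proof
   fix z assume z: "z \<in> V"
   show "case z of (x, q) => x \<in> U & poly_germ S x U G \<notin> q" using 1 U(4,6) z by (auto simp: case_prod_unfold)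
  qed
  then have "line_frac S U F G \<in> line_B V" unfolding line_B_def using U(1-3) by blast
  then show ?l using 1 U(5,6) by (intro bexI[of _ "line_frac S U F G"]) (auto simp: line_frac_def case_prod_unfold)
 qed
qed

sublocale line: frac_space line_top "\<lambda>z. K (fst z)" snd line_N line_B by (rule frac_space_line)

lemma topo_Ga_times: "topo (Ga_times S) = line_top" unfolding Ga_times_eq by simp

lemma points_Ga_times: "points (Ga_times S) = line_points S"
 unfolding topo_Ga_times by (rule topspace_line)

lemma rspace_Ga_times: "rspace (Ga_times S)" unfolding Ga_times_eq by (rule line.rspace_space)

lemma preimg_Ga_proj: "preimg (Ga_times S) (Ga_proj S) U = {z \<in> line_points S. fst z \<in> U}"
 unfolding preimg_def points_Ga_times Ga_proj_def by simp

lemma poly_germ_monom: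
 assumes "opens S U" "x \<in> U" "s \<in> \<Gamma> S U"
 shows "poly_germ S x U (up_ring.monom (UP (sections S U)) s n) = up_ring.monom (K x) (germ S x U s) n"
 unfolding UP_monom_apply[OF assms(3)] UP_monom_apply[OF germ_closed[OF assms]] poly_germ_def
 using germ_zero[OF assms(1,2)] by (simp add: fun_eq_iff)

lemma line_frac_monom:
 assumes "opens S U" "fst z \<in> U" "s \<in> \<Gamma> S U"
 shows "line_frac S U (up_ring.monom (UP (sections S U)) s n) \<one>\<^bsub>UP (sections S U)\<^esub> z
  = line.fr z (up_ring.monom (K (fst z)) (germ S (fst z) U s) n) \<one>\<^bsub>K (fst z)\<^esub>"
 using poly_germ_monom[OF assms] ring_hom_one[OF poly_germ_hom[OF assms(1,2)]]
 unfolding line_frac_def by (simp add: case_prod_unfold)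

text \<open>The constant \<open>c\<close> in the local ring at \<open>z\<close>.\<close>

abbreviation "cst z c \<equiv> line.fr z (up_ring.monom (K (fst z)) c 0) \<one>\<^bsub>K (fst z)\<^esub>"

lemma pull_Ga_proj:
 assumes "opens S U" "z \<in> line_points S" "fst z \<in> U" "s \<in> \<Gamma> S U"
 shows "pull (Ga_proj S) U s z = cst z (germ S (fst z) U s)"
 using line_frac_monom[OF assms(1,3,4)] assms(2,3) unfolding Ga_proj_def by simp

lemma const_hom:
 assumes "z \<in> line_points S"
 shows "(\<lambda>c. cst z c) \<in> ring_hom (stalk S (fst z)) (line.L z)"
proof -
 have z: "z \<in> topspace line_top" using assms topspace_line by simp
 have "(\<lambda>c. up_ring.monom (K (fst z)) c 0) \<in> ring_hom (stalk S (fst z)) (K (fst z))" by (rule UP_ring.const_ring_hom)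
   (use cring_stalk[OF line_pointsD(1)[OF assms]] in \<open>simp_all add: UP_ring_def cring.axioms\<close>)
 from ring_hom_trans[OF this localize.frac_hom[OF line.loc[OF z]]] show ?thesis by (simp add: o_def)
qed

lemma morphism_Ga_proj: "morphism (Ga_times S) S (Ga_proj S)"
proof (rule morphismI[OF rspace_Ga_times rspace_axioms])
 show "continuous_map (topo (Ga_times S)) (topo S) (pt (Ga_proj S))" unfolding topo_Ga_times
  by (rule continuous_mapI) (use line_pointsD(1) open_line_over in \<open>auto simp: Ga_proj_def topspace_line\<close>)
 fix V assume V: "opens S V"
 let ?W = "{z \<in> line_points S. fst z \<in> V}"
 have W: "openin line_top ?W" by (rule open_line_over) fact
 interpret V: cring "sections S V" by (rule cring_sections) fact
 have hom: "(\<lambda>s. pull (Ga_proj S) V s z) \<in> ring_hom (sections S V) (line.L z)" if z: "z \<in> ?W" for z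
 proof -
  have z': "z \<in> line_points S" "fst z \<in> V" using z by auto
  have h: "(\<lambda>s. cst z (germ S (fst z) V s))
    \<in> ring_hom (sections S V) (line.L z)"
   using ring_hom_trans[OF germ_hom[OF V z'(2)] const_hom[OF z'(1)]] by (simp add: o_def)
  show ?thesis using ring_hom_closed[OF h] ring_hom_mult[OF h] ring_hom_add[OF h] ring_hom_one[OF h]
   by (intro ring_hom_memI) (simp_all add: pull_Ga_proj[OF V z'])
 qed
 have ext: "pull (Ga_proj S) V s = restrict (pull (Ga_proj S) V s) ?W" for s unfolding Ga_proj_def by simp
 have N: "(\<lambda>z. up_ring.monom (K (fst z)) (germ S (fst z) V s) 0) \<in> line_N ?W"
  and eq: "pull (Ga_proj S) V s = (\<lambda>z\<in>?W. cst z (germ S (fst z) V s))" if s: "s \<in> \<Gamma> S V" for s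
 proof -
  show "(\<lambda>z. up_ring.monom (K (fst z)) (germ S (fst z) V s) 0) \<in> line_N ?W"
   by (rule line_NI[OF V UP_monom_closed[OF V.is_cring s]]) (use poly_germ_monom[OF V _ s] in auto)
  show "pull (Ga_proj S) V s = (\<lambda>z\<in>?W. cst z (germ S (fst z) V s))"
   by (subst ext) (rule restrict_ext, use pull_Ga_proj[OF V _ _ s] in auto)
 qed
 show "pull (Ga_proj S) V \<in> ring_hom (sections S V) (sections (Ga_times S) (preimg (Ga_times S) (Ga_proj S) V))"
  unfolding preimg_Ga_proj unfolding Ga_times_eq
 proof (rule ring_hom_memI)
  fix s assume s: "s \<in> \<Gamma> S V"
  have top: "z \<in> topspace line_top" if "z \<in> ?W" for z using that topspace_line by simp
  have "(\<lambda>z\<in>?W. cst z (germ S (fst z) V s))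
    \<in> \<Gamma> line.space ?W" by (rule line.section_frac[OF W N[OF s] line.N_one[OF W]])
    (use localize.one_M[OF line.loc[OF top]] in blast)
  then show "pull (Ga_proj S) V s \<in> \<Gamma> line.space ?W" unfolding eq[OF s] .
  fix t assume t: "t \<in> \<Gamma> S V"
  show "pull (Ga_proj S) V (s \<otimes>\<^bsub>sections S V\<^esub> t)
    = pull (Ga_proj S) V s \<otimes>\<^bsub>sections line.space ?W\<^esub> pull (Ga_proj S) V t"
   by (subst ext) (simp add: ring_hom_mult[OF hom s t] cong: restrict_cong)
  show "pull (Ga_proj S) V (s \<oplus>\<^bsub>sections S V\<^esub> t)
    = pull (Ga_proj S) V s \<oplus>\<^bsub>sections line.space ?W\<^esub> pull (Ga_proj S) V t"
   by (subst ext) (simp add: ring_hom_add[OF hom s t] cong: restrict_cong)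
 next
  show "pull (Ga_proj S) V \<one>\<^bsub>sections S V\<^esub> = \<one>\<^bsub>sections line.space ?W\<^esub>"
   by (subst ext) (simp add: ring_hom_one[OF hom] cong: restrict_cong)
 qed
 {
  fix W t assume W': "opens S W" "W \<subseteq> V" and t: "t \<in> \<Gamma> S V"
  have e: "pull (Ga_proj S) V t z = pull (Ga_proj S) W (res S V W t) z"
   if "z \<in> line_points S" "fst z \<in> W" for z
   using pull_Ga_proj[OF V that(1) _ t] pull_Ga_proj[OF W'(1) that res_closed[OF V W' t]]
    germ_res[OF V t W' that(2)] that W' by auto
  have "restrict (pull (Ga_proj S) V t) {z \<in> line_points S. fst z \<in> W}
    = restrict (pull (Ga_proj S) W (res S V W t)) {z \<in> line_points S. fst z \<in> W}" by (rule restrict_ext) (use e in auto)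
  also have "\<dots> = pull (Ga_proj S) W (res S V W t)" unfolding Ga_proj_def by simp
  finally show "res (Ga_times S) (preimg (Ga_times S) (Ga_proj S) V) (preimg (Ga_times S) (Ga_proj S) W)
    (pull (Ga_proj S) V t) = pull (Ga_proj S) W (res S V W t)" unfolding preimg_Ga_proj unfolding Ga_times_eq by simp
 }
 fix t z assume t: "t \<in> \<Gamma> S V" and "pt (Ga_proj S) z \<in> V"
  and l: "z \<in> locus (Ga_times S) (preimg (Ga_times S) (Ga_proj S) V) (pull (Ga_proj S) V t)"
 have z: "z \<in> line_points S" "fst z \<in> V" using l rspace.locus_subset[OF rspace_Ga_times] unfolding preimg_Ga_proj by blast+
 note eq[OF t]
 moreover have "\<one>\<^bsub>K (fst p)\<^esub> \<notin> snd p" if "p \<in> ?W" for p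
  using localize.one_M[OF prime_localize[OF line_pointsD(2)]] that by blast
 ultimately have "up_ring.monom (K (fst z)) (germ S (fst z) V t) 0 \<notin> snd z"
  using l line.locus_frac[OF W N[OF t] line.N_one[OF W]] unfolding preimg_Ga_proj unfolding Ga_times_eq by simp
 then have "germ S (fst z) V t \<in> Units (stalk S (fst z))" using line_pointsD(3)[OF z(1) germ_closed[OF V z(2) t]] by simp
 then show "pt (Ga_proj S) z \<in> locus S V t" using germ_Units_iff[OF V z(2) t] unfolding Ga_proj_def by simp
qed

end

section \<open>The chart of the relative affine line\<close>

context chart
begin

definition \<sigma> :: "'p => 'a => ('p set \<times> 's) set" where
 "\<sigma> x F = germ S x V (\<rho> F)"

lemma V_points: "x \<in> V ==> x \<in> points S"
 using openin_subset[OF open_V] by blast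

lemma \<sigma>_hom: "x \<in> V ==> \<sigma> x \<in> ring_hom R (stalk S x)"
 using ring_hom_trans[OF hom germ_hom[OF open_V]] unfolding \<sigma>_def by (simp add: o_def)

lemma \<sigma>_closed: "x \<in> V ==> F \<in> carrier R ==> \<sigma> x F \<in> carrier (stalk S x)"
 by (rule ring_hom_closed[OF \<sigma>_hom])

lemma \<sigma>_res: "opens S W ==> W \<subseteq> V ==> x \<in> W ==> F \<in> carrier R ==> germ S x W (\<rho>r W F) = \<sigma> x F"
 unfolding \<sigma>_def by (rule germ_res[OF open_V \<rho>_closed])

lemma \<sigma>_Units: "x \<in> V ==> F \<in> carrier R ==> \<sigma> x F \<in> Units (stalk S x) \<longleftrightarrow> x \<in> locus S V (\<rho> F)"
 unfolding \<sigma>_def by (rule germ_Units_iff[OF open_V _ \<rho>_closed])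

lemma \<sigma>_ker:
 assumes "x \<in> V" "F \<in> carrier R" "\<sigma> x F = \<zero>\<^bsub>stalk S x\<^esub>"
 shows "\<exists>h\<in>carrier R. x \<in> locus S V (\<rho> h) & h \<otimes> F = \<zero>"
proof -
 obtain W where "opens S W" "x \<in> W" "W \<subseteq> V" "\<rho>r W F = \<zero>\<^bsub>sections S W\<^esub>"
  using assms(3) germ_zero_iff[OF open_V assms(1) \<rho>_closed[OF assms(2)]] unfolding \<sigma>_def by blast
 then show ?thesis using ker assms(2) by blast
qed

lemma common_denominator:
 fixes N :: nat
 assumes U: "opens S U" "U \<subseteq> V" "x \<in> U" and F: "\<And>n. F n \<in> \<Gamma> S U"
 shows "\<exists>g a W. g \<in> carrier R & x \<in> locus S V (\<rho> g) & (\<forall>n. a n \<in> carrier R) &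
  opens S W & x \<in> W & W \<subseteq> U &
  (\<forall>n<N. \<rho>r W g \<otimes>\<^bsub>sections S W\<^esub> res S U W (F n) = \<rho>r W (a n))"
proof (induction N)
 case 0
 show ?case by (rule exI[of _ "\<one>"], rule exI[of _ "\<lambda>_. \<zero>"], rule exI[of _ U]) (use U locus_\<rho>_one in auto)
next
 case (Suc N)
 then obtain g a W where g: "g \<in> carrier R" "x \<in> locus S V (\<rho> g)" "\<And>n. a n \<in> carrier R" and W: "opens S W" "x \<in> W" "W \<subseteq> U"
  and e: "\<And>n. n < N ==> \<rho>r W g \<otimes>\<^bsub>sections S W\<^esub> res S U W (F n) = \<rho>r W (a n)" by blast
 obtain G' F' W' where G: "F' \<in> carrier R" "G' \<in> carrier R" "x \<in> locus S V (\<rho> G')" and W': "opens S W'" "x \<in> W'" "W' \<subseteq> U"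
   "\<rho>r W' G' \<otimes>\<^bsub>sections S W'\<^esub> res S U W' (F N) = \<rho>r W' F'" using fracs[OF U F] by blast
 let ?W = "W \<inter> W'" and ?g = "g \<otimes> G'" and ?a = "\<lambda>n. if n < N then G' \<otimes> a n else g \<otimes> F'"
 have o: "opens S ?W" using W W' by (simp add: openin_Int)
 have sub: "W \<subseteq> V" "W' \<subseteq> V" "?W \<subseteq> V" "?W \<subseteq> W" "?W \<subseteq> W'" "?W \<subseteq> U" using W W' U by auto
 interpret W: cring "sections S ?W" by (rule cring_sections) fact
 note h = res_\<rho>_hom[OF o sub(3)]
 note c = res_\<rho>_closed[OF o sub(3) g(1)] res_\<rho>_closed[OF o sub(3) G(2)] res_closed[OF U(1) o sub(6) F]
 have e1: "\<rho>r ?W g \<otimes>\<^bsub>sections S ?W\<^esub> res S U ?W (F n) = \<rho>r ?W (a n)" if "n < N" for n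
  using arg_cong[OF e[OF that], of "res S W ?W"]
   res_mult[OF W(1) o sub(4) res_\<rho>_closed[OF W(1) sub(1) g(1)] res_closed[OF U(1) W(1,3) F]]
   res_\<rho>_res[OF W(1) o sub(4,1)] g res_res[OF U(1) W(1) o sub(4) W(3) F] by simp
 have e2: "\<rho>r ?W G' \<otimes>\<^bsub>sections S ?W\<^esub> res S U ?W (F N) = \<rho>r ?W F'" using arg_cong[OF W'(4), of "res S W' ?W"]
   res_mult[OF W'(1) o sub(5) res_\<rho>_closed[OF W'(1) sub(2) G(2)] res_closed[OF U(1) W'(1,3) F]]
   res_\<rho>_res[OF W'(1) o sub(5,2)] G res_res[OF U(1) W'(1) o sub(5) W'(3) F] by simp
 have "\<rho>r ?W ?g \<otimes>\<^bsub>sections S ?W\<^esub> res S U ?W (F n) = \<rho>r ?W (?a n)" if "n < Suc N" for n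
 proof (cases "n < N")
  case True
  have "\<rho>r ?W ?g \<otimes>\<^bsub>sections S ?W\<^esub> res S U ?W (F n)
    = \<rho>r ?W G' \<otimes>\<^bsub>sections S ?W\<^esub> (\<rho>r ?W g \<otimes>\<^bsub>sections S ?W\<^esub> res S U ?W (F n))"
   using ring_hom_mult[OF h g(1) G(2)] c by (simp add: W.m_ac)
  then show ?thesis using e1[OF True] ring_hom_mult[OF h G(2) g(3)] True by simp
 next
  case False
  then have n: "n = N" using that by simp
  have "\<rho>r ?W ?g \<otimes>\<^bsub>sections S ?W\<^esub> res S U ?W (F N)
    = \<rho>r ?W g \<otimes>\<^bsub>sections S ?W\<^esub> (\<rho>r ?W G' \<otimes>\<^bsub>sections S ?W\<^esub> res S U ?W (F N))"
   using ring_hom_mult[OF h g(1) G(2)] c by (simp add: W.m_ac)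
  then show ?thesis using e2 ring_hom_mult[OF h g(1) G(1)] unfolding n by simp
 qed
 moreover have "x \<in> locus S V (\<rho> ?g)" using locus_\<rho>_mult[OF g(1) G(2)] g(2) G(3) by simp
 moreover have "x \<in> ?W" using W W' by simp
 ultimately show ?case using g G o sub(6) by (intro exI[of _ ?g] exI[of _ ?a] exI[of _ ?W]) auto
qed

lemma common_annihilator:
 fixes N :: nat
 assumes x: "x \<in> V" and F: "\<And>n. F n \<in> carrier R" "\<And>n. \<sigma> x (F n) = \<zero>\<^bsub>stalk S x\<^esub>"
 shows "\<exists>h\<in>carrier R. x \<in> locus S V (\<rho> h) & (\<forall>n<N. h \<otimes> F n = \<zero>)"
proof (induction N)
 case 0
 show ?case by (rule bexI[of _ "\<one>"]) (use locus_\<rho>_one x in auto)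
next
 case (Suc N)
 then obtain h where h: "h \<in> carrier R" "x \<in> locus S V (\<rho> h)" "\<And>n. n < N ==> h \<otimes> F n = \<zero>" by blast
 obtain k where k: "k \<in> carrier R" "x \<in> locus S V (\<rho> k)" "k \<otimes> F N = \<zero>" using \<sigma>_ker[OF x F] by blast
 have "(h \<otimes> k) \<otimes> F n = \<zero>" if "n < Suc N" for n
 proof (cases "n < N")
  case True
  have "(h \<otimes> k) \<otimes> F n = k \<otimes> (h \<otimes> F n)" using h k F by (simp add: R.m_ac)
  then show ?thesis using h(3)[OF True] k by simp
 next
  case False
  then have "n = N" using that by simp
  moreover have "(h \<otimes> k) \<otimes> F N = h \<otimes> (k \<otimes> F N)" using h k F by (simp add: R.m_ac)
  ultimately show ?thesis using k h by simp
 qed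
 then show ?case using h k locus_\<rho>_mult[OF h(1) k(1)] by (intro bexI[of _ "h \<otimes> k"]) auto
qed

end

lemma (in rspace) poly_germ_surj:
 assumes x: "x \<in> points S" and p: "p \<in> carrier (K x)"
 obtains U F where "opens S U" "x \<in> U" "F \<in> carrier (UP (sections S U))" "p = poly_germ S x U F"
proof -
 have pc: "p n \<in> carrier (stalk S x)" for n by (rule UP_coeff[OF p])
 have "\<exists>U F. opens S U & x \<in> U & (\<forall>n. F n \<in> \<Gamma> S U) &
   (\<forall>n<N. p n = germ S x U (F n)) & (\<forall>n\<ge>N. F n = \<zero>\<^bsub>sections S U\<^esub>)" for N :: nat
 proof (induction N)
  case 0
  interpret cring "sections S (points S)" by (rule cring_sections) simp
  show ?case using x by (intro exI[of _ "points S"] exI[of _ "\<lambda>n. \<zero>\<^bsub>sections S (points S)\<^esub>"]) auto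
 next
  case (Suc N)
  then obtain U F where U: "opens S U" "x \<in> U" "\<And>n. F n \<in> \<Gamma> S U"
   "\<And>n. n < N ==> p n = germ S x U (F n)" "\<And>n. n \<ge> N ==> F n = \<zero>\<^bsub>sections S U\<^esub>" by blast
  obtain W s where W: "opens S W" "x \<in> W" "s \<in> \<Gamma> S W" "p N = germ S x W s" using pc by (rule stalk_carrierE)
  let ?I = "U \<inter> W"
  have o: "opens S ?I" "x \<in> ?I" using U W by (auto simp: openin_Int)
  let ?F = "\<lambda>n. if n = N then res S W ?I s else res S U ?I (F n)"
  have "?F n \<in> \<Gamma> S ?I" for n using res_closed o U W by auto
  moreover have "p n = germ S x ?I (?F n)" if "n < Suc N" for n
   using that U(4)[of n] W(4) germ_res[OF U(1,3) o(1) _ o(2)] germ_res[OF W(1,3) o(1) _ o(2)] by auto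
  moreover have "?F n = \<zero>\<^bsub>sections S ?I\<^esub>" if "n \<ge> Suc N" for n using that U(5)[of n] res_zero[OF U(1) o(1)] by simp
  ultimately show ?case using o by (intro exI[of _ ?I] exI[of _ ?F]) blast
 qed
 note ex = this
 obtain N where N: "\<forall>n>N. p n = \<zero>\<^bsub>stalk S x\<^esub>" using p unfolding UP_carrier by blast
 obtain U F where U: "opens S U" "x \<in> U" "\<And>n. F n \<in> \<Gamma> S U"
   "\<And>n. n < Suc N ==> p n = germ S x U (F n)" "\<And>n. n \<ge> Suc N ==> F n = \<zero>\<^bsub>sections S U\<^esub>" using ex[of "Suc N"] by blast
 have "F \<in> carrier (UP (sections S U))" unfolding UP_carrier using U(3,5) by (auto intro!: exI[of _ N])
 moreover have "p n = germ S x U (F n)" for n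
 proof (cases "n < Suc N")
  case False
  then have "p n = \<zero>\<^bsub>stalk S x\<^esub>" "F n = \<zero>\<^bsub>sections S U\<^esub>" using N U(5) by auto
  then show ?thesis using germ_zero[OF U(1,2)] by simp
 qed (rule U(4))
 ultimately show thesis using that[OF U(1,2)] unfolding poly_germ_def by blast
qed

locale full_chart = chart S "points S" R \<rho> for S :: "('p, 's) ringed_space"
 and R :: "('a, 'm) ring_scheme" (structure) and \<rho>
begin

definition \<kappa> :: "('p, 's) line_point => (nat => 'a) => nat => ('p set \<times> 's) set" where
 "\<kappa> z F = (\<lambda>n. \<sigma> (fst z) (F n))"

lemma \<kappa>_hom: "fst z \<in> points S ==> \<kappa> z \<in> ring_hom (UP R) (K (fst z))"
 using UP_map_hom[OF cring_R cring_stalk \<sigma>_hom, of "fst z"] unfolding \<kappa>_def by simp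

lemma \<kappa>_poly_germ: "\<kappa> z F = poly_germ S (fst z) (points S) (\<lambda>n. \<rho> (F n))"
 unfolding \<kappa>_def poly_germ_def \<sigma>_def ..

lemma UP_\<rho>: "F \<in> carrier (UP R) ==> (\<lambda>n. \<rho> (F n)) \<in> carrier (UP (sections S (points S)))"
 by (rule ring_hom_closed[OF UP_map_hom[OF cring_R cring_sections[OF open_V] hom]])

abbreviation const :: "'a => nat => 'a" where "const g \<equiv> up_ring.monom (UP R) g 0"

lemma \<kappa>_const:
 assumes "fst z \<in> points S" "g \<in> carrier R"
 shows "\<kappa> z (const g) = up_ring.monom (K (fst z)) (\<sigma> (fst z) g) 0"
 unfolding \<kappa>_def UP_monom_apply[OF assms(2)] UP_monom_apply[OF \<sigma>_closed[OF assms]]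
 using ring_hom_zero[OF \<sigma>_hom[OF assms(1)] R.ring_axioms] cring_stalk[OF assms(1)] by (simp add: fun_eq_iff cring.axioms)

lemma \<kappa>_const_mem:
 assumes "z \<in> line_points S" "g \<in> carrier R"
 shows "\<kappa> z (const g) \<in> snd z \<longleftrightarrow> fst z \<notin> locus S (points S) (\<rho> g)"
 using \<kappa>_const[OF line_pointsD(1)[OF assms(1)] assms(2)] line_pointsD(3)[OF assms(1) \<sigma>_closed]
  \<sigma>_Units line_pointsD(1)[OF assms(1)] assms(2) by simp

lemma const_closed: "g \<in> carrier R ==> const g \<in> carrier (UP R)"
 by (rule UP_monom_closed[OF cring_R])

text \<open>Near every point, polynomials over a ring of sections are quotients of polynomials
  over \<open>R\<close>, with constant denominators.\<close>

lemma poly_fracs: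
 assumes U: "opens S U" "x \<in> U" and F: "F \<in> carrier (UP (sections S U))"
 shows "\<exists>g F0 W. g \<in> carrier R & F0 \<in> carrier (UP R) & x \<in> locus S (points S) (\<rho> g) &
  opens S W & x \<in> W & W \<subseteq> U &
  (\<forall>z. fst z \<in> W --> \<kappa> z (const g) \<otimes>\<^bsub>K (fst z)\<^esub> poly_germ S (fst z) U F = \<kappa> z F0)"
proof -
 obtain N where N: "\<forall>n>N. F n = \<zero>\<^bsub>sections S U\<^esub>" using F unfolding UP_carrier by blast
 have Fc: "F n \<in> \<Gamma> S U" for n by (rule UP_coeff[OF F])
 have sub: "U \<subseteq> points S" by (rule openin_subset) fact
 obtain g a W where *: "g \<in> carrier R & x \<in> locus S (points S) (\<rho> g) & (\<forall>n. a n \<in> carrier R) &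
  opens S W & x \<in> W & W \<subseteq> U &
  (\<forall>n<Suc N. res S (points S) W (\<rho> g) \<otimes>\<^bsub>sections S W\<^esub> res S U W (F n) = res S (points S) W (\<rho> (a n)))"
  using common_denominator[where N = "Suc N" and F = F, OF U(1) sub U(2) Fc] by (elim exE)
 have g: "g \<in> carrier R" "x \<in> locus S (points S) (\<rho> g)" "\<And>n. a n \<in> carrier R" and W: "opens S W" "x \<in> W" "W \<subseteq> U"
  and e: "\<And>n. n < Suc N ==> res S (points S) W (\<rho> g) \<otimes>\<^bsub>sections S W\<^esub> res S U W (F n) = res S (points S) W (\<rho> (a n))"
  using * by blast+
 have Wp: "W \<subseteq> points S" using W sub by auto
 let ?F0 = "\<lambda>n. if n < Suc N then a n else \<zero>"
 have F0: "?F0 \<in> carrier (UP R)" unfolding UP_carrier using g(3) by (auto intro!: exI[of _ N])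
 have "\<kappa> z (const g) \<otimes>\<^bsub>K (fst z)\<^esub> poly_germ S (fst z) U F = \<kappa> z ?F0" if z: "fst z \<in> W" for z :: "('p, 's) line_point"
 proof
  fix n
  have zp: "fst z \<in> points S" "fst z \<in> U" using z Wp W by auto
  interpret Z: cring "stalk S (fst z)" by (rule cring_stalk) fact
  have "(\<kappa> z (const g) \<otimes>\<^bsub>K (fst z)\<^esub> poly_germ S (fst z) U F) n = \<sigma> (fst z) g \<otimes>\<^bsub>stalk S (fst z)\<^esub> germ S (fst z) U (F n)"
   unfolding \<kappa>_const[OF zp(1) g(1)]
   using UP_const_mult_apply[OF Z.is_cring \<sigma>_closed[OF zp(1) g(1)] ring_hom_closed[OF poly_germ_hom[OF U(1) zp(2)] F]]
   by (simp add: poly_germ_def)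
  also have "\<dots> = \<kappa> z ?F0 n"
  proof (cases "n < Suc N")
   case True
   have "\<sigma> (fst z) g \<otimes>\<^bsub>stalk S (fst z)\<^esub> germ S (fst z) U (F n)
     = germ S (fst z) W (res S (points S) W (\<rho> g) \<otimes>\<^bsub>sections S W\<^esub> res S U W (F n))"
    using germ_mult[OF W(1) z res_\<rho>_closed[OF W(1) Wp g(1)] res_closed[OF U(1) W(1,3) Fc]]
     \<sigma>_res[OF W(1) Wp z g(1)] germ_res[OF U(1) Fc W(1,3) z] by simp
   also have "\<dots> = \<sigma> (fst z) (a n)" unfolding e[OF True] by (rule \<sigma>_res[OF W(1) Wp z g(3)])
   finally show ?thesis using True unfolding \<kappa>_def by simp
  next
   case False
   then show ?thesis
    using N germ_zero[OF U(1) zp(2)] \<sigma>_closed[OF zp(1) g(1)] ring_hom_zero[OF \<sigma>_hom[OF zp(1)] R.ring_axioms Z.ring_axioms]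
    unfolding \<kappa>_def by simp
  qed
  finally show "(\<kappa> z (const g) \<otimes>\<^bsub>K (fst z)\<^esub> poly_germ S (fst z) U F) n = \<kappa> z ?F0 n" .
 qed
 then show ?thesis using g(1,2) F0 W by blast
qed

lemma stalk_poly_fracs:
 assumes x: "fst z \<in> points S" and p: "p \<in> carrier (K (fst z))"
 shows "\<exists>g\<in>carrier R. fst z \<in> locus S (points S) (\<rho> g) &
  (\<exists>F\<in>carrier (UP R). \<kappa> z (const g) \<otimes>\<^bsub>K (fst z)\<^esub> p = \<kappa> z F)"
proof -
 obtain U F where U: "opens S U" "fst z \<in> U" "F \<in> carrier (UP (sections S U))" "p = poly_germ S (fst z) U F"
  using poly_germ_surj[OF x p] .
 then show ?thesis using poly_fracs[OF U(1-3)] by blast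
qed

lemma \<kappa>_ker:
 assumes x: "fst z \<in> points S" and F: "F \<in> carrier (UP R)" and 0: "\<kappa> z F = \<zero>\<^bsub>K (fst z)\<^esub>"
 shows "\<exists>g\<in>carrier R. fst z \<in> locus S (points S) (\<rho> g) & const g \<otimes>\<^bsub>UP R\<^esub> F = \<zero>\<^bsub>UP R\<^esub>"
proof -
 obtain N where N: "\<forall>n>N. F n = \<zero>" using F unfolding UP_carrier by blast
 have Fc: "F n \<in> carrier R" for n by (rule UP_coeff[OF F])
 have "\<sigma> (fst z) (F n) = \<zero>\<^bsub>stalk S (fst z)\<^esub>" for n using fun_cong[OF 0, of n] unfolding \<kappa>_def UP_zero_apply .
 from common_annihilator[where N = "Suc N" and F = F, OF x Fc this] obtain h where h: "h \<in> carrier R"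
  "fst z \<in> locus S (points S) (\<rho> h) & (\<forall>n<Suc N. h \<otimes> F n = \<zero>)" by (elim bexE)
 have "h \<otimes> F n = \<zero>" for n by (cases "n < Suc N") (use h N in auto)
 then have "const h \<otimes>\<^bsub>UP R\<^esub> F = \<zero>\<^bsub>UP R\<^esub>"
  using UP_const_mult_apply[OF cring_R h(1) F] by (simp add: fun_eq_iff UP_zero_apply)
 then show ?thesis using h by blast
qed

sublocale U: cring "UP R" by (rule cring_UP[OF cring_R])

abbreviation \<rho>' :: "(nat => 'a) => ('p, 's) line_section" where
 "\<rho>' F \<equiv> \<lambda>z\<in>points (Ga_times S). line.fr z (\<kappa> z F) \<one>\<^bsub>K (fst z)\<^esub>"

abbreviation "pT \<equiv> prm (Ga_times S) (points (Ga_times S)) (UP R) \<rho>'"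

text \<open>Over \<open>Spec R\<close> the relative affine line is \<open>Spec R[T]\<close>. The stalks \<open>\<O>\<^sub>x\<close> are localisations of
\<open>R\<close>, so polynomials over them, or over sections, become polynomials over \<open>R\<close> after multiplication with
a constant that is a unit at \<open>x\<close>.\<close>

lemma line_chart_and_prm:
 "chart (Ga_times S) (points (Ga_times S)) (UP R) \<rho>' & (\<forall>z\<in>points (Ga_times S).
  pT z = {F \<in> carrier (UP R). \<kappa> z F \<in> snd z})" unfolding points_Ga_times topspace_line[symmetric] unfolding Ga_times_eq
proof (rule line.chart_space[OF U.is_cring])
 fix z assume "z \<in> topspace line_top"
 then show "\<kappa> z \<in> ring_hom (UP R) (K (fst z))" using \<kappa>_hom line_pointsD(1) topspace_line by blast
next
 fix F assume F: "F \<in> carrier (UP R)"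
 show "(\<lambda>z. \<kappa> z F) \<in> line_N (topspace line_top)"
  by (rule line_NI[OF open_V UP_\<rho>[OF F]]) (use line_pointsD(1) topspace_line \<kappa>_poly_germ in auto)
next
 show "inj_on (\<lambda>z. {F \<in> carrier (UP R). \<kappa> z F \<in> snd z}) (topspace line_top)" unfolding topspace_line
 proof (rule inj_onI)
  fix z z' assume z: "z \<in> line_points S" and z': "z' \<in> line_points S"
   and e: "{F \<in> carrier (UP R). \<kappa> z F \<in> snd z} = {F \<in> carrier (UP R). \<kappa> z' F \<in> snd z'}"
  note p = line_pointsD(1)[OF z] line_pointsD(1)[OF z']
  have "prm S (points S) R \<rho> (fst z) = prm S (points S) R \<rho> (fst z')"
   unfolding prm_def using \<kappa>_const_mem[OF z] \<kappa>_const_mem[OF z'] e const_closed by blast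
  then have f: "fst z = fst z'" using inj p unfolding inj_on_def by blast
  then have k: "\<kappa> z = \<kappa> z'" unfolding \<kappa>_def by simp
  have "q \<in> snd z \<longleftrightarrow> q \<in> snd z'" if q: "q \<in> carrier (K (fst z))" for q
  proof -
   obtain g F where g: "g \<in> carrier R" "fst z \<in> locus S (points S) (\<rho> g)" "F \<in> carrier (UP R)"
    "\<kappa> z (const g) \<otimes>\<^bsub>K (fst z)\<^esub> q = \<kappa> z F" using stalk_poly_fracs[OF p(1) q] by blast
   have gc: "\<kappa> z (const g) \<in> carrier (K (fst z))" by (rule ring_hom_closed[OF \<kappa>_hom[OF p(1)] const_closed[OF g(1)]])
   have "\<kappa> z F \<in> snd z \<longleftrightarrow> q \<in> snd z"
    using primeideal_mult_iff[OF line_pointsD(2)[OF z] gc q] g(2,4) \<kappa>_const_mem[OF z g(1)] by simp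
   moreover have "\<kappa> z F \<in> snd z' \<longleftrightarrow> q \<in> snd z'"
    using primeideal_mult_iff[OF line_pointsD(2)[OF z'], folded f, OF gc q] g(2,4) \<kappa>_const_mem[OF z' g(1), folded f k] by simp
   ultimately show ?thesis using e g(3) k by auto
  qed
  moreover have "snd z \<subseteq> carrier (K (fst z))" "snd z' \<subseteq> carrier (K (fst z))"
   using line_pointsD(2)[OF z] line_pointsD(2)[OF z'] unfolding f by (auto dest!: primeideal.axioms(1) intro: ideal.Icarr)
  ultimately show "z = z'" using f by (auto simp: prod_eq_iff)
 qed
next
 fix W z assume W: "openin line_top W" "z \<in> W"
 obtain U F where U: "opens S U" "F \<in> carrier (UP (sections S U))" "z \<in> line_D U F" "line_D U F \<subseteq> W"
  using line_basis[OF W] .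
 have z: "z \<in> line_points S" "fst z \<in> U" "poly_germ S (fst z) U F \<notin> snd z" using U(3) by auto
 note zp = line_pointsD(1)[OF z(1)]
 obtain g F0 W0 where g: "g \<in> carrier R" "F0 \<in> carrier (UP R)" "fst z \<in> locus S (points S) (\<rho> g)"
  and W0: "opens S W0" "fst z \<in> W0" "W0 \<subseteq> U"
  and e: "\<And>z. fst z \<in> W0 ==> \<kappa> z (const g) \<otimes>\<^bsub>K (fst z)\<^esub> poly_germ S (fst z) U F = \<kappa> z F0"
  using poly_fracs[OF U(1) z(2) U(2)] by blast
 obtain h where h: "h \<in> carrier R" "fst z \<in> locus S (points S) (\<rho> h)" "locus S (points S) (\<rho> h) \<subseteq> W0"
  using basis[OF W0(1) openin_subset[OF W0(1)] W0(2)] by blast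
 let ?G = "const h \<otimes>\<^bsub>UP R\<^esub> F0"
 have mem: "\<kappa> z' ?G \<notin> snd z' \<longleftrightarrow> fst z' \<in> locus S (points S) (\<rho> h) & \<kappa> z' F0 \<notin> snd z'" if z': "z' \<in> line_points S" for z'
 proof -
  note hm = \<kappa>_hom[OF line_pointsD(1)[OF z']]
  show ?thesis
   using primeideal_mult_iff[OF line_pointsD(2)[OF z'] ring_hom_closed[OF hm const_closed[OF h(1)]] ring_hom_closed[OF hm g(2)]]
    ring_hom_mult[OF hm const_closed[OF h(1)] g(2)] \<kappa>_const_mem[OF z' h(1)] by simp
 qed
 have mem0: "\<kappa> z' F0 \<notin> snd z' \<longleftrightarrow> fst z' \<in> locus S (points S) (\<rho> g) & poly_germ S (fst z') U F \<notin> snd z'"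
  if z': "z' \<in> line_points S" "fst z' \<in> W0" for z'
 proof -
  note hm = \<kappa>_hom[OF line_pointsD(1)[OF z'(1)]]
  have "fst z' \<in> U" using z' W0 by auto
  then show ?thesis using primeideal_mult_iff[OF line_pointsD(2)[OF z'(1)] ring_hom_closed[OF hm const_closed[OF g(1)]]
     ring_hom_closed[OF poly_germ_hom[OF U(1)] U(2)]] e[OF z'(2)] \<kappa>_const_mem[OF z'(1) g(1)] by simp
 qed
 have "\<kappa> z ?G \<notin> snd z" using mem[OF z(1)] mem0[OF z(1) W0(2)] h g z by simp
 moreover have "{z' \<in> topspace line_top. \<kappa> z' ?G \<notin> snd z'} \<subseteq> W"
  using mem mem0 h(3) W0(3) U(4) unfolding topspace_line by blast
 ultimately show "\<exists>F\<in>carrier (UP R). \<kappa> z F \<notin> snd z & {z' \<in> topspace line_top. \<kappa> z' F \<notin> snd z'} \<subseteq> W"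
  using U.m_closed[OF const_closed[OF h(1)] g(2)] by blast
next
 fix W a z assume W: "openin line_top W" "a \<in> line_N W" "z \<in> W"
 obtain U F where U: "opens S U" "F \<in> carrier (UP (sections S U))"
  "\<And>z. z \<in> W ==> fst z \<in> U" "\<And>z. z \<in> W ==> a z = poly_germ S (fst z) U F" using W(2) by (rule line_NE) blast
 have z: "z \<in> line_points S" using openin_subset[OF W(1)] W(3) unfolding topspace_line by blast
 obtain g F0 W0 where g: "g \<in> carrier R" "F0 \<in> carrier (UP R)" "fst z \<in> locus S (points S) (\<rho> g)"
  and W0: "opens S W0" "fst z \<in> W0" "W0 \<subseteq> U"
  and e: "\<And>z. fst z \<in> W0 ==> \<kappa> z (const g) \<otimes>\<^bsub>K (fst z)\<^esub> poly_germ S (fst z) U F = \<kappa> z F0"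
  using poly_fracs[OF U(1) U(3)[OF W(3)] U(2)] by blast
 let ?W = "W \<inter> {z \<in> line_points S. fst z \<in> W0}"
 have "openin line_top ?W" using W(1) open_line_over[OF W0(1)] by (simp add: openin_Int)
 moreover have "\<kappa> z' (const g) \<otimes>\<^bsub>K (fst z')\<^esub> a z' = \<kappa> z' F0" if "z' \<in> ?W" for z' using that U(4) e by simp
 moreover have "\<kappa> z (const g) \<notin> snd z" using \<kappa>_const_mem[OF z g(1)] g(3) by simp
 ultimately show "\<exists>F\<in>carrier (UP R). \<exists>G\<in>carrier (UP R). \<kappa> z G \<notin> snd z &
   (\<exists>V. openin line_top V & z \<in> V & V \<subseteq> W & (\<forall>p'\<in>V. \<kappa> p' G \<otimes>\<^bsub>K (fst p')\<^esub> a p' = \<kappa> p' F))"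
  using g(2) const_closed[OF g(1)] W(3) z W0(2) by (intro bexI[of _ F0] bexI[of _ "const g"] conjI exI[of _ ?W]) auto
next
 fix z F h assume z: "z \<in> topspace line_top" and F: "F \<in> carrier (UP R)" and h: "h \<in> carrier (K (fst z))" "h \<notin> snd z"
  and 0: "h \<otimes>\<^bsub>K (fst z)\<^esub> \<kappa> z F = \<zero>\<^bsub>K (fst z)\<^esub>"
 have zl: "z \<in> line_points S" using z topspace_line by simp
 note zp = line_pointsD(1)[OF zl]
 note hm = \<kappa>_hom[OF zp]
 interpret Z: cring "K (fst z)" by (rule cring_UP[OF cring_stalk[OF zp]])
 obtain g H where g: "g \<in> carrier R" "fst z \<in> locus S (points S) (\<rho> g)" "H \<in> carrier (UP R)"
  "\<kappa> z (const g) \<otimes>\<^bsub>K (fst z)\<^esub> h = \<kappa> z H" using stalk_poly_fracs[OF zp h(1)] by blast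
 have gc: "\<kappa> z (const g) \<in> carrier (K (fst z))" "\<kappa> z F \<in> carrier (K (fst z))" "\<kappa> z H \<in> carrier (K (fst z))"
  using ring_hom_closed[OF hm] const_closed[OF g(1)] F g(3) by auto
 have "\<kappa> z (H \<otimes>\<^bsub>UP R\<^esub> F) = \<kappa> z (const g) \<otimes>\<^bsub>K (fst z)\<^esub> (h \<otimes>\<^bsub>K (fst z)\<^esub> \<kappa> z F)"
  using ring_hom_mult[OF hm g(3) F] g(4)[symmetric] gc h(1) by (simp add: Z.m_assoc)
 then have "\<kappa> z (H \<otimes>\<^bsub>UP R\<^esub> F) = \<zero>\<^bsub>K (fst z)\<^esub>" using 0 gc by simp
 then obtain k where k: "k \<in> carrier R" "fst z \<in> locus S (points S) (\<rho> k)" "const k \<otimes>\<^bsub>UP R\<^esub> (H \<otimes>\<^bsub>UP R\<^esub> F) = \<zero>\<^bsub>UP R\<^esub>"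
  using \<kappa>_ker[OF zp U.m_closed[OF g(3) F]] by blast
 have "\<kappa> z H \<notin> snd z"
  using primeideal_mult_iff[OF line_pointsD(2)[OF zl] gc(1) h(1)] g(2,4) h(2) \<kappa>_const_mem[OF zl g(1)] by simp
 then have "\<kappa> z (const k \<otimes>\<^bsub>UP R\<^esub> H) \<notin> snd z"
  using primeideal_mult_iff[OF line_pointsD(2)[OF zl] ring_hom_closed[OF hm const_closed[OF k(1)]] gc(3)]
   ring_hom_mult[OF hm const_closed[OF k(1)] g(3)] \<kappa>_const_mem[OF zl k(1)] k(2) by simp
 moreover have "(const k \<otimes>\<^bsub>UP R\<^esub> H) \<otimes>\<^bsub>UP R\<^esub> F = \<zero>\<^bsub>UP R\<^esub>" using k(3) U.m_assoc[OF const_closed[OF k(1)] g(3) F] by simp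
 ultimately show "\<exists>G\<in>carrier (UP R). \<kappa> z G \<notin> snd z & G \<otimes>\<^bsub>UP R\<^esub> F = \<zero>\<^bsub>UP R\<^esub>"
  using U.m_closed[OF const_closed[OF k(1)] g(3)] by blast
qed

lemmas line_chart = line_chart_and_prm[THEN conjunct1]

lemma line_prm: "z \<in> line_points S ==>
  pT z = {F \<in> carrier (UP R). \<kappa> z F \<in> snd z}" using line_chart_and_prm points_Ga_times by blast

lemma line_prm_contract:
 assumes "z \<in> line_points S"
 shows "{a \<in> carrier R. const a \<in> pT z} = prm S (points S) R \<rho> (fst z)"
 unfolding line_prm[OF assms] using \<kappa>_const_mem[OF assms] const_closed unfolding prm_def by auto

text \<open>A prime of \<open>R[T]\<close> over the prime of a point \<open>x\<close> contains no constant that is a unit at \<open>x\<close>, hence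
it extends to \<open>\<O>\<^sub>x[T]\<close>.\<close>

lemma line_prm_image:
 "pT ` points (Ga_times S)
  = {Q. primeideal Q (UP R) & {a \<in> carrier R. const a \<in> Q} \<in> prm S (points S) R \<rho> ` points S}" (is "?l = ?r")
proof (intro equalityI subsetI)
 interpret Z: chart "Ga_times S" "points (Ga_times S)" "UP R" \<rho>' by (rule line_chart)
 fix Q assume "Q \<in> ?l"
 then obtain z where z: "z \<in> line_points S" "Q = pT z" unfolding points_Ga_times by blast
 show "Q \<in> ?r" unfolding z(2) using Z.prime z(1) line_prm_contract[OF z(1)] line_pointsD(1)[OF z(1)]
  unfolding points_Ga_times by blast
next
 fix Q assume "Q \<in> ?r"
 then obtain x where Q: "primeideal Q (UP R)" and x: "x \<in> points S" "{a \<in> carrier R. const a \<in> Q} = prm S (points S) R \<rho> x"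
  by auto
 define M where "M = const ` {g \<in> carrier R. x \<in> locus S (points S) (\<rho> g)}"
 define q where "q = {p \<in> carrier (K x). \<exists>m\<in>M. \<exists>F\<in>Q. \<kappa> (x, {}) m \<otimes>\<^bsub>K x\<^esub> p = \<kappa> (x, {}) F}"
 have constQ: "const g \<in> Q \<longleftrightarrow> x \<notin> locus S (points S) (\<rho> g)" if "g \<in> carrier R" for g
  using x(2) that unfolding prm_def by blast
 note ch = UP_ring.const_ring_hom[of R, unfolded UP_ring_def, OF R.ring_axioms]
 have M: "M \<subseteq> carrier (UP R)" "\<one>\<^bsub>UP R\<^esub> \<in> M" "\<And>m m'. m \<in> M ==> m' \<in> M ==> m \<otimes>\<^bsub>UP R\<^esub> m' \<in> M" "Q \<inter> M = {}"
 proof -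
  show "M \<subseteq> carrier (UP R)" unfolding M_def using const_closed by blast
  show "\<one>\<^bsub>UP R\<^esub> \<in> M" unfolding M_def using ring_hom_one[OF ch] locus_\<rho>_one x(1) by (intro image_eqI[of _ _ "\<one>"]) auto
  show "m \<otimes>\<^bsub>UP R\<^esub> m' \<in> M" if m: "m \<in> M" "m' \<in> M" for m m'
  proof -
   obtain g g' where "m = const g" "m' = const g'" "g \<in> carrier R" "g' \<in> carrier R"
    "x \<in> locus S (points S) (\<rho> g)" "x \<in> locus S (points S) (\<rho> g')" using m unfolding M_def by blast
   then show ?thesis using ring_hom_mult[OF ch, of g g'] locus_\<rho>_mult[of g g'] unfolding M_def
    by (intro image_eqI[of _ _ "g \<otimes> g'"]) auto
  qed
  show "Q \<inter> M = {}" unfolding M_def using constQ by blast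
 qed
 have x': "fst (x, {}) \<in> points S" using x(1) by simp
 have K: "cring (K x)" by (rule cring_UP[OF cring_stalk[OF x(1)]])
 have surj: "\<exists>m\<in>M. \<exists>F\<in>carrier (UP R). \<kappa> (x, {}) m \<otimes>\<^bsub>K x\<^esub> p = \<kappa> (x, {}) F" if "p \<in> carrier (K x)" for p
  using stalk_poly_fracs[OF x', of p] that unfolding M_def by auto
 have ker': "\<exists>m\<in>M. m \<otimes>\<^bsub>UP R\<^esub> F = \<zero>\<^bsub>UP R\<^esub>" if "F \<in> carrier (UP R)" "\<kappa> (x, {}) F = \<zero>\<^bsub>K x\<^esub>" for F
  using \<kappa>_ker[OF x' that(1)] that(2) unfolding M_def by auto
 note h = \<kappa>_hom[OF x', simplified]
 have ext: "primeideal q (K x)" unfolding q_def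
  by (rule prime_extension(1)[OF U.is_cring K h M(1,2) _ _ _ Q M(4)]) (fact M(3) surj ker')+
 have ext_iff: "\<kappa> (x, {}) F \<in> q \<longleftrightarrow> F \<in> Q" if "F \<in> carrier (UP R)" for F unfolding q_def
  by (rule prime_extension(2)[OF U.is_cring K h M(1,2) _ _ _ Q M(4) that]) (fact M(3) surj ker')+
 have "(x, q) \<in> line_points S"
 proof -
  have "up_ring.monom (K x) c 0 \<in> q \<longleftrightarrow> c \<notin> Units (stalk S x)" if c: "c \<in> carrier (stalk S x)" for c
  proof -
   interpret Z: cring "stalk S x" by (rule cring_stalk) fact
   obtain U s where U: "opens S U" "x \<in> U" "s \<in> \<Gamma> S U" "c = germ S x U s" using c by (rule stalk_carrierE)
   obtain a g W where g: "a \<in> carrier R" "g \<in> carrier R" "x \<in> locus S (points S) (\<rho> g)" and W: "opens S W" "x \<in> W" "W \<subseteq> U"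
     "res S (points S) W (\<rho> g) \<otimes>\<^bsub>sections S W\<^esub> res S U W s = res S (points S) W (\<rho> a)"
    using fracs[OF U(1) openin_subset[OF U(1)] U(2,3)] by blast
   have Wp: "W \<subseteq> points S" using W(1) openin_subset by blast
   have eq: "\<sigma> x g \<otimes>\<^bsub>stalk S x\<^esub> c = \<sigma> x a"
    using germ_mult[OF W(1,2) res_\<rho>_closed[OF W(1) Wp g(2)] res_closed[OF U(1) W(1,3) U(3)]] W(4)
     \<sigma>_res[OF W(1) Wp W(2)] g germ_res[OF U(1,3) W(1,3,2)] U(4) by simp
   have gu: "\<sigma> x g \<in> Units (stalk S x)" using \<sigma>_Units x(1) g by simp
   have "up_ring.monom (K x) (\<sigma> x g) 0 \<otimes>\<^bsub>K x\<^esub> up_ring.monom (K x) c 0 = up_ring.monom (K x) (\<sigma> x a) 0"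
    using ring_hom_mult[OF UP_ring.const_ring_hom[of "stalk S x", unfolded UP_ring_def, OF Z.ring_axioms]
      \<sigma>_closed[OF x(1) g(2)] c] eq by simp
   moreover have "up_ring.monom (K x) (\<sigma> x g) 0 \<otimes>\<^bsub>K x\<^esub> up_ring.monom (K x) c 0 \<in> q \<longleftrightarrow> up_ring.monom (K x) c 0 \<in> q"
    using primeideal_mult_iff[OF ext UP_monom_closed[OF Z.is_cring \<sigma>_closed[OF x(1) g(2)]] UP_monom_closed[OF Z.is_cring c]]
     \<kappa>_const[OF x' g(2)] ext_iff[OF const_closed[OF g(2)]] constQ[OF g(2)] g(3) by simp
   ultimately have "up_ring.monom (K x) c 0 \<in> q \<longleftrightarrow> \<kappa> (x, {}) (const a) \<in> q" using \<kappa>_const[OF x' g(1)] by simp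
   also have "\<dots> \<longleftrightarrow> \<sigma> x a \<notin> Units (stalk S x)"
    using ext_iff[OF const_closed[OF g(1)]] constQ[OF g(1)] \<sigma>_Units[OF x(1) g(1)] by simp
   also have "\<dots> \<longleftrightarrow> c \<notin> Units (stalk S x)" using Z.Units_mult_iff[OF \<sigma>_closed[OF x(1) g(2)] c] gu eq by simp
   finally show ?thesis .
  qed
  then show ?thesis unfolding line_points_def using x(1) ext by auto
 qed
 moreover have "{F \<in> carrier (UP R). \<kappa> (x, q) F \<in> q} = Q"
 proof -
  have "\<kappa> (x, q) = \<kappa> (x, {})" unfolding \<kappa>_def by simp
  moreover have "Q \<subseteq> carrier (UP R)" using Q by (auto dest!: primeideal.axioms(1) intro: ideal.Icarr)
  ultimately show ?thesis using ext_iff by auto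
 qed
 ultimately show "Q \<in> ?l" using line_prm[of "(x, q)"] unfolding points_Ga_times by (intro image_eqI[of _ _ "(x, q)"]) auto
qed

end

section \<open>Charts over factorial rings\<close>

abbreviation tring :: "'a::comm_ring_1 ring" where "tring \<equiv> ring_of_type_algebra"

lemma tring_simps [simp]:
 "carrier (tring :: 'a::comm_ring_1 ring) = UNIV" "a \<otimes>\<^bsub>tring\<^esub> b = a * b" "\<one>\<^bsub>tring\<^esub> = (1::'a)"
 "a \<oplus>\<^bsub>tring\<^esub> b = a + b" "\<zero>\<^bsub>tring\<^esub> = (0::'a)" by (simp_all add: ring_of_type_algebra_def)

lemma cring_tring: "cring (tring :: 'a::comm_ring_1 ring)"
 by (rule cring_from_type_algebra)

lemma tring_prime_iff:
 fixes Q :: "'a::comm_ring_1 set"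
 shows "primeideal Q tring \<longleftrightarrow> 0 \<in> Q & (\<forall>a\<in>Q. \<forall>b\<in>Q. a + b \<in> Q) & (\<forall>a\<in>Q. \<forall>x. x * a \<in> Q) &
  1 \<notin> Q & (\<forall>a b. a * b \<in> Q --> a \<in> Q \<or> b \<in> Q)"
proof
 assume Q: "primeideal Q tring"
 then interpret primeideal Q "tring :: 'a ring" .
 have "1 \<notin> Q" using localize.one_M[OF prime_localize[OF Q]] by simp
 then show "0 \<in> Q & (\<forall>a\<in>Q. \<forall>b\<in>Q. a + b \<in> Q) & (\<forall>a\<in>Q. \<forall>x. x * a \<in> Q) &
  1 \<notin> Q & (\<forall>a b. a * b \<in> Q --> a \<in> Q \<or> b \<in> Q)"
  using additive_subgroup.zero_closed[OF is_additive_subgroup] additive_subgroup.a_closed[OF is_additive_subgroup]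
   I_l_closed I_prime by simp
qed (rule primeidealI'[OF cring_tring]; auto)

lemma tring_primeD:
 fixes Q :: "'a::comm_ring_1 set"
 assumes "primeideal Q tring"
 shows "0 \<in> Q" "a \<in> Q ==> b \<in> Q ==> a + b \<in> Q" "a \<in> Q ==> x * a \<in> Q" "1 \<notin> Q"
  "a * b \<in> Q \<longleftrightarrow> a \<in> Q \<or> b \<in> Q" "a ^ n \<in> Q ==> a \<in> Q"
proof -
 note * = assms[unfolded tring_prime_iff]
 show "0 \<in> Q" "a \<in> Q ==> b \<in> Q ==> a + b \<in> Q" "a \<in> Q ==> x * a \<in> Q" "1 \<notin> Q"
  "a * b \<in> Q \<longleftrightarrow> a \<in> Q \<or> b \<in> Q" using * by (blast, blast, blast, blast, metis mult.commute)
 show "a ^ n \<in> Q ==> a \<in> Q"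
 proof (induction n)
  case (Suc n)
  then have "a \<in> Q \<or> a ^ n \<in> Q" using * by simp
  then show ?case using Suc.IH by blast
 qed (use * in simp)
qed

lemma prime_zero: "primeideal {0 :: 'a::idom} tring"
 unfolding tring_prime_iff by auto

lemma prime_principal:
 fixes p :: "'a::idom"
 assumes "prime_elem p" shows "primeideal {a. p dvd a} tring"
proof -
 have "\<not> p dvd 1" using assms by (rule prime_elem_not_unit)
 then show ?thesis unfolding tring_prime_iff mem_Collect_eq prime_elem_dvd_mult_iff[OF assms]
  by (intro conjI allI ballI impI) (auto simp: prime_elem_dvd_mult_iff[OF assms])
qed

lemma dvd_power_of_primes:
 fixes g f :: "'a::factorial_semiring"
 assumes "g \<noteq> 0" "\<And>p. prime_elem p ==> p dvd g ==> p dvd f"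
 shows "\<exists>n. g dvd f ^ n" using assms
proof (induction g rule: prime_divisors_induct)
 case (unit x)
 then show ?case by (intro exI[of _ 0]) simp
next
 case (factor p x)
 have "x \<noteq> 0" using factor.prems(1) by auto
 moreover have "q dvd f" if "prime_elem q" "q dvd x" for q using factor.prems(2)[of q] that by simp
 ultimately obtain n where "x dvd f ^ n" using factor.IH by blast
 moreover have "p dvd f" using factor by simp
 ultimately have "p * x dvd f ^ Suc n" by (simp add: mult_dvd_mono)
 then show ?case by blast
qed simp

lemma chart_ring_iso:
 assumes c: "chart S V R \<rho>" and R': "cring R'" and h: "h \<in> ring_hom R' R" "bij_betw h (carrier R') (carrier R)"
 shows "chart S V R' (\<lambda>F. \<rho> (h F))" and "prm S V R' (\<lambda>F. \<rho> (h F)) y = {F \<in> carrier R'. h F \<in> prm S V R \<rho> y}"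
proof -
 interpret chart S V R \<rho> by fact
 interpret R': cring R' by fact
 interpret h: ring_hom_cring R' R h using R' R.is_cring h(1) by (simp add: ring_hom_cring_def ring_hom_cring_axioms_def)
 have ex: "\<exists>F'\<in>carrier R'. h F' = F" if "F \<in> carrier R" for F using h(2) that by (metis bij_betw_imp_surj_on imageE)
 have hc: "h F \<in> carrier R" if "F \<in> carrier R'" for F by (rule ring_hom_closed[OF h(1) that])
 have h0: "F = \<zero>\<^bsub>R'\<^esub>" if "F \<in> carrier R'" "h F = \<zero>\<^bsub>R\<^esub>" for F
  using h(2) that h.hom_zero unfolding bij_betw_def inj_on_def by (metis R'.zero_closed)
 show p: "prm S V R' (\<lambda>F. \<rho> (h F)) y = {F \<in> carrier R'. h F \<in> prm S V R \<rho> y}" for y unfolding prm_def using hc by auto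
 show "chart S V R' (\<lambda>F. \<rho> (h F))"
 proof (intro chart.intro chart_axioms.intro rspace_axioms R' open_V)
  show "(\<lambda>F. \<rho> (h F)) \<in> ring_hom R' (sections S V)" using ring_hom_trans[OF h(1) hom] by (simp add: o_def)
  show "primeideal (prm S V R' (\<lambda>F. \<rho> (h F)) y) R'" if "y \<in> V" for y
   unfolding p by (rule h.ring.primeideal_vimage[OF R' prime[OF that]])
  show "inj_on (prm S V R' (\<lambda>F. \<rho> (h F))) V"
  proof (rule inj_onI)
   fix x y assume xy: "x \<in> V" "y \<in> V" and e: "prm S V R' (\<lambda>F. \<rho> (h F)) x = prm S V R' (\<lambda>F. \<rho> (h F)) y"
   have "F \<in> prm S V R \<rho> x \<longleftrightarrow> F \<in> prm S V R \<rho> y" if F: "F \<in> carrier R" for F using ex[OF F] e unfolding p by blast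
   then have "prm S V R \<rho> x = prm S V R \<rho> y" unfolding prm_def by blast
   then show "x = y" using inj xy unfolding inj_on_def by blast
  qed
  fix W y assume W: "opens S W" "W \<subseteq> V" "y \<in> W"
  obtain F where "F \<in> carrier R" "y \<in> locus S V (\<rho> F)" "locus S V (\<rho> F) \<subseteq> W" using basis[OF W] by blast
  then show "\<exists>F\<in>carrier R'. y \<in> locus S V (\<rho> (h F)) & locus S V (\<rho> (h F)) \<subseteq> W" using ex by metis
  {
   fix s assume s: "s \<in> \<Gamma> S W"
   obtain F G W' where FG: "F \<in> carrier R" "G \<in> carrier R" and *: "y \<in> locus S V (\<rho> G)" "opens S W'" "y \<in> W'" "W' \<subseteq> W"
    "res S V W' (\<rho> G) \<otimes>\<^bsub>sections S W'\<^esub> res S W W' s = res S V W' (\<rho> F)" using fracs[OF W s] by blast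
   obtain F' G' where "F' \<in> carrier R'" "h F' = F" "G' \<in> carrier R'" "h G' = G" using ex FG by metis
   then show "\<exists>F\<in>carrier R'. \<exists>G\<in>carrier R'. y \<in> locus S V (\<rho> (h G)) & (\<exists>W'. opens S W' & y \<in> W' & W' \<subseteq> W &
     res S V W' (\<rho> (h G)) \<otimes>\<^bsub>sections S W'\<^esub> res S W W' s = res S V W' (\<rho> (h F)))"
    using * by (intro bexI[of _ F'] bexI[of _ G'] conjI exI[of _ W']) simp_all
  }
  fix F assume F: "F \<in> carrier R'" and 0: "res S V W (\<rho> (h F)) = \<zero>\<^bsub>sections S W\<^esub>"
  obtain k where k: "k \<in> carrier R" "y \<in> locus S V (\<rho> k)" "k \<otimes>\<^bsub>R\<^esub> h F = \<zero>\<^bsub>R\<^esub>" using ker[OF W hc[OF F] 0] by blast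
  obtain k' where k': "k' \<in> carrier R'" "h k' = k" using ex[OF k(1)] by blast
  have "k' \<otimes>\<^bsub>R'\<^esub> F = \<zero>\<^bsub>R'\<^esub>" by (rule h0) (use k k' F in auto)
  then show "\<exists>k\<in>carrier R'. y \<in> locus S V (\<rho> (h k)) & k \<otimes>\<^bsub>R'\<^esub> F = \<zero>\<^bsub>R'\<^esub>" using k k' by blast
 qed
qed

lemma finsum_tring: "finite I ==> finsum (tring :: 'a::comm_ring_1 ring) f I = sum f I"
proof (induction I rule: finite_induct)
 interpret cring "tring :: 'a ring" by (rule cring_tring)
 {
  case empty
  show ?case by simp
 next
  case (insert x I)
  then show ?case using finsum_insert[of I x f] by simp
 }
qed

lemma coeff_UP_hom: "coeff \<in> ring_hom (tring :: 'a::comm_ring_1 poly ring) (UP tring)"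
 and coeff_UP_bij: "bij_betw coeff (carrier (tring :: 'a::comm_ring_1 poly ring)) (carrier (UP tring))"
proof -
 have c: "coeff p \<in> carrier (UP (tring :: 'a ring))" for p :: "'a poly" unfolding UP_carrier using coeff_eq_0[of p] by auto
 show "coeff \<in> ring_hom (tring :: 'a poly ring) (UP tring)"
 proof (rule ring_hom_memI)
  fix p q :: "'a poly"
  show "coeff (p \<otimes>\<^bsub>tring\<^esub> q) = coeff p \<otimes>\<^bsub>UP tring\<^esub> coeff q"
   by (rule ext) (simp add: UP_mult_apply[OF c c] finsum_tring coeff_mult)
  show "coeff (p \<oplus>\<^bsub>tring\<^esub> q) = coeff p \<oplus>\<^bsub>UP tring\<^esub> coeff q" by (rule ext) (simp add: UP_add_apply[OF c c])
 next
  show "coeff \<one>\<^bsub>tring\<^esub> = \<one>\<^bsub>UP (tring :: 'a ring)\<^esub>"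
   by (rule ext) (simp add: UP_one_apply one_pCons coeff_pCons split: nat.split)
 qed (rule c)
 show "bij_betw coeff (carrier (tring :: 'a poly ring)) (carrier (UP tring))" unfolding bij_betw_def
 proof (intro conjI equalityI subsetI)
  show "inj_on coeff (carrier (tring :: 'a poly ring))" by (auto simp: inj_on_def coeff_inject)
  fix F assume "F \<in> carrier (UP (tring :: 'a ring))"
  then obtain N where "\<forall>n>N. F n = 0" unfolding UP_carrier by auto
  then have "coeff (Abs_poly F) = F" by (intro coeff_Abs_poly) auto
  then show "F \<in> coeff ` carrier (tring :: 'a poly ring)" by (metis UNIV_I image_eqI tring_simps(1))
 qed (use c in auto)
qed

lemma coeff_const_UP: "coeff [:a:] = up_ring.monom (UP tring) a 0"
 by (rule ext) (simp add: UP_monom_apply coeff_pCons split: nat.split)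

text \<open>A chart over a factorial domain \<open>B\<close> with image the basic open set of \<open>f\<close>.  A section is
  locally a fraction; reduced fractions are unique up to units, so a single reduced fraction
  represents the section everywhere, and every prime factor of its denominator divides \<open>f\<close>.\<close>

locale fchart = chart S V "tring :: 'b::{factorial_ring_gcd, semiring_gcd_mult_normalize} ring" \<rho>
 for S :: "('p, 's) ringed_space" and V and \<rho> :: "'b::{factorial_ring_gcd, semiring_gcd_mult_normalize} => 's" +
 fixes f :: 'b
 assumes f0: "f \<noteq> 0" and image: "prm S V tring \<rho> ` V = {Q. primeideal Q tring & f \<notin> Q}"
begin

lemma mem_prm: "y \<in> V ==> F \<in> prm S V tring \<rho> y \<longleftrightarrow> y \<notin> locus S V (\<rho> F)"
 unfolding prm_def by simp

lemma generic_ex: "\<exists>y\<in>V. prm S V tring \<rho> y = {0}"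
proof -
 have "{0} \<in> prm S V tring \<rho> ` V" unfolding image using prime_zero f0 by blast
 then show ?thesis by (metis imageE)
qed

lemma nonempty_open_basic:
 assumes W: "opens S W" "W \<subseteq> V" "y \<in> W"
 obtains F where "F \<noteq> 0" "y \<in> locus S V (\<rho> F)" "locus S V (\<rho> F) \<subseteq> W"
proof -
 obtain F where F: "y \<in> locus S V (\<rho> F)" "locus S V (\<rho> F) \<subseteq> W" using basis[OF W] by blast
 have yV: "y \<in> V" using W by blast
 have "F \<noteq> 0" using F(1) mem_prm[OF yV, of F] tring_primeD(1)[OF prime[OF yV]] by blast
 then show thesis using that F by blast
qed

lemma generic_mem:
 assumes \<eta>: "\<eta> \<in> V" "prm S V tring \<rho> \<eta> = {0}" and W: "opens S W" "W \<subseteq> V" "y \<in> W"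
 shows "\<eta> \<in> W"
proof -
 obtain F where F: "F \<noteq> 0" "y \<in> locus S V (\<rho> F)" "locus S V (\<rho> F) \<subseteq> W" using nonempty_open_basic[OF W] .
 then show ?thesis using mem_prm[OF \<eta>(1), of F] \<eta>(2) by blast
qed

lemma ker_zero:
 assumes W: "opens S W" "W \<subseteq> V" "y \<in> W" and 0: "\<rho>r W F = \<zero>\<^bsub>sections S W\<^esub>"
 shows "F = 0"
proof -
 obtain h where h: "y \<in> locus S V (\<rho> h)" "h * F = 0" using ker[OF W _ 0] by auto
 have yV: "y \<in> V" using W by blast
 have "h \<noteq> 0" using h(1) mem_prm[OF yV, of h] tring_primeD(1)[OF prime[OF yV]] by blast
 then show ?thesis using h(2) by simp
qed

lemma locus_\<rho>_times: "locus S V (\<rho> (F * G)) = locus S V (\<rho> F) \<inter> locus S V (\<rho> G)"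
 using locus_\<rho>_mult[of F G] by simp

lemma \<rho>_mult: "\<rho> (F * G) = \<rho> F \<otimes>\<^bsub>sections S V\<^esub> \<rho> G"
 using ring_hom_mult[OF hom, of F G] by simp

lemma res_\<rho>_times:
 "opens S W ==> W \<subseteq> V ==> \<rho>r W (F * G) = \<rho>r W F \<otimes>\<^bsub>sections S W\<^esub> \<rho>r W G" using ring_hom_mult[OF res_\<rho>_hom, of W F G] by simp

lemma cancel_factor:
 assumes W: "opens S W" "W \<subseteq> V" and s: "s \<in> \<Gamma> S W" and u: "W \<subseteq> locus S V (\<rho> u)"
  and e: "\<rho>r W (u * G) \<otimes>\<^bsub>sections S W\<^esub> s = \<rho>r W (u * F)"
 shows "\<rho>r W G \<otimes>\<^bsub>sections S W\<^esub> s = \<rho>r W F"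
proof -
 interpret W: cring "sections S W" by (rule cring_sections) fact
 note c = res_\<rho>_closed[OF W, of F] res_\<rho>_closed[OF W, of G] res_\<rho>_closed[OF W, of u]
 have "\<rho>r W u \<otimes>\<^bsub>sections S W\<^esub> (\<rho>r W G \<otimes>\<^bsub>sections S W\<^esub> s)
   = \<rho>r W u \<otimes>\<^bsub>sections S W\<^esub> \<rho>r W F" using e c s unfolding res_\<rho>_times[OF W] by (simp add: W.m_assoc)
 moreover have "\<rho>r W u \<in> Units (sections S W)" by (rule res_\<rho>_Units[OF W(1) u]) simp
 ultimately show ?thesis using c s by (simp add: W.Units_l_cancel)
qed

lemma reduced_frac:
 assumes s: "s \<in> \<Gamma> S V" and y: "y \<in> V"
 obtains W F G where "opens S W" "y \<in> W" "W \<subseteq> V" "coprime F G" "G \<noteq> 0" "W \<subseteq> locus S V (\<rho> G)"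
  "\<rho>r W G \<otimes>\<^bsub>sections S W\<^esub> res S V W s = \<rho>r W F"
proof -
 obtain W F G where W: "opens S W" "y \<in> W" "W \<subseteq> V" "W \<subseteq> locus S V (\<rho> G)"
  and e: "\<rho>r W G \<otimes>\<^bsub>sections S W\<^esub> res S V W s = \<rho>r W F" using fracs_on[OF open_V subset_refl y s] by metis
 have G0: "G \<noteq> 0" using W(2,4) mem_prm[OF y, of G] tring_primeD(1)[OF prime[OF y]] by blast
 obtain F' G' where d: "F = F' * gcd F G" "G = G' * gcd F G" "coprime F' G'" using gcd_coprime_exists[of F G] G0 by auto
 have "locus S V (\<rho> G) = locus S V (\<rho> (gcd F G)) \<inter> locus S V (\<rho> G')"
  using locus_\<rho>_times[of "gcd F G" G'] d(2) by (simp add: mult.commute)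
 then have u: "W \<subseteq> locus S V (\<rho> (gcd F G))" "W \<subseteq> locus S V (\<rho> G')" using W(4) by auto
 have "\<rho>r W G' \<otimes>\<^bsub>sections S W\<^esub> res S V W s = \<rho>r W F'" by (rule cancel_factor[OF W(1,3) res_closed[OF open_V W(1,3) s] u(1)])
   (use e d(1,2) in \<open>simp add: mult.commute\<close>)
 moreover have "G' \<noteq> 0" using d(2) G0 by auto
 ultimately show thesis using that[OF W(1-3) d(3) _ u(2)] by blast
qed

lemma section_global_frac:
 assumes s: "s \<in> \<Gamma> S V"
 shows "\<exists>n F. \<rho> (f ^ n) \<otimes>\<^bsub>sections S V\<^esub> s = \<rho> F"
proof -
 interpret SV: cring "sections S V" by (rule cring_sections[OF open_V])
 obtain \<eta> where \<eta>: "\<eta> \<in> V" "prm S V tring \<rho> \<eta> = {0}" using generic_ex by blast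
 obtain W0 F0 G0 where W0: "opens S W0" "\<eta> \<in> W0" "W0 \<subseteq> V" "coprime F0 G0" "G0 \<noteq> 0"
  and e0: "\<rho>r W0 G0 \<otimes>\<^bsub>sections S W0\<^esub> res S V W0 s = \<rho>r W0 F0" using reduced_frac[OF s \<eta>(1)] by metis
 have loc: "y \<in> locus S V (\<rho> G0) & (\<exists>W. opens S W & y \<in> W & W \<subseteq> V &
   \<rho>r W G0 \<otimes>\<^bsub>sections S W\<^esub> res S V W s = \<rho>r W F0)" if y: "y \<in> V" for y
 proof -
  obtain W F G where W: "opens S W" "y \<in> W" "W \<subseteq> V" "coprime F G" "G \<noteq> 0" "W \<subseteq> locus S V (\<rho> G)"
   and e: "\<rho>r W G \<otimes>\<^bsub>sections S W\<^esub> res S V W s = \<rho>r W F" using reduced_frac[OF s y] .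
  let ?I = "W0 \<inter> W"
  have I: "opens S ?I" "?I \<subseteq> V" "\<eta> \<in> ?I" using W0 W generic_mem[OF \<eta> W(1,3,2)] by (auto simp: openin_Int)
  interpret I: cring "sections S ?I" by (rule cring_sections) fact
  note c = res_\<rho>_closed[OF I(1,2)] and t = res_closed[OF open_V I(1,2) s]
  have down: "\<rho>r ?I G' \<otimes>\<^bsub>sections S ?I\<^esub> res S V ?I s = \<rho>r ?I F'"
   if "opens S W'" "W' \<subseteq> V" "?I \<subseteq> W'" "\<rho>r W' G' \<otimes>\<^bsub>sections S W'\<^esub> res S V W' s = \<rho>r W' F'" for W' F' G'
   using arg_cong[OF that(4), of "res S W' ?I"]
    res_mult[OF that(1) I(1) that(3) res_\<rho>_closed[OF that(1,2)] res_closed[OF open_V that(1,2) s]]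
    res_\<rho>_res[OF that(1) I(1) that(3,2)] res_res[OF open_V that(1) I(1) that(3,2) s] by simp
  have a: "\<rho>r ?I G0 \<otimes>\<^bsub>sections S ?I\<^esub> res S V ?I s = \<rho>r ?I F0" by (rule down[OF W0(1,3) _ e0]) auto
  have b: "\<rho>r ?I G \<otimes>\<^bsub>sections S ?I\<^esub> res S V ?I s = \<rho>r ?I F" by (rule down[OF W(1,3) _ e]) auto
  have eq: "\<rho>r ?I (G * F0) = \<rho>r ?I (G0 * F)"
   unfolding res_\<rho>_times[OF I(1,2)] a[symmetric] b[symmetric] using c[of G] c[of G0] t by (simp add: I.m_lcomm)
  interpret h: ring_hom_cring "tring :: 'b ring" "sections S ?I" "\<lambda>F. \<rho>r ?I F"
   using res_\<rho>_hom[OF I(1,2)] cring_tring I.is_cring by (simp add: ring_hom_cring_def ring_hom_cring_axioms_def)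
  have "\<rho>r ?I (G * F0 + (- 1) * (G0 * F)) = \<zero>\<^bsub>sections S ?I\<^esub>"
  proof -
   have "\<zero>\<^bsub>sections S ?I\<^esub> = \<rho>r ?I ((1 + (- 1)) * (G0 * F))" using h.hom_zero by simp
   also have "\<dots> = \<rho>r ?I (G0 * F) \<oplus>\<^bsub>sections S ?I\<^esub> \<rho>r ?I ((- 1) * (G0 * F))"
    using h.hom_add[of "G0 * F" "(- 1) * (G0 * F)"] by simp
   also have "\<dots> = \<rho>r ?I (G * F0 + (- 1) * (G0 * F))" using h.hom_add[of "G * F0" "(- 1) * (G0 * F)"] eq by simp
   finally show ?thesis by simp
  qed
  then have x: "G * F0 = G0 * F" using ker_zero[OF I] by fastforce
  then have "G0 dvd G * F0" by simp
  then have "G0 dvd G" using W0(4) by (metis coprime_commute coprime_dvd_mult_left_iff)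
  then obtain u where u: "G = u * G0" by (metis dvd_def mult.commute)
  then have F: "F = u * F0" using x W0(5) by auto
  have "y \<in> locus S V (\<rho> u) \<inter> locus S V (\<rho> G0)" using locus_\<rho>_times[of u G0] u W(2,6) by auto
  moreover have Wu: "W \<subseteq> locus S V (\<rho> u)" using locus_\<rho>_times[of u G0] u W(6) by auto
  have "\<rho>r W G0 \<otimes>\<^bsub>sections S W\<^esub> res S V W s = \<rho>r W F0"
   by (rule cancel_factor[OF W(1,3) res_closed[OF open_V W(1,3) s] Wu e[unfolded u F]])
  ultimately show ?thesis using W(1-3) by blast
 qed
 have "\<rho> G0 \<otimes>\<^bsub>sections S V\<^esub> s = \<rho> F0"
 proof (rule sections_eqI[OF open_V])
  fix y assume "y \<in> V"
  then obtain W where W: "opens S W" "y \<in> W" "W \<subseteq> V" "\<rho>r W G0 \<otimes>\<^bsub>sections S W\<^esub> res S V W s = \<rho>r W F0" using loc by blast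
  have "res S V W (\<rho> G0 \<otimes>\<^bsub>sections S V\<^esub> s) = \<rho>r W F0" using res_mult[OF open_V W(1,3) \<rho>_closed[of G0] s] W(4) by simp
  then show "\<exists>W. opens S W & y \<in> W & W \<subseteq> V & res S V W (\<rho> G0 \<otimes>\<^bsub>sections S V\<^esub> s) = \<rho>r W F0" using W(1-3) by blast
 qed (use s \<rho>_closed in auto)
 moreover have "\<exists>n. G0 dvd f ^ n"
 proof (rule dvd_power_of_primes[OF W0(5)])
  fix p assume p: "prime_elem p" "p dvd G0"
  show "p dvd f"
  proof (rule ccontr)
   assume "\<not> p dvd f"
   then have "{a. p dvd a} \<in> prm S V tring \<rho> ` V" unfolding image using prime_principal[OF p(1)] by blast
   then obtain y where y: "y \<in> V" "prm S V tring \<rho> y = {a. p dvd a}" by auto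
   then show False using loc[OF y(1)] mem_prm[OF y(1), of G0] p(2) by blast
  qed
 qed
 then obtain n k where "f ^ n = k * G0" by (metis dvd_def mult.commute)
 then have "\<rho> (f ^ n) = \<rho> k \<otimes>\<^bsub>sections S V\<^esub> \<rho> G0" using \<rho>_mult by simp
 ultimately have "\<rho> (f ^ n) \<otimes>\<^bsub>sections S V\<^esub> s = \<rho> (k * F0)"
  using \<rho>_closed[of k] \<rho>_closed[of G0] s \<rho>_mult[of k F0] by (simp add: SV.m_assoc)
 then show ?thesis by blast
qed

end

section \<open>Functions on the total space as elements of a field\<close>

definition is_ideal :: "'a::comm_ring_1 set => bool" where
 "is_ideal I \<longleftrightarrow> 0 \<in> I & (\<forall>a\<in>I. \<forall>b\<in>I. a + b \<in> I) & (\<forall>a\<in>I. \<forall>r. r * a \<in> I)"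

lemma is_ideal_add_principal:
 assumes "is_ideal I" shows "is_ideal {a + r * b | a r. a \<in> I}" unfolding is_ideal_def
proof (intro conjI ballI allI)
 note I = assms[unfolded is_ideal_def]
 have in_set: "a + r * b \<in> {a + r * b | a r. a \<in> I}" if "a \<in> I" for a r using that by blast
 show "0 \<in> {a + r * b | a r. a \<in> I}" using in_set[of 0 0] I by simp
 fix x assume "x \<in> {a + r * b | a r. a \<in> I}"
 then obtain a r where x: "x = a + r * b" "a \<in> I" by blast
 show "t * x \<in> {a + r * b | a r. a \<in> I}" for t using in_set[of "t * a" "t * r"] x I by (simp add: algebra_simps)
 fix y assume "y \<in> {a + r * b | a r. a \<in> I}"
 then obtain a' r' where y: "y = a' + r' * b" "a' \<in> I" by blast
 show "x + y \<in> {a + r * b | a r. a \<in> I}" using in_set[of "a + a'" "r + r'"] x y I by (simp add: algebra_simps)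
qed

text \<open>By Zorn: an ideal that is maximal among those without powers of \<open>x\<close> is prime.\<close>

lemma prime_avoiding_powers:
 fixes x :: "'a::comm_ring_1"
 assumes I: "is_ideal I" and x: "\<And>n. x ^ n \<notin> I"
 obtains p where "primeideal p tring" "I \<subseteq> p" "x \<notin> p"
proof -
 define \<A> where "\<A> = {J. is_ideal J & I \<subseteq> J & (\<forall>n. x ^ n \<notin> J)}"
 have "\<exists>M\<in>\<A>. \<forall>J\<in>\<A>. M \<subseteq> J --> J = M"
 proof (rule subset_Zorn_nonempty)
  show "\<A> \<noteq> {}" using I x unfolding \<A>_def by blast
  fix \<C> assume ne: "\<C> \<noteq> {}" and ch: "subset.chain \<A> \<C>"
  have C: "J \<in> \<A>" if "J \<in> \<C>" for J using ch that unfolding subset_chain_def by blast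
  have "is_ideal (\<Union>\<C>)" unfolding is_ideal_def
  proof (intro conjI ballI allI)
   show "0 \<in> \<Union>\<C>" using ne C unfolding \<A>_def is_ideal_def by blast
   fix a assume "a \<in> \<Union>\<C>"
   then obtain J where J: "J \<in> \<C>" "a \<in> J" by blast
   show "r * a \<in> \<Union>\<C>" for r using J C[OF J(1)] unfolding \<A>_def is_ideal_def by blast
   fix b assume "b \<in> \<Union>\<C>"
   then obtain J' where J': "J' \<in> \<C>" "b \<in> J'" by blast
   have "J \<subseteq> J' \<or> J' \<subseteq> J" using ch J J' unfolding subset_chain_def by blast
   then obtain M where "M \<in> \<C>" "a \<in> M" "b \<in> M" using J J' by blast
   then show "a + b \<in> \<Union>\<C>" using C[of M] unfolding \<A>_def is_ideal_def by blast
  qed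
  then show "\<Union>\<C> \<in> \<A>" using ne C unfolding \<A>_def by blast
 qed
 then obtain M where M: "M \<in> \<A>" "\<And>J. J \<in> \<A> ==> M \<subseteq> J ==> J = M" by blast
 have id: "is_ideal M" and nx: "\<And>n. x ^ n \<notin> M" and IM: "I \<subseteq> M" using M(1) unfolding \<A>_def by auto
 note idM = id[unfolded is_ideal_def]
 have big: "\<exists>n a r. x ^ n = a + r * b & a \<in> M" if b: "b \<notin> M" for b
 proof (rule ccontr)
  assume no: "\<not> ?thesis"
  let ?J = "{a + r * b | a r. a \<in> M}"
  have in_set: "a + r * b \<in> ?J" if "a \<in> M" for a r using that by blast
  have sub: "M \<subseteq> ?J" using in_set[of _ 0] by auto
  have "b \<in> ?J" using in_set[of 0 1] idM by simp
  moreover have "?J \<in> \<A>" unfolding \<A>_def using is_ideal_add_principal[OF id] sub IM no by blast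
  ultimately show False using M(2)[of ?J] sub b by blast
 qed
 have "primeideal M tring" unfolding tring_prime_iff
 proof (intro conjI allI impI)
  show "1 \<notin> M" using nx[of 0] by simp
  fix a b assume ab: "a * b \<in> M"
  show "a \<in> M \<or> b \<in> M"
  proof (rule ccontr)
   assume "\<not> (a \<in> M \<or> b \<in> M)"
   then obtain n c r n' c' r' where 1: "x ^ n = c + r * a" "c \<in> M" and 2: "x ^ n' = c' + r' * b" "c' \<in> M"
    using big[of a] big[of b] by blast
   have "x ^ (n + n') = (c' + r' * b) * c + ((r * a) * c' + (r * r') * (a * b))"
    unfolding power_add 1 2 by (simp add: algebra_simps)
   also have "\<dots> \<in> M" using idM 1(2) 2(2) ab by blast
   finally show False using nx by blast
  qed
 qed (use idM in blast)+
 moreover have "x \<notin> M" using nx[of 1] by simp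
 ultimately show thesis using that IM by blast
qed

subsection \<open>The coordinate ring of the plane\<close>

type_synonym plane_ring = "complex poly poly"

definition X1 :: plane_ring where "X1 = [:[:0, 1:]:]"
definition Y1 :: plane_ring where "Y1 = [:0, 1:]"

lemma plane_decompose: "\<exists>c s t. r = [:[:c:]:] + X1 * s + Y1 * t & c = poly (poly r 0) 0"
proof -
 obtain a t where r: "r = pCons a t" by (cases r)
 obtain c s where a: "a = pCons c s" by (cases a)
 have "r = [:[:c:]:] + X1 * [:s:] + Y1 * t" unfolding r a X1_def Y1_def by simp
 moreover have "c = poly (poly r 0) 0" unfolding r a by simp
 ultimately show ?thesis by blast
qed

lemma prime_X1: "prime_elem X1"
proof -
 have "prime_elem ([:0, 1:] :: complex poly)"
  by (rule irreducible_imp_prime_elem) (rule irreducible_linear_field_poly, simp)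
 then show ?thesis unfolding X1_def by (simp add: prime_elem_const_poly_iff)
qed

lemma X1_not_dvd_Y1: "\<not> X1 dvd Y1"
proof
 assume "X1 dvd Y1"
 then have "[:0, 1:] dvd coeff Y1 1" unfolding X1_def by (rule const_poly_dvd_iff[THEN iffD1, rule_format])
 then have "([:0, 1:] :: complex poly) dvd 1" unfolding Y1_def by simp
 then show False by (simp add: is_unit_pCons_iff)
qed

lemma origin_iff: "a \<in> origin \<longleftrightarrow> poly (poly a 0) 0 = 0"
 unfolding origin_def by simp

lemma X1_Y1_origin: "X1 \<in> origin" "Y1 \<in> origin"
 unfolding origin_iff X1_def Y1_def by simp_all

lemma prime_origin: "primeideal origin tring"
 unfolding tring_prime_iff by (auto simp: origin_iff)

lemma prime_X1_Y1:
 assumes p: "primeideal p tring" and xy: "X1 \<in> p" "Y1 \<in> p"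
 shows "p = origin"
proof -
 note pD = tring_primeD[OF p]
 have u: "[:[:c:]:] \<in> p \<longleftrightarrow> c = 0" for c :: complex
 proof
  assume *: "[:[:c:]:] \<in> p"
  show "c = 0"
  proof (rule ccontr)
   assume "c \<noteq> 0"
   then have "[:[:inverse c:]:] * [:[:c:]:] = 1" by (simp add: one_pCons)
   then show False using pD(3)[OF *, of "[:[:inverse c:]:]"] pD(4) by simp
  qed
 qed (use pD(1) in simp)
 have m: "X1 * s + Y1 * t \<in> p" for s t
  using pD(2)[OF pD(3)[OF xy(1), of s] pD(3)[OF xy(2), of t]] by (simp add: mult.commute)
 have "r \<in> p \<longleftrightarrow> r \<in> origin" for r
 proof -
  obtain c s t where r: "r = [:[:c:]:] + X1 * s + Y1 * t" "c = poly (poly r 0) 0" using plane_decompose by blast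
  have "r \<in> p \<longleftrightarrow> [:[:c:]:] \<in> p"
  proof
   assume "r \<in> p"
   moreover have "- (X1 * s + Y1 * t) \<in> p" using pD(3)[OF m, of "-1"] by simp
   ultimately have "r + - (X1 * s + Y1 * t) \<in> p" by (rule pD(2))
   then show "[:[:c:]:] \<in> p" unfolding r(1) by simp
  next
   assume "[:[:c:]:] \<in> p"
   then have "[:[:c:]:] + (X1 * s + Y1 * t) \<in> p" using m by (rule pD(2))
   then show "r \<in> p" unfolding r(1) by (simp add: add.assoc)
  qed
  then show ?thesis using u r(2) origin_iff by simp
 qed
 then show ?thesis by blast
qed

subsection \<open>The ideal of leading coefficients\<close>

text \<open>The ring of functions on the total space, inside its function field \<open>L\<close>.  The field
  contains \<open>A = \<complex>[x, y]\<close> by \<open>\<iota>\<close>, and over \<open>D(f)\<close> the functions are the polynomials in \<open>\<tau> f\<close>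
  with coefficients in \<open>A\<^sub>f\<close>, where the \<open>D(f)\<close> cover the punctured plane.\<close>

locale torsor =
 fixes \<iota> :: "plane_ring => 'l::field" and Fs :: "plane_ring set" and \<tau> :: "plane_ring => 'l"
 assumes \<iota>_add: "\<iota> (a + b) = \<iota> a + \<iota> b" and \<iota>_mult: "\<iota> (a * b) = \<iota> a * \<iota> b" and \<iota>_one: "\<iota> 1 = 1"
  and \<iota>_inj: "\<iota> a = 0 ==> a = 0" and finite_Fs: "finite Fs" and Fs_ne: "Fs \<noteq> {}" and Fs0: "0 \<notin> Fs"
  and Fs_cover: "\<And>p. primeideal p tring ==> p \<noteq> origin \<longleftrightarrow> (\<exists>f\<in>Fs. f \<notin> p)"
  and trans: "\<And>f b. f \<in> Fs ==> poly (map_poly \<iota> b) (\<tau> f) = 0 ==> b = 0"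
  and diff: "\<And>f g. f \<in> Fs ==> g \<in> Fs ==> \<exists>n c. \<iota> ((f * g) ^ n) * (\<tau> f - \<tau> g) = \<iota> c"
begin

lemma \<iota>_zero [simp]: "\<iota> 0 = 0"
 using \<iota>_add[of 0 0] by (metis add.right_neutral add_left_cancel)

lemma \<iota>_eq_0 [simp]: "\<iota> a = 0 \<longleftrightarrow> a = 0" using \<iota>_inj by auto

lemma \<iota>_minus: "\<iota> (- a) = - \<iota> a"
 using \<iota>_add[of a "- a"] by (simp add: eq_neg_iff_add_eq_0 add.commute)

lemma \<iota>_diff: "\<iota> (a - b) = \<iota> a - \<iota> b"
 using \<iota>_add[of a "- b"] by (simp add: \<iota>_minus)

definition ev :: "plane_ring poly => 'l => 'l" where "ev b t = poly (map_poly \<iota> b) t"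

lemma ev_pCons: "ev (pCons a b) t = \<iota> a + t * ev b t"
 unfolding ev_def by (cases "a = 0 & b = 0") (auto simp: map_poly_pCons)

lemma ev_0 [simp]: "ev 0 t = 0" unfolding ev_def by simp

lemma ev_add: "ev (b + b') t = ev b t + ev b' t"
proof (induction b b' rule: poly_induct2)
 case (pCons a b a' b')
 then show ?case by (simp add: ev_pCons \<iota>_add algebra_simps)
qed simp

lemma ev_smult: "ev (smult a b) t = \<iota> a * ev b t"
 by (induction b) (simp_all add: ev_pCons \<iota>_mult algebra_simps)

lemma ev_mult: "ev (b * b') t = ev b t * ev b' t"
 by (induction b) (simp_all add: ev_pCons ev_add ev_smult algebra_simps)

lemma ev_const [simp]: "ev [:a:] t = \<iota> a" by (simp add: ev_pCons)

lemma ev_one: "ev 1 t = 1" using ev_const[of 1 t] by (simp only: one_pCons[symmetric] \<iota>_one)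

lemma ev_minus: "ev (- b) t = - ev b t"
 using ev_smult[of "- 1" b t] by (simp add: \<iota>_minus \<iota>_one)

lemma ev_inj: "f \<in> Fs ==> ev b (\<tau> f) = ev b' (\<tau> f) ==> b = b'"
 using trans[of f "b - b'"] ev_add[of b "- b'" "\<tau> f"] unfolding ev_def[symmetric] by (simp add: ev_minus)

text \<open>Substituting \<open>t = t' + c / e\<close>, and clearing denominators.\<close>

lemma ev_shift:
 assumes e: "\<iota> e * (t - t') = \<iota> c"
 shows "\<exists>m b'. \<iota> (e ^ m) * ev b t = ev b' t' & (e \<noteq> 0 --> b' = 0 --> b = 0)"
proof (induction b)
 case 0
 show ?case by (rule exI[of _ 0], rule exI[of _ 0]) simp
next
 case (pCons a b)
 then obtain m b' where b': "\<iota> (e ^ m) * ev b t = ev b' t'" "e \<noteq> 0 --> b' = 0 --> b = 0" by blast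
 let ?b = "[:e ^ Suc m * a:] + [:c, e:] * b'"
 have "\<iota> e * t = \<iota> e * t' + \<iota> c" using e by (simp add: algebra_simps)
 moreover have "\<iota> (e ^ Suc m) * ev (pCons a b) t = \<iota> (e ^ Suc m * a) + (\<iota> e * t) * (\<iota> (e ^ m) * ev b t)"
  by (simp add: ev_pCons \<iota>_mult algebra_simps)
 ultimately have "\<iota> (e ^ Suc m) * ev (pCons a b) t = \<iota> (e ^ Suc m * a) + (\<iota> e * t' + \<iota> c) * ev b' t'"
  unfolding b'(1) by simp
 also have "\<dots> = ev ?b t'" unfolding ev_add ev_mult ev_pCons ev_0 by (simp add: algebra_simps)
 finally have "\<iota> (e ^ Suc m) * ev (pCons a b) t = ev ?b t'" .
 moreover have "pCons a b = 0" if "e \<noteq> 0" "?b = 0"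
 proof -
  have "[:c, e:] * b' = [:- (e ^ Suc m * a):]" using that(2) by (simp add: add_eq_0_iff)
  then have "degree ([:c, e:] * b') = 0" by simp
  then have "b' = 0" using that(1) degree_mult_eq[of "[:c, e:]" b'] by fastforce
  then show ?thesis using b'(2) that by simp
 qed
 ultimately show ?case by blast
qed

definition E :: "plane_ring => 'l set" where "E f = {e. \<exists>n b. \<iota> (f ^ n) * e = ev b (\<tau> f)}"

definition \<R> :: "'l set" where "\<R> = (\<Inter>f\<in>Fs. E f)"

lemma E_common:
 assumes "e \<in> E f" "e' \<in> E f"
 obtains n b b' where "\<iota> (f ^ n) * e = ev b (\<tau> f)" "\<iota> (f ^ n) * e' = ev b' (\<tau> f)"
proof -
 obtain n b m b' where 1: "\<iota> (f ^ n) * e = ev b (\<tau> f)" and 2: "\<iota> (f ^ m) * e' = ev b' (\<tau> f)"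
  using assms unfolding E_def by blast
 have "\<iota> (f ^ (n + m)) * e = ev (smult (f ^ m) b) (\<tau> f)" unfolding ev_smult 1[symmetric] by (simp add: power_add \<iota>_mult)
 moreover have "\<iota> (f ^ (n + m)) * e' = ev (smult (f ^ n) b') (\<tau> f)"
  unfolding ev_smult 2[symmetric] by (simp add: power_add \<iota>_mult)
 ultimately show thesis by (rule that)
qed

lemma E_add: "e \<in> E f ==> e' \<in> E f ==> e + e' \<in> E f"
proof -
 assume "e \<in> E f" "e' \<in> E f"
 then obtain n b b' where "\<iota> (f ^ n) * e = ev b (\<tau> f)" "\<iota> (f ^ n) * e' = ev b' (\<tau> f)" by (rule E_common)
 then have "\<iota> (f ^ n) * (e + e') = ev (b + b') (\<tau> f)" unfolding distrib_left ev_add by simp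
 then show ?thesis unfolding E_def by blast
qed

lemma E_mult:
 assumes "e \<in> E f" "e' \<in> E f" shows "e * e' \<in> E f"
proof -
 obtain n b b' where "\<iota> (f ^ n) * e = ev b (\<tau> f)" "\<iota> (f ^ n) * e' = ev b' (\<tau> f)" using E_common[OF assms] .
 moreover have "\<iota> (f ^ (n + n)) * (e * e') = (\<iota> (f ^ n) * e) * (\<iota> (f ^ n) * e')"
  unfolding power_add \<iota>_mult by (simp add: mult_ac)
 ultimately have "\<iota> (f ^ (n + n)) * (e * e') = ev (b * b') (\<tau> f)" unfolding ev_mult by simp
 then show ?thesis unfolding E_def by blast
qed

lemma E_\<iota>: "\<iota> a \<in> E f"
 unfolding E_def by (intro CollectI exI[of _ 0] exI[of _ "[:a:]"]) (simp add: \<iota>_one)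

lemma E_\<tau>: "\<tau> f \<in> E f"
 unfolding E_def by (intro CollectI exI[of _ 0] exI[of _ "[:0, 1:]"]) (simp add: \<iota>_one ev_pCons)

lemma \<R>_add: "e \<in> \<R> ==> e' \<in> \<R> ==> e + e' \<in> \<R>" and \<R>_mult: "e \<in> \<R> ==> e' \<in> \<R> ==> e * e' \<in> \<R>"
 and \<R>_\<iota>: "\<iota> a \<in> \<R>" unfolding \<R>_def using E_add E_mult E_\<iota> by auto

lemma \<R>_minus: "e \<in> \<R> ==> - e \<in> \<R>"
 using \<R>_mult[OF \<R>_\<iota>[of "- 1"], of e] by (simp add: \<iota>_minus \<iota>_one)

lemma \<R>_diff: "e \<in> \<R> ==> e' \<in> \<R> ==> e - e' \<in> \<R>"
 using \<R>_add[OF _ \<R>_minus, of e e'] by simp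

text \<open>A polynomial in \<open>\<tau> f\<close> is one in \<open>\<tau> g\<close> up to a power of \<open>f g\<close>, and the powers of \<open>g\<close> are invertible over
\<open>D(g)\<close>. Finitely many \<open>g\<close> need only one power of \<open>f\<close>.\<close>

lemma extend:
 assumes f: "f \<in> Fs" and e: "e \<in> E f"
 shows "\<exists>n. \<iota> (f ^ n) * e \<in> \<R>"
proof -
 obtain n b where b: "\<iota> (f ^ n) * e = ev b (\<tau> f)" using e unfolding E_def by blast
 have "\<exists>m. \<iota> (f ^ m) * e \<in> E g" if g: "g \<in> Fs" for g
 proof -
  obtain k c where "\<iota> ((f * g) ^ k) * (\<tau> f - \<tau> g) = \<iota> c" using diff[OF f g] by blast
  then obtain m b' where "\<iota> (((f * g) ^ k) ^ m) * ev b (\<tau> f) = ev b' (\<tau> g)" using ev_shift by blast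
  then have "\<iota> (g ^ (k * m)) * (\<iota> (f ^ (n + k * m)) * e) = ev b' (\<tau> g)"
   unfolding b[symmetric] by (simp add: power_mult_distrib power_mult[symmetric] \<iota>_mult power_add algebra_simps)
  then show ?thesis unfolding E_def by blast
 qed
 then obtain m where m: "\<And>g. g \<in> Fs ==> \<iota> (f ^ m g) * e \<in> E g" by metis
 define M where "M = Max (m ` Fs)"
 have "\<iota> (f ^ M) * e \<in> E g" if g: "g \<in> Fs" for g
 proof -
  have "m g \<le> M" unfolding M_def using finite_Fs g by simp
  then have "f ^ M = f ^ (M - m g) * f ^ m g" by (simp flip: power_add)
  then show ?thesis using E_mult[OF E_\<iota> m[OF g], of "f ^ (M - m g)"] by (simp add: \<iota>_mult mult.assoc)
 qed
 then show ?thesis unfolding \<R>_def by blast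
qed

definition Kf :: "'l set" where "Kf = {k. \<exists>e c. e \<noteq> 0 & \<iota> e * k = \<iota> c}"

lemma Kf_add:
 assumes "k \<in> Kf" "k' \<in> Kf" shows "k + k' \<in> Kf"
proof -
 obtain e c e' c' where 1: "e \<noteq> 0" "\<iota> e * k = \<iota> c" and 2: "e' \<noteq> 0" "\<iota> e' * k' = \<iota> c'" using assms unfolding Kf_def by blast
 have "\<iota> (e * e') * (k + k') = \<iota> e' * (\<iota> e * k) + \<iota> e * (\<iota> e' * k')" by (simp add: \<iota>_mult algebra_simps)
 also have "\<dots> = \<iota> (e' * c + e * c')" unfolding 1 2 by (simp add: \<iota>_add \<iota>_mult)
 finally have "\<iota> (e * e') * (k + k') = \<iota> (e' * c + e * c')" .
 moreover have "e * e' \<noteq> 0" using 1 2 by simp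
 ultimately show ?thesis unfolding Kf_def by blast
qed

lemma Kf_\<iota>_mult:
 assumes "k \<in> Kf" shows "\<iota> a * k \<in> Kf"
proof -
 obtain e c where 1: "e \<noteq> 0" "\<iota> e * k = \<iota> c" using assms unfolding Kf_def by blast
 have "\<iota> e * (\<iota> a * k) = \<iota> (a * c)" unfolding \<iota>_mult 1(2)[symmetric] by (simp add: algebra_simps)
 then show ?thesis unfolding Kf_def using 1 by blast
qed

lemma Kf_\<iota>: "\<iota> a \<in> Kf"
 unfolding Kf_def by (intro CollectI exI[of _ 1] exI[of _ a]) (simp add: \<iota>_one)

lemma Kf_diff: "k \<in> Kf ==> k' \<in> Kf ==> k - k' \<in> Kf"
 using Kf_add[OF _ Kf_\<iota>_mult[of k' "- 1"], of k] by (simp add: \<iota>_minus \<iota>_one)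

lemma Kf_cancel:
 assumes "\<iota> a * k \<in> Kf" "a \<noteq> 0" shows "k \<in> Kf"
proof -
 obtain e c where 1: "e \<noteq> 0" "\<iota> e * (\<iota> a * k) = \<iota> c" using assms unfolding Kf_def by blast
 then have "\<iota> (e * a) * k = \<iota> c" by (simp add: \<iota>_mult mult.assoc)
 moreover have "e * a \<noteq> 0" using 1 assms by simp
 ultimately show ?thesis unfolding Kf_def by blast
qed

lemma Kf_diff_\<tau>: "f \<in> Fs ==> g \<in> Fs ==> \<tau> f - \<tau> g \<in> Kf"
 using diff[of f g] Fs0 unfolding Kf_def by (metis (mono_tags, lifting) mem_Collect_eq mult_eq_0_iff power_not_zero)

text \<open>A polynomial in the transcendental element \<open>\<tau> f\<close> with value in \<open>Frac A\<close> is constant.\<close>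

lemma E_Kf:
 assumes f: "f \<in> Fs" and k: "k \<in> E f" "\<iota> e * k = \<iota> c" "e \<noteq> 0"
 shows "\<exists>n b. \<iota> (f ^ n) * k = \<iota> b & f ^ n * c = e * b"
proof -
 obtain n b where b: "\<iota> (f ^ n) * k = ev b (\<tau> f)" using k(1) unfolding E_def by blast
 have "ev (smult e b) (\<tau> f) = \<iota> (f ^ n) * (\<iota> e * k)" unfolding ev_smult b[symmetric] by (simp add: algebra_simps)
 also have "\<dots> = ev [:f ^ n * c:] (\<tau> f)" unfolding k(2) by (simp add: \<iota>_mult)
 finally have eq: "smult e b = [:f ^ n * c:]" by (rule ev_inj[OF f])
 have "degree b = 0" using arg_cong[OF eq, of degree] k(3) by simp
 then obtain b0 where b0: "b = [:b0:]" by (rule degree_eq_zeroE)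
 have "\<iota> (f ^ n) * k = \<iota> b0" "f ^ n * c = e * b0" using b eq b0 by simp_all
 then show ?thesis by blast
qed

text \<open>Write \<open>r\<close> as a reduced fraction. Its denominator divides powers of all \<open>f \<in> Fs\<close>, so a prime factor
of it would generate a prime ideal that contains all of \<open>Fs\<close>. This is the ideal of the origin, which
is not principal.\<close>

lemma hartogs:
 assumes r: "r \<in> \<R>" "r \<in> Kf"
 shows "\<exists>a. r = \<iota> a"
proof -
 obtain e0 c0 where 0: "e0 \<noteq> 0" "\<iota> e0 * r = \<iota> c0" using r(2) unfolding Kf_def by blast
 obtain c e where d: "c0 = c * gcd c0 e0" "e0 = e * gcd c0 e0" "coprime c e" using gcd_coprime_exists[of c0 e0] 0(1) by auto
 have g0: "gcd c0 e0 \<noteq> 0" and e0: "e \<noteq> 0" using d(2) 0(1) by auto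
 have "\<iota> (gcd c0 e0) * (\<iota> e * r) = \<iota> (gcd c0 e0) * \<iota> c" using 0(2) d(1,2) by (metis \<iota>_mult mult.assoc mult.commute)
 moreover have "\<iota> (gcd c0 e0) \<noteq> 0" using g0 unfolding \<iota>_eq_0 .
 ultimately have er: "\<iota> e * r = \<iota> c" by (metis mult_left_cancel)
 have dv: "\<exists>n. e dvd f ^ n" if f: "f \<in> Fs" for f
 proof -
  have "r \<in> E f" using r(1) f unfolding \<R>_def by blast
  then obtain n b where "f ^ n * c = e * b" using E_Kf[OF f _ er e0] by blast
  then have "e dvd f ^ n * c" by simp
  then have "e dvd f ^ n" using d(3) by (metis coprime_commute coprime_dvd_mult_left_iff)
  then show ?thesis ..
 qed
 have "is_unit e"
 proof (rule ccontr)
  assume "\<not> is_unit e"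
  then obtain p where p: "prime_elem p" "p dvd e" using prime_divisor_exists[OF e0] by (auto dest: prime_imp_prime_elem)
  have "p dvd f" if f: "f \<in> Fs" for f
  proof -
   obtain n where "e dvd f ^ n" using dv[OF f] ..
   then show ?thesis by (rule prime_elem_dvd_power[OF p(1) dvd_trans[OF p(2)]])
  qed
  then have "\<not> (\<exists>f\<in>Fs. f \<notin> {a. p dvd a})" by simp
  then have "{a. p dvd a} = origin" using Fs_cover[OF prime_principal[OF p(1)]] by simp
  then have pX: "p dvd X1" "p dvd Y1" using X1_Y1_origin by auto
  have "\<not> p dvd 1" using prime_elem_not_unit[OF p(1)] .
  then have "X1 dvd p" using irreducibleD'[OF prime_elem_imp_irreducible[OF prime_X1] pX(1)] by simp
  then show False using dvd_trans[OF _ pX(2)] X1_not_dvd_Y1 by simp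
 qed
 then obtain e' where "1 = e * e'" by (rule dvdE)
 then have "\<iota> e * \<iota> e' = 1" using \<iota>_mult[of e e'] \<iota>_one by simp
 then have "r = \<iota> e' * (\<iota> e * r)" by (metis mult.commute mult.left_commute mult_1)
 then have "r = \<iota> (e' * c)" unfolding er \<iota>_mult .
 then show ?thesis ..
qed

definition f0 :: plane_ring where "f0 = (SOME f. f \<in> Fs)"

lemma f0: "f0 \<in> Fs" unfolding f0_def using Fs_ne by (auto intro: someI)

text \<open>The coefficients of the coordinate in the global functions of degree one: the annihilator
  of the cohomology class of the bundle.\<close>

definition J :: "plane_ring set" where "J = {a. \<exists>v\<in>\<R>. \<iota> a * \<tau> f0 - v \<in> Kf}"

lemma ideal_J: "is_ideal J"
 unfolding is_ideal_def
proof (intro conjI ballI allI)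
 show "0 \<in> J" unfolding J_def using \<R>_\<iota>[of 0] Kf_\<iota>[of 0] by (intro CollectI bexI[of _ 0]) auto
 fix a assume "a \<in> J"
 then obtain v where v: "v \<in> \<R>" "\<iota> a * \<tau> f0 - v \<in> Kf" unfolding J_def by blast
 have "\<iota> (r * a) * \<tau> f0 - \<iota> r * v \<in> Kf" for r using Kf_\<iota>_mult[OF v(2), of r] by (simp add: \<iota>_mult algebra_simps)
 then show "r * a \<in> J" for r unfolding J_def using \<R>_mult[OF \<R>_\<iota> v(1)] by blast
 fix b assume "b \<in> J"
 then obtain w where w: "w \<in> \<R>" "\<iota> b * \<tau> f0 - w \<in> Kf" unfolding J_def by blast
 have "\<iota> (a + b) * \<tau> f0 - (v + w) \<in> Kf" using Kf_add[OF v(2) w(2)] by (simp add: \<iota>_add algebra_simps)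
 then show "a + b \<in> J" unfolding J_def using \<R>_add[OF v(1) w(1)] by blast
qed

lemma J_power: "f \<in> Fs ==> \<exists>n. f ^ n \<in> J"
proof -
 assume f: "f \<in> Fs"
 obtain n where n: "\<iota> (f ^ n) * \<tau> f \<in> \<R>" using extend[OF f E_\<tau>] by blast
 have "\<iota> (f ^ n) * \<tau> f0 - \<iota> (f ^ n) * \<tau> f \<in> Kf"
  using Kf_\<iota>_mult[OF Kf_diff_\<tau>[OF f0 f], of "f ^ n"] by (simp add: algebra_simps)
 then show ?thesis unfolding J_def using n by blast
qed

lemma J_X1_Y1: "\<exists>n. X1 ^ n \<in> J" "\<exists>n. Y1 ^ n \<in> J"
proof -
 have "\<exists>n. z ^ n \<in> J" if z: "z \<in> origin" for z
 proof (rule ccontr)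
  assume "\<not> ?thesis"
  then obtain p where p: "primeideal p tring" "J \<subseteq> p" "z \<notin> p" using prime_avoiding_powers[OF ideal_J] by blast
  then obtain f where f: "f \<in> Fs" "f \<notin> p" using Fs_cover[OF p(1)] z by blast
  then show False using J_power[OF f(1)] p(2) tring_primeD(6)[OF p(1)] by blast
 qed
 then show "\<exists>n. X1 ^ n \<in> J" "\<exists>n. Y1 ^ n \<in> J" using X1_Y1_origin by auto
qed

text \<open>As \<open>J\<close> contains powers of \<open>x\<close> and \<open>y\<close>, the process of multiplying \<open>1\<close> by \<open>x\<close> as long as the product
stays outside \<open>J\<close>, and then by \<open>y\<close>, ends.\<close>

lemma socle:
 assumes "1 \<notin> J" obtains a where "a \<notin> J" "X1 * a \<in> J" "Y1 * a \<in> J"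
proof -
 note J = ideal_J[unfolded is_ideal_def]
 obtain N where N: "X1 ^ N \<in> J" using J_X1_Y1(1) by blast
 define i where "i = (LEAST n. X1 ^ n \<in> J)"
 have i: "X1 ^ i \<in> J" unfolding i_def by (rule LeastI) fact
 then obtain i' where i': "i = Suc i'" using assms by (cases i) auto
 have ni: "X1 ^ i' \<notin> J" using not_less_Least[of i' "\<lambda>n. X1 ^ n \<in> J"] i' unfolding i_def by auto
 obtain M where M: "Y1 ^ M \<in> J" using J_X1_Y1(2) by blast
 then have M': "Y1 ^ M * X1 ^ i' \<in> J" using J by (metis mult.commute)
 define j where "j = (LEAST n. Y1 ^ n * X1 ^ i' \<in> J)"
 have j: "Y1 ^ j * X1 ^ i' \<in> J" unfolding j_def by (rule LeastI) fact
 then obtain j' where j': "j = Suc j'" using ni by (cases j) auto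
 have nj: "Y1 ^ j' * X1 ^ i' \<notin> J" using not_less_Least[of j' "\<lambda>n. Y1 ^ n * X1 ^ i' \<in> J"] j' unfolding j_def by auto
 have "X1 * (Y1 ^ j' * X1 ^ i') = Y1 ^ j' * X1 ^ i" unfolding i' by (simp add: algebra_simps)
 moreover have "Y1 ^ j' * X1 ^ i \<in> J" using J i by blast
 ultimately have "X1 * (Y1 ^ j' * X1 ^ i') \<in> J" by (simp only:)
 moreover have "Y1 * (Y1 ^ j' * X1 ^ i') \<in> J" using j unfolding j' by (simp add: algebra_simps)
 ultimately show thesis using that nj by blast
qed

text \<open>If \<open>1 \<notin> J\<close>, the element of \<open>socle\<close> gives two members \<open>v\<close> and \<open>u\<close> of \<open>\<R>\<close> whose combination \<open>y v - x u\<close> is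
an element of \<open>A\<close> that cannot vanish at the origin.\<close>

lemma dichotomy:
 "(\<exists>v\<in>\<R>. \<forall>f\<in>Fs. \<exists>n c. \<iota> (f ^ n) * (\<tau> f - v) = \<iota> c) \<or>
 (\<exists>u\<in>\<R>. \<exists>v\<in>\<R>. \<iota> X1 * u + \<iota> Y1 * v = 1)"
proof (cases "1 \<in> J")
 case True
 then obtain v where v: "v \<in> \<R>" "\<tau> f0 - v \<in> Kf" unfolding J_def by (auto simp: \<iota>_one)
 have "\<exists>n c. \<iota> (f ^ n) * (\<tau> f - v) = \<iota> c" if f: "f \<in> Fs" for f
 proof -
  have "(\<tau> f - \<tau> f0) + (\<tau> f0 - v) \<in> Kf" by (rule Kf_add[OF Kf_diff_\<tau>[OF f f0] v(2)])
  then obtain e c where e: "e \<noteq> 0" "\<iota> e * (\<tau> f - v) = \<iota> c" unfolding Kf_def by auto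
  have "v \<in> E f" using v(1) f unfolding \<R>_def by blast
  then have "\<tau> f - v \<in> E f" using E_add[OF E_\<tau> E_mult[OF E_\<iota>[of "- 1"]], of v f] by (simp add: \<iota>_minus \<iota>_one)
  then show ?thesis using E_Kf[OF f _ e(2,1)] by blast
 qed
 then show ?thesis using v(1) by blast
next
 case False
 obtain a where a: "a \<notin> J" "X1 * a \<in> J" "Y1 * a \<in> J" using socle[OF False] .
 obtain v where v: "v \<in> \<R>" "\<iota> (X1 * a) * \<tau> f0 - v \<in> Kf" using a(2) unfolding J_def by blast
 obtain u where u: "u \<in> \<R>" "\<iota> (Y1 * a) * \<tau> f0 - u \<in> Kf" using a(3) unfolding J_def by blast
 have "\<iota> X1 * (\<iota> (Y1 * a) * \<tau> f0 - u) - \<iota> Y1 * (\<iota> (X1 * a) * \<tau> f0 - v) = \<iota> Y1 * v - \<iota> X1 * u"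
  by (simp add: \<iota>_mult algebra_simps)
 then have "\<iota> Y1 * v - \<iota> X1 * u \<in> Kf" using Kf_diff[OF Kf_\<iota>_mult[OF u(2), of X1] Kf_\<iota>_mult[OF v(2), of Y1]] by simp
 moreover have "\<iota> Y1 * v - \<iota> X1 * u \<in> \<R>" by (intro \<R>_diff \<R>_mult \<R>_\<iota> u v)
 ultimately obtain r where r: "\<iota> Y1 * v - \<iota> X1 * u = \<iota> r" using hartogs by blast
 obtain c s t where rd: "r = [:[:c:]:] + X1 * s + Y1 * t" using plane_decompose by blast
 show ?thesis
 proof (cases "c = 0")
  case False
  let ?c = "[:[:inverse c:]:]"
  have inv: "?c * [:[:c:]:] = 1" using False by (simp add: one_pCons)
  have "\<iota> X1 * (- u - \<iota> s) + \<iota> Y1 * (v - \<iota> t) = \<iota> [:[:c:]:]" using r unfolding rd by (simp add: \<iota>_add \<iota>_mult algebra_simps)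
  moreover have "\<iota> X1 * (\<iota> ?c * w) + \<iota> Y1 * (\<iota> ?c * w') = \<iota> ?c * (\<iota> X1 * w + \<iota> Y1 * w')" for w w'
   by (simp add: algebra_simps)
  ultimately have "\<iota> X1 * (\<iota> ?c * (- u - \<iota> s)) + \<iota> Y1 * (\<iota> ?c * (v - \<iota> t)) = \<iota> ?c * \<iota> [:[:c:]:]" by simp
  also have "\<dots> = 1" unfolding \<iota>_mult[symmetric] inv by (rule \<iota>_one)
  finally show ?thesis using \<R>_mult[OF \<R>_\<iota> \<R>_diff[OF \<R>_minus[OF u(1)] \<R>_\<iota>]] \<R>_mult[OF \<R>_\<iota> \<R>_diff[OF v(1) \<R>_\<iota>]] by blast
 next
  case True
 \<comment> \<open>here \<open>r\<close> vanishes at the origin, which contradicts the choice of \<open>a\<close>\<close>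
  then have eq: "\<iota> Y1 * (v - \<iota> t) = \<iota> X1 * (u + \<iota> s)" using r unfolding rd by (simp add: \<iota>_add \<iota>_mult algebra_simps)
  have X0: "X1 \<noteq> 0" using prime_X1 by auto
  define w where "w = (v - \<iota> t) / \<iota> X1"
  have xw: "\<iota> X1 * w = v - \<iota> t" unfolding w_def using X0 by simp
 \<comment> \<open>the polynomial that represents \<open>v - t\<close> over \<open>D(f)\<close> is divisible by \<open>x\<close>, because \<open>x\<close> is prime and does not divide \<open>y\<close>\<close>
  have "w \<in> E f" if f: "f \<in> Fs" for f
  proof -
   have "v - \<iota> t \<in> E f" "u + \<iota> s \<in> E f" using \<R>_diff[OF v(1) \<R>_\<iota>] \<R>_add[OF u(1) \<R>_\<iota>] f unfolding \<R>_def by auto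
   then obtain n b b' where b: "\<iota> (f ^ n) * (v - \<iota> t) = ev b (\<tau> f)" "\<iota> (f ^ n) * (u + \<iota> s) = ev b' (\<tau> f)"
    by (rule E_common)
   have "ev (smult Y1 b) (\<tau> f) = ev (smult X1 b') (\<tau> f)"
    unfolding ev_smult b[symmetric] using eq by (metis mult.left_commute)
   then have bb: "smult Y1 b = smult X1 b'" by (rule ev_inj[OF f])
   have "[:X1:] dvd [:Y1:] * b" using bb by (simp add: dvd_def) (metis mult_pCons_left mult_zero_left add_0_right pCons_0_0)
   moreover have "prime_elem [:X1:]" using prime_X1 by (simp add: prime_elem_const_poly_iff)
   moreover have "\<not> [:X1:] dvd [:Y1:]" using X1_not_dvd_Y1 by simp
   ultimately have "[:X1:] dvd b" using prime_elem_dvd_multD by blast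
   then obtain d where d: "b = smult X1 d" by (auto simp: dvd_def)
   have "\<iota> X1 * (\<iota> (f ^ n) * w) = \<iota> X1 * ev d (\<tau> f)"
    using b(1) unfolding d ev_smult xw[symmetric] by (simp add: algebra_simps)
   then have "\<iota> (f ^ n) * w = ev d (\<tau> f)" using X0 by simp
   then show ?thesis unfolding E_def by blast
  qed
  then have w: "w \<in> \<R>" unfolding \<R>_def by blast
  have "\<iota> X1 * (\<iota> a * \<tau> f0 - w) = (\<iota> (X1 * a) * \<tau> f0 - v) + \<iota> t"
   unfolding right_diff_distrib xw by (simp add: \<iota>_mult algebra_simps)
  then have "\<iota> X1 * (\<iota> a * \<tau> f0 - w) \<in> Kf" using Kf_add[OF v(2) Kf_\<iota>] by simp
  then have "\<iota> a * \<tau> f0 - w \<in> Kf" using X0 by (rule Kf_cancel)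
  then have "a \<in> J" unfolding J_def using w by blast
  then show ?thesis using a(1) by contradiction
 qed
qed

end

section \<open>The function field of the total space\<close>

text \<open>At the generic point the stalk is the field of fractions of the ring of the chart.\<close>

locale generic = fchart S V \<rho> f
 for S :: "('p, 's) ringed_space" and V and \<rho> :: "'b::{factorial_ring_gcd, semiring_gcd_mult_normalize} => 's" and f +
 fixes \<eta> :: 'p
 assumes \<eta>: "\<eta> \<in> V" "prm S V tring \<rho> \<eta> = {0}"
begin

sublocale K0: cring "stalk S \<eta>" by (rule cring_stalk[OF V_points[OF \<eta>(1)]])

lemma \<sigma>\<eta>_closed [simp]: "\<sigma> \<eta> F \<in> carrier (stalk S \<eta>)"
 by (rule \<sigma>_closed[OF \<eta>(1)]) simp

lemma \<sigma>\<eta>_mult: "\<sigma> \<eta> (F * G) = \<sigma> \<eta> F \<otimes>\<^bsub>stalk S \<eta>\<^esub> \<sigma> \<eta> G"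
 and \<sigma>\<eta>_add: "\<sigma> \<eta> (F + G) = \<sigma> \<eta> F \<oplus>\<^bsub>stalk S \<eta>\<^esub> \<sigma> \<eta> G" and \<sigma>\<eta>_one: "\<sigma> \<eta> 1 = \<one>\<^bsub>stalk S \<eta>\<^esub>"
 using ring_hom_mult[OF \<sigma>_hom[OF \<eta>(1)], of F G] ring_hom_add[OF \<sigma>_hom[OF \<eta>(1)], of F G]
  ring_hom_one[OF \<sigma>_hom[OF \<eta>(1)]] by simp_all

lemma \<sigma>\<eta>_zero: "\<sigma> \<eta> 0 = \<zero>\<^bsub>stalk S \<eta>\<^esub>"
proof -
 have "\<sigma> \<eta> 0 \<oplus>\<^bsub>stalk S \<eta>\<^esub> \<sigma> \<eta> 0 = \<sigma> \<eta> 0" using \<sigma>\<eta>_add[of 0 0] by simp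
 then show ?thesis using K0.add.l_cancel_one[OF \<sigma>\<eta>_closed \<sigma>\<eta>_closed] by simp
qed

lemma \<sigma>\<eta>_unit: "G \<noteq> 0 ==> \<sigma> \<eta> G \<in> Units (stalk S \<eta>)"
 using \<sigma>_Units[OF \<eta>(1), of G] mem_prm[OF \<eta>(1), of G] \<eta>(2) by simp

lemma \<sigma>\<eta>_eq_0: "\<sigma> \<eta> F = \<zero>\<^bsub>stalk S \<eta>\<^esub> ==> F = 0"
proof -
 assume "\<sigma> \<eta> F = \<zero>\<^bsub>stalk S \<eta>\<^esub>"
 then obtain h where h: "\<eta> \<in> locus S V (\<rho> h)" "h * F = 0" using \<sigma>_ker[OF \<eta>(1), of F] by auto
 then have "h \<noteq> 0" using mem_prm[OF \<eta>(1), of h] \<eta>(2) by blast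
 then show "F = 0" using h(2) by simp
qed

lemma \<sigma>\<eta>_inj: "\<sigma> \<eta> F = \<sigma> \<eta> G ==> F = G"
proof -
 assume e: "\<sigma> \<eta> F = \<sigma> \<eta> G"
 have "\<sigma> \<eta> (F - G) \<oplus>\<^bsub>stalk S \<eta>\<^esub> \<sigma> \<eta> G = \<sigma> \<eta> G" using \<sigma>\<eta>_add[of "F - G" G] e by simp
 then have "\<sigma> \<eta> (F - G) = \<zero>\<^bsub>stalk S \<eta>\<^esub>" by simp
 then show "F = G" using \<sigma>\<eta>_eq_0 by fastforce
qed

lemma stalk_frac:
 assumes c: "c \<in> carrier (stalk S \<eta>)"
 shows "\<exists>F G. G \<noteq> 0 & \<sigma> \<eta> G \<otimes>\<^bsub>stalk S \<eta>\<^esub> c = \<sigma> \<eta> F"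
proof -
 obtain U s where U: "opens S U" "\<eta> \<in> U" "s \<in> \<Gamma> S U" "c = germ S \<eta> U s" using stalk_carrierE[OF c] .
 let ?W = "U \<inter> V"
 have o: "opens S ?W" "?W \<subseteq> V" "?W \<subseteq> U" "\<eta> \<in> ?W" using U \<eta> open_V by (auto simp: openin_Int)
 obtain W F G where W: "opens S W" "\<eta> \<in> W" "W \<subseteq> ?W" "W \<subseteq> locus S V (\<rho> G)"
  and e: "\<rho>r W G \<otimes>\<^bsub>sections S W\<^esub> res S ?W W (res S U ?W s) = \<rho>r W F"
  using fracs_on[OF o(1,2,4) res_closed[OF U(1) o(1,3) U(3)]] by metis
 have WV: "W \<subseteq> V" "W \<subseteq> U" using W o by auto
 have "\<sigma> \<eta> G \<otimes>\<^bsub>stalk S \<eta>\<^esub> c = \<sigma> \<eta> F"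
  using arg_cong[OF e, of "germ S \<eta> W"] \<sigma>_res[OF W(1) WV(1) W(2)] germ_res[OF U(1,3) W(1) WV(2) W(2)]
   germ_mult[OF W(1,2) res_\<rho>_closed[OF W(1) WV(1)] res_closed[OF U(1) W(1) WV(2) U(3)]]
   res_res[OF U(1) o(1) W(1,3) o(3) U(3)] U(4) by simp
 moreover have "G \<noteq> 0" using W(2,4) mem_prm[OF \<eta>(1), of G] \<eta>(2) by blast
 ultimately show ?thesis by blast
qed

definition \<psi> :: "('p set \<times> 's) set => 'b fract" where
 "\<psi> c = (SOME k. \<exists>F G. G \<noteq> 0 & \<sigma> \<eta> G \<otimes>\<^bsub>stalk S \<eta>\<^esub> c = \<sigma> \<eta> F & k = Fract F G)"

lemma \<psi>_eq:
 assumes c: "c \<in> carrier (stalk S \<eta>)" and G: "G \<noteq> 0" "\<sigma> \<eta> G \<otimes>\<^bsub>stalk S \<eta>\<^esub> c = \<sigma> \<eta> F"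
 shows "\<psi> c = Fract F G" unfolding \<psi>_def
proof (rule some_equality)
 show "\<exists>F' G'. G' \<noteq> 0 & \<sigma> \<eta> G' \<otimes>\<^bsub>stalk S \<eta>\<^esub> c = \<sigma> \<eta> F' & Fract F G = Fract F' G'" using G by blast
 fix k assume "\<exists>F G. G \<noteq> 0 & \<sigma> \<eta> G \<otimes>\<^bsub>stalk S \<eta>\<^esub> c = \<sigma> \<eta> F & k = Fract F G"
 then obtain F' G' where k: "G' \<noteq> 0" "\<sigma> \<eta> G' \<otimes>\<^bsub>stalk S \<eta>\<^esub> c = \<sigma> \<eta> F'" "k = Fract F' G'" by blast
 have "\<sigma> \<eta> (F' * G) = \<sigma> \<eta> (F * G')" unfolding \<sigma>\<eta>_mult k(2)[symmetric] G(2)[symmetric] using c by (simp add: K0.m_ac)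
 then have "F' * G = F * G'" by (rule \<sigma>\<eta>_inj)
 then show "k = Fract F G" unfolding k(3) using k(1) G(1) by (simp add: eq_fract)
qed

lemma \<psi>_ring:
 assumes c: "c \<in> carrier (stalk S \<eta>)" "d \<in> carrier (stalk S \<eta>)"
 shows "\<psi> (c \<otimes>\<^bsub>stalk S \<eta>\<^esub> d) = \<psi> c * \<psi> d" "\<psi> (c \<oplus>\<^bsub>stalk S \<eta>\<^esub> d) = \<psi> c + \<psi> d"
proof -
 obtain F G where F: "G \<noteq> 0" "\<sigma> \<eta> G \<otimes>\<^bsub>stalk S \<eta>\<^esub> c = \<sigma> \<eta> F" using stalk_frac[OF c(1)] by blast
 obtain F' G' where F': "G' \<noteq> 0" "\<sigma> \<eta> G' \<otimes>\<^bsub>stalk S \<eta>\<^esub> d = \<sigma> \<eta> F'" using stalk_frac[OF c(2)] by blast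
 have "\<sigma> \<eta> (G * G') \<otimes>\<^bsub>stalk S \<eta>\<^esub> (c \<otimes>\<^bsub>stalk S \<eta>\<^esub> d) = \<sigma> \<eta> (F * F')"
  unfolding \<sigma>\<eta>_mult F(2)[symmetric] F'(2)[symmetric] using c by (simp add: K0.m_ac)
 then show "\<psi> (c \<otimes>\<^bsub>stalk S \<eta>\<^esub> d) = \<psi> c * \<psi> d"
  using \<psi>_eq[OF c(1) F] \<psi>_eq[OF c(2) F'] \<psi>_eq[of "c \<otimes>\<^bsub>stalk S \<eta>\<^esub> d" "G * G'" "F * F'"] c F F' by simp
 have "\<sigma> \<eta> (G * G') \<otimes>\<^bsub>stalk S \<eta>\<^esub> (c \<oplus>\<^bsub>stalk S \<eta>\<^esub> d) = \<sigma> \<eta> (F * G' + F' * G)"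
  unfolding \<sigma>\<eta>_mult \<sigma>\<eta>_add F(2)[symmetric] F'(2)[symmetric] using c by (simp add: K0.m_ac K0.r_distr K0.l_distr)
 then show "\<psi> (c \<oplus>\<^bsub>stalk S \<eta>\<^esub> d) = \<psi> c + \<psi> d"
  using \<psi>_eq[OF c(1) F] \<psi>_eq[OF c(2) F'] \<psi>_eq[of "c \<oplus>\<^bsub>stalk S \<eta>\<^esub> d" "G * G'" "F * G' + F' * G"] c F F' by simp
qed

lemma \<psi>_one: "\<psi> \<one>\<^bsub>stalk S \<eta>\<^esub> = 1"
 using \<psi>_eq[of "\<one>\<^bsub>stalk S \<eta>\<^esub>" 1 1] \<sigma>\<eta>_one by (simp add: One_fract_def)

lemma \<psi>_eq_0:
 assumes c: "c \<in> carrier (stalk S \<eta>)" and 0: "\<psi> c = 0" shows "c = \<zero>\<^bsub>stalk S \<eta>\<^esub>"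
proof -
 obtain F G where F: "G \<noteq> 0" "\<sigma> \<eta> G \<otimes>\<^bsub>stalk S \<eta>\<^esub> c = \<sigma> \<eta> F" using stalk_frac[OF c(1)] by blast
 then have "F = 0" using \<psi>_eq[OF c F] 0 by (simp add: Zero_fract_def eq_fract)
 then have "\<sigma> \<eta> G \<otimes>\<^bsub>stalk S \<eta>\<^esub> c = \<sigma> \<eta> G \<otimes>\<^bsub>stalk S \<eta>\<^esub> \<zero>\<^bsub>stalk S \<eta>\<^esub>" using F(2) \<sigma>\<eta>_zero by simp
 then show ?thesis using K0.Units_l_cancel[OF \<sigma>\<eta>_unit[OF F(1)] c K0.zero_closed] by simp
qed

lemma domain_stalk: "domain (stalk S \<eta>)"
proof (intro domain.intro domain_axioms.intro K0.is_cring)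
 show "\<one>\<^bsub>stalk S \<eta>\<^esub> \<noteq> \<zero>\<^bsub>stalk S \<eta>\<^esub>" using \<sigma>\<eta>_one \<sigma>\<eta>_eq_0[of 1] by auto
 fix c d assume cd: "c \<otimes>\<^bsub>stalk S \<eta>\<^esub> d = \<zero>\<^bsub>stalk S \<eta>\<^esub>" "c \<in> carrier (stalk S \<eta>)" "d \<in> carrier (stalk S \<eta>)"
 have "\<psi> \<zero>\<^bsub>stalk S \<eta>\<^esub> = 0" using \<psi>_eq[OF K0.zero_closed, of 1 0] \<sigma>\<eta>_zero by (simp add: Zero_fract_def)
 then have "\<psi> c * \<psi> d = 0" using \<psi>_ring(1)[OF cd(2,3)] cd(1) by simp
 then show "c = \<zero>\<^bsub>stalk S \<eta>\<^esub> \<or> d = \<zero>\<^bsub>stalk S \<eta>\<^esub>" using \<psi>_eq_0 cd(2,3) by auto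
qed

lemma section_zero_of_germ:
 assumes W: "opens S W" "W \<subseteq> V" and s: "s \<in> \<Gamma> S W" and 0: "\<eta> \<in> W ==> germ S \<eta> W s = \<zero>\<^bsub>stalk S \<eta>\<^esub>"
 shows "s = \<zero>\<^bsub>sections S W\<^esub>"
proof (rule sections_eqI[OF W(1) s])
 interpret G: cring "sections S W" by (rule cring_sections) fact
 show "\<zero>\<^bsub>sections S W\<^esub> \<in> \<Gamma> S W" by simp
 fix y assume y: "y \<in> W"
 obtain W' F G where W': "opens S W'" "y \<in> W'" "W' \<subseteq> W" "W' \<subseteq> locus S V (\<rho> G)"
  and e: "\<rho>r W' G \<otimes>\<^bsub>sections S W'\<^esub> res S W W' s = \<rho>r W' F" using fracs_on[OF W y s] by metis
 interpret G': cring "sections S W'" by (rule cring_sections) fact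
 have sub: "W' \<subseteq> V" using W' W by blast
 have \<eta>W: "\<eta> \<in> W'" by (rule generic_mem[OF \<eta> W'(1) sub W'(2)])
 have z: "germ S \<eta> W' (res S W W' s) = \<zero>\<^bsub>stalk S \<eta>\<^esub>" using germ_res[OF W(1) s W'(1,3) \<eta>W] 0 W'(3) \<eta>W by auto
 have "\<sigma> \<eta> F = \<zero>\<^bsub>stalk S \<eta>\<^esub>" using arg_cong[OF e, of "germ S \<eta> W'"] \<sigma>_res[OF W'(1) sub \<eta>W] z
   germ_mult[OF W'(1) \<eta>W res_\<rho>_closed[OF W'(1) sub] res_closed[OF W(1) W'(1,3) s]] by simp
 then have F0: "F = 0" by (rule \<sigma>\<eta>_eq_0)
 have r0: "\<rho>r W' 0 = \<zero>\<^bsub>sections S W'\<^esub>"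
  using ring_hom_zero[OF res_\<rho>_hom[OF W'(1) sub] cring.axioms(1)[OF cring_R] G'.ring_axioms] by simp
 have u: "\<rho>r W' G \<in> Units (sections S W')" by (rule res_\<rho>_Units) (use W' in auto)
 have "res S W W' s = \<zero>\<^bsub>sections S W'\<^esub>"
  using G'.Units_l_cancel[OF u res_closed[OF W(1) W'(1,3) s] G'.zero_closed] e r0 G'.Units_closed[OF u] unfolding F0 by simp
 then show "\<exists>W'. opens S W' & y \<in> W' & W' \<subseteq> W & res S W W' s = res S W W' \<zero>\<^bsub>sections S W\<^esub>"
  using W' res_zero[OF W(1) W'(1,3)] by auto
qed

end

section \<open>Bundles given by an atlas over the punctured plane\<close>

type_synonym cylinder_ring = "plane_ring poly"

text \<open>What is left of a bundle when the group action is forgotten: charts over the \<open>D(f)\<close> whose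
coordinates differ by functions of the base.\<close>

locale atlas = rspace P for P :: "('p, 's) ringed_space" +
 fixes \<alpha> :: "plane_ring => 's" and Fs :: "plane_ring set" and \<rho> :: "plane_ring => cylinder_ring => 's"
 assumes \<alpha>_hom: "\<alpha> \<in> ring_hom tring (sections P (points P))" and finite_Fs: "finite Fs" and Fs0: "0 \<notin> Fs"
  and Fs_cover: "\<And>p. primeideal p tring ==> p \<noteq> origin \<longleftrightarrow> (\<exists>f\<in>Fs. f \<notin> p)"
  and chart: "\<And>f. f \<in> Fs ==> fchart P (locus P (points P) (\<alpha> f)) (\<rho> f) [:f:]"
  and cover: "\<And>y. y \<in> points P ==> \<exists>f\<in>Fs. y \<in> locus P (points P) (\<alpha> f)"
  and const: "\<And>f a. f \<in> Fs ==> \<rho> f [:a:] = res P (points P) (locus P (points P) (\<alpha> f)) (\<alpha> a)"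
  and diff: "\<And>f g W. f \<in> Fs ==> g \<in> Fs ==> W = locus P (points P) (\<alpha> f) \<inter> locus P (points P) (\<alpha> g) ==>
   \<exists>n c. res P (points P) W (\<alpha> ((f * g) ^ n)) \<otimes>\<^bsub>sections P W\<^esub>
    (res P (locus P (points P) (\<alpha> f)) W (\<rho> f [:0, 1:]) \<ominus>\<^bsub>sections P W\<^esub>
    res P (locus P (points P) (\<alpha> g)) W (\<rho> g [:0, 1:])) = res P (points P) W (\<alpha> c)"
begin

abbreviation "PP \<equiv> points P"
abbreviation "V f \<equiv> locus P PP (\<alpha> f)"

lemma open_PP: "opens P PP" by simp

lemma open_V: "opens P (V f)" by (rule open_locus) simp

lemma V_sub: "V f \<subseteq> PP" by (rule locus_subset)

lemma \<alpha>_closed: "\<alpha> a \<in> \<Gamma> P PP" using ring_hom_closed[OF \<alpha>_hom] by simp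

lemma \<alpha>_mult: "\<alpha> (a * b) = \<alpha> a \<otimes>\<^bsub>sections P PP\<^esub> \<alpha> b"
 and \<alpha>_add: "\<alpha> (a + b) = \<alpha> a \<oplus>\<^bsub>sections P PP\<^esub> \<alpha> b" and \<alpha>_one: "\<alpha> 1 = \<one>\<^bsub>sections P PP\<^esub>"
 using ring_hom_mult[OF \<alpha>_hom, of a b] ring_hom_add[OF \<alpha>_hom, of a b] ring_hom_one[OF \<alpha>_hom] by simp_all

definition f1 :: plane_ring where "f1 = (SOME f. f \<in> Fs)"

lemma f1: "f1 \<in> Fs"
proof -
 have "X1 \<noteq> 0" by (simp add: X1_def)
 then have "{0} \<noteq> origin" using X1_Y1_origin(1) by blast
 then obtain f where "f \<in> Fs" using Fs_cover[OF prime_zero] by blast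
 then show ?thesis unfolding f1_def by (rule someI)
qed

sublocale F1: fchart P "V f1" "\<rho> f1" "[:f1:]" by (rule chart[OF f1])

definition \<eta> :: 'p where "\<eta> = (SOME y. y \<in> V f1 & prm P (V f1) tring (\<rho> f1) y = {0})"

lemma \<eta>1: "\<eta> \<in> V f1" "prm P (V f1) tring (\<rho> f1) \<eta> = {0}"
 using someI_ex[of "\<lambda>y. y \<in> V f1 & prm P (V f1) tring (\<rho> f1) y = {0}"] F1.generic_ex unfolding \<eta>_def by blast+

lemma locus_\<rho>_const: "f \<in> Fs ==> locus P (V f) (\<rho> f [:a:]) = V f \<inter> V a"
 unfolding const by (rule locus_res[OF open_PP \<alpha>_closed open_V V_sub])

lemma generic_common:
 assumes f: "f \<in> Fs" and y: "y \<in> V f" "prm P (V f) tring (\<rho> f) y = {0}" and a: "a \<noteq> 0"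
 shows "y \<in> V a"
proof -
 interpret F: fchart P "V f" "\<rho> f" "[:f:]" by (rule chart[OF f])
 have "[:a:] \<notin> prm P (V f) tring (\<rho> f) y" unfolding y(2) using a by simp
 then have "y \<in> locus P (V f) (\<rho> f [:a:])" using F.mem_prm[OF y(1)] by simp
 then show ?thesis unfolding locus_\<rho>_const[OF f] by simp
qed

text \<open>Any two of the charts meet, so they have the same generic point.\<close>

lemma \<eta>:
 assumes g: "g \<in> Fs" shows "\<eta> \<in> V g" "prm P (V g) tring (\<rho> g) \<eta> = {0}"
proof -
 interpret G: fchart P "V g" "\<rho> g" "[:g:]" by (rule chart[OF g])
 obtain \<zeta> where \<zeta>: "\<zeta> \<in> V g" "prm P (V g) tring (\<rho> g) \<zeta> = {0}" using G.generic_ex by blast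
 have g0: "g \<noteq> 0" "f1 \<noteq> 0" using g f1 Fs0 by metis+
 show \<eta>V: "\<eta> \<in> V g" by (rule generic_common[OF f1 \<eta>1 g0(1)])
 have \<zeta>1: "\<zeta> \<in> V f1" by (rule generic_common[OF g \<zeta> g0(2)])
 have "F \<notin> prm P (V g) tring (\<rho> g) \<eta>" if F: "F \<noteq> 0" for F
 proof -
  let ?D = "locus P (V g) (\<rho> g F)"
  have "\<zeta> \<in> ?D" using G.mem_prm[OF \<zeta>(1), of F] \<zeta>(2) F by simp
  then have "\<eta> \<in> ?D \<inter> V f1" by (intro F1.generic_mem[OF \<eta>1]) (use \<zeta>1 open_V open_locus in \<open>auto simp: openin_Int\<close>)
  then show ?thesis using G.mem_prm[OF \<eta>V, of F] by simp
 qed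
 moreover have "0 \<in> prm P (V g) tring (\<rho> g) \<eta>" by (rule tring_primeD(1)[OF G.prime[OF \<eta>V]])
 ultimately show "prm P (V g) tring (\<rho> g) \<eta> = {0}" by blast
qed

lemma generic_chart: "f \<in> Fs ==> generic P (V f) (\<rho> f) [:f:] \<eta>"
 by (rule generic.intro[OF chart generic_axioms.intro[OF \<eta>]])

lemma \<eta>_mem: assumes W: "opens P W" "y \<in> W" shows "\<eta> \<in> W"
proof -
 have "y \<in> PP" using openin_subset[OF W(1)] W(2) by blast
 then obtain f where f: "f \<in> Fs" "y \<in> V f" using cover by blast
 interpret F: fchart P "V f" "\<rho> f" "[:f:]" by (rule chart[OF f(1)])
 have "\<eta> \<in> W \<inter> V f" by (rule F.generic_mem[OF \<eta>[OF f(1)], of _ y]) (use W f open_V in \<open>auto simp: openin_Int\<close>)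
 then show ?thesis by blast
qed

lemma \<eta>_PP: "\<eta> \<in> PP" using \<eta>(1)[OF f1] V_sub by blast

sublocale G1: generic P "V f1" "\<rho> f1" "[:f1:]" \<eta> by (rule generic_chart[OF f1])

lemma zero_of_germ:
 assumes W: "opens P W" and s: "s \<in> \<Gamma> P W" and 0: "\<eta> \<in> W ==> germ P \<eta> W s = \<zero>\<^bsub>stalk P \<eta>\<^esub>"
 shows "s = \<zero>\<^bsub>sections P W\<^esub>"
proof (rule sections_eqI[OF W s])
 interpret G: cring "sections P W" by (rule cring_sections) fact
 show "\<zero>\<^bsub>sections P W\<^esub> \<in> \<Gamma> P W" by simp
 fix y assume y: "y \<in> W"
 then have "y \<in> PP" using openin_subset[OF W(1)] by blast
 then obtain f where f: "f \<in> Fs" "y \<in> V f" using cover by blast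
 interpret F: generic P "V f" "\<rho> f" "[:f:]" \<eta> by (rule generic_chart[OF f(1)])
 let ?W = "W \<inter> V f"
 have o: "opens P ?W" "?W \<subseteq> W" "?W \<subseteq> V f" using W open_V by (auto simp: openin_Int)
 have "germ P \<eta> ?W (res P W ?W s) = \<zero>\<^bsub>stalk P \<eta>\<^esub>" if "\<eta> \<in> ?W" using germ_res[OF W s o(1,2) that] 0 that by simp
 then have "res P W ?W s = \<zero>\<^bsub>sections P ?W\<^esub>" by (rule F.section_zero_of_germ[OF o(1,3) res_closed[OF W o(1,2) s]])
 then show "\<exists>W'. opens P W' & y \<in> W' & W' \<subseteq> W & res P W W' s = res P W W' \<zero>\<^bsub>sections P W\<^esub>"
  using o y f(2) res_zero[OF W o(1,2)] by (intro exI[of _ ?W]) auto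
qed

text \<open>The value of a section in the function field.\<close>

definition \<epsilon> :: "'p set => 's => cylinder_ring fract" where "\<epsilon> W s = G1.\<psi> (germ P \<eta> W s)"

lemma \<epsilon>_ring:
 assumes "opens P W" "\<eta> \<in> W" "s \<in> \<Gamma> P W" "t \<in> \<Gamma> P W"
 shows "\<epsilon> W (s \<otimes>\<^bsub>sections P W\<^esub> t) = \<epsilon> W s * \<epsilon> W t" "\<epsilon> W (s \<oplus>\<^bsub>sections P W\<^esub> t) = \<epsilon> W s + \<epsilon> W t"
 unfolding \<epsilon>_def germ_mult[OF assms, symmetric] germ_add[OF assms, symmetric]
 using G1.\<psi>_ring[OF germ_closed[OF assms(1-3)] germ_closed[OF assms(1,2,4)]] by auto

lemma \<epsilon>_one: "opens P W ==> \<eta> \<in> W ==> \<epsilon> W \<one>\<^bsub>sections P W\<^esub> = 1"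
 unfolding \<epsilon>_def by (simp add: germ_one G1.\<psi>_one)

lemma \<epsilon>_minus:
 assumes W: "opens P W" "\<eta> \<in> W" and s: "s \<in> \<Gamma> P W" "t \<in> \<Gamma> P W"
 shows "\<epsilon> W (s \<ominus>\<^bsub>sections P W\<^esub> t) = \<epsilon> W s - \<epsilon> W t"
proof -
 interpret G: cring "sections P W" by (rule cring_sections) fact
 have "(s \<ominus>\<^bsub>sections P W\<^esub> t) \<oplus>\<^bsub>sections P W\<^esub> t = s" using s by (simp add: G.minus_eq G.a_assoc G.l_neg)
 then have "\<epsilon> W (s \<ominus>\<^bsub>sections P W\<^esub> t) + \<epsilon> W t = \<epsilon> W s" using \<epsilon>_ring(2)[OF W G.minus_closed[OF s] s(2)] by simp
 then show ?thesis by (simp add: eq_diff_eq)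
qed

lemma \<epsilon>_inj:
 assumes W: "opens P W" "\<eta> \<in> W" and s: "s \<in> \<Gamma> P W" "t \<in> \<Gamma> P W" and eq: "\<epsilon> W s = \<epsilon> W t"
 shows "s = t"
proof -
 interpret G: cring "sections P W" by (rule cring_sections) fact
 have "\<epsilon> W (s \<ominus>\<^bsub>sections P W\<^esub> t) = 0" using \<epsilon>_minus[OF W s] eq by simp
 then have "s \<ominus>\<^bsub>sections P W\<^esub> t = \<zero>\<^bsub>sections P W\<^esub>" unfolding \<epsilon>_def
  by (intro zero_of_germ W G1.\<psi>_eq_0 germ_closed G.minus_closed s)
 then show "s = t" using s by simp
qed

lemma \<epsilon>_res:
 "opens P W ==> opens P W' ==> W' \<subseteq> W ==> \<eta> \<in> W' ==> s \<in> \<Gamma> P W ==> \<epsilon> W' (res P W W' s) = \<epsilon> W s"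
 unfolding \<epsilon>_def by (simp add: germ_res)

definition \<iota> :: "plane_ring => cylinder_ring fract" where "\<iota> a = \<epsilon> PP (\<alpha> a)"

definition \<tau> :: "plane_ring => cylinder_ring fract" where "\<tau> f = \<epsilon> (V f) (\<rho> f [:0, 1:])"

lemma \<iota>: "\<iota> (a * b) = \<iota> a * \<iota> b" "\<iota> (a + b) = \<iota> a + \<iota> b" "\<iota> 1 = 1"
 unfolding \<iota>_def \<alpha>_mult \<alpha>_add \<alpha>_one
 by (rule \<epsilon>_ring(1)[OF open_PP \<eta>_PP \<alpha>_closed \<alpha>_closed] \<epsilon>_ring(2)[OF open_PP \<eta>_PP \<alpha>_closed \<alpha>_closed] \<epsilon>_one[OF open_PP \<eta>_PP])+

lemma \<rho>_closed: "f \<in> Fs ==> \<rho> f b \<in> \<Gamma> P (V f)"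
proof -
 assume f: "f \<in> Fs"
 interpret F: fchart P "V f" "\<rho> f" "[:f:]" by (rule chart[OF f])
 show ?thesis by (rule F.\<rho>_closed) simp
qed

lemma \<epsilon>_\<rho>:
 assumes f: "f \<in> Fs"
 shows "\<epsilon> (V f) (\<rho> f (b * b')) = \<epsilon> (V f) (\<rho> f b) * \<epsilon> (V f) (\<rho> f b')"
  and "\<epsilon> (V f) (\<rho> f (b + b')) = \<epsilon> (V f) (\<rho> f b) + \<epsilon> (V f) (\<rho> f b')" and "\<epsilon> (V f) (\<rho> f [:a:]) = \<iota> a"
proof -
 interpret F: fchart P "V f" "\<rho> f" "[:f:]" by (rule chart[OF f])
 show "\<epsilon> (V f) (\<rho> f (b * b')) = \<epsilon> (V f) (\<rho> f b) * \<epsilon> (V f) (\<rho> f b')"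
  using \<epsilon>_ring(1)[OF open_V \<eta>(1)[OF f] \<rho>_closed[OF f] \<rho>_closed[OF f], of b b'] F.\<rho>_mult[of b b'] by simp
 show "\<epsilon> (V f) (\<rho> f (b + b')) = \<epsilon> (V f) (\<rho> f b) + \<epsilon> (V f) (\<rho> f b')"
  using \<epsilon>_ring(2)[OF open_V \<eta>(1)[OF f] \<rho>_closed[OF f] \<rho>_closed[OF f], of b b'] ring_hom_add[OF F.hom, of b b'] by simp
 show "\<epsilon> (V f) (\<rho> f [:a:]) = \<iota> a" unfolding const[OF f] \<iota>_def by (rule \<epsilon>_res[OF open_PP open_V V_sub \<eta>(1)[OF f] \<alpha>_closed])
qed

lemma \<epsilon>_\<rho>_inj:
 assumes f: "f \<in> Fs" and 0: "\<epsilon> (V f) (\<rho> f b) = 0" shows "b = 0"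
proof -
 interpret F: generic P "V f" "\<rho> f" "[:f:]" \<eta> by (rule generic_chart[OF f])
 have "germ P \<eta> (V f) (\<rho> f b) = \<zero>\<^bsub>stalk P \<eta>\<^esub>"
  by (rule G1.\<psi>_eq_0[OF germ_closed[OF open_V \<eta>(1)[OF f] \<rho>_closed[OF f]]]) (use 0 in \<open>simp add: \<epsilon>_def\<close>)
 then show "b = 0" using F.\<sigma>\<eta>_eq_0[of b] by (simp add: F.\<sigma>_def)
qed

lemma \<iota>_eq_0: "\<iota> a = 0 ==> a = 0"
 using \<epsilon>_\<rho>_inj[OF f1, of "[:a:]"] \<epsilon>_\<rho>(3)[OF f1, of a] by simp

lemma \<iota>_0: "\<iota> 0 = 0"
proof -
 have "\<iota> 0 + \<iota> 0 = \<iota> 0 + 0" using \<iota>(2)[of 0 0] by simp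
 then show ?thesis by (simp only: add_left_cancel)
qed

lemma \<epsilon>_\<rho>_eval:
 assumes f: "f \<in> Fs" shows "\<epsilon> (V f) (\<rho> f b) = poly (map_poly \<iota> b) (\<tau> f)"
proof (induction b)
 case 0
 have "\<epsilon> (V f) (\<rho> f 0) = 0" using \<epsilon>_\<rho>(3)[OF f, of 0] \<iota>_0 by simp
 then show ?case by simp
next
 case (pCons a b)
 have "pCons a b = [:a:] + [:0, 1:] * b" by simp
 then have "\<epsilon> (V f) (\<rho> f (pCons a b)) = \<iota> a + \<tau> f * \<epsilon> (V f) (\<rho> f b)"
  unfolding \<tau>_def using \<epsilon>_\<rho>(3)[OF f, of a] \<epsilon>_\<rho>(1,2)[OF f] by metis
 then show ?case using pCons by (simp add: map_poly_pCons[where f = \<iota>, OF \<iota>_0])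
qed

lemma \<epsilon>_diff:
 assumes fg: "f \<in> Fs" "g \<in> Fs"
 shows "\<exists>n c. \<iota> ((f * g) ^ n) * (\<tau> f - \<tau> g) = \<iota> c"
proof -
 let ?W = "V f \<inter> V g"
 have o: "opens P ?W" "?W \<subseteq> PP" "?W \<subseteq> V f" "?W \<subseteq> V g" "\<eta> \<in> ?W" using open_V V_sub \<eta>(1) fg by (auto simp: openin_Int)
 obtain n c where e: "res P PP ?W (\<alpha> ((f * g) ^ n)) \<otimes>\<^bsub>sections P ?W\<^esub>
    (res P (V f) ?W (\<rho> f [:0, 1:]) \<ominus>\<^bsub>sections P ?W\<^esub> res P (V g) ?W (\<rho> g [:0, 1:])) = res P PP ?W (\<alpha> c)"
  using diff[OF fg refl] by blast
 interpret G: cring "sections P ?W" by (rule cring_sections) fact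
 note c = res_closed[OF open_V o(1,3) \<rho>_closed[OF fg(1), of "[:0, 1:]"]]
  res_closed[OF open_V o(1,4) \<rho>_closed[OF fg(2), of "[:0, 1:]"]] res_closed[OF open_PP o(1,2) \<alpha>_closed]
 have "\<iota> ((f * g) ^ n) * (\<tau> f - \<tau> g) = \<iota> c"
  using arg_cong[OF e, of "\<epsilon> ?W"] \<epsilon>_ring(1)[OF o(1,5) c(3) G.minus_closed[OF c(1,2)]] \<epsilon>_minus[OF o(1,5) c(1,2)]
   \<epsilon>_res[OF open_PP o(1,2,5) \<alpha>_closed] \<epsilon>_res[OF open_V o(1,3,5) \<rho>_closed[OF fg(1)]]
   \<epsilon>_res[OF open_V o(1,4,5) \<rho>_closed[OF fg(2)]] unfolding \<iota>_def \<tau>_def by simp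
 then show ?thesis by blast
qed

sublocale torsor \<iota> Fs \<tau>
proof
 show "\<iota> (a + b) = \<iota> a + \<iota> b" "\<iota> (a * b) = \<iota> a * \<iota> b" "\<iota> 1 = 1" for a b by (rule \<iota>)+
 show "\<iota> a = 0 ==> a = 0" for a by (rule \<iota>_eq_0)
 show "finite Fs" by (rule finite_Fs)
 show "Fs \<noteq> {}" using f1 by blast
 show "0 \<notin> Fs" by (rule Fs0)
 show "primeideal p tring ==> p \<noteq> origin \<longleftrightarrow> (\<exists>f\<in>Fs. f \<notin> p)" for p by (rule Fs_cover)
 show "b = 0" if "f \<in> Fs" "poly (map_poly \<iota> b) (\<tau> f) = 0" for f b
  using \<epsilon>_\<rho>_inj[OF that(1)] \<epsilon>_\<rho>_eval[OF that(1)] that(2) by simp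
 show "\<exists>n c. \<iota> ((f * g) ^ n) * (\<tau> f - \<tau> g) = \<iota> c" if "f \<in> Fs" "g \<in> Fs" for f g by (rule \<epsilon>_diff[OF that])
qed

lemma \<epsilon>_\<rho>_ev: "f \<in> Fs ==> \<epsilon> (V f) (\<rho> f b) = ev b (\<tau> f)"
 unfolding ev_def by (rule \<epsilon>_\<rho>_eval)

lemma \<rho>_const_power: "\<epsilon> (V f) (\<rho> f ([:f:] ^ n)) = \<iota> (f ^ n)" if f: "f \<in> Fs"
 using \<epsilon>_\<rho>(3)[OF f, of "f ^ n"] by (simp add: poly_const_pow)

text \<open>Sections over \<open>V f\<close> are fractions with a power of \<open>f\<close> as denominator.\<close>

lemma E_iff:
 assumes f: "f \<in> Fs" shows "E f = \<epsilon> (V f) ` \<Gamma> P (V f)"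
proof (intro equalityI subsetI)
 interpret F: fchart P "V f" "\<rho> f" "[:f:]" by (rule chart[OF f])
 interpret G: cring "sections P (V f)" by (rule cring_sections[OF open_V])
 note o = open_V[of f] \<eta>(1)[OF f]
 {
  fix e assume "e \<in> E f"
  then obtain n b where e: "\<iota> (f ^ n) * e = ev b (\<tau> f)" unfolding E_def by blast
  have "res P (V f) (V f) (\<rho> f ([:f:] ^ n)) \<in> Units (sections P (V f))"
  proof (rule F.res_\<rho>_Units[OF open_V])
   show "V f \<subseteq> locus P (V f) (\<rho> f ([:f:] ^ n))"
   proof (induction n)
    case 0 show ?case using F.locus_\<rho>_one by simp
   next
    case (Suc n)
    have "locus P (V f) (\<rho> f [:f:]) = V f" unfolding locus_\<rho>_const[OF f] by simp
    then show ?case using Suc F.locus_\<rho>_times[of "[:f:]" "[:f:] ^ n"] by simp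
   qed
  qed simp
  then have u: "\<rho> f ([:f:] ^ n) \<in> Units (sections P (V f))" using res_id[OF open_V \<rho>_closed[OF f]] by simp
  define s where "s = inv\<^bsub>sections P (V f)\<^esub> (\<rho> f ([:f:] ^ n)) \<otimes>\<^bsub>sections P (V f)\<^esub> \<rho> f b"
  have s: "s \<in> \<Gamma> P (V f)" unfolding s_def using u \<rho>_closed[OF f] by simp
  have "\<rho> f ([:f:] ^ n) \<otimes>\<^bsub>sections P (V f)\<^esub> s = \<rho> f b"
   unfolding s_def using u \<rho>_closed[OF f] by (simp add: G.m_assoc[symmetric])
  then have "\<iota> (f ^ n) * \<epsilon> (V f) s = ev b (\<tau> f)"
   using \<epsilon>_ring(1)[OF o \<rho>_closed[OF f] s, of "[:f:] ^ n"] \<epsilon>_\<rho>_ev[OF f, of b] \<rho>_const_power[OF f, of n] by simp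
  then have "\<iota> (f ^ n) * \<epsilon> (V f) s = \<iota> (f ^ n) * e" using e by simp
  moreover have "f \<noteq> 0" using f Fs0 by metis
  then have "\<iota> (f ^ n) \<noteq> 0" by simp
  ultimately have "e = \<epsilon> (V f) s" by (metis mult_left_cancel)
  then show "e \<in> \<epsilon> (V f) ` \<Gamma> P (V f)" using s by blast
 next
  fix e assume "e \<in> \<epsilon> (V f) ` \<Gamma> P (V f)"
  then obtain s where s: "s \<in> \<Gamma> P (V f)" "e = \<epsilon> (V f) s" by blast
  obtain n b where "\<rho> f ([:f:] ^ n) \<otimes>\<^bsub>sections P (V f)\<^esub> s = \<rho> f b" using F.section_global_frac[OF s(1)] by blast
  then have "\<iota> (f ^ n) * e = ev b (\<tau> f)"
   using \<epsilon>_ring(1)[OF o \<rho>_closed[OF f] s(1), of "[:f:] ^ n"] \<epsilon>_\<rho>_ev[OF f, of b] \<rho>_const_power[OF f, of n] s(2) by simp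
  then show "e \<in> E f" unfolding E_def by blast
 }
qed

text \<open>Sections with the same value in the function field agree on overlaps, so they glue.\<close>

lemma \<R>_iff: "\<R> = \<epsilon> PP ` \<Gamma> P PP"
proof (intro equalityI subsetI)
 fix e assume e: "e \<in> \<R>"
 define D where "D W s \<longleftrightarrow> (\<exists>f\<in>Fs. W = V f & s \<in> \<Gamma> P (V f) & \<epsilon> (V f) s = e)" for W s
 have D_ex: "\<exists>s. D (V f) s" if f: "f \<in> Fs" for f
 proof -
  have "e \<in> E f" using e f unfolding \<R>_def by blast
  then show ?thesis unfolding E_iff[OF f] D_def using f by auto
 qed
 have DD: "\<exists>t \<in> \<Gamma> P PP. \<forall>W s. D W s --> res P PP W t = s"
 proof (rule glue_rel[OF open_PP])
  show "D W s ==> opens P W & W \<subseteq> PP & s \<in> \<Gamma> P W" for W s unfolding D_def using open_V V_sub by auto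
  show "\<exists>W s. x \<in> W & D W s" if "x \<in> PP" for x using cover[OF that] D_ex by blast
  fix W s W' s' assume "D W s" "D W' s'"
  then obtain f g where f: "f \<in> Fs" "W = V f" "s \<in> \<Gamma> P W" "\<epsilon> W s = e"
   and g: "g \<in> Fs" "W' = V g" "s' \<in> \<Gamma> P W'" "\<epsilon> W' s' = e" unfolding D_def by auto
  have oW: "opens P W" "opens P W'" unfolding f(2) g(2) by (rule open_V)+
  have o: "opens P (W \<inter> W')" "\<eta> \<in> W \<inter> W'" "W \<inter> W' \<subseteq> W" "W \<inter> W' \<subseteq> W'"
   using oW \<eta>(1)[OF f(1)] \<eta>(1)[OF g(1)] f(2) g(2) by (auto simp: openin_Int)
  show "res P W (W \<inter> W') s = res P W' (W \<inter> W') s'"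
   using \<epsilon>_inj[OF o(1,2) res_closed[OF oW(1) o(1,3) f(3)] res_closed[OF oW(2) o(1,4) g(3)]]
    \<epsilon>_res[OF oW(1) o(1,3,2) f(3)] \<epsilon>_res[OF oW(2) o(1,4,2) g(3)] f(4) g(4) by simp
 qed
 then obtain t where t: "t \<in> \<Gamma> P PP" "\<And>W s. D W s ==> res P PP W t = s" by blast
 obtain s where s: "D (V f1) s" using D_ex[OF f1] by blast
 have "\<epsilon> PP t = e" using \<epsilon>_res[OF open_PP open_V V_sub \<eta>(1)[OF f1] t(1)] t(2)[OF s] s unfolding D_def by (metis)
 then show "e \<in> \<epsilon> PP ` \<Gamma> P PP" using t(1) by blast
next
 fix e assume "e \<in> \<epsilon> PP ` \<Gamma> P PP"
 then obtain s where s: "s \<in> \<Gamma> P PP" "e = \<epsilon> PP s" by blast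
 have "e \<in> E f" if f: "f \<in> Fs" for f unfolding E_iff[OF f] s(2) using \<epsilon>_res[OF open_PP open_V V_sub \<eta>(1)[OF f] s(1)]
   res_closed[OF open_PP open_V V_sub s(1)] by (metis image_eqI)
 then show "e \<in> \<R>" unfolding \<R>_def by blast
qed

end

lemma (in fchart) locus_\<rho>_power:
 assumes "locus S V (\<rho> F) = V" shows "locus S V (\<rho> (F ^ n * G)) = locus S V (\<rho> G)"
proof (induction n)
 case (Suc n)
 have "locus S V (\<rho> (F * (F ^ n * G))) = locus S V (\<rho> G)"
  by (simp only: locus_\<rho>_times[of F "F ^ n * G"] assms Suc Int_absorb1[OF locus_subset])
 then show ?case by (simp add: mult.assoc)
qed simp

text \<open>A ring \<open>R'\<close> of global functions is a global chart if inverting \<open>h f\<close> turns it into the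
ring of the chart over \<open>D(f)\<close>. This is used for the ring of all global functions, and for the polynomials
in a global coordinate. All elements are compared in the function field.\<close>

locale glued = atlas P \<alpha> Fs \<rho> for P :: "('p, 's) ringed_space" and \<alpha> Fs \<rho> +
 fixes R' :: "'r ring" and \<theta> :: "'r => 's" and h :: "plane_ring => 'r"
 assumes R': "cring R'" and \<theta>_hom: "\<theta> \<in> ring_hom R' (sections P (points P))"
  and \<theta>_inj: "\<And>r r'. r \<in> carrier R' ==> r' \<in> carrier R' ==> \<theta> r = \<theta> r' ==> r = r'"
  and h: "\<And>f. f \<in> Fs ==> h f \<in> carrier R'" "\<And>f. f \<in> Fs ==> \<theta> (h f) = \<alpha> f"
  and dense: "\<And>f b. f \<in> Fs ==> \<exists>n. \<exists>r\<in>carrier R'. \<epsilon> (points P) (\<theta> r) = \<iota> (f ^ n) * ev b (\<tau> f)"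
begin

sublocale R': cring R' by (rule R')

lemma \<theta>_closed: "r \<in> carrier R' ==> \<theta> r \<in> \<Gamma> P PP"
 by (rule ring_hom_closed[OF \<theta>_hom])

definition e :: "'r => cylinder_ring fract" where "e r = \<epsilon> PP (\<theta> r)"

lemma e_ring:
 "r \<in> carrier R' ==> r' \<in> carrier R' ==> e (r \<otimes>\<^bsub>R'\<^esub> r') = e r * e r'"
 "r \<in> carrier R' ==> r' \<in> carrier R' ==> e (r \<oplus>\<^bsub>R'\<^esub> r') = e r + e r'" "e \<one>\<^bsub>R'\<^esub> = 1"
 using \<epsilon>_ring[OF open_PP \<eta>_PP \<theta>_closed \<theta>_closed] \<epsilon>_one[OF open_PP \<eta>_PP] ring_hom_mult[OF \<theta>_hom]
  ring_hom_add[OF \<theta>_hom] ring_hom_one[OF \<theta>_hom] unfolding e_def by simp_all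

lemma e_inj: "r \<in> carrier R' ==> r' \<in> carrier R' ==> e r = e r' ==> r = r'"
 unfolding e_def by (rule \<theta>_inj) (auto intro: \<epsilon>_inj[OF open_PP \<eta>_PP \<theta>_closed \<theta>_closed])

lemma e_zero: "e \<zero>\<^bsub>R'\<^esub> = 0"
proof -
 have "e \<zero>\<^bsub>R'\<^esub> + e \<zero>\<^bsub>R'\<^esub> = e \<zero>\<^bsub>R'\<^esub> + 0" using e_ring(2)[of "\<zero>\<^bsub>R'\<^esub>" "\<zero>\<^bsub>R'\<^esub>"] by simp
 then show ?thesis by (simp only: add_left_cancel)
qed

lemma e_h: "f \<in> Fs ==> e (h f) = \<iota> f" unfolding e_def \<iota>_def by (simp add: h)

lemma e_h_power: "f \<in> Fs ==> e (h f [^]\<^bsub>R'\<^esub> (n::nat)) = \<iota> (f ^ n)"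
 by (induction n) (simp_all add: e_ring e_h h \<iota>_mult \<iota>_one mult.commute)

lemma rep:
 assumes "f \<in> Fs" "r \<in> carrier R'" obtains n b where "\<iota> (f ^ n) * e r = ev b (\<tau> f)"
proof -
 have "e r \<in> \<R>" unfolding \<R>_iff e_def using \<theta>_closed[OF assms(2)] by blast
 then have "e r \<in> E f" unfolding \<R>_def using assms(1) by blast
 then show thesis using that unfolding E_def by blast
qed

lemma locus_\<theta>:
 assumes f: "f \<in> Fs" and r: "r \<in> carrier R'" and eq: "\<iota> (f ^ n) * e r = \<iota> (f ^ m) * ev b (\<tau> f)"
 shows "V f \<inter> locus P PP (\<theta> r) = locus P (V f) (\<rho> f b)"
proof -
 interpret F: fchart P "V f" "\<rho> f" "[:f:]" by (rule chart[OF f])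
 interpret G: cring "sections P (V f)" by (rule cring_sections[OF open_V])
 note o = open_V[of f] \<eta>(1)[OF f]
 note rc = res_closed[OF open_PP open_V V_sub \<theta>_closed[OF r], of f]
 have full: "locus P (V f) (\<rho> f [:f:]) = V f" unfolding locus_\<rho>_const[OF f] by simp
 have "\<epsilon> (V f) (\<rho> f ([:f:] ^ n) \<otimes>\<^bsub>sections P (V f)\<^esub> res P PP (V f) (\<theta> r)) = \<epsilon> (V f) (\<rho> f ([:f:] ^ m * b))"
  unfolding \<epsilon>_ring(1)[OF o \<rho>_closed[OF f] rc] \<epsilon>_\<rho>(1)[OF f] \<rho>_const_power[OF f] \<epsilon>_\<rho>_ev[OF f, of b]
   \<epsilon>_res[OF open_PP open_V V_sub \<eta>(1)[OF f] \<theta>_closed[OF r]] eq[unfolded e_def] ..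
 then have "\<rho> f ([:f:] ^ n) \<otimes>\<^bsub>sections P (V f)\<^esub> res P PP (V f) (\<theta> r) = \<rho> f ([:f:] ^ m * b)"
  by (rule \<epsilon>_inj[OF o G.m_closed[OF \<rho>_closed[OF f] rc] \<rho>_closed[OF f]])
 then have "locus P (V f) (\<rho> f ([:f:] ^ n)) \<inter> locus P (V f) (res P PP (V f) (\<theta> r)) = locus P (V f) (\<rho> f b)"
  using locus_mult[OF open_V \<rho>_closed[OF f] rc, of "[:f:] ^ n"] F.locus_\<rho>_power[OF full, of m b] by simp
 moreover have "locus P (V f) (\<rho> f ([:f:] ^ n)) = V f" using F.locus_\<rho>_power[OF full, of n 1] F.locus_\<rho>_one by simp
 ultimately show ?thesis using locus_res[OF open_PP \<theta>_closed[OF r] open_V V_sub] by auto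
qed

lemma mem_prm_\<theta>:
 assumes f: "f \<in> Fs" and r: "r \<in> carrier R'" and eq: "\<iota> (f ^ n) * e r = \<iota> (f ^ m) * ev b (\<tau> f)" and y: "y \<in> V f"
 shows "r \<in> prm P PP R' \<theta> y \<longleftrightarrow> b \<in> prm P (V f) tring (\<rho> f) y" using locus_\<theta>[OF f r eq] y r unfolding prm_def by auto

lemma mem_prm_\<theta>':
 "f \<in> Fs ==> r \<in> carrier R' ==> \<iota> (f ^ n) * e r = ev b (\<tau> f) ==> y \<in> V f ==>
  r \<in> prm P PP R' \<theta> y \<longleftrightarrow> b \<in> prm P (V f) tring (\<rho> f) y" using mem_prm_\<theta>[of f r n 0 b y] by (simp add: \<iota>_one)

lemma prime_\<theta>: assumes y: "y \<in> PP" shows "primeideal (prm P PP R' \<theta> y) R'"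
proof (rule primeidealI'[OF R'])
 obtain f where f: "f \<in> Fs" "y \<in> V f" using cover[OF y] by blast
 interpret F: fchart P "V f" "\<rho> f" "[:f:]" by (rule chart[OF f(1)])
 note D = tring_primeD[OF F.prime[OF f(2)]]
 let ?I = "prm P PP R' \<theta> y"
 have lm: "locus P PP (\<theta> (a \<otimes>\<^bsub>R'\<^esub> b)) = locus P PP (\<theta> a) \<inter> locus P PP (\<theta> b)" if "a \<in> carrier R'" "b \<in> carrier R'" for a b
  using locus_mult[OF open_PP \<theta>_closed \<theta>_closed, OF that] ring_hom_mult[OF \<theta>_hom that] by simp
 show sub: "?I \<subseteq> carrier R'" unfolding prm_def by blast
 show "\<zero>\<^bsub>R'\<^esub> \<in> ?I" using mem_prm_\<theta>'[OF f(1) R'.zero_closed _ f(2), of 0 0] e_zero D(1) by simp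
 show "x \<otimes>\<^bsub>R'\<^esub> a \<in> ?I" if "a \<in> ?I" "x \<in> carrier R'" for a x using that lm[of x a] unfolding prm_def by auto
 show "\<one>\<^bsub>R'\<^esub> \<notin> ?I" using mem_prm_\<theta>'[OF f(1) R'.one_closed _ f(2), of 0 1] e_ring(3) D(4) by (simp add: \<iota>_one ev_one)
 show "a \<in> ?I \<or> b \<in> ?I" if "a \<in> carrier R'" "b \<in> carrier R'" "a \<otimes>\<^bsub>R'\<^esub> b \<in> ?I" for a b
  using that lm[OF that(1,2)] unfolding prm_def by auto
 fix a b assume ab: "a \<in> ?I" "b \<in> ?I"
 then have c: "a \<in> carrier R'" "b \<in> carrier R'" using sub by auto
 obtain n a' where a': "\<iota> (f ^ n) * e a = ev a' (\<tau> f)" using rep[OF f(1) c(1)] .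
 obtain m b' where b': "\<iota> (f ^ m) * e b = ev b' (\<tau> f)" using rep[OF f(1) c(2)] .
 have "\<iota> (f ^ (n + m)) * e (a \<oplus>\<^bsub>R'\<^esub> b) = ev (smult (f ^ m) a' + smult (f ^ n) b') (\<tau> f)"
  unfolding ev_add ev_smult a'[symmetric] b'[symmetric] e_ring(2)[OF c] by (simp add: power_add \<iota>_mult algebra_simps)
 moreover have "a' \<in> prm P (V f) tring (\<rho> f) y" "b' \<in> prm P (V f) tring (\<rho> f) y"
  using ab mem_prm_\<theta>'[OF f(1) c(1) a' f(2)] mem_prm_\<theta>'[OF f(1) c(2) b' f(2)] by auto
 then have "smult (f ^ m) a' + smult (f ^ n) b' \<in> prm P (V f) tring (\<rho> f) y"
  using D(2)[OF D(3)[of a' "[:f ^ m:]"] D(3)[of b' "[:f ^ n:]"]] by simp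
 ultimately show "a \<oplus>\<^bsub>R'\<^esub> b \<in> ?I" using mem_prm_\<theta>'[OF f(1) R'.a_closed[OF c] _ f(2)] by blast
qed

lemma h_prm: "f \<in> Fs ==> y \<in> PP ==> h f \<notin> prm P PP R' \<theta> y \<longleftrightarrow> y \<in> V f"
 unfolding prm_def using h by simp

lemma inj_\<theta>: "inj_on (prm P PP R' \<theta>) PP"
proof (rule inj_onI)
 fix y y' assume y: "y \<in> PP" "y' \<in> PP" and eq: "prm P PP R' \<theta> y = prm P PP R' \<theta> y'"
 obtain f where f: "f \<in> Fs" "y \<in> V f" using cover[OF y(1)] by blast
 have f': "y' \<in> V f" using h_prm[OF f(1) y(1)] h_prm[OF f(1) y(2)] eq f(2) by simp
 interpret F: fchart P "V f" "\<rho> f" "[:f:]" by (rule chart[OF f(1)])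
 have "b \<in> prm P (V f) tring (\<rho> f) y \<longleftrightarrow> b \<in> prm P (V f) tring (\<rho> f) y'" for b
 proof -
  obtain n r where r: "r \<in> carrier R'" "\<epsilon> PP (\<theta> r) = \<iota> (f ^ n) * ev b (\<tau> f)" using dense[OF f(1)] by blast
  have "\<iota> (f ^ 0) * e r = \<iota> (f ^ n) * ev b (\<tau> f)" using r(2) unfolding e_def by (simp add: \<iota>_one)
  from mem_prm_\<theta>[OF f(1) r(1) this f(2)] mem_prm_\<theta>[OF f(1) r(1) this f'] show ?thesis unfolding eq by blast
 qed
 then show "y = y'" using inj_onD[OF F.inj _ f(2) f'] by blast
qed

lemma basis_\<theta>:
 assumes W: "opens P W" "W \<subseteq> PP" "y \<in> W"
 shows "\<exists>r\<in>carrier R'. y \<in> locus P PP (\<theta> r) & locus P PP (\<theta> r) \<subseteq> W"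
proof -
 have "y \<in> PP" using W by blast
 then obtain f where f: "f \<in> Fs" "y \<in> V f" using cover by blast
 interpret F: fchart P "V f" "\<rho> f" "[:f:]" by (rule chart[OF f(1)])
 have "opens P (W \<inter> V f)" "W \<inter> V f \<subseteq> V f" "y \<in> W \<inter> V f" using W f open_V by (auto simp: openin_Int)
 then obtain b where b: "y \<in> locus P (V f) (\<rho> f b)" "locus P (V f) (\<rho> f b) \<subseteq> W \<inter> V f" using F.basis by blast
 obtain n r where r: "r \<in> carrier R'" "\<epsilon> PP (\<theta> r) = \<iota> (f ^ n) * ev b (\<tau> f)" using dense[OF f(1)] by blast
 have "\<iota> (f ^ 0) * e r = \<iota> (f ^ n) * ev b (\<tau> f)" using r(2) unfolding e_def by (simp add: \<iota>_one)
 from locus_\<theta>[OF f(1) r(1) this] have "locus P PP (\<theta> (h f \<otimes>\<^bsub>R'\<^esub> r)) = locus P (V f) (\<rho> f b)"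
  using locus_mult[OF open_PP \<theta>_closed[OF h(1)[OF f(1)]] \<theta>_closed[OF r(1)]] ring_hom_mult[OF \<theta>_hom h(1)[OF f(1)] r(1)] h(2)[OF f(1)]
  by simp
 then show ?thesis using b h(1)[OF f(1)] r(1) by (intro bexI[of _ "h f \<otimes>\<^bsub>R'\<^esub> r"]) auto
qed

lemma fracs_\<theta>:
 assumes W: "opens P W" "W \<subseteq> PP" "y \<in> W" and s: "s \<in> \<Gamma> P W"
 shows "\<exists>F\<in>carrier R'. \<exists>G\<in>carrier R'. y \<in> locus P PP (\<theta> G) & (\<exists>W'. opens P W' & y \<in> W' & W' \<subseteq> W &
     res P PP W' (\<theta> G) \<otimes>\<^bsub>sections P W'\<^esub> res P W W' s = res P PP W' (\<theta> F))"
proof -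
 have "y \<in> PP" using W by blast
 then obtain f where f: "f \<in> Fs" "y \<in> V f" using cover by blast
 interpret F: fchart P "V f" "\<rho> f" "[:f:]" by (rule chart[OF f(1)])
 let ?W = "W \<inter> V f"
 have o: "opens P ?W" "?W \<subseteq> V f" "y \<in> ?W" "?W \<subseteq> W" using W f open_V by (auto simp: openin_Int)
 obtain W' F G where W': "opens P W'" "y \<in> W'" "W' \<subseteq> ?W" "W' \<subseteq> locus P (V f) (\<rho> f G)"
  and eq: "res P (V f) W' (\<rho> f G) \<otimes>\<^bsub>sections P W'\<^esub> res P ?W W' (res P W ?W s) = res P (V f) W' (\<rho> f F)"
  using F.fracs_on[OF o(1-3) res_closed[OF W(1) o(1,4) s]] by metis
 have sub: "W' \<subseteq> W" "W' \<subseteq> V f" "W' \<subseteq> PP" using W' V_sub by blast+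
 have \<eta>W: "\<eta> \<in> W'" by (rule \<eta>_mem[OF W'(1,2)])
 obtain n rG where rG: "rG \<in> carrier R'" "e rG = \<iota> (f ^ n) * ev G (\<tau> f)" using dense[OF f(1), of G] unfolding e_def by blast
 obtain m rF where rF: "rF \<in> carrier R'" "e rF = \<iota> (f ^ m) * ev F (\<tau> f)" using dense[OF f(1), of F] unfolding e_def by blast
 let ?G = "h f [^]\<^bsub>R'\<^esub> m \<otimes>\<^bsub>R'\<^esub> rG" and ?F = "h f [^]\<^bsub>R'\<^esub> n \<otimes>\<^bsub>R'\<^esub> rF"
 have c: "?G \<in> carrier R'" "?F \<in> carrier R'" using h(1)[OF f(1)] rG rF by auto
 have eG: "e ?G = \<iota> (f ^ m) * (\<iota> (f ^ n) * ev G (\<tau> f))" and eF: "e ?F = \<iota> (f ^ n) * (\<iota> (f ^ m) * ev F (\<tau> f))"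
  using h(1)[OF f(1)] rG rF by (simp_all add: e_ring(1) e_h_power[OF f(1)])
 have "ev G (\<tau> f) * \<epsilon> W s = ev F (\<tau> f)"
  using arg_cong[OF eq, of "\<epsilon> W'"] \<epsilon>_ring(1)[OF W'(1) \<eta>W res_closed[OF open_V W'(1) sub(2) \<rho>_closed[OF f(1)]] res_closed[OF W(1) W'(1) sub(1) s]]
   res_res[OF W(1) o(1) W'(1,3) o(4) s] \<epsilon>_res[OF open_V W'(1) sub(2) \<eta>W \<rho>_closed[OF f(1)]] \<epsilon>_res[OF W(1) W'(1) sub(1) \<eta>W s] \<epsilon>_\<rho>_ev[OF f(1)]
  by simp
 then have eq': "e ?G * \<epsilon> W s = e ?F" unfolding eG eF by (simp add: algebra_simps)
 note Wc = res_closed[OF open_PP W'(1) sub(3) \<theta>_closed] res_closed[OF W(1) W'(1) sub(1) s]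
 interpret G: cring "sections P W'" by (rule cring_sections[OF W'(1)])
 from eq' have "\<epsilon> W' (res P PP W' (\<theta> ?G) \<otimes>\<^bsub>sections P W'\<^esub> res P W W' s) = \<epsilon> W' (res P PP W' (\<theta> ?F))"
  unfolding \<epsilon>_ring(1)[OF W'(1) \<eta>W Wc(1)[OF c(1)] Wc(2)] \<epsilon>_res[OF open_PP W'(1) sub(3) \<eta>W \<theta>_closed[OF c(1)]]
   \<epsilon>_res[OF open_PP W'(1) sub(3) \<eta>W \<theta>_closed[OF c(2)]] \<epsilon>_res[OF W(1) W'(1) sub(1) \<eta>W s] e_def .
 then have "res P PP W' (\<theta> ?G) \<otimes>\<^bsub>sections P W'\<^esub> res P W W' s = res P PP W' (\<theta> ?F)"
  by (rule \<epsilon>_inj[OF W'(1) \<eta>W G.m_closed[OF Wc(1)[OF c(1)] Wc(2)] Wc(1)[OF c(2)]])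
 moreover have "y \<in> locus P PP (\<theta> ?G)"
 proof -
  have "\<iota> (f ^ 0) * e ?G = \<iota> (f ^ (m + n)) * ev G (\<tau> f)" unfolding eG by (simp add: \<iota>_mult \<iota>_one power_add)
  from locus_\<theta>[OF f(1) c(1) this] show ?thesis using W'(2,4) by blast
 qed
 ultimately show ?thesis by (intro bexI[OF _ c(2)] bexI[OF _ c(1)] conjI exI[of _ W'] W'(1,2) sub(1))
qed

lemma glued_chart: "chart P PP R' \<theta>"
proof (intro chart.intro chart_axioms.intro rspace_axioms)
 show "opens P PP" by (rule open_PP)
 show "cring R'" by (rule R')
 show "\<theta> \<in> ring_hom R' (sections P PP)" by (rule \<theta>_hom)
 show "y \<in> PP ==> primeideal (prm P PP R' \<theta> y) R'" for y by (rule prime_\<theta>)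
 show "inj_on (prm P PP R' \<theta>) PP" by (rule inj_\<theta>)
 show "\<exists>r\<in>carrier R'. y \<in> locus P PP (\<theta> r) & locus P PP (\<theta> r) \<subseteq> W" if "opens P W" "W \<subseteq> PP" "y \<in> W" for W y
  by (rule basis_\<theta>[OF that])
 show "\<exists>F\<in>carrier R'. \<exists>G\<in>carrier R'. y \<in> locus P PP (\<theta> G) & (\<exists>W'. opens P W' & y \<in> W' & W' \<subseteq> W &
     res P PP W' (\<theta> G) \<otimes>\<^bsub>sections P W'\<^esub> res P W W' s = res P PP W' (\<theta> F))"
  if "opens P W" "W \<subseteq> PP" "y \<in> W" "s \<in> \<Gamma> P W" for W y s by (rule fracs_\<theta>[OF that])
 fix W y F assume W: "opens P W" "W \<subseteq> PP" "y \<in> W" and F: "F \<in> carrier R'" and 0: "res P PP W (\<theta> F) = \<zero>\<^bsub>sections P W\<^esub>"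
 have \<eta>W: "\<eta> \<in> W" by (rule \<eta>_mem[OF W(1,3)])
 have "res P PP W (\<theta> \<zero>\<^bsub>R'\<^esub>) = \<zero>\<^bsub>sections P W\<^esub>"
  using ring_hom_zero[OF \<theta>_hom R'.ring_axioms cring.axioms(1)[OF cring_sections[OF open_PP]]] res_zero[OF open_PP W(1,2)] by simp
 then have "e F = e \<zero>\<^bsub>R'\<^esub>"
  unfolding e_def using \<epsilon>_res[OF open_PP W(1,2) \<eta>W \<theta>_closed[OF F]] \<epsilon>_res[OF open_PP W(1,2) \<eta>W \<theta>_closed[OF R'.zero_closed]] 0 by simp
 then have "F = \<zero>\<^bsub>R'\<^esub>" by (rule e_inj[OF F R'.zero_closed])
 moreover have "locus P PP (\<theta> \<one>\<^bsub>R'\<^esub>) = PP" using ring_hom_one[OF \<theta>_hom] locus_one[OF open_PP] by simp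
 ultimately show "\<exists>g\<in>carrier R'. y \<in> locus P PP (\<theta> g) & g \<otimes>\<^bsub>R'\<^esub> F = \<zero>\<^bsub>R'\<^esub>" using W by (intro bexI[of _ "\<one>\<^bsub>R'\<^esub>"]) auto
qed

text \<open>A prime of \<open>R'\<close> not containing \<open>h f\<close> extends to the localisation at \<open>h f\<close>, and is therefore
  the prime of a point of the chart over \<open>D(f)\<close>.\<close>

lemma glued_prm_image: "prm P PP R' \<theta> ` PP = {Q. primeideal Q R' & (\<exists>f\<in>Fs. h f \<notin> Q)}"
proof (intro equalityI subsetI)
 fix Q assume "Q \<in> prm P PP R' \<theta> ` PP"
 then obtain y where y: "y \<in> PP" "Q = prm P PP R' \<theta> y" by blast
 then show "Q \<in> {Q. primeideal Q R' & (\<exists>f\<in>Fs. h f \<notin> Q)}" using prime_\<theta>[OF y(1)] cover[OF y(1)] h_prm[OF _ y(1)] by blast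
next
 fix Q assume "Q \<in> {Q. primeideal Q R' & (\<exists>f\<in>Fs. h f \<notin> Q)}"
 then obtain f where Q: "primeideal Q R'" and f: "f \<in> Fs" "h f \<notin> Q" by blast
 interpret F: fchart P "V f" "\<rho> f" "[:f:]" by (rule chart[OF f(1)])
 interpret Q: primeideal Q R' by (rule Q)
 note pm = primeideal_mult_iff[OF Q]
 note hc = h(1)[OF f(1)]
 have hn: "h f [^]\<^bsub>R'\<^esub> (n::nat) \<notin> Q" for n by (induction n) (use pm hc f(2) Q.I_notcarr Q.one_imp_carrier in auto)
 define q where "q = {b. \<exists>n r. r \<in> Q & e r = \<iota> (f ^ n) * ev b (\<tau> f)}"
 have q_iff: "b \<in> q \<longleftrightarrow> r \<in> Q" if r: "r \<in> carrier R'" "e r = \<iota> (f ^ n) * ev b (\<tau> f)" for b r n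
 proof
  assume "b \<in> q"
  then obtain m r' where r': "r' \<in> Q" "e r' = \<iota> (f ^ m) * ev b (\<tau> f)" unfolding q_def by blast
  have c: "r' \<in> carrier R'" using r'(1) by (rule Q.a_Hcarr)
  have "e (h f [^]\<^bsub>R'\<^esub> m \<otimes>\<^bsub>R'\<^esub> r) = e (h f [^]\<^bsub>R'\<^esub> n \<otimes>\<^bsub>R'\<^esub> r')" using r r' c hc by (simp add: e_ring(1) e_h_power[OF f(1)])
  then have "h f [^]\<^bsub>R'\<^esub> m \<otimes>\<^bsub>R'\<^esub> r = h f [^]\<^bsub>R'\<^esub> n \<otimes>\<^bsub>R'\<^esub> r'" by (rule e_inj[rotated 2]) (use r c hc in auto)
  then show "r \<in> Q" using pm[of "h f [^]\<^bsub>R'\<^esub> m" r] pm[of "h f [^]\<^bsub>R'\<^esub> n" r'] hc r c r'(1) hn by auto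
 next
  assume "r \<in> Q" then show "b \<in> q" unfolding q_def using r(2) by blast
 qed
 have rep_b: "\<exists>n r. r \<in> carrier R' & e r = \<iota> (f ^ n) * ev b (\<tau> f)" for b using dense[OF f(1), of b] unfolding e_def by blast
 have mult_q: "a * b \<in> q \<longleftrightarrow> a \<in> q \<or> b \<in> q" for a b
 proof -
  obtain n r m r' where r: "r \<in> carrier R'" "e r = \<iota> (f ^ n) * ev a (\<tau> f)"
   and r': "r' \<in> carrier R'" "e r' = \<iota> (f ^ m) * ev b (\<tau> f)" using rep_b[of a] rep_b[of b] by blast
  have "e (r \<otimes>\<^bsub>R'\<^esub> r') = \<iota> (f ^ (n + m)) * ev (a * b) (\<tau> f)" using r r' by (simp add: e_ring(1) power_add \<iota>_mult ev_mult)
  then show ?thesis using q_iff[OF r] q_iff[OF r'] q_iff[OF R'.m_closed[OF r(1) r'(1)]] pm[OF r(1) r'(1)] by blast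
 qed
 have "primeideal q tring" unfolding tring_prime_iff
 proof (intro conjI ballI allI impI)
  show "0 \<in> q" using q_iff[of "\<zero>\<^bsub>R'\<^esub>" 0 0] e_zero Q.zero_closed by simp
  show "1 \<notin> q" using q_iff[of "\<one>\<^bsub>R'\<^esub>" 0 1] e_ring(3) hn[of 0] by (simp add: \<iota>_one ev_one)
  show "x * a \<in> q" if "a \<in> q" for a x using mult_q that by blast
  show "a \<in> q \<or> b \<in> q" if "a * b \<in> q" for a b using mult_q that by blast
  fix a b assume "a \<in> q" "b \<in> q"
  then obtain n r m r' where r: "r \<in> Q" "e r = \<iota> (f ^ n) * ev a (\<tau> f)"
   and r': "r' \<in> Q" "e r' = \<iota> (f ^ m) * ev b (\<tau> f)" unfolding q_def by blast
  have c: "r \<in> carrier R'" "r' \<in> carrier R'" using r r' Q.a_Hcarr by auto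
  let ?r = "h f [^]\<^bsub>R'\<^esub> m \<otimes>\<^bsub>R'\<^esub> r \<oplus>\<^bsub>R'\<^esub> h f [^]\<^bsub>R'\<^esub> n \<otimes>\<^bsub>R'\<^esub> r'"
  have "e ?r = \<iota> (f ^ (n + m)) * ev (a + b) (\<tau> f)"
   using r r' c hc by (simp add: e_ring e_h_power[OF f(1)] power_add \<iota>_mult ev_add algebra_simps)
  moreover have "?r \<in> Q" by (intro Q.a_closed Q.I_l_closed r r') (use hc in auto)
  ultimately show "a + b \<in> q" unfolding q_def by blast
 qed
 moreover have "[:f:] \<notin> q" using q_iff[OF hc, of 0 "[:f:]"] e_h[OF f(1)] f(2) by (simp add: \<iota>_one)
 ultimately have "q \<in> prm P (V f) tring (\<rho> f) ` V f" unfolding F.image by blast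
 then obtain y where y: "y \<in> V f" "q = prm P (V f) tring (\<rho> f) y" by blast
 have "r \<in> prm P PP R' \<theta> y \<longleftrightarrow> r \<in> Q" if r: "r \<in> carrier R'" for r
 proof -
  obtain n b where b: "\<iota> (f ^ n) * e r = ev b (\<tau> f)" using rep[OF f(1) r] .
  have "e (h f [^]\<^bsub>R'\<^esub> n \<otimes>\<^bsub>R'\<^esub> r) = \<iota> (f ^ 0) * ev b (\<tau> f)" using r hc b by (simp add: e_ring(1) e_h_power[OF f(1)] \<iota>_one)
  then have "b \<in> q \<longleftrightarrow> h f [^]\<^bsub>R'\<^esub> n \<otimes>\<^bsub>R'\<^esub> r \<in> Q" by (rule q_iff[rotated]) (use r hc in auto)
  also have "\<dots> \<longleftrightarrow> r \<in> Q" using pm[of "h f [^]\<^bsub>R'\<^esub> n" r] r hc hn by auto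
  finally show ?thesis using mem_prm_\<theta>'[OF f(1) r b y(1)] y(2) by simp
 qed
 then have "prm P PP R' \<theta> y = Q" using Q.a_subset by (auto simp: prm_def)
 then show "Q \<in> prm P PP R' \<theta> ` PP" using y(1) V_sub by blast
qed

end

context atlas
begin

definition coordinate_chart :: "(cylinder_ring => 's) => bool" where
 "coordinate_chart \<theta> \<longleftrightarrow> chart P PP (tring :: cylinder_ring ring) \<theta> &
  prm P PP tring \<theta> ` PP = {Q. primeideal Q tring & (\<exists>f\<in>Fs. [:f:] \<notin> Q)} &
  (\<forall>a. \<theta> [:a:] = \<alpha> a) &
  (\<forall>f\<in>Fs. \<exists>n c. res P PP (V f) (\<alpha> (f ^ n)) \<otimes>\<^bsub>sections P (V f)\<^esub>
   (\<rho> f [:0, 1:] \<ominus>\<^bsub>sections P (V f)\<^esub> res P PP (V f) (\<theta> [:0, 1:])) = res P PP (V f) (\<alpha> c))"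

text \<open>A prime of the ring of global functions that contained all \<open>f \<in> Fs\<close> would contract to the
origin of the plane, so it would contain \<open>x\<close> and \<open>y\<close>, which generate the unit ideal. So all primes are
primes of points.\<close>

lemma affine_of_unit_ideal:
 assumes u: "u \<in> \<R>" and v: "v \<in> \<R>" and uv: "\<iota> X1 * u + \<iota> Y1 * v = 1"
 shows "\<exists>(R :: 's ring) f. cring R & isomorphism P (Spec R) f"
proof -
 let ?R = "sections P PP"
 interpret R: cring ?R by (rule cring_sections[OF open_PP])
 interpret glued P \<alpha> Fs \<rho> ?R "\<lambda>s. s" \<alpha>
 proof (intro glued.intro glued_axioms.intro atlas_axioms)
  show "cring ?R" by (rule R.is_cring)
  show "(\<lambda>s. s) \<in> ring_hom ?R ?R" by (rule ring_hom_memI) auto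
  show "\<alpha> f \<in> carrier ?R" for f by (rule \<alpha>_closed)
  show "\<exists>n. \<exists>r\<in>carrier ?R. \<epsilon> PP r = \<iota> (f ^ n) * ev b (\<tau> f)" if f: "f \<in> Fs" for f b
  proof -
   have "ev b (\<tau> f) \<in> E f" unfolding E_def by (intro CollectI exI[of _ 0] exI[of _ b]) (simp add: \<iota>_one)
   from extend[OF f this] obtain n where "\<iota> (f ^ n) * ev b (\<tau> f) \<in> \<epsilon> PP ` carrier ?R" unfolding \<R>_iff by blast
   then obtain r where "r \<in> carrier ?R" "\<iota> (f ^ n) * ev b (\<tau> f) = \<epsilon> PP r" by (rule imageE)
   then show ?thesis by (intro exI[of _ n] bexI[of _ r]) simp_all
  qed
 qed auto
 obtain u' v' where u': "u' \<in> carrier ?R" "\<epsilon> PP u' = u" and v': "v' \<in> carrier ?R" "\<epsilon> PP v' = v"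
  using u v unfolding \<R>_iff by blast
 have "\<epsilon> PP (\<alpha> X1 \<otimes>\<^bsub>?R\<^esub> u' \<oplus>\<^bsub>?R\<^esub> \<alpha> Y1 \<otimes>\<^bsub>?R\<^esub> v') = \<epsilon> PP \<one>\<^bsub>?R\<^esub>" using uv u' v' \<alpha>_closed
  by (simp add: \<epsilon>_ring[OF open_PP \<eta>_PP] \<epsilon>_one[OF open_PP \<eta>_PP] \<iota>_def)
 then have one: "\<alpha> X1 \<otimes>\<^bsub>?R\<^esub> u' \<oplus>\<^bsub>?R\<^esub> \<alpha> Y1 \<otimes>\<^bsub>?R\<^esub> v' = \<one>\<^bsub>?R\<^esub>"
  by (rule \<epsilon>_inj[OF open_PP \<eta>_PP, rotated 2]) (use u' v' \<alpha>_closed in auto)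
 have all: "\<exists>f\<in>Fs. \<alpha> f \<notin> Q" if Q: "primeideal Q ?R" for Q
 proof (rule ccontr)
  assume n: "\<not> ?thesis"
  interpret Q: primeideal Q ?R by (rule Q)
  have z: "\<alpha> 0 = \<zero>\<^bsub>?R\<^esub>" using R.add.l_cancel_one[OF \<alpha>_closed \<alpha>_closed, of 0 0] \<alpha>_add[of 0 0] by simp
  have "primeideal {a. \<alpha> a \<in> Q} tring" unfolding tring_prime_iff
   using primeideal_mult_iff[OF Q \<alpha>_closed \<alpha>_closed] Q.I_l_closed[OF _ \<alpha>_closed] Q.a_closed
    Q.I_notcarr Q.one_imp_carrier Q.zero_closed by (auto simp: \<alpha>_mult \<alpha>_add \<alpha>_one z)
  from Fs_cover[OF this] n have "{a. \<alpha> a \<in> Q} = origin" by auto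
  then have "\<alpha> X1 \<in> Q" "\<alpha> Y1 \<in> Q" using X1_Y1_origin by auto
  then have "\<one>\<^bsub>?R\<^esub> \<in> Q" unfolding one[symmetric] by (intro Q.a_closed Q.I_r_closed u' v')
  then show False using Q.one_imp_carrier Q.I_notcarr by simp
 qed
 note S = Spec_chart[OF R.is_cring]
 let ?\<rho> = "\<lambda>a. \<lambda>p\<in>points (Spec ?R). frac ?R (carrier ?R - p) a \<one>\<^bsub>?R\<^esub>"
 have "prm (Spec ?R) (points (Spec ?R)) ?R ?\<rho> ` points (Spec ?R) = {Q. primeideal Q ?R}"
  unfolding S(1) using S(4)[unfolded S(1)] by (auto simp: image_iff)
 also have "\<dots> = prm P PP ?R (\<lambda>s. s) ` PP" unfolding glued_prm_image using all by auto
 finally interpret I: chart_pair P "Spec ?R" ?R "\<lambda>s. s" ?\<rho>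
  by (intro chart_pair.intro chart_pair_axioms.intro glued_chart S(3)) simp
 show ?thesis using R.is_cring I.isomorphism_iso by blast
qed

lemma ev_closed: "v \<in> \<R> ==> ev b v \<in> \<R>"
proof (induction b)
 case 0 then show ?case using \<R>_\<iota>[of 0] by simp
next
 case (pCons a b) then show ?case unfolding ev_pCons by (intro \<R>_add \<R>_mult \<R>_\<iota>) auto
qed

lemma ev_coordinate_inj:
 assumes v: "\<forall>f\<in>Fs. \<exists>n c. \<iota> (f ^ n) * (\<tau> f - v) = \<iota> c" and eq: "ev b v = ev b' v"
 shows "b = b'"
proof -
 obtain n c where c: "\<iota> (f1 ^ n) * (\<tau> f1 - v) = \<iota> c" using v f1 by blast
 have "\<iota> (f1 ^ n) * (v - \<tau> f1) = \<iota> (- c)" unfolding \<iota>_minus c[symmetric] by (simp add: algebra_simps)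
 from ev_shift[OF this, of "b - b'"] obtain m d
  where d: "\<iota> ((f1 ^ n) ^ m) * ev (b - b') v = ev d (\<tau> f1)" "f1 ^ n \<noteq> 0 --> d = 0 --> b - b' = 0" by blast
 have "ev (b - b') v = 0" using ev_add[of b "- b'" v] ev_minus[of b' v] eq by simp
 then have "ev d (\<tau> f1) = ev 0 (\<tau> f1)" using d(1) by simp
 then have "d = 0" by (rule ev_inj[OF f1])
 moreover have "f1 \<noteq> 0" using f1 Fs0 by metis
 ultimately show ?thesis using d(2) by simp
qed

text \<open>The polynomials in a global coordinate \<open>v\<close>, with coefficients in \<open>A\<close>. Over \<open>D(f)\<close> they are the
polynomials in \<open>\<tau> f\<close>, since \<open>\<tau> f - v\<close> lies in \<open>A\<^sub>f\<close>.\<close>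

lemma chart_of_coordinate:
 assumes v: "v \<in> \<R>" "\<forall>f\<in>Fs. \<exists>n c. \<iota> (f ^ n) * (\<tau> f - v) = \<iota> c"
 shows "\<exists>\<theta>. coordinate_chart \<theta>"
proof -
 have "\<forall>b. \<exists>s. s \<in> \<Gamma> P PP & \<epsilon> PP s = ev b v" using ev_closed[OF v(1)] unfolding \<R>_iff by (metis imageE)
 then obtain \<theta> where \<theta>: "\<And>b. \<theta> b \<in> \<Gamma> P PP" "\<And>b. \<epsilon> PP (\<theta> b) = ev b v" by metis
 interpret R: cring "sections P PP" by (rule cring_sections[OF open_PP])
 note \<epsilon>I = \<epsilon>_inj[OF open_PP \<eta>_PP]
 have \<theta>_const: "\<theta> [:a:] = \<alpha> a" for a by (rule \<epsilon>I[OF \<theta>(1) \<alpha>_closed]) (simp add: \<theta>(2) \<iota>_def[symmetric])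
 interpret glued P \<alpha> Fs \<rho> tring \<theta> "\<lambda>f. [:f:]"
 proof (intro glued.intro glued_axioms.intro atlas_axioms)
  show "cring (tring :: cylinder_ring ring)" by (rule cring_tring)
  show "\<theta> \<in> ring_hom tring (sections P PP)"
  proof (rule ring_hom_memI)
   fix x y
   show "\<theta> (x \<otimes>\<^bsub>tring\<^esub> y) = \<theta> x \<otimes>\<^bsub>sections P PP\<^esub> \<theta> y"
    by (rule \<epsilon>I) (simp_all add: \<theta> \<epsilon>_ring[OF open_PP \<eta>_PP \<theta>(1) \<theta>(1)] ev_mult)
   show "\<theta> (x \<oplus>\<^bsub>tring\<^esub> y) = \<theta> x \<oplus>\<^bsub>sections P PP\<^esub> \<theta> y"
    by (rule \<epsilon>I) (simp_all add: \<theta> \<epsilon>_ring[OF open_PP \<eta>_PP \<theta>(1) \<theta>(1)] ev_add)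
   show "\<theta> \<one>\<^bsub>tring\<^esub> = \<one>\<^bsub>sections P PP\<^esub>" by (rule \<epsilon>I) (simp_all add: \<theta> \<epsilon>_one[OF open_PP \<eta>_PP] ev_one)
  qed (rule \<theta>(1))
  show "r = r'" if "\<theta> r = \<theta> r'" for r r' by (rule ev_coordinate_inj[OF v(2)]) (metis \<theta>(2) that)
  show "[:f:] \<in> carrier tring" "\<theta> [:f:] = \<alpha> f" for f by (simp_all add: \<theta>_const)
  show "\<exists>n. \<exists>r\<in>carrier tring. \<epsilon> PP (\<theta> r) = \<iota> (f ^ n) * ev b (\<tau> f)" if f: "f \<in> Fs" for f b
  proof -
   obtain n c where "\<iota> (f ^ n) * (\<tau> f - v) = \<iota> c" using v(2) f by blast
   from ev_shift[OF this, of b] obtain m b' where "\<iota> ((f ^ n) ^ m) * ev b (\<tau> f) = ev b' v" by blast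
   then show ?thesis by (intro exI[of _ "n * m"] bexI[of _ b']) (simp_all add: \<theta> power_mult)
  qed
 qed
 have "\<exists>n c. res P PP (V f) (\<alpha> (f ^ n)) \<otimes>\<^bsub>sections P (V f)\<^esub>
   (\<rho> f [:0, 1:] \<ominus>\<^bsub>sections P (V f)\<^esub> res P PP (V f) (\<theta> [:0, 1:])) = res P PP (V f) (\<alpha> c)" if f: "f \<in> Fs" for f
 proof -
  obtain n c where c: "\<iota> (f ^ n) * (\<tau> f - v) = \<iota> c" using v(2) f by blast
  interpret G: cring "sections P (V f)" by (rule cring_sections[OF open_V])
  note rc = res_closed[OF open_PP open_V V_sub]
  have ev: "ev [:0, 1:] v = v" by (simp add: ev_pCons \<iota>_one)
  have "\<epsilon> (V f) (res P PP (V f) (\<alpha> (f ^ n)) \<otimes>\<^bsub>sections P (V f)\<^esub>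
   (\<rho> f [:0, 1:] \<ominus>\<^bsub>sections P (V f)\<^esub> res P PP (V f) (\<theta> [:0, 1:]))) = \<epsilon> (V f) (res P PP (V f) (\<alpha> c))"
   using c \<epsilon>_ring(1)[OF open_V \<eta>(1)[OF f] rc[OF \<alpha>_closed] G.minus_closed[OF \<rho>_closed[OF f] rc[OF \<theta>(1)]]]
    \<epsilon>_minus[OF open_V \<eta>(1)[OF f] \<rho>_closed[OF f] rc[OF \<theta>(1)]] \<epsilon>_res[OF open_PP open_V V_sub \<eta>(1)[OF f] \<alpha>_closed]
    \<epsilon>_res[OF open_PP open_V V_sub \<eta>(1)[OF f] \<theta>(1)] \<theta>(2) ev unfolding \<iota>_def \<tau>_def by simp
  then have "res P PP (V f) (\<alpha> (f ^ n)) \<otimes>\<^bsub>sections P (V f)\<^esub>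
   (\<rho> f [:0, 1:] \<ominus>\<^bsub>sections P (V f)\<^esub> res P PP (V f) (\<theta> [:0, 1:])) = res P PP (V f) (\<alpha> c)"
   by (rule \<epsilon>_inj[OF open_V \<eta>(1)[OF f] G.m_closed[OF rc[OF \<alpha>_closed] G.minus_closed[OF \<rho>_closed[OF f] rc[OF \<theta>(1)]]] rc[OF \<alpha>_closed]])
  then show ?thesis by blast
 qed
 then show ?thesis unfolding coordinate_chart_def using glued_chart glued_prm_image \<theta>_const by blast
qed

theorem affine_or_coordinate:
 "(\<exists>(R :: 's ring) f. cring R & isomorphism P (Spec R) f) \<or>
 (\<exists>\<theta>. coordinate_chart \<theta>)" using dichotomy affine_of_unit_ideal chart_of_coordinate by meson

end

section \<open>The punctured plane and its cylinders\<close>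

lemma affine_plane_chart:
 defines "\<rho>0 \<equiv> (\<lambda>a. \<lambda>p\<in>points affine_plane. frac tring (carrier tring - p) a \<one>\<^bsub>tring\<^esub>)"
 shows "points affine_plane = {p. primeideal p tring}" "rspace affine_plane"
  and "chart affine_plane (points affine_plane) (tring :: plane_ring ring) \<rho>0"
  and "primeideal p tring ==> prm affine_plane (points affine_plane) tring \<rho>0 p = p"
 unfolding \<rho>0_def affine_plane_def using Spec_chart[OF cring_tring[where 'a = plane_ring]] by blast+

text \<open>The canonical chart of the plane, restricted to the punctured plane.\<close>

definition plane_fun :: "plane_ring => plane_section" where
 "plane_fun a = res affine_plane (points affine_plane) (points affine_plane - {origin})
  (\<lambda>p\<in>points affine_plane. frac tring (carrier tring - p) a \<one>\<^bsub>tring\<^esub>)"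

lemma open_punctured: "opens affine_plane (points affine_plane - {origin})"
proof -
 interpret A: chart affine_plane "points affine_plane" "tring :: plane_ring ring"
  "\<lambda>a. \<lambda>p\<in>points affine_plane. frac tring (carrier tring - p) a \<one>\<^bsub>tring\<^esub>" by (rule affine_plane_chart(3))
 let ?D = "\<lambda>a. locus affine_plane (points affine_plane) (\<lambda>p\<in>points affine_plane. frac tring (carrier tring - p) a \<one>\<^bsub>tring\<^esub>)"
 have D: "?D a = {p \<in> points affine_plane. a \<notin> p}" for a
  using affine_plane_chart(4) A.locus_subset unfolding prm_def affine_plane_chart(1)
  by (fastforce simp: affine_plane_chart(1))
 have "points affine_plane - {origin} = ?D X1 \<union> ?D Y1"
  unfolding D using prime_X1_Y1 X1_Y1_origin by (auto simp: affine_plane_chart(1))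
 then show ?thesis using A.open_locus[OF A.open_V] by (simp add: openin_Un)
qed

lemma plane_chart:
 shows "points punctured_plane = {p. primeideal p tring & p \<noteq> origin}" and "rspace punctured_plane"
  and "chart punctured_plane (points punctured_plane) tring plane_fun"
  and "p \<in> points punctured_plane ==> prm punctured_plane (points punctured_plane) tring plane_fun p = p"
proof -
 interpret A: rspace affine_plane by (rule affine_plane_chart(2))
 let ?U = "points affine_plane - {origin}"
 have pts: "points punctured_plane = ?U" unfolding punctured_plane_def by (rule A.points_open_subspace[OF open_punctured])
 then show "points punctured_plane = {p. primeideal p tring & p \<noteq> origin}" unfolding affine_plane_chart(1) by blast
 show "rspace punctured_plane" unfolding punctured_plane_def by (rule A.rspace_open_subspace[OF open_punctured])
 have sub: "?U \<subseteq> points affine_plane" by blast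
 have pf: "plane_fun = (\<lambda>a. res affine_plane (points affine_plane) ?U
   (\<lambda>p\<in>points affine_plane. frac tring (carrier tring - p) a \<one>\<^bsub>tring\<^esub>))" by (rule ext) (rule plane_fun_def)
 note R = chart_restrict[OF affine_plane_chart(3) open_punctured sub, folded pf]
 note O = A.chart_open_subspace[OF open_punctured subset_refl, folded punctured_plane_def]
 show "chart punctured_plane (points punctured_plane) tring plane_fun" unfolding pts O(1) by (rule R(1))
 show "prm punctured_plane (points punctured_plane) tring plane_fun p = p" if "p \<in> points punctured_plane"
  using that unfolding pts O(2) R(2)[OF that[unfolded pts]] by (intro affine_plane_chart(4)) (simp add: affine_plane_chart(1))
qed

lemma open_subspace_chart:
 assumes U: "opens punctured_plane U"
 defines "\<rho> \<equiv> (\<lambda>a. res punctured_plane (points punctured_plane) U (plane_fun a))"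
 shows "full_chart (open_subspace punctured_plane U) tring \<rho>"
  and "p \<in> U ==> prm (open_subspace punctured_plane U) U tring \<rho> p = p" and "points (open_subspace punctured_plane U) = U"
proof -
 interpret S: rspace punctured_plane by (rule plane_chart(2))
 have sub: "U \<subseteq> points punctured_plane" by (rule openin_subset[OF U])
 show pts: "points (open_subspace punctured_plane U) = U" by (rule S.points_open_subspace[OF U])
 note R = chart_restrict[OF plane_chart(3) U sub, folded \<rho>_def]
 note O = S.chart_open_subspace[OF U subset_refl]
 show "full_chart (open_subspace punctured_plane U) tring \<rho>" by (intro full_chart.intro) (simp only: pts O(1) R(1))
 show "prm (open_subspace punctured_plane U) U tring \<rho> p = p" if p: "p \<in> U"
  unfolding O(2) R(2)[OF p] by (rule plane_chart(4)) (use p sub in blast)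
qed

text \<open>For a ring \<open>'b\<close> the chart of the relative affine line is over univariate polynomials
given as functions; here it is rewritten over the type \<open>'b poly\<close>.\<close>

locale cylinder = full_chart S "tring :: 'b::idom ring" \<rho>
 for S :: "('p, 's) ringed_space" and \<rho> :: "'b::idom => 's"
begin

definition C :: "'b poly => ('p, 's) line_section" where "C F = \<rho>' (coeff F)"

abbreviation "pC \<equiv> prm (Ga_times S) (points (Ga_times S)) tring C"

lemma cylinder_chart: "chart (Ga_times S) (points (Ga_times S)) (tring :: 'b poly ring) C"
 unfolding C_def[abs_def] by (rule chart_ring_iso(1)[OF line_chart cring_tring coeff_UP_hom coeff_UP_bij])

lemma prm_C:
 "pC z =
  {F. coeff F \<in> pT z}" using chart_ring_iso(2)[OF line_chart cring_tring coeff_UP_hom coeff_UP_bij, of z]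
 unfolding C_def[abs_def] by simp

lemma C_image:
 "pC ` points (Ga_times S) =
  {Q. primeideal Q tring & {a. [:a:] \<in> Q} \<in> prm S (points S) tring \<rho> ` points S}"
proof (intro equalityI subsetI)
 interpret C: chart "Ga_times S" "points (Ga_times S)" "tring :: 'b poly ring" C by (rule cylinder_chart)
 fix Q assume "Q \<in> pC ` points (Ga_times S)"
 then obtain z where z: "z \<in> points (Ga_times S)" "Q = pC z" by blast
 have z': "z \<in> line_points S" using z(1) by (simp add: points_Ga_times)
 have "{a. [:a:] \<in> Q} = prm S (points S) tring \<rho> (fst z)"
  using line_prm_contract[OF z'] unfolding z(2) prm_C by (simp add: coeff_const_UP)
 moreover have "fst z \<in> points S" using line_pointsD(1)[OF z'] .
 ultimately show "Q \<in> {Q. primeideal Q tring & {a. [:a:] \<in> Q} \<in> prm S (points S) tring \<rho> ` points S}"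
  using C.prime[OF z(1)] z(2) by blast
next
 fix Q assume "Q \<in> {Q :: 'b poly set. primeideal Q tring & {a. [:a:] \<in> Q} \<in> prm S (points S) tring \<rho> ` points S}"
 then have Q: "primeideal Q tring" "{a. [:a:] \<in> Q} \<in> prm S (points S) tring \<rho> ` points S" by auto
 have bij: "bij_betw coeff (UNIV :: 'b poly set) (carrier (UP tring))" using coeff_UP_bij by simp
 have inj: "inj (coeff :: 'b poly => _)" using bij by (rule bij_betw_imp_inj_on)
 have mem: "coeff F \<in> coeff ` Q \<longleftrightarrow> F \<in> Q" for F by (rule inj_image_mem_iff[OF inj])
 note D = tring_primeD[OF Q(1)]
 note h = ring_hom_mult[OF coeff_UP_hom, simplified] ring_hom_add[OF coeff_UP_hom, simplified] ring_hom_one[OF coeff_UP_hom, simplified]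
 have ex: "\<exists>F. G = coeff F" if "G \<in> carrier (UP (tring :: 'b ring))" for G using that bij unfolding bij_betw_def by auto
 have "primeideal (coeff ` Q) (UP tring)"
 proof (rule primeidealI'[OF U.is_cring])
  show "coeff ` Q \<subseteq> carrier (UP tring)" using bij unfolding bij_betw_def by auto
  have "coeff 0 = \<zero>\<^bsub>UP (tring :: 'b ring)\<^esub>" by (rule ext) (simp add: UP_zero_apply)
  then show "\<zero>\<^bsub>UP tring\<^esub> \<in> coeff ` Q" using mem[of 0] D(1) by simp
  show "a \<oplus>\<^bsub>UP tring\<^esub> b \<in> coeff ` Q" if "a \<in> coeff ` Q" "b \<in> coeff ` Q" for a b
   using that D(2) by (auto simp: h(2)[symmetric])
  show "x \<otimes>\<^bsub>UP tring\<^esub> a \<in> coeff ` Q" if a: "a \<in> coeff ` Q" "x \<in> carrier (UP tring)" for a x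
   using ex[OF a(2)] a(1) D(3) by (auto simp: h(1)[symmetric])
  show "\<one>\<^bsub>UP tring\<^esub> \<notin> coeff ` Q" unfolding h(3)[symmetric] mem by (rule D(4))
  show "a \<in> coeff ` Q \<or> b \<in> coeff ` Q"
   if ab: "a \<in> carrier (UP tring)" "b \<in> carrier (UP tring)" "a \<otimes>\<^bsub>UP tring\<^esub> b \<in> coeff ` Q" for a b
  proof -
   obtain F G where FG: "a = coeff F" "b = coeff G" using ex[OF ab(1)] ex[OF ab(2)] by blast
   have "F * G \<in> Q" using ab(3) unfolding FG h(1)[symmetric] mem .
   then show ?thesis unfolding FG mem D(5) .
  qed
 qed
 moreover have "{a \<in> carrier tring. const a \<in> coeff ` Q} = {a. [:a:] \<in> Q}" unfolding coeff_const_UP[symmetric] mem by simp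
 ultimately have "coeff ` Q \<in> pT ` points (Ga_times S)" unfolding line_prm_image using Q(2) by simp
 then obtain z where z: "z \<in> points (Ga_times S)" "coeff ` Q = pT z" by blast
 have "pC z = Q" unfolding prm_C z(2)[symmetric] mem by simp
 then show "Q \<in> pC ` points (Ga_times S)" using z(1) by blast
qed

lemma C_const: "C [:a:] = pull (Ga_proj S) (points S) (\<rho> a)"
proof (rule ext)
 fix z
 show "C [:a:] z = pull (Ga_proj S) (points S) (\<rho> a) z"
 proof (cases "z \<in> line_points S")
  case True
  have x: "fst z \<in> points S" by (rule line_pointsD(1)[OF True])
  have "C [:a:] z = line.fr z (\<kappa> z (const a)) \<one>\<^bsub>K (fst z)\<^esub>"
   unfolding C_def coeff_const_UP using True by (simp add: points_Ga_times)
  also have "\<dots> = pull (Ga_proj S) (points S) (\<rho> a) z"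
   using \<kappa>_const[OF x, of a] pull_Ga_proj[OF open_V True x \<rho>_closed[of a]] by (simp add: \<sigma>_def)
  finally show ?thesis .
 next
  case False
  then show ?thesis unfolding C_def Ga_proj_def by (simp add: points_Ga_times)
 qed
qed

lemma C_coord: "C [:0, 1:] = Ga_coord S"
proof (rule ext)
 fix z
 have co: "coeff [:0, 1:] = up_ring.monom (UP (tring :: 'b ring)) \<one>\<^bsub>tring\<^esub> 1"
  by (rule ext) (auto simp: UP_monom_apply coeff_pCons split: nat.split)
 show "C [:0, 1:] z = Ga_coord S z"
 proof (cases "z \<in> line_points S")
  case True
  have x: "fst z \<in> points S" by (rule line_pointsD(1)[OF True])
  interpret G: cring "sections S (points S)" by (rule cring_sections[OF open_V])
  interpret K0: cring "stalk S (fst z)" by (rule cring_stalk[OF x])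
  have "\<kappa> z (coeff [:0, 1:]) = up_ring.monom (K (fst z)) (germ S (fst z) (points S) \<one>\<^bsub>sections S (points S)\<^esub>) 1"
   using germ_closed[OF open_V x G.one_closed] ring_hom_zero[OF \<sigma>_hom[OF x] R.ring_axioms K0.ring_axioms] ring_hom_one[OF hom]
   by (auto simp: \<kappa>_def UP_monom_apply \<sigma>_def coeff_pCons fun_eq_iff split: nat.split)
  then show ?thesis using True line_frac_monom[OF open_V x G.one_closed, of 1]
   unfolding C_def Ga_coord_def by (simp add: points_Ga_times)
 next
  case False
  then show ?thesis unfolding C_def Ga_coord_def by (simp add: points_Ga_times)
 qed
qed

end

section \<open>Rigidity of invariant functions\<close>

context rspace
begin

lemma Ga_coord_apply:
 assumes "z \<in> line_points S"
 shows "Ga_coord S z = line.fr z (up_ring.monom (K (fst z)) \<one>\<^bsub>stalk S (fst z)\<^esub> 1) \<one>\<^bsub>K (fst z)\<^esub>"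
proof -
 have o: "opens S (points S)" "fst z \<in> points S" using line_pointsD(1)[OF assms] by auto
 interpret G: cring "sections S (points S)" by (rule cring_sections[OF o(1)])
 show ?thesis unfolding Ga_coord_def using assms line_frac_monom[OF o G.one_closed, of 1] germ_one[OF o] by simp
qed

lemma Ga_coord_closed: "Ga_coord S \<in> \<Gamma> (Ga_times S) (points (Ga_times S))"
proof -
 have o: "opens S (points S)" by simp
 let ?M = "up_ring.monom (UP (sections S (points S))) \<one>\<^bsub>sections S (points S)\<^esub> 1"
 have x: "fst z \<in> points S" if "z \<in> line_points S" for z by (rule line_pointsD(1)[OF that])
 have M: "?M \<in> carrier (UP (sections S (points S)))"
  by (rule UP_monom_closed[OF cring_sections[OF o] monoid.one_closed]) (meson cring_sections[OF o] cring.axioms(1) ring.is_monoid)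
 have l: "openin line_top (line_points S)" by (metis openin_topspace topspace_line)
 have N: "(\<lambda>z. poly_germ S (fst z) (points S) ?M) \<in> line_N (line_points S)" by (rule line_NI[OF o M]) (use x in auto)
 have one: "\<one>\<^bsub>K (fst z)\<^esub> \<notin> snd z" if "z \<in> line_points S" for z
 proof -
  interpret q: primeideal "snd z" "K (fst z)" by (rule line_pointsD(2)[OF that])
  show ?thesis using q.one_imp_carrier q.I_notcarr by blast
 qed
 have "(\<lambda>z\<in>line_points S. line.fr z (poly_germ S (fst z) (points S) ?M) \<one>\<^bsub>K (fst z)\<^esub>)
  \<in> \<Gamma> (Ga_times S) (line_points S)"
  unfolding Ga_times_eq by (rule line.section_frac[OF l N line.N_one[OF l]]) (use one in auto)
 also have "(\<lambda>z\<in>line_points S. line.fr z (poly_germ S (fst z) (points S) ?M) \<one>\<^bsub>K (fst z)\<^esub>) = Ga_coord S"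
  unfolding Ga_coord_def line_frac_def using ring_hom_one[OF poly_germ_hom[OF o]] x
  by (intro restrict_ext) (simp add: case_prod_beta)
 finally show ?thesis unfolding points_Ga_times .
qed

lemma Ga_times_apply:
 assumes "z \<in> W"
 shows "(s \<otimes>\<^bsub>sections (Ga_times S) W\<^esub> t) z = s z \<otimes>\<^bsub>line.L z\<^esub> t z"
  and "(s \<oplus>\<^bsub>sections (Ga_times S) W\<^esub> t) z = s z \<oplus>\<^bsub>line.L z\<^esub> t z" using assms unfolding Ga_times_eq by simp_all

lemma res_Ga_times: "res (Ga_times S) U W s = restrict s W"
 unfolding Ga_times_eq by simp

end

lemma UP_shift_apply:
 assumes R: "cring R" and p: "p \<in> carrier (UP R)"
 shows "(up_ring.monom (UP R) \<one>\<^bsub>R\<^esub> 1 \<otimes>\<^bsub>UP R\<^esub> p) n = (case n of 0 => \<zero>\<^bsub>R\<^esub> | Suc m => p m)"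
proof -
 interpret R: cring R by (rule R)
 have c: "p k \<in> carrier R" for k using p unfolding UP_carrier by blast
 have "(up_ring.monom (UP R) \<one>\<^bsub>R\<^esub> 1 \<otimes>\<^bsub>UP R\<^esub> p) n = (\<Oplus>\<^bsub>R\<^esub>i\<in>{..n}. if 1 = i then p (n - i) else \<zero>\<^bsub>R\<^esub>)"
  unfolding UP_mult_apply[OF UP_monom_closed[OF R R.one_closed] p] by (rule R.finsum_cong') (auto simp: UP_monom_apply c)
 also have "\<dots> = (case n of 0 => \<zero>\<^bsub>R\<^esub> | Suc m => p m)"
 proof (cases n)
  case (Suc m)
  have "1 \<in> {..n}" "(\<lambda>i. p (n - i)) \<in> {..n} \<rightarrow> carrier R" using c Suc by auto
  from R.add.finprod_singleton[OF this(1) _ this(2)] show ?thesis using Suc by simp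
 qed simp
 finally show ?thesis .
qed

lemma (in domain) UP_cancel:
 assumes "h \<in> carrier (UP R)" "h \<noteq> \<zero>\<^bsub>UP R\<^esub>" "a \<in> carrier (UP R)" "b \<in> carrier (UP R)" and "h \<otimes>\<^bsub>UP R\<^esub> a = h \<otimes>\<^bsub>UP R\<^esub> b"
 shows "a = b"
proof -
 interpret D: domain "UP R" by (rule UP_domain.UP_domain) (simp add: UP_domain_def domain_axioms)
 show ?thesis using D.m_lcancel[OF assms(2,1,3,4)] assms(5) by simp
qed

section \<open>Bundles over the punctured plane\<close>

locale Ga_bundle =
 fixes P :: "('p, 's) ringed_space" and \<pi> :: "('p, 's, plane_point, plane_section) space_map"
  and \<mu> :: "(('p, 's) line_point, ('p, 's) line_section, 'p, 's) space_map"
 assumes Ga_bundle: "principal_Ga_bundle P punctured_plane \<pi> \<mu>"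
begin

lemma locally_ringed_P: "locally_ringed_space P"
 using Ga_bundle unfolding principal_Ga_bundle_def scheme_def by blast

sublocale rspace P using locally_ringed_P unfolding locally_ringed_space_def by (intro rspace.intro) blast

sublocale S: chart punctured_plane "points punctured_plane" tring plane_fun by (rule plane_chart(3))

sublocale G: rspace "Ga_times P" by (rule rspace_Ga_times)

abbreviation "PP \<equiv> points P"
abbreviation "PS \<equiv> points punctured_plane"
abbreviation "GP \<equiv> Ga_times P"
abbreviation "pr \<equiv> Ga_proj P"

lemma morphism_\<pi>: "morphism P punctured_plane \<pi>" and morphism_\<mu>: "morphism GP P \<mu>"
 and \<pi>_\<mu>: "mor_eq GP punctured_plane (mcomp P \<pi> \<mu>) (mcomp P \<pi> pr)"
 using Ga_bundle unfolding principal_Ga_bundle_def Ga_action_def by blast+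

text \<open>The neutral element of \<open>\<bbbG>\<^sub>a\<close> gives a point of \<open>\<bbbG>\<^sub>a \<times> P\<close> over each point of \<open>P\<close>, at which
functions on \<open>\<bbbG>\<^sub>a \<times> P\<close> will be evaluated.\<close>

lemma unit_section:
 obtains e where "\<And>y. y \<in> PP ==> e y \<in> line_points P & fst (e y) = y & pt \<mu> (e y) = y"
proof -
 obtain e where e: "Ga_pair P P \<zero>\<^bsub>sections P PP\<^esub> id_map e" "mor_eq P P (mcomp GP \<mu> e) id_map"
  using Ga_bundle unfolding principal_Ga_bundle_def Ga_action_def by blast
 have m: "morphism P GP e" and p: "mor_eq P P (mcomp GP pr e) id_map" using e(1) unfolding Ga_pair_def by blast+
 have "pt e y \<in> line_points P & fst (pt e y) = y & pt \<mu> (pt e y) = y" if "y \<in> PP" for y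
  using morphism_pt[OF m that] p e(2) that unfolding mor_eq_def mcomp_def id_map_def Ga_proj_def
  by (simp add: points_Ga_times)
 then show thesis by (rule that)
qed

lemma plane_locus: "locus punctured_plane PS (plane_fun f) = {p \<in> PS. f \<notin> p}"
proof -
 have "f \<in> p \<longleftrightarrow> p \<notin> locus punctured_plane PS (plane_fun f)" if "p \<in> PS" for p
  using plane_chart(4)[OF that] unfolding prm_def by auto
 then show ?thesis using S.locus_subset by blast
qed

definition \<alpha> :: "plane_ring => 's" where "\<alpha> a = pull \<pi> PS (plane_fun a)"

lemma preimg_PS: "preimg P \<pi> PS = PP" by (rule preimg_points[OF morphism_\<pi>])

lemma \<alpha>_hom: "\<alpha> \<in> ring_hom tring (sections P PP)"
 using ring_hom_trans[OF S.hom morphism_hom[OF morphism_\<pi> S.open_V]] unfolding preimg_PS by (simp add: \<alpha>_def[abs_def] o_def)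

lemma \<alpha>_closed: "\<alpha> a \<in> \<Gamma> P PP" using ring_hom_closed[OF \<alpha>_hom] by simp

abbreviation "V f \<equiv> locus P PP (\<alpha> f)"

lemma V_eq: "V f = preimg P \<pi> {p \<in> PS. f \<notin> p}"
 using locus_pull[OF rspace_axioms S.rspace_axioms morphism_\<pi> S.open_V S.\<rho>_closed[of f]]
 unfolding preimg_PS plane_locus \<alpha>_def by simp

lemma open_V: "opens P (V f)" by (rule open_locus) simp

lemma mem_V: "y \<in> V f \<longleftrightarrow> y \<in> PP & f \<notin> pt \<pi> y"
 unfolding V_eq preimg_def using morphism_pt[OF morphism_\<pi>] by auto

lemma pt_\<pi>: "y \<in> PP ==> primeideal (pt \<pi> y) tring & pt \<pi> y \<noteq> origin"
 using morphism_pt[OF morphism_\<pi>] unfolding plane_chart(1) by blast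

definition invariant :: "'p set => bool" where "invariant W \<longleftrightarrow> opens P W & preimg GP \<mu> W = preimg GP pr W"

lemma invariant_preimg: "opens punctured_plane D ==> invariant (preimg P \<pi> D)"
 unfolding invariant_def using morphism_open[OF morphism_\<pi>] \<pi>_\<mu> morphism_pt[OF morphism_\<mu>] morphism_pt[OF morphism_Ga_proj]
 unfolding mor_eq_def mcomp_def preimg_def by auto

lemma invariant_V: "invariant (V f)"
 unfolding V_eq by (rule invariant_preimg) (use S.open_locus[OF S.open_V, of "plane_fun f"] in \<open>simp add: plane_locus\<close>)

lemma invariant_PP: "invariant PP"
 using invariant_preimg[OF S.open_V] unfolding preimg_PS .

text \<open>The condition on the coordinate in a trivialisation: \<open>t (a \<cdot> p) = t p + a\<close>.\<close>

definition translated :: "'p set => 's => bool" where "translated W t \<longleftrightarrow> pull \<mu> W t =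
  pull pr W t \<oplus>\<^bsub>sections GP (preimg GP pr W)\<^esub> res GP (points GP) (preimg GP pr W) (Ga_coord P)"

context
 fixes W assumes W: "invariant W"
begin

lemma open_W: "opens P W" "W \<subseteq> PP" "opens GP (preimg GP pr W)" "preimg GP pr W \<subseteq> points GP"
 using W openin_subset morphism_open[OF morphism_Ga_proj] unfolding invariant_def by (auto simp: preimg_def)

lemma pull_hom: "pull \<mu> W \<in> ring_hom (sections P W) (sections GP (preimg GP pr W))"
 "pull pr W \<in> ring_hom (sections P W) (sections GP (preimg GP pr W))"
 using morphism_hom[OF morphism_\<mu> open_W(1)] morphism_hom[OF morphism_Ga_proj open_W(1)] W
 unfolding invariant_def by simp_all

lemma coord_closed: "res GP (points GP) (preimg GP pr W) (Ga_coord P) \<in> \<Gamma> GP (preimg GP pr W)"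
 by (rule G.res_closed[OF _ open_W(3,4) Ga_coord_closed]) simp

lemma pull_restrict:
 assumes W': "invariant W'" "W' \<subseteq> W" and t: "t \<in> \<Gamma> P W"
 shows "pull \<mu> W' (res P W W' t) = res GP (preimg GP pr W) (preimg GP pr W') (pull \<mu> W t)"
  and "pull pr W' (res P W W' t) = res GP (preimg GP pr W) (preimg GP pr W') (pull pr W t)"
 using morphism_nat[OF morphism_\<mu> open_W(1) _ W'(2) t] morphism_nat[OF morphism_Ga_proj open_W(1) _ W'(2) t] W W'(1)
 unfolding invariant_def by simp_all

lemma translated_restrict:
 assumes W': "invariant W'" "W' \<subseteq> W" and t: "t \<in> \<Gamma> P W" "translated W t"
 shows "translated W' (res P W W' t)"
proof -
 have o: "opens GP (preimg GP pr W')" "preimg GP pr W' \<subseteq> preimg GP pr W"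
  using W' morphism_open[OF morphism_Ga_proj] unfolding invariant_def by (auto simp: preimg_def)
 show ?thesis unfolding translated_def pull_restrict[OF W' t(1)] t(2)[unfolded translated_def]
  using G.res_add[OF open_W(3) o ring_hom_closed[OF pull_hom(2) t(1)] coord_closed]
   G.res_res[OF _ open_W(3) o(1,2) open_W(4) Ga_coord_closed] by simp
qed

end

lemma \<alpha>_invariant:
 assumes W: "invariant W"
 shows "pull \<mu> W (res P PP W (\<alpha> a)) = pull pr W (res P PP W (\<alpha> a))"
proof -
 have "pull \<mu> (preimg P \<pi> D) (pull \<pi> D t) = pull pr (preimg P \<pi> D) (pull \<pi> D t)"
  if "opens punctured_plane D" "t \<in> \<Gamma> punctured_plane D" for D t using \<pi>_\<mu> that unfolding mor_eq_def mcomp_def by simp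
 from this[OF S.open_V S.\<rho>_closed[of a]] have "pull \<mu> PP (\<alpha> a) = pull pr PP (\<alpha> a)" unfolding preimg_PS \<alpha>_def by simp
 then show ?thesis using pull_restrict[OF invariant_PP W open_W(2)[OF W] \<alpha>_closed] by simp
qed

text \<open>The values of \<open>\<mu>\<^sup>*\<close> at a point over \<open>y\<close>: on the image of \<open>B\<close> it is the
  substitution \<open>T \<mapsto> \<tau> + T\<close>, which raises the degree in \<open>T\<close> of every non-constant polynomial.\<close>

lemma pull_\<mu>_poly:
 assumes W: "invariant W" and c: "fchart P W r f'"
  and const: "\<And>a. r [:a:] = res P PP W (\<alpha> a)" and tr: "translated W (r [:0, 1:])"
  and y: "y \<in> W" and z: "z \<in> line_points P" "fst z = y"
 shows "\<exists>G \<in> carrier (K y). pull \<mu> W (r F) z = line.fr z G \<one>\<^bsub>K y\<^esub> &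
  (\<forall>n>degree F. G n = \<zero>\<^bsub>stalk P y\<^esub>) & G (degree F) = germ P y W (r [:lead_coeff F:])"
proof (induction F)
 interpret F: fchart P W r f' by (rule c)
 have x: "y \<in> PP" using open_W(2)[OF W] y by blast
 interpret K0: cring "stalk P y" by (rule cring_stalk[OF x])
 interpret U: cring "K y" by (rule cring_UP[OF K0.is_cring])
 let ?W = "preimg GP pr W"
 have zW: "z \<in> ?W" using z y by (simp add: preimg_Ga_proj)
 let ?fr = "\<lambda>G. line.fr z G \<one>\<^bsub>K y\<^esub>" and ?m = "\<lambda>c. up_ring.monom (K y) c 0"
  and ?T = "up_ring.monom (K y) \<one>\<^bsub>stalk P y\<^esub> 1" and ?g = "\<lambda>F. germ P y W (r F)"
 have lz: "localize (K y) (carrier (K y) - snd z)" using prime_localize[OF line_pointsD(2)[OF z(1)]] z(2) by simp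
 have fr_hom: "?fr \<in> ring_hom (K y) (line.L z)" using localize.frac_hom[OF lz] z(2) by simp
 have gc: "?g F \<in> carrier (stalk P y)" for F by (rule germ_closed[OF open_W(1)[OF W] y]) (rule F.\<rho>_closed, simp)
 have mc: "?m c \<in> carrier (K y)" if "c \<in> carrier (stalk P y)" for c by (rule UP_monom_closed[OF K0.is_cring that])
 have Tc: "?T \<in> carrier (K y)" by (rule UP_monom_closed[OF K0.is_cring K0.one_closed])
 have pr_z: "pull pr W (r F) z = ?fr (?m (?g F))" for F
  using pull_Ga_proj[OF open_W(1)[OF W] z(1) _ F.\<rho>_closed[of F]] y z(2) by simp
 have co: "res GP (points GP) ?W (Ga_coord P) z = ?fr ?T" using Ga_coord_apply[OF z(1)] zW z(2) by (simp add: res_Ga_times)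
 have const_z: "pull \<mu> W (r [:a:]) z = ?fr (?m (?g [:a:]))" for a
  using pr_z[of "[:a:]"] \<alpha>_invariant[OF W, of a] const[of a] by simp
 have tau_z: "pull \<mu> W (r [:0, 1:]) z = ?fr (?m (?g [:0, 1:]) \<oplus>\<^bsub>K y\<^esub> ?T)"
  unfolding tr[unfolded translated_def] Ga_times_apply(2)[OF zW] pr_z co ring_hom_add[OF fr_hom mc[OF gc] Tc] ..
 have zero: "?g 0 = \<zero>\<^bsub>stalk P y\<^esub>"
  using ring_hom_zero[OF F.\<sigma>_hom[OF y] F.R.ring_axioms K0.ring_axioms] unfolding F.\<sigma>_def by simp
 {
  case 0
  have "pull \<mu> W (r 0) z = ?fr \<zero>\<^bsub>K y\<^esub>"
  proof -
   have "?m (?g 0) = \<zero>\<^bsub>K y\<^esub>" unfolding zero by (rule ext) (simp add: UP_monom_apply UP_zero_apply)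
   then show ?thesis using const_z[of 0] by simp
  qed
  then show ?case by (intro bexI[OF _ U.zero_closed] conjI) (assumption, simp_all add: UP_zero_apply zero)
 next
  case (pCons a b)
  then obtain G where G: "G \<in> carrier (K y)" "pull \<mu> W (r b) z = ?fr G"
   "\<And>n. n > degree b ==> G n = \<zero>\<^bsub>stalk P y\<^esub>" "G (degree b) = ?g [:lead_coeff b:]" by blast
  have Gc: "G n \<in> carrier (stalk P y)" for n using G(1) unfolding UP_carrier by blast
  let ?H = "?m (?g [:a:]) \<oplus>\<^bsub>K y\<^esub> (?m (?g [:0, 1:]) \<oplus>\<^bsub>K y\<^esub> ?T) \<otimes>\<^bsub>K y\<^esub> G"
  note cl = mc[OF gc, of "[:a:]"] mc[OF gc, of "[:0, 1:]"] Tc G(1)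
  have H: "?H \<in> carrier (K y)" using cl by simp
  have "r (pCons a b) = r [:a:] \<oplus>\<^bsub>sections P W\<^esub> r [:0, 1:] \<otimes>\<^bsub>sections P W\<^esub> r b"
   using ring_hom_add[OF F.hom, of "[:a:]" "[:0, 1:] * b"] F.\<rho>_mult[of "[:0, 1:]" b] by simp
  moreover interpret GW: cring "sections P W" by (rule cring_sections[OF open_W(1)[OF W]])
  have rc: "r F \<in> \<Gamma> P W" for F by (rule F.\<rho>_closed) simp
  ultimately have "pull \<mu> W (r (pCons a b)) z = ?fr ?H"
   unfolding ring_hom_add[OF fr_hom cl(1) U.m_closed[OF U.a_closed[OF cl(2,3)] cl(4)]]
    ring_hom_mult[OF fr_hom U.a_closed[OF cl(2,3)] cl(4)] const_z[symmetric] tau_z[symmetric] G(2)[symmetric]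
   using ring_hom_add[OF pull_hom(1)[OF W] rc GW.m_closed[OF rc rc], of "[:a:]" "[:0, 1:]" b]
    ring_hom_mult[OF pull_hom(1)[OF W] rc rc, of "[:0, 1:]" b] by (simp add: Ga_times_apply[OF zW])
  moreover have Hn: "?H n = (if n = 0 then ?g [:a:] else \<zero>\<^bsub>stalk P y\<^esub>) \<oplus>\<^bsub>stalk P y\<^esub>
    (?g [:0, 1:] \<otimes>\<^bsub>stalk P y\<^esub> G n \<oplus>\<^bsub>stalk P y\<^esub> (case n of 0 => \<zero>\<^bsub>stalk P y\<^esub> | Suc m => G m))" for n
   unfolding U.l_distr[OF cl(2-4)] UP_add_apply[OF cl(1) U.a_closed[OF U.m_closed[OF cl(2,4)] U.m_closed[OF cl(3,4)]]]
    UP_add_apply[OF U.m_closed[OF cl(2,4)] U.m_closed[OF cl(3,4)]] UP_const_mult_apply[OF K0.is_cring gc G(1)]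
    UP_shift_apply[OF K0.is_cring G(1)] unfolding UP_monom_apply[OF gc] ..
  have "(\<forall>n>degree (pCons a b). ?H n = \<zero>\<^bsub>stalk P y\<^esub>) & ?H (degree (pCons a b)) = ?g [:lead_coeff (pCons a b):]"
  proof (cases "b = 0")
   case True
   have G0: "G n = \<zero>\<^bsub>stalk P y\<^esub>" for n using G(3)[of n] G(4) zero unfolding True by (cases n) auto
   show ?thesis unfolding Hn G0 True using gc by (auto split: nat.split)
  next
   case False
   then show ?thesis unfolding Hn using G(3,4) gc Gc by (auto split: nat.split)
  qed
  ultimately show ?case using H by blast
 }
qed

text \<open>At the generic point polynomials over the stalk form a domain, so the equation holds between
polynomials in \<open>T\<close>; the coefficient of \<open>T\<^sup>d\<close>, for \<open>d\<close> the degree of \<open>F\<close>, is the leading coefficient of \<open>F\<close>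
on the left and, unless \<open>d = 0\<close>, vanishes on the right.\<close>

lemma invariant_polynomial:
 assumes W: "invariant W" and c: "fchart P W r f'"
  and const: "\<And>a. r [:a:] = res P PP W (\<alpha> a)" and tr: "translated W (r [:0, 1:])"
  and inv: "pull \<mu> W (r F) = pull pr W (r F)"
 shows "\<exists>a. F = [:a:]"
proof -
 interpret F: fchart P W r f' by (rule c)
 obtain y where y: "y \<in> W" "prm P W tring r y = {0}" using F.generic_ex by blast
 interpret F: generic P W r f' y by (intro generic.intro generic_axioms.intro c y)
 interpret D: domain "stalk P y" by (rule F.domain_stalk)
 interpret U: cring "K y" by (rule cring_UP[OF F.K0.is_cring])
 have x: "y \<in> PP" using open_W(2)[OF W] y by blast
 obtain e where e: "\<And>y. y \<in> PP ==> e y \<in> line_points P & fst (e y) = y & pt \<mu> (e y) = y" using unit_section by blast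
 define z where "z = e y"
 have z: "z \<in> line_points P" "fst z = y" using e[OF x] unfolding z_def by auto
 obtain G where G: "G \<in> carrier (K y)" "pull \<mu> W (r F) z = line.fr z G \<one>\<^bsub>K y\<^esub>"
  "G (degree F) = germ P y W (r [:lead_coeff F:])" using pull_\<mu>_poly[OF W c const tr y(1) z] by blast
 let ?M = "up_ring.monom (K y) (F.\<sigma> y F) 0"
 have M: "?M \<in> carrier (K y)" by (rule UP_monom_closed[OF F.K0.is_cring F.\<sigma>\<eta>_closed])
 have fr_eq: "line.fr z G \<one>\<^bsub>K y\<^esub> = line.fr z ?M \<one>\<^bsub>K y\<^esub>"
  using G(2) inv pull_Ga_proj[OF open_W(1)[OF W] z(1) _ F.\<rho>_closed[of F]] y z(2) by (simp add: F.\<sigma>_def)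
 have q: "primeideal (snd z) (K y)" using line_pointsD(2)[OF z(1)] z(2) by simp
 interpret q: primeideal "snd z" "K y" by (rule q)
 interpret L: localize "K y" "carrier (K y) - snd z" by (rule prime_localize[OF q])
 obtain h where h: "h \<in> carrier (K y) - snd z" "h \<otimes>\<^bsub>K y\<^esub> (\<one>\<^bsub>K y\<^esub> \<otimes>\<^bsub>K y\<^esub> G) = h \<otimes>\<^bsub>K y\<^esub> (\<one>\<^bsub>K y\<^esub> \<otimes>\<^bsub>K y\<^esub> ?M)"
  using L.frac_eq_iff[OF G(1) L.one_M M L.one_M] fr_eq unfolding z(2) by blast
 have "h \<noteq> \<zero>\<^bsub>K y\<^esub>" using h(1) q.zero_closed by auto
 then have GM: "G = ?M" using D.UP_cancel[of h G ?M] h G(1) M by simp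
 have "degree F = 0"
 proof (rule ccontr)
  assume d: "degree F \<noteq> 0"
  have "F.\<sigma> y [:lead_coeff F:] = \<zero>\<^bsub>stalk P y\<^esub>"
   using G(3) d unfolding GM UP_monom_apply[OF F.\<sigma>\<eta>_closed] by (simp add: F.\<sigma>_def)
  then have "[:lead_coeff F:] = 0" by (rule F.\<sigma>\<eta>_eq_0)
  then show False using d by simp
 qed
 then show ?thesis by (meson degree_eq_zeroE)
qed

end

section \<open>The atlas of a bundle\<close>

context Ga_bundle
begin

lemma trivialization_chart:
 assumes U: "opens punctured_plane U" and \<phi>: "Ga_trivialization P punctured_plane \<pi> \<mu> U \<phi>"
 shows "\<exists>r. chart P (preimg P \<pi> U) (tring :: cylinder_ring ring) r &
  prm P (preimg P \<pi> U) tring r ` preimg P \<pi> U = {Q. primeideal Q tring & {a. [:a:] \<in> Q} \<in> U} &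
  (\<forall>a. r [:a:] = res P PP (preimg P \<pi> U) (\<alpha> a)) & translated (preimg P \<pi> U) (r [:0, 1:])"
proof -
 let ?V = "preimg P \<pi> U" and ?S = "open_subspace punctured_plane U"
 let ?P = "open_subspace P ?V" and ?Z = "Ga_times ?S"
 let ?\<rho> = "\<lambda>a. res punctured_plane PS U (plane_fun a)"
 note sc = open_subspace_chart[OF U]
 interpret C: cylinder ?S ?\<rho> by (rule cylinder.intro[OF sc(1)])
 have oV: "opens P ?V" by (rule morphism_open[OF morphism_\<pi> U])
 have iso: "isomorphism ?P ?Z \<phi>" and over: "mor_eq ?P ?S (mcomp ?Z (Ga_proj ?S) \<phi>) \<pi>"
  and eqv: "translated ?V (pull \<phi> (points ?Z) (Ga_coord ?S))"
  using \<phi> unfolding Ga_trivialization_def Let_def translated_def by blast+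
 let ?r = "\<lambda>F. pull \<phi> (points ?Z) (C.C F)"
 have ptsP: "points ?P = ?V" by (rule points_open_subspace[OF oV])
 note T = chart_transport[OF rspace_open_subspace[OF oV] C.cylinder_chart iso, unfolded ptsP]
 note O = chart_open_subspace[OF oV subset_refl]
 have c: "chart P ?V (tring :: cylinder_ring ring) ?r" using T(1) unfolding O(1) .
 have "prm P ?V tring ?r ` ?V = prm ?Z (points ?Z) tring C.C ` pt \<phi> ` ?V"
  unfolding image_image using T(2) unfolding O(2) by (intro image_cong refl) simp
 also have "\<dots> = {Q. primeideal Q tring & {a. [:a:] \<in> Q} \<in> prm ?S U tring ?\<rho> ` U}" unfolding T(3) C.C_image sc(3) ..
 also have "prm ?S U tring ?\<rho> ` U = U" using sc(2) by simp
 finally have im: "prm P ?V tring ?r ` ?V = {Q. primeideal Q tring & {a. [:a:] \<in> Q} \<in> U}" .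
 have "?r [:a:] = res P PP ?V (\<alpha> a)" for a
 proof -
  have "opens ?S U" using openin_topspace[of "topo ?S"] unfolding sc(3) .
  moreover have t: "?\<rho> a \<in> \<Gamma> ?S U" using C.\<rho>_closed[of a] unfolding sc(3) by simp
  ultimately have "pull \<phi> (preimg ?Z (Ga_proj ?S) U) (pull (Ga_proj ?S) U (?\<rho> a)) = pull \<pi> U (?\<rho> a)"
   using over unfolding mor_eq_def mcomp_def by simp
  also have "preimg ?Z (Ga_proj ?S) U = points ?Z" using preimg_points[OF C.morphism_Ga_proj] unfolding sc(3) .
  also have "pull (Ga_proj ?S) U (?\<rho> a) = C.C [:a:]" using C.C_const[of a] unfolding sc(3) by simp
  also have "pull \<pi> U (?\<rho> a) = res P PP ?V (\<alpha> a)"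
   using morphism_nat[OF morphism_\<pi> S.open_V U openin_subset[OF U] S.\<rho>_closed[of a]] unfolding preimg_PS \<alpha>_def by simp
  finally show ?thesis .
 qed
 then show ?thesis using c im eqv unfolding C.C_coord[symmetric] by blast
qed

lemma fchart_restrict:
 assumes c: "chart P V' tring r" and const: "\<And>a. r [:a:] = res P PP V' (\<alpha> a)" and V': "V' \<subseteq> PP" "V f \<subseteq> V'" and f: "f \<noteq> 0"
  and im: "{Q. primeideal Q (tring :: cylinder_ring ring) & [:f:] \<notin> Q} \<subseteq> prm P V' tring r ` V'"
 shows "fchart P (V f) (\<lambda>F. res P V' (V f) (r F)) [:f:]" and "res P V' (V f) (r [:a:]) = res P PP (V f) (\<alpha> a)"
proof -
 interpret C: chart P V' tring r by (rule c)
 note R = chart_restrict[OF c open_V V'(2)]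
 have "locus P V' (r [:f:]) = V f" unfolding const using locus_res[OF _ \<alpha>_closed C.open_V V'(1), of f] V'(2) by auto
 then have mem: "[:f:] \<notin> prm P V' tring r y \<longleftrightarrow> y \<in> V f" if "y \<in> V'" for y unfolding prm_def by simp
 have "prm P (V f) tring (\<lambda>F. res P V' (V f) (r F)) ` V f = {Q. primeideal Q tring & [:f:] \<notin> Q}"
 proof (intro equalityI subsetI)
  fix Q assume "Q \<in> prm P (V f) tring (\<lambda>F. res P V' (V f) (r F)) ` V f"
  then obtain y where y: "y \<in> V f" "Q = prm P V' tring r y" using R(2) by auto
  then show "Q \<in> {Q. primeideal Q tring & [:f:] \<notin> Q}" using mem C.prime V'(2) by blast
 next
  fix Q assume "Q \<in> {Q. primeideal Q (tring :: cylinder_ring ring) & [:f:] \<notin> Q}"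
  then have Q: "primeideal Q tring" "[:f:] \<notin> Q" by auto
  obtain y where y: "y \<in> V'" "Q = prm P V' tring r y" using im Q by blast
  then have yV: "y \<in> V f" using mem Q(2) by blast
  show "Q \<in> prm P (V f) tring (\<lambda>F. res P V' (V f) (r F)) ` V f"
   using R(2)[OF yV] y(2) yV by (intro image_eqI[of _ _ y]) simp_all
 qed
 then show "fchart P (V f) (\<lambda>F. res P V' (V f) (r F)) [:f:]"
  by (intro fchart.intro fchart_axioms.intro R(1)) (use f in simp)
 show "res P V' (V f) (r [:a:]) = res P PP (V f) (\<alpha> a)"
  unfolding const by (rule res_res[OF _ C.open_V open_V V'(2,1) \<alpha>_closed]) simp
qed

text \<open>That \<open>f\<close> vanishes at the origin makes \<open>{p \<in> PS. f \<notin> p}\<close> the whole basic open set of \<open>f\<close> in the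
plane, so that the chart over it contains all the primes that avoid \<open>f\<close>.\<close>

definition good :: "plane_ring => bool" where "good f \<longleftrightarrow> f \<in> origin & f \<noteq> 0 & (\<exists>U \<phi>. opens punctured_plane U &
  Ga_trivialization P punctured_plane \<pi> \<mu> U \<phi> & {p \<in> PS. f \<notin> p} \<subseteq> U)"

lemma contract_prime:
 assumes "primeideal Q (tring :: cylinder_ring ring)" shows "primeideal {a. [:a:] \<in> Q} tring"
proof -
 note D = tring_primeD[OF assms]
 have m: "[:a * b:] = [:a:] * [:b:]" "[:a + b:] = [:a:] + [:b:]" for a b :: plane_ring by simp_all
 show ?thesis
  unfolding tring_prime_iff mem_Collect_eq m using D by (auto simp: one_pCons[symmetric] simp del: mult_pCons_left mult_pCons_right add_pCons)
qed

lemma good_chart: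
 assumes f: "good f"
 shows "\<exists>r. fchart P (V f) r [:f:] & (\<forall>a. r [:a:] = res P PP (V f) (\<alpha> a)) & translated (V f) (r [:0, 1:])"
proof -
 obtain U \<phi> where U: "opens punctured_plane U" "Ga_trivialization P punctured_plane \<pi> \<mu> U \<phi>" "{p \<in> PS. f \<notin> p} \<subseteq> U"
  and f': "f \<in> origin" "f \<noteq> 0" using f unfolding good_def by blast
 let ?V = "preimg P \<pi> U"
 obtain r where r: "chart P ?V (tring :: cylinder_ring ring) r"
  "prm P ?V tring r ` ?V = {Q. primeideal Q tring & {a. [:a:] \<in> Q} \<in> U}"
  "\<And>a. r [:a:] = res P PP ?V (\<alpha> a)" "translated ?V (r [:0, 1:])" using trivialization_chart[OF U(1,2)] by blast
 interpret C: chart P ?V tring r by (rule r(1))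
 have V: "?V \<subseteq> PP" "V f \<subseteq> ?V" unfolding V_eq using U(3) by (auto simp: preimg_def)
 have im: "{Q. primeideal Q tring & [:f:] \<notin> Q} \<subseteq> prm P ?V tring r ` ?V"
 proof
  fix Q assume "Q \<in> {Q. primeideal Q (tring :: cylinder_ring ring) & [:f:] \<notin> Q}"
  then have Q: "primeideal Q tring" "[:f:] \<notin> Q" by auto
  have "{a. [:a:] \<in> Q} \<in> {p \<in> PS. f \<notin> p}" unfolding plane_chart(1) using contract_prime[OF Q(1)] Q(2) f'(1) by auto
  then show "Q \<in> prm P ?V tring r ` ?V" unfolding r(2) using Q(1) U(3) by blast
 qed
 note F = fchart_restrict[OF r(1,3) V f'(2) im]
 have "translated (V f) (res P ?V (V f) (r [:0, 1:]))"
  by (rule translated_restrict[OF invariant_preimg[OF U(1)] invariant_V V(2) C.\<rho>_closed r(4)]) simp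
 then show ?thesis using F by blast
qed

lemma translated_diff:
 assumes W: "invariant W" and t: "t \<in> \<Gamma> P W" "t' \<in> \<Gamma> P W" "translated W t"
 shows "pull \<mu> W (t \<ominus>\<^bsub>sections P W\<^esub> t') = pull pr W (t \<ominus>\<^bsub>sections P W\<^esub> t') \<longleftrightarrow> translated W t'"
proof -
 let ?R = "sections GP (preimg GP pr W)"
 interpret R: cring ?R by (rule G.cring_sections[OF open_W(3)[OF W]])
 interpret A: cring "sections P W" by (rule cring_sections[OF open_W(1)[OF W]])
 interpret m: ring_hom_cring "sections P W" ?R "pull \<mu> W"
  by (rule ring_hom_cringI[OF A.is_cring R.is_cring pull_hom(1)[OF W]])
 interpret p: ring_hom_cring "sections P W" ?R "pull pr W"
  by (rule ring_hom_cringI[OF A.is_cring R.is_cring pull_hom(2)[OF W]])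
 let ?T = "res GP (points GP) (preimg GP pr W) (Ga_coord P)"
 have T: "?T \<in> carrier ?R" by (rule coord_closed[OF W])
 note c = m.hom_closed[OF t(2)] p.hom_closed[OF t(1)] p.hom_closed[OF t(2)] T
 have 1: "pull \<mu> W (t \<ominus>\<^bsub>sections P W\<^esub> t') = (pull pr W t \<oplus>\<^bsub>?R\<^esub> ?T) \<ominus>\<^bsub>?R\<^esub> pull \<mu> W t'"
  using t(3) t(1,2) unfolding translated_def by (simp add: A.minus_eq R.minus_eq)
 have 2: "pull pr W (t \<ominus>\<^bsub>sections P W\<^esub> t') = pull pr W t \<ominus>\<^bsub>?R\<^esub> pull pr W t'"
  using t(1,2) by (simp add: A.minus_eq R.minus_eq)
 have "(b \<oplus>\<^bsub>?R\<^esub> T) \<ominus>\<^bsub>?R\<^esub> a' = b \<ominus>\<^bsub>?R\<^esub> b' \<longleftrightarrow> a' = b' \<oplus>\<^bsub>?R\<^esub> T"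
  if c: "a' \<in> carrier ?R" "b \<in> carrier ?R" "b' \<in> carrier ?R" "T \<in> carrier ?R" for a' b b' T
 proof
  assume e: "(b \<oplus>\<^bsub>?R\<^esub> T) \<ominus>\<^bsub>?R\<^esub> a' = b \<ominus>\<^bsub>?R\<^esub> b'"
  have "a' = (b \<oplus>\<^bsub>?R\<^esub> T) \<ominus>\<^bsub>?R\<^esub> ((b \<oplus>\<^bsub>?R\<^esub> T) \<ominus>\<^bsub>?R\<^esub> a')" using c by algebra
  also have "\<dots> = b' \<oplus>\<^bsub>?R\<^esub> T" unfolding e using c by algebra
  finally show "a' = b' \<oplus>\<^bsub>?R\<^esub> T" .
 next
  assume "a' = b' \<oplus>\<^bsub>?R\<^esub> T" then show "(b \<oplus>\<^bsub>?R\<^esub> T) \<ominus>\<^bsub>?R\<^esub> a' = b \<ominus>\<^bsub>?R\<^esub> b'" using c by algebra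
 qed
 from this[OF c] show ?thesis unfolding 1 2 translated_def .
qed

text \<open>The difference of the coordinates is a fraction with a power of \<open>f g\<close> as denominator. It is
invariant, so its numerator is an invariant polynomial, that is, a constant.\<close>

lemma chart_diff:
 assumes f: "fchart P (V f) r [:f:]" "\<And>a. r [:a:] = res P PP (V f) (\<alpha> a)" "translated (V f) (r [:0, 1:])"
  and g: "fchart P (V g) s [:g:]" "translated (V g) (s [:0, 1:])" and W: "W = V f \<inter> V g"
 shows "\<exists>n c. res P PP W (\<alpha> ((f * g) ^ n)) \<otimes>\<^bsub>sections P W\<^esub>
  (res P (V f) W (r [:0, 1:]) \<ominus>\<^bsub>sections P W\<^esub> res P (V g) W (s [:0, 1:])) = res P PP W (\<alpha> c)"
proof -
 interpret F: fchart P "V f" r "[:f:]" by (rule f(1))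
 interpret H: fchart P "V g" s "[:g:]" by (rule g(1))
 have W': "W = V (f * g)" unfolding W using mem_V pt_\<pi> tring_primeD(5) by blast
 have sub: "W \<subseteq> V f" "W \<subseteq> V g" "W \<subseteq> PP" unfolding W using locus_subset by blast+
 have i: "invariant W" unfolding W' by (rule invariant_V)
 note o = open_W(1)[OF i]
 have fg: "f * g \<noteq> 0" using F.f0 H.f0 by simp
 have im: "{Q. primeideal Q tring & [:f * g:] \<notin> Q} \<subseteq> prm P (V f) tring r ` V f"
 proof
  fix Q assume "Q \<in> {Q. primeideal Q (tring :: cylinder_ring ring) & [:f * g:] \<notin> Q}"
  then have Q: "primeideal Q tring" "[:f * g:] \<notin> Q" by auto
  have "[:f * g:] = [:g:] * [:f:]" by simp
  then have "[:f:] \<notin> Q" using Q(2) tring_primeD(3)[OF Q(1), of "[:f:]" "[:g:]"] by argo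
  then show "Q \<in> prm P (V f) tring r ` V f" unfolding F.image using Q(1) by blast
 qed
 let ?r = "\<lambda>F. res P (V f) W (r F)"
 have sub': "V f \<subseteq> PP" by (rule locus_subset)
 note c = fchart_restrict[OF F.chart_axioms f(2) sub' sub(1)[unfolded W'] fg im, folded W']
 interpret C: fchart P W ?r "[:f * g:]" by (rule c(1))
 interpret A: cring "sections P W" by (rule cring_sections[OF o])
 have rc: "?r F \<in> \<Gamma> P W" for F by (rule C.\<rho>_closed) simp
 have sc: "res P (V g) W (s [:0, 1:]) \<in> \<Gamma> P W" by (rule res_closed[OF open_V o sub(2) H.\<rho>_closed]) simp
 have tr: "translated W (?r [:0, 1:])" "translated W (res P (V g) W (s [:0, 1:]))"
  using translated_restrict[OF invariant_V i sub(1) F.\<rho>_closed f(3)] translated_restrict[OF invariant_V i sub(2) H.\<rho>_closed g(2)]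
  by auto
 let ?d = "?r [:0, 1:] \<ominus>\<^bsub>sections P W\<^esub> res P (V g) W (s [:0, 1:])"
 have d: "?d \<in> \<Gamma> P W" by (rule A.minus_closed[OF rc sc])
 have inv: "pull \<mu> W ?d = pull pr W ?d" using translated_diff[OF i rc sc tr(1)] tr(2) by blast
 obtain n F where F: "?r ([:f * g:] ^ n) \<otimes>\<^bsub>sections P W\<^esub> ?d = ?r F" using C.section_global_frac[OF d] by blast
 have rn: "?r ([:f * g:] ^ n) = res P PP W (\<alpha> ((f * g) ^ n))" unfolding c(2)[symmetric] poly_const_pow ..
 have "pull \<mu> W (?r F) = pull pr W (?r F)"
  unfolding F[symmetric] using ring_hom_mult[OF pull_hom(1)[OF i] rc d] ring_hom_mult[OF pull_hom(2)[OF i] rc d] inv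
   \<alpha>_invariant[OF i, of "(f * g) ^ n"] unfolding rn by (metis rn)
 then obtain a where "F = [:a:]" using invariant_polynomial[OF i c(1) c(2) tr(1)] by blast
 then have "res P PP W (\<alpha> ((f * g) ^ n)) \<otimes>\<^bsub>sections P W\<^esub> ?d = res P PP W (\<alpha> a)" using F unfolding rn c(2)[symmetric] by simp
 then show ?thesis by blast
qed

lemma good_cover: "p \<in> PS ==> \<exists>f. good f & f \<notin> p"
proof -
 assume p: "p \<in> PS"
 obtain U \<phi> where U: "opens punctured_plane U" "p \<in> U" "Ga_trivialization P punctured_plane \<pi> \<mu> U \<phi>"
  using Ga_bundle p unfolding principal_Ga_bundle_def by blast
 obtain a where a: "p \<in> {p \<in> PS. a \<notin> p}" "{p \<in> PS. a \<notin> p} \<subseteq> U"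
  using S.basis[OF U(1) openin_subset[OF U(1)] U(2)] unfolding plane_locus by blast
 have P: "primeideal p tring" "p \<noteq> origin" using p unfolding plane_chart(1) by auto
 obtain b where b: "b \<notin> p" "b \<in> origin" using prime_X1_Y1[OF P(1)] P(2) X1_Y1_origin by blast
 have ab: "a * b \<notin> p" using a(1) b(1) tring_primeD(5)[OF P(1)] by blast
 have "good (a * b)" unfolding good_def
 proof (intro conjI exI)
  show "a * b \<in> origin" using tring_primeD(3)[OF prime_origin b(2)] .
  show "a * b \<noteq> 0" using ab tring_primeD(1)[OF P(1)] by metis
  show "{p \<in> PS. a * b \<notin> p} \<subseteq> U" using a(2) tring_primeD(5) unfolding plane_chart(1) by blast
 qed (rule U)+
 then show "\<exists>f. good f & f \<notin> p" using ab by blast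
qed

text \<open>Finitely many good functions suffice because \<open>x\<close> and \<open>y\<close> lie in the radical of the ideal
  that they generate.\<close>

lemma finite_good:
 assumes x: "x \<in> origin"
 shows "\<exists>F. finite F & (\<forall>f\<in>F. good f) & (\<forall>p. primeideal p tring --> F \<subseteq> p --> x \<in> p)"
proof -
 define I where "I = {b. \<exists>F. finite F & (\<forall>f\<in>F. good f) & (\<forall>p. primeideal p tring --> F \<subseteq> p --> b \<in> p)}"
 have I: "is_ideal I" unfolding is_ideal_def
 proof (intro conjI ballI allI)
  show "0 \<in> I" unfolding I_def using tring_primeD(1) by (intro CollectI exI[of _ "{}"]) auto
  fix a assume "a \<in> I"
  then obtain F where F: "finite F" "\<forall>f\<in>F. good f" "\<forall>p. primeideal p tring --> F \<subseteq> p --> a \<in> p" unfolding I_def by blast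
  show "r * a \<in> I" for r unfolding I_def by (intro CollectI exI[of _ F]) (use F tring_primeD(3) in blast)
  fix b assume "b \<in> I"
  then obtain F' where F': "finite F'" "\<forall>f\<in>F'. good f" "\<forall>p. primeideal p tring --> F' \<subseteq> p --> b \<in> p" unfolding I_def by blast
  show "a + b \<in> I" unfolding I_def
   by (intro CollectI exI[of _ "F \<union> F'"] conjI allI impI tring_primeD(2)) (use F F' in auto)
 qed
 have "\<exists>n. x ^ n \<in> I"
 proof (rule ccontr)
  assume "\<not> ?thesis"
  then obtain p where p: "primeideal p tring" "I \<subseteq> p" "x \<notin> p" using prime_avoiding_powers[OF I] by blast
  then have "p \<in> PS" using x unfolding plane_chart(1) by blast
  then obtain f where f: "good f" "f \<notin> p" using good_cover by blast
  have "f \<in> I" unfolding I_def using f(1) by (intro CollectI exI[of _ "{f}"]) auto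
  then show False using p(2) f(2) by blast
 qed
 then obtain n F where F: "finite F" "\<forall>f\<in>F. good f" "\<forall>p. primeideal p tring --> F \<subseteq> p --> x ^ n \<in> p" unfolding I_def by blast
 show ?thesis
 proof (intro exI[of _ F] conjI allI impI F(1,2))
  fix p assume p: "primeideal p tring" "F \<subseteq> p"
  then have "x ^ n \<in> p" using F(3) by blast
  then show "x \<in> p" by (rule tring_primeD(6)[OF p(1)])
 qed
qed

lemma atlas_ex:
 "\<exists>Fs \<rho>. atlas P \<alpha> Fs \<rho> & (\<forall>f\<in>Fs. translated (V f) (\<rho> f [:0, 1:]))"
proof -
 obtain F where F: "finite F" "\<And>f. f \<in> F ==> good f" "\<And>p. primeideal p tring ==> F \<subseteq> p ==> X1 \<in> p"
  using finite_good[OF X1_Y1_origin(1)] by blast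
 obtain F' where F': "finite F'" "\<And>f. f \<in> F' ==> good f" "\<And>p. primeideal p tring ==> F' \<subseteq> p ==> Y1 \<in> p"
  using finite_good[OF X1_Y1_origin(2)] by blast
 define Fs where "Fs = F \<union> F'"
 have good: "good f" if "f \<in> Fs" for f using that F(2) F'(2) unfolding Fs_def by blast
 then have "\<forall>f\<in>Fs. \<exists>r. fchart P (V f) r [:f:] & (\<forall>a. r [:a:] = res P PP (V f) (\<alpha> a)) & translated (V f) (r [:0, 1:])"
  using good_chart by blast
 then obtain \<rho> where \<rho>: "\<And>f. f \<in> Fs ==> fchart P (V f) (\<rho> f) [:f:]"
  "\<And>f a. f \<in> Fs ==> \<rho> f [:a:] = res P PP (V f) (\<alpha> a)" "\<And>f. f \<in> Fs ==> translated (V f) (\<rho> f [:0, 1:])" by metis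
 have cov: "p \<noteq> origin \<longleftrightarrow> (\<exists>f\<in>Fs. f \<notin> p)" if p: "primeideal p tring" for p
 proof
  assume n: "p \<noteq> origin"
  show "\<exists>f\<in>Fs. f \<notin> p"
  proof (rule ccontr)
   assume "\<not> ?thesis"
   then have "F \<subseteq> p" "F' \<subseteq> p" unfolding Fs_def by auto
   then have "X1 \<in> p" "Y1 \<in> p" using F(3)[OF p] F'(3)[OF p] by auto
   then show False using prime_X1_Y1[OF p] n by blast
  qed
 next
  assume "\<exists>f\<in>Fs. f \<notin> p" then show "p \<noteq> origin" using good unfolding good_def by blast
 qed
 have "atlas P \<alpha> Fs \<rho>"
 proof (intro atlas.intro atlas_axioms.intro rspace_axioms \<alpha>_hom)
  show "finite Fs" unfolding Fs_def using F(1) F'(1) by simp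
  show "0 \<notin> Fs" using good unfolding good_def by blast
  show "\<exists>f\<in>Fs. y \<in> V f" if "y \<in> PP" for y using cov[of "pt \<pi> y"] pt_\<pi>[OF that] mem_V that by blast
  show "\<exists>n c. res P PP W (\<alpha> ((f * g) ^ n)) \<otimes>\<^bsub>sections P W\<^esub>
    (res P (V f) W (\<rho> f [:0, 1:]) \<ominus>\<^bsub>sections P W\<^esub> res P (V g) W (\<rho> g [:0, 1:])) = res P PP W (\<alpha> c)"
   if "f \<in> Fs" "g \<in> Fs" "W = V f \<inter> V g" for f g W
   by (rule chart_diff[OF \<rho>(1)[OF that(1)] \<rho>(2)[OF that(1)] \<rho>(3)[OF that(1)] \<rho>(1)[OF that(2)] \<rho>(3)[OF that(2)] that(3)])
 qed (rule \<rho> cov, assumption)+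
 then show ?thesis using \<rho>(3) by blast
qed

end

section \<open>A global coordinate trivialises the bundle\<close>

context Ga_bundle
begin

context
 fixes Fs \<rho> \<theta>
 assumes atlas: "atlas P \<alpha> Fs \<rho>" and tr: "\<And>f. f \<in> Fs ==> translated (V f) (\<rho> f [:0, 1:])"
  and coordinate: "atlas.coordinate_chart P \<alpha> Fs \<rho> \<theta>"
begin

interpretation A: atlas P \<alpha> Fs \<rho> by (rule atlas)

lemma coordinateD:
 shows chart: "chart P PP (tring :: cylinder_ring ring) \<theta>"
  and image: "prm P PP tring \<theta> ` PP = {Q. primeideal Q tring & (\<exists>f\<in>Fs. [:f:] \<notin> Q)}" and const: "\<theta> [:a:] = \<alpha> a"
 using coordinate unfolding A.coordinate_chart_def by blast+

lemma \<theta>_closed: "\<theta> b \<in> \<Gamma> P PP"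
 using chart.\<rho>_closed[OF chart, of b] by simp

text \<open>A power of \<open>f\<close> times the difference of the two coordinates is a function of the base, hence
invariant, and \<open>f\<close> is invertible.\<close>

lemma coord_translated_local:
 assumes f: "f \<in> Fs" shows "translated (V f) (res P PP (V f) (\<theta> [:0, 1:]))"
proof -
 note i = invariant_V[of f]
 let ?R = "sections GP (preimg GP pr (V f))" and ?v = "res P PP (V f) (\<theta> [:0, 1:])"
 interpret R: cring ?R by (rule G.cring_sections[OF open_W(3)[OF i]])
 interpret B: cring "sections P (V f)" by (rule cring_sections[OF open_V])
 obtain n c where c: "res P PP (V f) (\<alpha> (f ^ n)) \<otimes>\<^bsub>sections P (V f)\<^esub>
   (\<rho> f [:0, 1:] \<ominus>\<^bsub>sections P (V f)\<^esub> ?v) = res P PP (V f) (\<alpha> c)"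
  using coordinate f unfolding A.coordinate_chart_def by blast
 let ?u = "res P PP (V f) (\<alpha> (f ^ n))" and ?d = "\<rho> f [:0, 1:] \<ominus>\<^bsub>sections P (V f)\<^esub> ?v"
 have sub: "V f \<subseteq> PP" by (rule locus_subset)
 have v: "?v \<in> \<Gamma> P (V f)" by (rule res_closed[OF _ open_V sub \<theta>_closed]) simp
 note t = A.\<rho>_closed[OF f, of "[:0, 1:]"]
 have d: "?d \<in> \<Gamma> P (V f)" by (rule B.minus_closed[OF t v])
 have uc: "?u \<in> \<Gamma> P (V f)" by (rule res_closed[OF _ open_V sub \<alpha>_closed]) simp
 have "V f \<subseteq> V (f ^ n)" using mem_V pt_\<pi> tring_primeD(6) by blast
 then have "?u \<in> Units (sections P (V f))" using Units_iff_locus[OF _ \<alpha>_closed open_V sub] by simp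
 then have u: "pull pr (V f) ?u \<in> Units ?R" by (rule hom_Units[OF pull_hom(2)[OF i] B.is_cring R.is_cring])
 have "pull pr (V f) ?u \<otimes>\<^bsub>?R\<^esub> pull \<mu> (V f) ?d = pull pr (V f) ?u \<otimes>\<^bsub>?R\<^esub> pull pr (V f) ?d"
  using ring_hom_mult[OF pull_hom(1)[OF i] uc d] ring_hom_mult[OF pull_hom(2)[OF i] uc d] \<alpha>_invariant[OF i] c by metis
 then have "pull \<mu> (V f) ?d = pull pr (V f) ?d"
  using R.Units_l_cancel[OF u ring_hom_closed[OF pull_hom(1)[OF i] d] ring_hom_closed[OF pull_hom(2)[OF i] d]] by simp
 then show ?thesis using translated_diff[OF i t v tr[OF f]] by blast
qed

lemma coord_translated: "translated PP (\<theta> [:0, 1:])"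
 unfolding translated_def
proof (rule G.sections_eqI)
 note i = invariant_PP
 let ?v = "\<theta> [:0, 1:]" and ?W = "preimg GP pr PP"
 let ?rhs = "pull pr PP ?v \<oplus>\<^bsub>sections GP ?W\<^esub> res GP (points GP) ?W (Ga_coord P)"
 note o = open_W(3,4)[OF i]
 interpret R: cring "sections GP ?W" by (rule G.cring_sections[OF o(1)])
 note cl = ring_hom_closed[OF pull_hom(1)[OF i] \<theta>_closed] ring_hom_closed[OF pull_hom(2)[OF i] \<theta>_closed] coord_closed[OF i]
 show "opens GP ?W" by (rule o)
 show "pull \<mu> PP ?v \<in> \<Gamma> GP ?W" by (rule cl)
 show "?rhs \<in> \<Gamma> GP ?W" by (rule R.a_closed[OF cl(2,3)])
 fix z assume z: "z \<in> ?W"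
 then obtain f where f: "f \<in> Fs" "pt pr z \<in> V f" using A.cover[of "pt pr z"] unfolding preimg_def by blast
 let ?W' = "preimg GP pr (V f)"
 have sub: "V f \<subseteq> PP" by (rule locus_subset)
 have o': "opens GP ?W'" "?W' \<subseteq> ?W" using open_W(3)[OF invariant_V] sub by (auto simp: preimg_def)
 have "res GP ?W ?W' (pull \<mu> PP ?v) = res GP ?W ?W' ?rhs"
  unfolding G.res_add[OF o(1) o' cl(2,3)] G.res_res[OF _ o(1) o' o(2) Ga_coord_closed, OF openin_topspace]
   pull_restrict[OF i invariant_V sub \<theta>_closed, symmetric]
  by (rule coord_translated_local[OF f(1), unfolded translated_def])
 then show "\<exists>W'. opens GP W' & z \<in> W' & W' \<subseteq> ?W & res GP ?W W' (pull \<mu> PP ?v) = res GP ?W W' ?rhs"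
  using o' z f(2) by (intro exI[of _ ?W']) (auto simp: preimg_def)
qed

text \<open>The polynomials in the coordinate are a chart of \<open>P\<close> over \<open>A[T]\<close>, with the primes that do not
lie over the origin. These are also the primes of \<open>\<bbbG>\<^sub>a\<close> times the punctured plane.\<close>

lemma trivial_of_coordinate: "trivial_Ga_bundle P punctured_plane \<pi> \<mu>"
proof -
 let ?S = punctured_plane and ?Z = "Ga_times punctured_plane"
 interpret C: cylinder ?S plane_fun by (intro cylinder.intro full_chart.intro plane_chart(3))
 have "prm ?Z (points ?Z) tring C.C ` points ?Z = {Q. primeideal Q tring & {a. [:a:] \<in> Q} \<in> PS}"
  unfolding C.C_image using plane_chart(4) by simp
 also have "\<dots> = prm P PP tring \<theta> ` PP"
  unfolding image plane_chart(1) using A.Fs_cover[OF contract_prime] contract_prime by auto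
 finally interpret I: chart_pair P ?Z tring \<theta> C.C
  by (intro chart_pair.intro chart_pair_axioms.intro chart C.cylinder_chart) simp
 have pre: "I.pre (points ?Z) = PP" using preimg_points[OF I.morphism_iso] unfolding I.preimg_iso .
 have tr_C: "pull I.iso (points ?Z) (C.C F) = \<theta> F" for F
  using I.tr_\<rho>[OF I.Z.open_V, of F] res_id[OF _ \<theta>_closed] I.Z.res_id[OF I.Z.open_V I.Z.\<rho>_closed[of F]]
  unfolding pre by (simp add: I.iso_def)
 have over: "mor_eq P ?S (mcomp ?Z (Ga_proj ?S) I.iso) \<pi>"
 proof (rule mor_eq_chart[OF rspace_axioms plane_chart(3) _ morphism_\<pi>])
  show "morphism P ?S (mcomp ?Z (Ga_proj ?S) I.iso)"
   by (rule morphism_mcomp[OF rspace_axioms S.rspace_Ga_times S.rspace_axioms I.morphism_iso S.morphism_Ga_proj])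
  show "pull (mcomp ?Z (Ga_proj ?S) I.iso) PS (plane_fun a) = pull \<pi> PS (plane_fun a)" for a
   unfolding mcomp_def using C.C_const[of a] tr_C[of "[:a:]"] const[of a] preimg_points[OF S.morphism_Ga_proj]
   by (simp add: \<alpha>_def)
 qed
 have "Ga_trivialization P ?S \<pi> \<mu> PS I.iso"
  unfolding Ga_trivialization_def Let_def preimg_PS open_subspace_points C.C_coord[symmetric] tr_C
  using I.isomorphism_iso over coord_translated unfolding translated_def by blast
 then show ?thesis unfolding trivial_Ga_bundle_def by blast
qed

end

end

theorem mainTheorem4:
  fixes P :: "('p, 's) ringed_space"
    and \<pi> :: "('p, 's, plane_point, plane_section) space_map"
    and \<mu> :: "(('p, 's) line_point, ('p, 's) line_section, 'p, 's) space_map"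
  assumes "principal_Ga_bundle P punctured_plane \<pi> \<mu>"
    and "\<not> trivial_Ga_bundle P punctured_plane \<pi> \<mu>"
  shows "affine_scheme P"
proof -
 interpret Ga_bundle P \<pi> \<mu> by (rule Ga_bundle.intro) (rule assms(1))
 obtain Fs \<rho> where a: "atlas P \<alpha> Fs \<rho>" and tr: "\<And>f. f \<in> Fs ==> translated (V f) (\<rho> f [:0, 1:])" using atlas_ex by blast
 from atlas.affine_or_coordinate[OF a] show ?thesis
 proof (elim disjE exE conjE)
  fix R :: "'s ring" and f assume "cring R" "isomorphism P (Spec R) f"
  then show ?thesis unfolding affine_scheme_def using locally_ringed_P by blast
 next
  fix \<theta> assume "atlas.coordinate_chart P \<alpha> Fs \<rho> \<theta>"
  then have "trivial_Ga_bundle P punctured_plane \<pi> \<mu>" by (rule trivial_of_coordinate[OF a tr, rotated])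
  then show ?thesis using assms(2) by blast
 qed
qed

end
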